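(* Let $\mathcal V$ be a braided monoidal category. There is an equivalence of 2-categories $$\mathrm{Pairs}\;\cong\;\mathrm{UModMonCat}$$ between the 2-category $\mathrm{Pairs}$ of pairs over $\mathcal V$ and the 2-category $\mathrm{UModMonCat}$ of unital module monoidal categories over $\mathcal V$.
   Context: **Equivalence of 2-categories.** This means a 2-equivalence of strict 2-categories: there are (strict) 2-functors $\Psi\colon\mathrm{Pairs}\to\mathrm{UModMonCat}$ and $\Phi\colon\mathrm{UModMonCat}\to\mathrm{Pairs}$ together with 2-natural isomorphisms $\mathrm{Id}\cong\Phi\Psi$ and $\Psi\Phi\cong\mathrm{Id}$. **Monoidal conventions.** A monoidal category $(\mathcal C,\otimes,\mathbf 1,a,l,r)$ is unital, with associator $a_{u,v,w}\colon(u\otimes v)\otimes w\to u\otimes(v\otimes w)$ and unit constraints $l_v\colon\mathbf 1\otimes v\to v$, $r_v\colon v\otimes\mathbf 1\to v$ satisfying the pentagon and triangle axioms. A monoidal functor $(F,\varphi_2,\varphi_0)$ has a natural isomorphism $\varphi_{2,u,v}\colon F(u)\otimes'F(v)\to F(u\otimes v)$ satisfying the associativity hexagon and an isomorphism $\varphi_0\colon\mathbf 1'\to F(\mathbf 1)$ satisfying the two unit squares. A monoidal natural transformation $\eta\colon F\Rightarrow G$ satisfies $\eta_{u\otimes v}\circ\varphi^F_{2,u,v}=\varphi^G_{2,u,v}\circ(\eta_u\otimes'\eta_v)$ and $\eta_{\mathbf 1}\circ\varphi_0^F=\varphi_0^G$. A braiding on $\mathcal V$ is a natural isomorphism $\beta^{\mathcal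 V}_{v,w}\colon v\otimes w\to w\otimes v$ satisfying both hexagon axioms; a braided monoidal functor is a monoidal functor with $\varphi_{2,w,v}\circ\beta'_{F(v),F(w)}=F(\beta_{v,w})\circ\varphi_{2,v,w}$. Composites of monoidal functors carry $\varphi_2^{GF}=G(\varphi_2^F)\circ\varphi_2^G$, $\varphi_0^{GF}=G(\varphi_0^F)\circ\varphi_0^G$. **Module conventions.** A (left) $\mathcal V$-module category $(\mathcal M,\rhd,m,l^\rhd)$ has a functor $\rhd\colon\mathcal V\times\mathcal M\to\mathcal M$ and natural isomorphisms $m_{v,w,x}\colon(v\otimes w)\rhd x\to v\rhd(w\rhd x)$ and $l^\rhd_x\colon\mathbf 1_{\mathcal V}\rhd x\to x$ satisfying the pentagon $m_{u,v,w\rhd x}\circ m_{u\otimes v,w,x}=(\mathrm{id}_u\rhd m_{v,w,x})\circ m_{u,v\otimes w,x}\circ(a_{u,v,w}\rhd\mathrm{id}_x)$ and triangle $(\mathrm{id}_v\rhd l^\rhd_x)\circ m_{v,\mathbf 1,x}=r_v\rhd\mathrm{id}_x$. A module functor $(F,s)$ has a natural isomorphism $s_{v,x}\colon v\rhd'F(x)\to F(v\rhd x)$ with $F(m_{v,w,x})\circ s_{v\otimes w,x}=s_{v,w\rhd x}\circ(\mathrm{id}_v\rhd's_{w,x})\circ m'_{v,w,F(x)}$ and $F(l^\rhd_x)\circ s_{\mathbf 1,x}=l^{\rhd'}_{F(x)}$. A module natural transformation $\eta\colon F\Rightarrow G$ satisfies $\eta_{v\rhd x}\circ s^F_{v,x}=s^G_{v,x}\circ(\mathrm{id}_v\rhd'\eta_x)$.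 **Unital module monoidal category over $\mathcal V$.** A tuple $(\mathcal M,\otimes,\mathbf 1_{\mathcal M},a,l,r,\rhd,m,l^\rhd,\alpha^{(1)},\alpha^{(2)})$ where $(\mathcal M,\otimes,\mathbf 1_{\mathcal M},a,l,r)$ is a monoidal category, $(\mathcal M,\rhd,m,l^\rhd)$ is a $\mathcal V$-module category, and $$\alpha^{(1)}_{v,x,y}\colon(v\rhd x)\otimes y\to v\rhd(x\otimes y),\qquad \alpha^{(2)}_{v,x,y}\colon x\otimes(v\rhd y)\to v\rhd(x\otimes y)$$ are natural isomorphisms such that for all $v,w\in\mathcal V$, $x,y,z\in\mathcal M$: 1. $\alpha^{(1)}_{v,x,y\otimes z}\circ a_{v\rhd x,y,z}=(\mathrm{id}_v\rhd a_{x,y,z})\circ\alpha^{(1)}_{v,x\otimes y,z}\circ(\alpha^{(1)}_{v,x,y}\otimes\mathrm{id}_z)$; 2. $m_{v,w,x\otimes y}\circ\alpha^{(1)}_{v\otimes w,x,y}=(\mathrm{id}_v\rhd\alpha^{(1)}_{w,x,y})\circ\alpha^{(1)}_{v,w\rhd x,y}\circ(m_{v,w,x}\otimes\mathrm{id}_y)$; 3. $(\mathrm{id}_v\rhd a_{x,y,z})\circ\alpha^{(2)}_{v,x\otimes y,z}=\alpha^{(2)}_{v,x,y\otimes z}\circ(\mathrm{id}_x\otimes\alpha^{(2)}_{v,y,z})\circ a_{x,y,v\rhd z}$; 4. $m_{v,w,x\otimes y}\circ\alpha^{(2)}_{v\otimes w,x,y}=(\mathrm{id}_v\rhd\alpha^{(2)}_{w,x,y})\circ\alpha^{(2)}_{v,x,w\rhd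 y}\circ(\mathrm{id}_x\otimes m_{v,w,y})$; 5. $(\mathrm{id}_v\rhd a_{x,y,z})\circ\alpha^{(1)}_{v,x\otimes y,z}\circ(\alpha^{(2)}_{v,x,y}\otimes\mathrm{id}_z)=\alpha^{(2)}_{v,x,y\otimes z}\circ(\mathrm{id}_x\otimes\alpha^{(1)}_{v,y,z})\circ a_{x,v\rhd y,z}$; 6. $(\beta^{\mathcal V}_{v,w}\rhd\mathrm{id}_{x\otimes y})\circ m^{-1}_{v,w,x\otimes y}\circ(\mathrm{id}_v\rhd\alpha^{(1)}_{w,x,y})\circ\alpha^{(2)}_{v,w\rhd x,y}=m^{-1}_{w,v,x\otimes y}\circ(\mathrm{id}_w\rhd\alpha^{(2)}_{v,x,y})\circ\alpha^{(1)}_{w,x,v\rhd y}$. A *unital module monoidal functor* $(F,\varphi_2,\varphi_0,s)\colon\mathcal M\to\mathcal M'$ is such that $(F,\varphi_2,\varphi_0)$ is a monoidal functor, $(F,s)$ is a module functor, and for all $v\in\mathcal V$, $x,y\in\mathcal M$ $$s_{v,x\otimes y}\circ(\mathrm{id}_v\rhd'\varphi_{2,x,y})\circ\alpha^{(1)\prime}_{v,F(x),F(y)}=F(\alpha^{(1)}_{v,x,y})\circ\varphi_{2,v\rhd x,y}\circ(s_{v,x}\otimes'\mathrm{id}_{F(y)}),$$ $$s_{v,x\otimes y}\circ(\mathrm{id}_v\rhd'\varphi_{2,x,y})\circ\alpha^{(2)\prime}_{v,F(x),F(y)}=F(\alpha^{(2)}_{v,x,y})\circ\varphi_{2,x,v\rhd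 y}\circ(\mathrm{id}_{F(x)}\otimes's_{v,y}).$$ Composition is as monoidal functors with $s^{GF}_{v,x}=G(s^F_{v,x})\circ s^G_{v,F(x)}$. A *unital module monoidal natural transformation* is a natural transformation that is both a monoidal and a module natural transformation. $\mathrm{UModMonCat}$ is the strict 2-category of these objects, 1-morphisms and 2-morphisms. **Drinfeld center.** For a monoidal category $\mathcal T$, $Z(\mathcal T)$ has objects $(t,\beta_{t,-})$ with $\beta_{t,x}\colon t\otimes x\to x\otimes t$ a natural isomorphism satisfying $a_{x,y,t}\circ\beta_{t,x\otimes y}\circ a_{t,x,y}=(\mathrm{id}_x\otimes\beta_{t,y})\circ a_{x,t,y}\circ(\beta_{t,x}\otimes\mathrm{id}_y)$; morphisms are morphisms $f\colon t\to t'$ in $\mathcal T$ with $(\mathrm{id}_x\otimes f)\circ\beta_{t,x}=\beta_{t',x}\circ(f\otimes\mathrm{id}_x)$ for all $x$. It is monoidal with $\beta_{t\otimes t',x}=a_{x,t,t'}\circ(\beta_{t,x}\otimes\mathrm{id}_{t'})\circ a^{-1}_{t,x,t'}\circ(\mathrm{id}_t\otimes\beta_{t',x})\circ a_{t,t',x}$, unit $(\mathbf 1,\beta_{\mathbf 1,x}=r_x^{-1}\circ l_x)$, constraints from $\mathcal T$, and braided by $\beta_{t,t'}$. $R\colon Z(\mathcal T)\to\mathcal T$ is the forgetful functor. **Pairs.** A *pair* $(\mathcal T,F)$ over $\mathcal V$ consists of a monoidal category $\mathcal T$ and a braided central monoidal functor $F\colon\mathcal V\to\mathcal T$, i.e.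 a monoidal functor $F$ together with a braided monoidal functor $F^Z\colon\mathcal V\to Z(\mathcal T)$ with $F=RF^Z$ (as monoidal functors). Write $F^Z(v)=(F(v),\beta_{F(v),-})$. A *morphism of pairs* $(G,\varphi_2,\varphi_0,\gamma)\colon(\mathcal T,F)\to(\mathcal T',F')$ is a monoidal functor $(G,\varphi_2,\varphi_0)\colon\mathcal T\to\mathcal T'$ with a monoidal natural isomorphism $\gamma\colon F'\Rightarrow GF$ such that for all $v\in\mathcal V$, $t\in\mathcal T$ $$G(\beta_{F(v),t})\circ\varphi_{2,F(v),t}\circ(\gamma_v\otimes'\mathrm{id}_{G(t)})=\varphi_{2,t,F(v)}\circ(\mathrm{id}_{G(t)}\otimes'\gamma_v)\circ\beta_{F'(v),G(t)}.$$ The composite of $G\colon(\mathcal T,F)\to(\mathcal T',F')$ and $G'\colon(\mathcal T',F')\to(\mathcal T'',F'')$ is $G'G$ as monoidal functors, with $\gamma_v=G'(\gamma^G_v)\circ\gamma^{G'}_v$. A *2-morphism of pairs* $\eta\colon G\Rightarrow G'$ is a monoidal natural transformation with $\eta_{F(v)}\circ\gamma^G_v=\gamma^{G'}_v$ for all $v\in\mathcal V$. $\mathrm{Pairs}$ is the strict 2-category of these data. *)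

theory Defs
  imports "HOL-Library.FuncSet"
begin

section \<open>Categories, functors, natural transformations\<close>

text \<open>
  A category has its objects in a type \<open>'o\<close> and its arrows in a type \<open>'a\<close>. All structure maps are
  required to be extensional (\<open>undefined\<close> outside their domain), so that equality of the HOL records
  is equality of the mathematical data. The same convention is followed for functors, natural
  transformations and all structures built from them.
\<close>

record ('o, 'a) category =
  obj :: "'o set"
  arr :: "'a set"
  src :: "'a \<Rightarrow> 'o"
  trg :: "'a \<Rightarrow> 'o"
  ident :: "'o \<Rightarrow> 'a"
  cmp :: "'a \<Rightarrow> 'a \<Rightarrow> 'a" (infixr "\<cdot>\<index>" 55)

definition hom :: "('o, 'a, 'z) category_scheme \<Rightarrow> 'o \<Rightarrow> 'o \<Rightarrow> 'a set" where
  "hom C x y = {f \<in> arr C. src C f = x \<and> trg C f = y}"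

locale category =
  fixes C :: "('o, 'a, 'z) category_scheme" (structure)
  assumes src_obj: "f \<in> arr C \<Longrightarrow> src C f \<in> obj C"
    and trg_obj: "f \<in> arr C \<Longrightarrow> trg C f \<in> obj C"
    and ident_hom: "x \<in> obj C \<Longrightarrow> ident C x \<in> hom C x x"
    and cmp_hom: "f \<in> hom C x y \<Longrightarrow> g \<in> hom C y z \<Longrightarrow> g \<cdot> f \<in> hom C x z"
    and cmp_ident_right: "f \<in> hom C x y \<Longrightarrow> f \<cdot> ident C x = f"
    and cmp_ident_left: "f \<in> hom C x y \<Longrightarrow> ident C y \<cdot> f = f"
    and cmp_assoc: "f \<in> hom C w x \<Longrightarrow> g \<in> hom C x y \<Longrightarrow> h \<in> hom C y z \<Longrightarrow>
      (h \<cdot> g) \<cdot> f = h \<cdot> (g \<cdot> f)"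
    and src_ext: "src C \<in> extensional (arr C)"
    and trg_ext: "trg C \<in> extensional (arr C)"
    and ident_ext: "ident C \<in> extensional (obj C)"
    and cmp_ext: "\<not> (f \<in> arr C \<and> g \<in> arr C \<and> trg C f = src C g) \<Longrightarrow> g \<cdot> f = undefined"

definition inverse_arrows :: "('o, 'a, 'z) category_scheme \<Rightarrow> 'a \<Rightarrow> 'a \<Rightarrow> bool" where
  "inverse_arrows C f g \<longleftrightarrow> f \<in> arr C \<and> g \<in> hom C (trg C f) (src C f) \<and>
     g \<cdot>\<^bsub>C\<^esub> f = ident C (src C f) \<and> f \<cdot>\<^bsub>C\<^esub> g = ident C (trg C f)"

definition iso_arr :: "('o, 'a, 'z) category_scheme \<Rightarrow> 'a \<Rightarrow> bool" where
  "iso_arr C f \<longleftrightarrow> (\<exists>g. inverse_arrows C f g)"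

definition inv_arr :: "('o, 'a, 'z) category_scheme \<Rightarrow> 'a \<Rightarrow> 'a" where
  "inv_arr C f = (THE g. inverse_arrows C f g)"

text \<open>
  The category given by a family of hom-sets \<open>H x y\<close> (not necessarily disjoint): arrows are hom-set
  elements tagged with their source and target.
\<close>

definition hom_cat ::
  "'o set \<Rightarrow> ('o \<Rightarrow> 'o \<Rightarrow> 'f set) \<Rightarrow> ('o \<Rightarrow> 'f) \<Rightarrow> ('o \<Rightarrow> 'o \<Rightarrow> 'o \<Rightarrow> 'f \<Rightarrow> 'f \<Rightarrow> 'f) \<Rightarrow>
   ('o, 'o \<times> 'f \<times> 'o) category" where
  "hom_cat Os H i c =
    (let A = {(x, f, y). x \<in> Os \<and> y \<in> Os \<and> f \<in> H x y} in
     \<lparr>obj = Os,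
      arr = A,
      src = (\<lambda>(x, f, y) \<in> A. x),
      trg = (\<lambda>(x, f, y) \<in> A. y),
      ident = (\<lambda>x \<in> Os. (x, i x, x)),
      cmp = (\<lambda>(y', g, z) (x, f, y).
        if (y', g, z) \<in> A \<and> (x, f, y) \<in> A \<and> y = y' then (x, c x y z g f, z) else undefined)\<rparr>)"

definition prod_cat ::
  "('o, 'a, 'y) category_scheme \<Rightarrow> ('p, 'b, 'z) category_scheme \<Rightarrow> ('o \<times> 'p, 'a \<times> 'b) category"
  (infixr "\<times>\<^sub>C" 75) where
  "C \<times>\<^sub>C D =
    \<lparr>obj = obj C \<times> obj D,
     arr = arr C \<times> arr D,
     src = (\<lambda>(f, g) \<in> arr C \<times> arr D. (src C f, src D g)),
     trg = (\<lambda>(f, g) \<in> arr C \<times> arr D. (trg C f, trg D g)),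
     ident = (\<lambda>(x, y) \<in> obj C \<times> obj D. (ident C x, ident D y)),
     cmp = (\<lambda>(f', g') (f, g).
       if f \<in> arr C \<and> f' \<in> arr C \<and> g \<in> arr D \<and> g' \<in> arr D \<and> trg C f = src C f' \<and> trg D g = src D g'
       then (f' \<cdot>\<^bsub>C\<^esub> f, g' \<cdot>\<^bsub>D\<^esub> g) else undefined)\<rparr>"

record ('o, 'a, 'p, 'b) cat_functor =
  omap :: "'o \<Rightarrow> 'p"
  amap :: "'a \<Rightarrow> 'b"

locale cat_functor = C: category C + D: category D
  for C :: "('o, 'a, 'x) category_scheme" and D :: "('p, 'b, 'y) category_scheme" +
  fixes F :: "('o, 'a, 'p, 'b, 'z) cat_functor_scheme"
  assumes omap_obj: "omap F \<in> obj C \<rightarrow>\<^sub>E obj D"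
    and amap_ext: "amap F \<in> extensional (arr C)"
    and amap_hom: "f \<in> hom C x y \<Longrightarrow> amap F f \<in> hom D (omap F x) (omap F y)"
    and amap_ident: "x \<in> obj C \<Longrightarrow> amap F (ident C x) = ident D (omap F x)"
    and amap_cmp: "f \<in> hom C x y \<Longrightarrow> g \<in> hom C y z \<Longrightarrow>
      amap F (g \<cdot>\<^bsub>C\<^esub> f) = amap F g \<cdot>\<^bsub>D\<^esub> amap F f"

text \<open>
  The functor arguments of the next two predicates are only evaluated on objects and arrows of \<open>C\<close>,
  so they may be given by plain (non-extensional) lambda terms.
\<close>

definition nat_trans ::
  "('o, 'a, 'x) category_scheme \<Rightarrow> ('p, 'b, 'y) category_scheme \<Rightarrow>
   ('o, 'a, 'p, 'b, 'z) cat_functor_scheme \<Rightarrow> ('o, 'a, 'p, 'b, 'w) cat_functor_scheme \<Rightarrow>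
   ('o \<Rightarrow> 'b) \<Rightarrow> bool" where
  "nat_trans C D F G \<eta> \<longleftrightarrow>
     \<eta> \<in> extensional (obj C) \<and>
     (\<forall>x \<in> obj C. \<eta> x \<in> hom D (omap F x) (omap G x)) \<and>
     (\<forall>f \<in> arr C. amap G f \<cdot>\<^bsub>D\<^esub> \<eta> (src C f) = \<eta> (trg C f) \<cdot>\<^bsub>D\<^esub> amap F f)"

definition nat_iso ::
  "('o, 'a, 'x) category_scheme \<Rightarrow> ('p, 'b, 'y) category_scheme \<Rightarrow>
   ('o, 'a, 'p, 'b, 'z) cat_functor_scheme \<Rightarrow> ('o, 'a, 'p, 'b, 'w) cat_functor_scheme \<Rightarrow>
   ('o \<Rightarrow> 'b) \<Rightarrow> bool" where
  "nat_iso C D F G \<eta> \<longleftrightarrow> nat_trans C D F G \<eta> \<and> (\<forall>x \<in> obj C. iso_arr D (\<eta> x))"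


section \<open>Monoidal and braided monoidal categories\<close>

record ('o, 'a) mon_cat = "('o, 'a) category" +
  tens :: "('o \<times> 'o, 'a \<times> 'a, 'o, 'a) cat_functor"
  unit_obj :: 'o ("\<I>\<index>")
  assoc :: "'o \<times> 'o \<times> 'o \<Rightarrow> 'a"
  lunit :: "'o \<Rightarrow> 'a"
  runit :: "'o \<Rightarrow> 'a"

abbreviation tens_obj :: "('o, 'a, 'z) mon_cat_scheme \<Rightarrow> 'o \<Rightarrow> 'o \<Rightarrow> 'o" (infixl "\<otimes>\<index>" 70) where
  "x \<otimes>\<^bsub>C\<^esub> y \<equiv> omap (tens C) (x, y)"

abbreviation tens_arr :: "('o, 'a, 'z) mon_cat_scheme \<Rightarrow> 'a \<Rightarrow> 'a \<Rightarrow> 'a" (infixl "\<otimes>\<^sub>a\<index>" 70) where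
  "f \<otimes>\<^sub>a\<^bsub>C\<^esub> g \<equiv> amap (tens C) (f, g)"

locale monoidal_category = category C
  for C :: "('o, 'a, 'z) mon_cat_scheme" (structure) +
  assumes tens_functor: "cat_functor (C \<times>\<^sub>C C) C (tens C)"
    and unit_obj: "\<I> \<in> obj C"
    and assoc_iso: "nat_iso (C \<times>\<^sub>C C \<times>\<^sub>C C) C
      \<lparr>omap = \<lambda>(x, y, z). (x \<otimes> y) \<otimes> z, amap = \<lambda>(f, g, h). (f \<otimes>\<^sub>a g) \<otimes>\<^sub>a h\<rparr>
      \<lparr>omap = \<lambda>(x, y, z). x \<otimes> (y \<otimes> z), amap = \<lambda>(f, g, h). f \<otimes>\<^sub>a (g \<otimes>\<^sub>a h)\<rparr>
      (assoc C)"
    and lunit_iso: "nat_iso C C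
      \<lparr>omap = \<lambda>x. \<I> \<otimes> x, amap = \<lambda>f. ident C \<I> \<otimes>\<^sub>a f\<rparr> \<lparr>omap = \<lambda>x. x, amap = \<lambda>f. f\<rparr>
      (lunit C)"
    and runit_iso: "nat_iso C C
      \<lparr>omap = \<lambda>x. x \<otimes> \<I>, amap = \<lambda>f. f \<otimes>\<^sub>a ident C \<I>\<rparr> \<lparr>omap = \<lambda>x. x, amap = \<lambda>f. f\<rparr>
      (runit C)"
    and pentagon: "u \<in> obj C \<Longrightarrow> v \<in> obj C \<Longrightarrow> w \<in> obj C \<Longrightarrow> x \<in> obj C \<Longrightarrow>
      assoc C (u, v, w \<otimes> x) \<cdot> assoc C (u \<otimes> v, w, x) =
      (ident C u \<otimes>\<^sub>a assoc C (v, w, x)) \<cdot> assoc C (u, v \<otimes> w, x) \<cdot> (assoc C (u, v, w) \<otimes>\<^sub>a ident C x)"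
    and triangle: "v \<in> obj C \<Longrightarrow> w \<in> obj C \<Longrightarrow>
      (ident C v \<otimes>\<^sub>a lunit C w) \<cdot> assoc C (v, \<I>, w) = runit C v \<otimes>\<^sub>a ident C w"

record ('o, 'a) braided_cat = "('o, 'a) mon_cat" +
  braid :: "'o \<times> 'o \<Rightarrow> 'a"

locale braided_category = monoidal_category C
  for C :: "('o, 'a, 'z) braided_cat_scheme" (structure) +
  assumes braid_iso: "nat_iso (C \<times>\<^sub>C C) C
      \<lparr>omap = \<lambda>(x, y). x \<otimes> y, amap = \<lambda>(f, g). f \<otimes>\<^sub>a g\<rparr>
      \<lparr>omap = \<lambda>(x, y). y \<otimes> x, amap = \<lambda>(f, g). g \<otimes>\<^sub>a f\<rparr>
      (braid C)"
    and hexagon1: "x \<in> obj C \<Longrightarrow> y \<in> obj C \<Longrightarrow> z \<in> obj C \<Longrightarrow>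
      assoc C (y, z, x) \<cdot> braid C (x, y \<otimes> z) \<cdot> assoc C (x, y, z) =
      (ident C y \<otimes>\<^sub>a braid C (x, z)) \<cdot> assoc C (y, x, z) \<cdot> (braid C (x, y) \<otimes>\<^sub>a ident C z)"
    and hexagon2: "x \<in> obj C \<Longrightarrow> y \<in> obj C \<Longrightarrow> z \<in> obj C \<Longrightarrow>
      inv_arr C (assoc C (z, x, y)) \<cdot> braid C (x \<otimes> y, z) \<cdot> inv_arr C (assoc C (x, y, z)) =
      (braid C (x, z) \<otimes>\<^sub>a ident C y) \<cdot> inv_arr C (assoc C (x, z, y)) \<cdot> (ident C x \<otimes>\<^sub>a braid C (y, z))"

record ('o, 'a, 'p, 'b) mon_functor = "('o, 'a, 'p, 'b) cat_functor" +
  phi2 :: "'o \<times> 'o \<Rightarrow> 'b"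
  phi0 :: 'b

locale monoidal_functor = C: monoidal_category C + D: monoidal_category D + cat_functor C D F
  for C :: "('o, 'a, 'x) mon_cat_scheme" and D :: "('p, 'b, 'y) mon_cat_scheme"
    and F :: "('o, 'a, 'p, 'b, 'z) mon_functor_scheme" +
  assumes phi2_iso: "nat_iso (C \<times>\<^sub>C C) D
      \<lparr>omap = \<lambda>(x, y). omap F x \<otimes>\<^bsub>D\<^esub> omap F y, amap = \<lambda>(f, g). amap F f \<otimes>\<^sub>a\<^bsub>D\<^esub> amap F g\<rparr>
      \<lparr>omap = \<lambda>(x, y). omap F (x \<otimes>\<^bsub>C\<^esub> y), amap = \<lambda>(f, g). amap F (f \<otimes>\<^sub>a\<^bsub>C\<^esub> g)\<rparr>
      (phi2 F)"
    and phi0_hom: "phi0 F \<in> hom D \<I>\<^bsub>D\<^esub> (omap F \<I>\<^bsub>C\<^esub>)"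
    and phi0_iso: "iso_arr D (phi0 F)"
    and phi2_assoc: "u \<in> obj C \<Longrightarrow> v \<in> obj C \<Longrightarrow> w \<in> obj C \<Longrightarrow>
      amap F (assoc C (u, v, w)) \<cdot>\<^bsub>D\<^esub> phi2 F (u \<otimes>\<^bsub>C\<^esub> v, w)
        \<cdot>\<^bsub>D\<^esub> (phi2 F (u, v) \<otimes>\<^sub>a\<^bsub>D\<^esub> ident D (omap F w)) =
      phi2 F (u, v \<otimes>\<^bsub>C\<^esub> w) \<cdot>\<^bsub>D\<^esub> (ident D (omap F u) \<otimes>\<^sub>a\<^bsub>D\<^esub> phi2 F (v, w))
        \<cdot>\<^bsub>D\<^esub> assoc D (omap F u, omap F v, omap F w)"
    and phi0_left: "v \<in> obj C \<Longrightarrow>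
      amap F (lunit C v) \<cdot>\<^bsub>D\<^esub> phi2 F (\<I>\<^bsub>C\<^esub>, v) \<cdot>\<^bsub>D\<^esub> (phi0 F \<otimes>\<^sub>a\<^bsub>D\<^esub> ident D (omap F v)) =
      lunit D (omap F v)"
    and phi0_right: "v \<in> obj C \<Longrightarrow>
      amap F (runit C v) \<cdot>\<^bsub>D\<^esub> phi2 F (v, \<I>\<^bsub>C\<^esub>) \<cdot>\<^bsub>D\<^esub> (ident D (omap F v) \<otimes>\<^sub>a\<^bsub>D\<^esub> phi0 F) =
      runit D (omap F v)"

locale braided_functor = C: braided_category C + D: braided_category D + monoidal_functor C D F
  for C :: "('o, 'a, 'x) braided_cat_scheme" and D :: "('p, 'b, 'y) braided_cat_scheme"
    and F :: "('o, 'a, 'p, 'b, 'z) mon_functor_scheme" +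
  assumes braid_compat: "v \<in> obj C \<Longrightarrow> w \<in> obj C \<Longrightarrow>
      phi2 F (w, v) \<cdot>\<^bsub>D\<^esub> braid D (omap F v, omap F w) = amap F (braid C (v, w)) \<cdot>\<^bsub>D\<^esub> phi2 F (v, w)"

definition id_mon_functor :: "('o, 'a, 'z) mon_cat_scheme \<Rightarrow> ('o, 'a, 'o, 'a) mon_functor" where
  "id_mon_functor C =
    \<lparr>omap = (\<lambda>x \<in> obj C. x),
     amap = (\<lambda>f \<in> arr C. f),
     phi2 = (\<lambda>(x, y) \<in> obj C \<times> obj C. ident C (x \<otimes>\<^bsub>C\<^esub> y)),
     phi0 = ident C \<I>\<^bsub>C\<^esub>\<rparr>"

text \<open>The composite of \<open>F : C \<rightarrow> D\<close> and \<open>G : D \<rightarrow> E\<close>; the category \<open>D\<close> does not enter the formulas.\<close>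

definition comp_mon_functor ::
  "('o, 'a, 'x) mon_cat_scheme \<Rightarrow> ('q, 'c, 'y) mon_cat_scheme \<Rightarrow>
   ('p, 'b, 'q, 'c) mon_functor \<Rightarrow> ('o, 'a, 'p, 'b) mon_functor \<Rightarrow> ('o, 'a, 'q, 'c) mon_functor" where
  "comp_mon_functor C E G F =
    \<lparr>omap = (\<lambda>x \<in> obj C. omap G (omap F x)),
     amap = (\<lambda>f \<in> arr C. amap G (amap F f)),
     phi2 = (\<lambda>(x, y) \<in> obj C \<times> obj C. amap G (phi2 F (x, y)) \<cdot>\<^bsub>E\<^esub> phi2 G (omap F x, omap F y)),
     phi0 = amap G (phi0 F) \<cdot>\<^bsub>E\<^esub> phi0 G\<rparr>"

definition mon_nat_trans ::
  "('o, 'a, 'x) mon_cat_scheme \<Rightarrow> ('p, 'b, 'y) mon_cat_scheme \<Rightarrow>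
   ('o, 'a, 'p, 'b) mon_functor \<Rightarrow> ('o, 'a, 'p, 'b) mon_functor \<Rightarrow> ('o \<Rightarrow> 'b) \<Rightarrow> bool" where
  "mon_nat_trans C D F G \<eta> \<longleftrightarrow>
     nat_trans C D F G \<eta> \<and>
     (\<forall>u \<in> obj C. \<forall>v \<in> obj C.
        \<eta> (u \<otimes>\<^bsub>C\<^esub> v) \<cdot>\<^bsub>D\<^esub> phi2 F (u, v) = phi2 G (u, v) \<cdot>\<^bsub>D\<^esub> (\<eta> u \<otimes>\<^sub>a\<^bsub>D\<^esub> \<eta> v)) \<and>
     \<eta> \<I>\<^bsub>C\<^esub> \<cdot>\<^bsub>D\<^esub> phi0 F = phi0 G"


section \<open>Module categories\<close>

record ('v, 'w, 'o, 'a) mod_struct =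
  act :: "('v \<times> 'o, 'w \<times> 'a, 'o, 'a) cat_functor"
  massoc :: "'v \<times> 'v \<times> 'o \<Rightarrow> 'a"
  munit :: "'o \<Rightarrow> 'a"

abbreviation act_obj :: "('v, 'w, 'o, 'a, 'z) mod_struct_scheme \<Rightarrow> 'v \<Rightarrow> 'o \<Rightarrow> 'o" (infixr "\<rhd>\<index>" 72)
  where "v \<rhd>\<^bsub>A\<^esub> x \<equiv> omap (act A) (v, x)"

abbreviation act_arr :: "('v, 'w, 'o, 'a, 'z) mod_struct_scheme \<Rightarrow> 'w \<Rightarrow> 'a \<Rightarrow> 'a" (infixr "\<rhd>\<^sub>a\<index>" 72)
  where "f \<rhd>\<^sub>a\<^bsub>A\<^esub> g \<equiv> amap (act A) (f, g)"

locale module_category = V: monoidal_category V + M: category M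
  for V :: "('v, 'w, 'x) mon_cat_scheme" and M :: "('o, 'a, 'y) category_scheme" +
  fixes A :: "('v, 'w, 'o, 'a) mod_struct"
  assumes act_functor: "cat_functor (V \<times>\<^sub>C M) M (act A)"
    and massoc_iso: "nat_iso (V \<times>\<^sub>C V \<times>\<^sub>C M) M
      \<lparr>omap = \<lambda>(v, w, x). (v \<otimes>\<^bsub>V\<^esub> w) \<rhd>\<^bsub>A\<^esub> x, amap = \<lambda>(f, g, h). (f \<otimes>\<^sub>a\<^bsub>V\<^esub> g) \<rhd>\<^sub>a\<^bsub>A\<^esub> h\<rparr>
      \<lparr>omap = \<lambda>(v, w, x). v \<rhd>\<^bsub>A\<^esub> (w \<rhd>\<^bsub>A\<^esub> x), amap = \<lambda>(f, g, h). f \<rhd>\<^sub>a\<^bsub>A\<^esub> (g \<rhd>\<^sub>a\<^bsub>A\<^esub> h)\<rparr>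
      (massoc A)"
    and munit_iso: "nat_iso M M
      \<lparr>omap = \<lambda>x. \<I>\<^bsub>V\<^esub> \<rhd>\<^bsub>A\<^esub> x, amap = \<lambda>f. ident V \<I>\<^bsub>V\<^esub> \<rhd>\<^sub>a\<^bsub>A\<^esub> f\<rparr> \<lparr>omap = \<lambda>x. x, amap = \<lambda>f. f\<rparr>
      (munit A)"
    and mod_pentagon: "u \<in> obj V \<Longrightarrow> v \<in> obj V \<Longrightarrow> w \<in> obj V \<Longrightarrow> x \<in> obj M \<Longrightarrow>
      massoc A (u, v, w \<rhd>\<^bsub>A\<^esub> x) \<cdot>\<^bsub>M\<^esub> massoc A (u \<otimes>\<^bsub>V\<^esub> v, w, x) =
      (ident V u \<rhd>\<^sub>a\<^bsub>A\<^esub> massoc A (v, w, x)) \<cdot>\<^bsub>M\<^esub> massoc A (u, v \<otimes>\<^bsub>V\<^esub> w, x)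
        \<cdot>\<^bsub>M\<^esub> (assoc V (u, v, w) \<rhd>\<^sub>a\<^bsub>A\<^esub> ident M x)"
    and mod_triangle: "v \<in> obj V \<Longrightarrow> x \<in> obj M \<Longrightarrow>
      (ident V v \<rhd>\<^sub>a\<^bsub>A\<^esub> munit A x) \<cdot>\<^bsub>M\<^esub> massoc A (v, \<I>\<^bsub>V\<^esub>, x) = runit V v \<rhd>\<^sub>a\<^bsub>A\<^esub> ident M x"

locale module_functor = M: module_category V M A + N: module_category V N B + cat_functor M N F
  for V :: "('v, 'w, 'x) mon_cat_scheme"
    and M :: "('o, 'a, 'y) category_scheme" and A :: "('v, 'w, 'o, 'a) mod_struct"
    and N :: "('p, 'b, 'z) category_scheme" and B :: "('v, 'w, 'p, 'b) mod_struct"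
    and F :: "('o, 'a, 'p, 'b, 't) cat_functor_scheme" +
  fixes s :: "'v \<times> 'o \<Rightarrow> 'b"
  assumes s_iso: "nat_iso (V \<times>\<^sub>C M) N
      \<lparr>omap = \<lambda>(v, x). v \<rhd>\<^bsub>B\<^esub> omap F x, amap = \<lambda>(f, g). f \<rhd>\<^sub>a\<^bsub>B\<^esub> amap F g\<rparr>
      \<lparr>omap = \<lambda>(v, x). omap F (v \<rhd>\<^bsub>A\<^esub> x), amap = \<lambda>(f, g). amap F (f \<rhd>\<^sub>a\<^bsub>A\<^esub> g)\<rparr>
      s"
    and s_assoc: "v \<in> obj V \<Longrightarrow> w \<in> obj V \<Longrightarrow> x \<in> obj M \<Longrightarrow>
      amap F (massoc A (v, w, x)) \<cdot>\<^bsub>N\<^esub> s (v \<otimes>\<^bsub>V\<^esub> w, x) =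
      s (v, w \<rhd>\<^bsub>A\<^esub> x) \<cdot>\<^bsub>N\<^esub> (ident V v \<rhd>\<^sub>a\<^bsub>B\<^esub> s (w, x)) \<cdot>\<^bsub>N\<^esub> massoc B (v, w, omap F x)"
    and s_unit: "x \<in> obj M \<Longrightarrow> amap F (munit A x) \<cdot>\<^bsub>N\<^esub> s (\<I>\<^bsub>V\<^esub>, x) = munit B (omap F x)"

definition mod_nat_trans ::
  "('v, 'w, 'x) mon_cat_scheme \<Rightarrow>
   ('o, 'a, 'y) category_scheme \<Rightarrow> ('v, 'w, 'o, 'a) mod_struct \<Rightarrow>
   ('p, 'b, 'z) category_scheme \<Rightarrow> ('v, 'w, 'p, 'b) mod_struct \<Rightarrow>
   ('o, 'a, 'p, 'b, 't) cat_functor_scheme \<Rightarrow> ('v \<times> 'o \<Rightarrow> 'b) \<Rightarrow>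
   ('o, 'a, 'p, 'b, 'u) cat_functor_scheme \<Rightarrow> ('v \<times> 'o \<Rightarrow> 'b) \<Rightarrow> ('o \<Rightarrow> 'b) \<Rightarrow> bool" where
  "mod_nat_trans V M A N B F sF G sG \<eta> \<longleftrightarrow>
     nat_trans M N F G \<eta> \<and>
     (\<forall>v \<in> obj V. \<forall>x \<in> obj M.
        \<eta> (v \<rhd>\<^bsub>A\<^esub> x) \<cdot>\<^bsub>N\<^esub> sF (v, x) = sG (v, x) \<cdot>\<^bsub>N\<^esub> (ident V v \<rhd>\<^sub>a\<^bsub>B\<^esub> \<eta> x))"


section \<open>Unital module monoidal categories\<close>

locale module_monoidal_category = V: braided_category V + C: monoidal_category C + module_category V C A
  for V :: "('v, 'w, 'x) braided_cat_scheme" and C :: "('o, 'a, 'y) mon_cat_scheme" (structure)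
    and A :: "('v, 'w, 'o, 'a) mod_struct" +
  fixes \<alpha>1 \<alpha>2 :: "'v \<times> 'o \<times> 'o \<Rightarrow> 'a"
  assumes \<alpha>1_iso: "nat_iso (V \<times>\<^sub>C C \<times>\<^sub>C C) C
      \<lparr>omap = \<lambda>(v, x, y). (v \<rhd>\<^bsub>A\<^esub> x) \<otimes> y, amap = \<lambda>(f, g, h). (f \<rhd>\<^sub>a\<^bsub>A\<^esub> g) \<otimes>\<^sub>a h\<rparr>
      \<lparr>omap = \<lambda>(v, x, y). v \<rhd>\<^bsub>A\<^esub> (x \<otimes> y), amap = \<lambda>(f, g, h). f \<rhd>\<^sub>a\<^bsub>A\<^esub> (g \<otimes>\<^sub>a h)\<rparr>
      \<alpha>1"
    and \<alpha>2_iso: "nat_iso (V \<times>\<^sub>C C \<times>\<^sub>C C) C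
      \<lparr>omap = \<lambda>(v, x, y). x \<otimes> (v \<rhd>\<^bsub>A\<^esub> y), amap = \<lambda>(f, g, h). g \<otimes>\<^sub>a (f \<rhd>\<^sub>a\<^bsub>A\<^esub> h)\<rparr>
      \<lparr>omap = \<lambda>(v, x, y). v \<rhd>\<^bsub>A\<^esub> (x \<otimes> y), amap = \<lambda>(f, g, h). f \<rhd>\<^sub>a\<^bsub>A\<^esub> (g \<otimes>\<^sub>a h)\<rparr>
      \<alpha>2"
    and \<alpha>1_assoc: "v \<in> obj V \<Longrightarrow> x \<in> obj C \<Longrightarrow> y \<in> obj C \<Longrightarrow> z \<in> obj C \<Longrightarrow>
      \<alpha>1 (v, x, y \<otimes> z) \<cdot> assoc C (v \<rhd>\<^bsub>A\<^esub> x, y, z) =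
      (ident V v \<rhd>\<^sub>a\<^bsub>A\<^esub> assoc C (x, y, z)) \<cdot> \<alpha>1 (v, x \<otimes> y, z) \<cdot> (\<alpha>1 (v, x, y) \<otimes>\<^sub>a ident C z)"
    and \<alpha>1_massoc: "v \<in> obj V \<Longrightarrow> w \<in> obj V \<Longrightarrow> x \<in> obj C \<Longrightarrow> y \<in> obj C \<Longrightarrow>
      massoc A (v, w, x \<otimes> y) \<cdot> \<alpha>1 (v \<otimes>\<^bsub>V\<^esub> w, x, y) =
      (ident V v \<rhd>\<^sub>a\<^bsub>A\<^esub> \<alpha>1 (w, x, y)) \<cdot> \<alpha>1 (v, w \<rhd>\<^bsub>A\<^esub> x, y) \<cdot> (massoc A (v, w, x) \<otimes>\<^sub>a ident C y)"
    and \<alpha>2_assoc: "v \<in> obj V \<Longrightarrow> x \<in> obj C \<Longrightarrow> y \<in> obj C \<Longrightarrow> z \<in> obj C \<Longrightarrow>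
      (ident V v \<rhd>\<^sub>a\<^bsub>A\<^esub> assoc C (x, y, z)) \<cdot> \<alpha>2 (v, x \<otimes> y, z) =
      \<alpha>2 (v, x, y \<otimes> z) \<cdot> (ident C x \<otimes>\<^sub>a \<alpha>2 (v, y, z)) \<cdot> assoc C (x, y, v \<rhd>\<^bsub>A\<^esub> z)"
    and \<alpha>2_massoc: "v \<in> obj V \<Longrightarrow> w \<in> obj V \<Longrightarrow> x \<in> obj C \<Longrightarrow> y \<in> obj C \<Longrightarrow>
      massoc A (v, w, x \<otimes> y) \<cdot> \<alpha>2 (v \<otimes>\<^bsub>V\<^esub> w, x, y) =
      (ident V v \<rhd>\<^sub>a\<^bsub>A\<^esub> \<alpha>2 (w, x, y)) \<cdot> \<alpha>2 (v, x, w \<rhd>\<^bsub>A\<^esub> y) \<cdot> (ident C x \<otimes>\<^sub>a massoc A (v, w, y))"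
    and \<alpha>1_\<alpha>2_assoc: "v \<in> obj V \<Longrightarrow> x \<in> obj C \<Longrightarrow> y \<in> obj C \<Longrightarrow> z \<in> obj C \<Longrightarrow>
      (ident V v \<rhd>\<^sub>a\<^bsub>A\<^esub> assoc C (x, y, z)) \<cdot> \<alpha>1 (v, x \<otimes> y, z) \<cdot> (\<alpha>2 (v, x, y) \<otimes>\<^sub>a ident C z) =
      \<alpha>2 (v, x, y \<otimes> z) \<cdot> (ident C x \<otimes>\<^sub>a \<alpha>1 (v, y, z)) \<cdot> assoc C (x, v \<rhd>\<^bsub>A\<^esub> y, z)"
    and \<alpha>1_\<alpha>2_braid: "v \<in> obj V \<Longrightarrow> w \<in> obj V \<Longrightarrow> x \<in> obj C \<Longrightarrow> y \<in> obj C \<Longrightarrow>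
      (braid V (v, w) \<rhd>\<^sub>a\<^bsub>A\<^esub> ident C (x \<otimes> y)) \<cdot> inv_arr C (massoc A (v, w, x \<otimes> y))
        \<cdot> (ident V v \<rhd>\<^sub>a\<^bsub>A\<^esub> \<alpha>1 (w, x, y)) \<cdot> \<alpha>2 (v, w \<rhd>\<^bsub>A\<^esub> x, y) =
      inv_arr C (massoc A (w, v, x \<otimes> y)) \<cdot> (ident V w \<rhd>\<^sub>a\<^bsub>A\<^esub> \<alpha>2 (v, x, y)) \<cdot> \<alpha>1 (w, x, v \<rhd>\<^bsub>A\<^esub> y)"

record ('v, 'w, 'o, 'a) umm_cat =
  ucat :: "('o, 'a) mon_cat"
  uact :: "('v, 'w, 'o, 'a) mod_struct"
  alpha1 :: "'v \<times> 'o \<times> 'o \<Rightarrow> 'a"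
  alpha2 :: "'v \<times> 'o \<times> 'o \<Rightarrow> 'a"

abbreviation umm_category :: "('v, 'w) braided_cat \<Rightarrow> ('v, 'w, 'o, 'a) umm_cat \<Rightarrow> bool" where
  "umm_category V M \<equiv> module_monoidal_category V (ucat M) (uact M) (alpha1 M) (alpha2 M)"

record ('v, 'o, 'a) umm_functor =
  ufun :: "('o, 'a, 'o, 'a) mon_functor"
  ustr :: "'v \<times> 'o \<Rightarrow> 'a"

locale umm_functor =
  monoidal_functor "ucat M" "ucat N" "ufun F" +
  module_functor V "ucat M" "uact M" "ucat N" "uact N" "ufun F" "ustr F"
  for V :: "('v, 'w) braided_cat" and M N :: "('v, 'w, 'o, 'a) umm_cat"
    and F :: "('v, 'o, 'a) umm_functor" +
  assumes source: "umm_category V M"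
    and target: "umm_category V N"
    and alpha1_compat: "v \<in> obj V \<Longrightarrow> x \<in> obj (ucat M) \<Longrightarrow> y \<in> obj (ucat M) \<Longrightarrow>
      ustr F (v, x \<otimes>\<^bsub>ucat M\<^esub> y) \<cdot>\<^bsub>ucat N\<^esub> (ident V v \<rhd>\<^sub>a\<^bsub>uact N\<^esub> phi2 (ufun F) (x, y))
        \<cdot>\<^bsub>ucat N\<^esub> alpha1 N (v, omap (ufun F) x, omap (ufun F) y) =
      amap (ufun F) (alpha1 M (v, x, y)) \<cdot>\<^bsub>ucat N\<^esub> phi2 (ufun F) (v \<rhd>\<^bsub>uact M\<^esub> x, y)
        \<cdot>\<^bsub>ucat N\<^esub> (ustr F (v, x) \<otimes>\<^sub>a\<^bsub>ucat N\<^esub> ident (ucat N) (omap (ufun F) y))"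
    and alpha2_compat: "v \<in> obj V \<Longrightarrow> x \<in> obj (ucat M) \<Longrightarrow> y \<in> obj (ucat M) \<Longrightarrow>
      ustr F (v, x \<otimes>\<^bsub>ucat M\<^esub> y) \<cdot>\<^bsub>ucat N\<^esub> (ident V v \<rhd>\<^sub>a\<^bsub>uact N\<^esub> phi2 (ufun F) (x, y))
        \<cdot>\<^bsub>ucat N\<^esub> alpha2 N (v, omap (ufun F) x, omap (ufun F) y) =
      amap (ufun F) (alpha2 M (v, x, y)) \<cdot>\<^bsub>ucat N\<^esub> phi2 (ufun F) (x, v \<rhd>\<^bsub>uact M\<^esub> y)
        \<cdot>\<^bsub>ucat N\<^esub> (ident (ucat N) (omap (ufun F) x) \<otimes>\<^sub>a\<^bsub>ucat N\<^esub> ustr F (v, y))"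

definition id_umm_functor ::
  "('v, 'w) braided_cat \<Rightarrow> ('v, 'w, 'o, 'a) umm_cat \<Rightarrow> ('v, 'o, 'a) umm_functor" where
  "id_umm_functor V M =
    \<lparr>ufun = id_mon_functor (ucat M),
     ustr = (\<lambda>(v, x) \<in> obj V \<times> obj (ucat M). ident (ucat M) (v \<rhd>\<^bsub>uact M\<^esub> x))\<rparr>"

definition comp_umm_functor ::
  "('v, 'w) braided_cat \<Rightarrow> ('v, 'w, 'o, 'a) umm_cat \<Rightarrow> ('v, 'w, 'o, 'a) umm_cat \<Rightarrow>
   ('v, 'o, 'a) umm_functor \<Rightarrow> ('v, 'o, 'a) umm_functor \<Rightarrow> ('v, 'o, 'a) umm_functor" where
  "comp_umm_functor V M N G F =
    \<lparr>ufun = comp_mon_functor (ucat M) (ucat N) (ufun G) (ufun F),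
     ustr = (\<lambda>(v, x) \<in> obj V \<times> obj (ucat M).
       amap (ufun G) (ustr F (v, x)) \<cdot>\<^bsub>ucat N\<^esub> ustr G (v, omap (ufun F) x))\<rparr>"

definition umm_trans ::
  "('v, 'w) braided_cat \<Rightarrow> ('v, 'w, 'o, 'a) umm_cat \<Rightarrow> ('v, 'w, 'o, 'a) umm_cat \<Rightarrow>
   ('v, 'o, 'a) umm_functor \<Rightarrow> ('v, 'o, 'a) umm_functor \<Rightarrow> ('o \<Rightarrow> 'a) set" where
  "umm_trans V M N F G =
    {\<eta>. mon_nat_trans (ucat M) (ucat N) (ufun F) (ufun G) \<eta> \<and>
        mod_nat_trans V (ucat M) (uact M) (ucat N) (uact N) (ufun F) (ustr F) (ufun G) (ustr G) \<eta>}"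


section \<open>Drinfeld center\<close>

definition half_braiding :: "('o, 'a, 'z) mon_cat_scheme \<Rightarrow> 'o \<Rightarrow> ('o \<Rightarrow> 'a) \<Rightarrow> bool" where
  "half_braiding T t \<beta> \<longleftrightarrow>
     t \<in> obj T \<and>
     nat_iso T T
       \<lparr>omap = \<lambda>x. t \<otimes>\<^bsub>T\<^esub> x, amap = \<lambda>f. ident T t \<otimes>\<^sub>a\<^bsub>T\<^esub> f\<rparr>
       \<lparr>omap = \<lambda>x. x \<otimes>\<^bsub>T\<^esub> t, amap = \<lambda>f. f \<otimes>\<^sub>a\<^bsub>T\<^esub> ident T t\<rparr> \<beta> \<and>
     (\<forall>x \<in> obj T. \<forall>y \<in> obj T.
        assoc T (x, y, t) \<cdot>\<^bsub>T\<^esub> \<beta> (x \<otimes>\<^bsub>T\<^esub> y) \<cdot>\<^bsub>T\<^esub> assoc T (t, x, y) =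
        (ident T x \<otimes>\<^sub>a\<^bsub>T\<^esub> \<beta> y) \<cdot>\<^bsub>T\<^esub> assoc T (x, t, y) \<cdot>\<^bsub>T\<^esub> (\<beta> x \<otimes>\<^sub>a\<^bsub>T\<^esub> ident T y))"

type_synonym ('o, 'a) center_obj = "'o \<times> ('o \<Rightarrow> 'a)"
type_synonym ('o, 'a) center_arr = "('o, 'a) center_obj \<times> 'a \<times> ('o, 'a) center_obj"

definition center_hom ::
  "('o, 'a, 'z) mon_cat_scheme \<Rightarrow> ('o, 'a) center_obj \<Rightarrow> ('o, 'a) center_obj \<Rightarrow> 'a set" where
  "center_hom T X Y =
    {f \<in> hom T (fst X) (fst Y). \<forall>x \<in> obj T.
       (ident T x \<otimes>\<^sub>a\<^bsub>T\<^esub> f) \<cdot>\<^bsub>T\<^esub> snd X x = snd Y x \<cdot>\<^bsub>T\<^esub> (f \<otimes>\<^sub>a\<^bsub>T\<^esub> ident T x)}"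

definition center_cat ::
  "('o, 'a, 'z) mon_cat_scheme \<Rightarrow> (('o, 'a) center_obj, ('o, 'a) center_arr) category" where
  "center_cat T =
    hom_cat {(t, \<beta>). half_braiding T t \<beta>} (center_hom T) (\<lambda>X. ident T (fst X))
      (\<lambda>X Y Z g f. g \<cdot>\<^bsub>T\<^esub> f)"

definition center_tens_obj ::
  "('o, 'a, 'z) mon_cat_scheme \<Rightarrow> ('o, 'a) center_obj \<Rightarrow> ('o, 'a) center_obj \<Rightarrow> ('o, 'a) center_obj"
  where
  "center_tens_obj T X Y =
    (let t = fst X; t' = fst Y in
     (t \<otimes>\<^bsub>T\<^esub> t',
      \<lambda>x \<in> obj T.
        assoc T (x, t, t') \<cdot>\<^bsub>T\<^esub> (snd X x \<otimes>\<^sub>a\<^bsub>T\<^esub> ident T t') \<cdot>\<^bsub>T\<^esub> inv_arr T (assoc T (t, x, t'))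
          \<cdot>\<^bsub>T\<^esub> (ident T t \<otimes>\<^sub>a\<^bsub>T\<^esub> snd Y x) \<cdot>\<^bsub>T\<^esub> assoc T (t, t', x)))"

definition center_unit :: "('o, 'a, 'z) mon_cat_scheme \<Rightarrow> ('o, 'a) center_obj" where
  "center_unit T = (\<I>\<^bsub>T\<^esub>, \<lambda>x \<in> obj T. inv_arr T (runit T x) \<cdot>\<^bsub>T\<^esub> lunit T x)"

definition center ::
  "('o, 'a, 'z) mon_cat_scheme \<Rightarrow> (('o, 'a) center_obj, ('o, 'a) center_arr) braided_cat" where
  "center T =
    (let Z = center_cat T; O2 = obj Z \<times> obj Z; O3 = obj Z \<times> obj Z \<times> obj Z;
         tz = center_tens_obj T; I = center_unit T in
     \<lparr>obj = obj Z, arr = arr Z, src = src Z, trg = trg Z, ident = ident Z, cmp = cmp Z,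
      tens =
       \<lparr>omap = (\<lambda>(X, Y) \<in> O2. tz X Y),
        amap = (\<lambda>((X, f, Y), (X', f', Y')) \<in> arr Z \<times> arr Z. (tz X X', f \<otimes>\<^sub>a\<^bsub>T\<^esub> f', tz Y Y'))\<rparr>,
      unit_obj = I,
      assoc = (\<lambda>(X, Y, W) \<in> O3. (tz (tz X Y) W, assoc T (fst X, fst Y, fst W), tz X (tz Y W))),
      lunit = (\<lambda>X \<in> obj Z. (tz I X, lunit T (fst X), X)),
      runit = (\<lambda>X \<in> obj Z. (tz X I, runit T (fst X), X)),
      braid = (\<lambda>(X, Y) \<in> O2. (tz X Y, snd X (fst Y), tz Y X))\<rparr>)"

definition forget ::
  "('o, 'a, 'z) mon_cat_scheme \<Rightarrow> (('o, 'a) center_obj, ('o, 'a) center_arr, 'o, 'a) mon_functor" where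
  "forget T =
    \<lparr>omap = (\<lambda>X \<in> obj (center T). fst X),
     amap = (\<lambda>(X, f, Y) \<in> arr (center T). f),
     phi2 = (\<lambda>(X, Y) \<in> obj (center T) \<times> obj (center T). ident T (fst X \<otimes>\<^bsub>T\<^esub> fst Y)),
     phi0 = ident T \<I>\<^bsub>T\<^esub>\<rparr>"


section \<open>Pairs\<close>

record ('v, 'w, 'o, 'a) pair =
  pcat :: "('o, 'a) mon_cat"
  pfun :: "('v, 'w, 'o, 'a) mon_functor"
  pcen :: "('v, 'w, ('o, 'a) center_obj, ('o, 'a) center_arr) mon_functor"

abbreviation pair_braid :: "('v, 'w, 'o, 'a) pair \<Rightarrow> 'v \<Rightarrow> 'o \<Rightarrow> 'a" where
  "pair_braid P v t \<equiv> snd (omap (pcen P) v) t"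

locale pair_over =
  V: braided_category V + T: monoidal_category "pcat P" + F: monoidal_functor V "pcat P" "pfun P" +
  FZ: braided_functor V "center (pcat P)" "pcen P"
  for V :: "('v, 'w) braided_cat" and P :: "('v, 'w, 'o, 'a) pair" +
  assumes pfun_eq: "pfun P = comp_mon_functor V (pcat P) (forget (pcat P)) (pcen P)"

record ('v, 'o, 'a) pair_mor =
  gfun :: "('o, 'a, 'o, 'a) mon_functor"
  gamma :: "'v \<Rightarrow> 'a"

locale pair_morphism =
  P: pair_over V P + Q: pair_over V Q + G: monoidal_functor "pcat P" "pcat Q" "gfun G"
  for V :: "('v, 'w) braided_cat" and P Q :: "('v, 'w, 'o, 'a) pair"
    and G :: "('v, 'o, 'a) pair_mor" +
  assumes gamma_mon_nat: "mon_nat_trans V (pcat Q)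
      (pfun Q) (comp_mon_functor V (pcat Q) (gfun G) (pfun P)) (gamma G)"
    and gamma_iso: "v \<in> obj V \<Longrightarrow> iso_arr (pcat Q) (gamma G v)"
    and gamma_braid: "v \<in> obj V \<Longrightarrow> t \<in> obj (pcat P) \<Longrightarrow>
      amap (gfun G) (pair_braid P v t) \<cdot>\<^bsub>pcat Q\<^esub> phi2 (gfun G) (omap (pfun P) v, t)
        \<cdot>\<^bsub>pcat Q\<^esub> (gamma G v \<otimes>\<^sub>a\<^bsub>pcat Q\<^esub> ident (pcat Q) (omap (gfun G) t)) =
      phi2 (gfun G) (t, omap (pfun P) v)
        \<cdot>\<^bsub>pcat Q\<^esub> (ident (pcat Q) (omap (gfun G) t) \<otimes>\<^sub>a\<^bsub>pcat Q\<^esub> gamma G v)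
        \<cdot>\<^bsub>pcat Q\<^esub> pair_braid Q v (omap (gfun G) t)"

definition id_pair_mor ::
  "('v, 'w) braided_cat \<Rightarrow> ('v, 'w, 'o, 'a) pair \<Rightarrow> ('v, 'o, 'a) pair_mor" where
  "id_pair_mor V P =
    \<lparr>gfun = id_mon_functor (pcat P),
     gamma = (\<lambda>v \<in> obj V. ident (pcat P) (omap (pfun P) v))\<rparr>"

definition comp_pair_mor ::
  "('v, 'w) braided_cat \<Rightarrow> ('v, 'w, 'o, 'a) pair \<Rightarrow> ('v, 'w, 'o, 'a) pair \<Rightarrow>
   ('v, 'o, 'a) pair_mor \<Rightarrow> ('v, 'o, 'a) pair_mor \<Rightarrow> ('v, 'o, 'a) pair_mor" where
  "comp_pair_mor V P R G' G =
    \<lparr>gfun = comp_mon_functor (pcat P) (pcat R) (gfun G') (gfun G),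
     gamma = (\<lambda>v \<in> obj V. amap (gfun G') (gamma G v) \<cdot>\<^bsub>pcat R\<^esub> gamma G' v)\<rparr>"

definition pair_trans ::
  "('v, 'w) braided_cat \<Rightarrow> ('v, 'w, 'o, 'a) pair \<Rightarrow> ('v, 'w, 'o, 'a) pair \<Rightarrow>
   ('v, 'o, 'a) pair_mor \<Rightarrow> ('v, 'o, 'a) pair_mor \<Rightarrow> ('o \<Rightarrow> 'a) set" where
  "pair_trans V P Q G G' =
    {\<eta>. mon_nat_trans (pcat P) (pcat Q) (gfun G) (gfun G') \<eta> \<and>
        (\<forall>v \<in> obj V. \<eta> (omap (pfun P) v) \<cdot>\<^bsub>pcat Q\<^esub> gamma G v = gamma G' v)}"


section \<open>Strict 2-categories\<close>

text \<open>
  A strict 2-category consists of three categories: \<open>cat1\<close> (objects and 1-cells), \<open>vcat\<close> (1-cells and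
  2-cells with vertical composition) and \<open>hcat\<close> (objects and 2-cells with horizontal composition).
\<close>

record ('o, 'm, 'c) two_cat =
  cat1 :: "('o, 'm) category"
  vcat :: "('m, 'c) category"
  hcat :: "('o, 'c) category"

locale strict_two_category =
  C1: category "cat1 K" + CV: category "vcat K" + CH: category "hcat K"
  for K :: "('o, 'm, 'c) two_cat" +
  assumes obj_vcat: "obj (vcat K) = arr (cat1 K)"
    and obj_hcat: "obj (hcat K) = obj (cat1 K)"
    and arr_hcat: "arr (hcat K) = arr (vcat K)"
    and src_hcat: "\<alpha> \<in> arr (vcat K) \<Longrightarrow>
      src (hcat K) \<alpha> = src (cat1 K) (src (vcat K) \<alpha>) \<and> src (hcat K) \<alpha> = src (cat1 K) (trg (vcat K) \<alpha>)"
    and trg_hcat: "\<alpha> \<in> arr (vcat K) \<Longrightarrow>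
      trg (hcat K) \<alpha> = trg (cat1 K) (src (vcat K) \<alpha>) \<and> trg (hcat K) \<alpha> = trg (cat1 K) (trg (vcat K) \<alpha>)"
    and ident_hcat: "X \<in> obj (cat1 K) \<Longrightarrow> ident (hcat K) X = ident (vcat K) (ident (cat1 K) X)"
    and hcmp_src: "\<alpha> \<in> hom (hcat K) X Y \<Longrightarrow> \<beta> \<in> hom (hcat K) Y Z \<Longrightarrow>
      src (vcat K) (\<beta> \<cdot>\<^bsub>hcat K\<^esub> \<alpha>) = src (vcat K) \<beta> \<cdot>\<^bsub>cat1 K\<^esub> src (vcat K) \<alpha>"
    and hcmp_trg: "\<alpha> \<in> hom (hcat K) X Y \<Longrightarrow> \<beta> \<in> hom (hcat K) Y Z \<Longrightarrow>
      trg (vcat K) (\<beta> \<cdot>\<^bsub>hcat K\<^esub> \<alpha>) = trg (vcat K) \<beta> \<cdot>\<^bsub>cat1 K\<^esub> trg (vcat K) \<alpha>"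
    and hcmp_ident: "f \<in> hom (cat1 K) X Y \<Longrightarrow> g \<in> hom (cat1 K) Y Z \<Longrightarrow>
      ident (vcat K) g \<cdot>\<^bsub>hcat K\<^esub> ident (vcat K) f = ident (vcat K) (g \<cdot>\<^bsub>cat1 K\<^esub> f)"
    and interchange: "\<alpha> \<in> hom (hcat K) X Y \<Longrightarrow> \<alpha>' \<in> hom (hcat K) X Y \<Longrightarrow>
      \<beta> \<in> hom (hcat K) Y Z \<Longrightarrow> \<beta>' \<in> hom (hcat K) Y Z \<Longrightarrow>
      trg (vcat K) \<alpha> = src (vcat K) \<alpha>' \<Longrightarrow> trg (vcat K) \<beta> = src (vcat K) \<beta>' \<Longrightarrow>
      (\<beta>' \<cdot>\<^bsub>vcat K\<^esub> \<beta>) \<cdot>\<^bsub>hcat K\<^esub> (\<alpha>' \<cdot>\<^bsub>vcat K\<^esub> \<alpha>) =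
      (\<beta>' \<cdot>\<^bsub>hcat K\<^esub> \<alpha>') \<cdot>\<^bsub>vcat K\<^esub> (\<beta> \<cdot>\<^bsub>hcat K\<^esub> \<alpha>)"

record ('o, 'm, 'c, 'p, 'n, 'd) two_functor =
  map0 :: "'o \<Rightarrow> 'p"
  map1 :: "'m \<Rightarrow> 'n"
  map2 :: "'c \<Rightarrow> 'd"

locale two_functor = K: strict_two_category K + L: strict_two_category L
  for K :: "('o, 'm, 'c) two_cat" and L :: "('p, 'n, 'd) two_cat" +
  fixes F :: "('o, 'm, 'c, 'p, 'n, 'd) two_functor"
  assumes functor1: "cat_functor (cat1 K) (cat1 L) \<lparr>omap = map0 F, amap = map1 F\<rparr>"
    and functor_v: "cat_functor (vcat K) (vcat L) \<lparr>omap = map1 F, amap = map2 F\<rparr>"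
    and functor_h: "cat_functor (hcat K) (hcat L) \<lparr>omap = map0 F, amap = map2 F\<rparr>"

definition id_two_functor :: "('o, 'm, 'c) two_cat \<Rightarrow> ('o, 'm, 'c, 'o, 'm, 'c) two_functor" where
  "id_two_functor K =
    \<lparr>map0 = (\<lambda>X \<in> obj (cat1 K). X), map1 = (\<lambda>f \<in> arr (cat1 K). f), map2 = (\<lambda>\<alpha> \<in> arr (vcat K). \<alpha>)\<rparr>"

definition comp_two_functor ::
  "('o, 'm, 'c) two_cat \<Rightarrow> ('p, 'n, 'd, 'q, 'r, 'e) two_functor \<Rightarrow>
   ('o, 'm, 'c, 'p, 'n, 'd) two_functor \<Rightarrow> ('o, 'm, 'c, 'q, 'r, 'e) two_functor" where
  "comp_two_functor K G F =
    \<lparr>map0 = (\<lambda>X \<in> obj (cat1 K). map0 G (map0 F X)),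
     map1 = (\<lambda>f \<in> arr (cat1 K). map1 G (map1 F f)),
     map2 = (\<lambda>\<alpha> \<in> arr (vcat K). map2 G (map2 F \<alpha>))\<rparr>"

locale two_natural_iso = F: two_functor K L F + G: two_functor K L G
  for K :: "('o, 'm, 'c) two_cat" and L :: "('p, 'n, 'd) two_cat"
    and F G :: "('o, 'm, 'c, 'p, 'n, 'd) two_functor" +
  fixes \<eta> :: "'o \<Rightarrow> 'n"
  assumes natural1: "nat_iso (cat1 K) (cat1 L)
      \<lparr>omap = map0 F, amap = map1 F\<rparr> \<lparr>omap = map0 G, amap = map1 G\<rparr> \<eta>"
    and natural2: "\<alpha> \<in> hom (hcat K) X Y \<Longrightarrow>
      map2 G \<alpha> \<cdot>\<^bsub>hcat L\<^esub> ident (vcat L) (\<eta> X) = ident (vcat L) (\<eta> Y) \<cdot>\<^bsub>hcat L\<^esub> map2 F \<alpha>"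

definition two_equivalent :: "('o, 'm, 'c) two_cat \<Rightarrow> ('p, 'n, 'd) two_cat \<Rightarrow> bool" where
  "two_equivalent K L \<longleftrightarrow>
    (\<exists>\<Psi> \<Phi> \<eta> \<epsilon>.
      two_functor K L \<Psi> \<and> two_functor L K \<Phi> \<and>
      two_natural_iso K K (id_two_functor K) (comp_two_functor K \<Phi> \<Psi>) \<eta> \<and>
      two_natural_iso L L (comp_two_functor L \<Psi> \<Phi>) (id_two_functor L) \<epsilon>)"

text \<open>
  The 2-category with objects \<open>Os\<close>, 1-cells \<open>H X Y\<close> and 2-cells \<open>T X Y F G\<close>, where each object \<open>X\<close> has
  an underlying category \<open>U X\<close>, each 1-cell \<open>F\<close> an underlying functor \<open>u F\<close>, and 2-cells are natural
  transformations between underlying functors with componentwise vertical and Godement horizontal composition.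
\<close>

type_synonym ('x, 'f) cell1 = "'x \<times> 'f \<times> 'x"
type_synonym ('x, 'f, 'o, 'a) cell2 = "('x, 'f) cell1 \<times> ('o \<Rightarrow> 'a) \<times> ('x, 'f) cell1"

definition concrete_two_cat ::
  "'x set \<Rightarrow> ('x \<Rightarrow> 'x \<Rightarrow> 'f set) \<Rightarrow> ('x \<Rightarrow> 'f) \<Rightarrow> ('x \<Rightarrow> 'x \<Rightarrow> 'x \<Rightarrow> 'f \<Rightarrow> 'f \<Rightarrow> 'f) \<Rightarrow>
   ('x \<Rightarrow> 'x \<Rightarrow> 'f \<Rightarrow> 'f \<Rightarrow> ('o \<Rightarrow> 'a) set) \<Rightarrow>
   ('x \<Rightarrow> ('o, 'a) mon_cat) \<Rightarrow> ('f \<Rightarrow> ('o, 'a, 'o, 'a) mon_functor) \<Rightarrow>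
   ('x, ('x, 'f) cell1, ('x, 'f, 'o, 'a) cell2) two_cat" where
  "concrete_two_cat Os H i c T U u =
    (let C1 = hom_cat Os H i c;
         CV = hom_cat (arr C1)
           (\<lambda>(X, F, Y) (X', G, Y'). if X = X' \<and> Y = Y' then T X Y F G else {})
           (\<lambda>(X, F, Y). \<lambda>x \<in> obj (U X). ident (U Y) (omap (u F) x))
           (\<lambda>(X, F, Y) _ _ \<theta> \<eta>. \<lambda>x \<in> obj (U X). \<theta> x \<cdot>\<^bsub>U Y\<^esub> \<eta> x);
         sh = (\<lambda>\<alpha> \<in> arr CV. src C1 (src CV \<alpha>));
         th = (\<lambda>\<alpha> \<in> arr CV. trg C1 (src CV \<alpha>))
     in
     \<lparr>cat1 = C1,
      vcat = CV,
      hcat =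
       \<lparr>obj = Os,
        arr = arr CV,
        src = sh,
        trg = th,
        ident = (\<lambda>X \<in> Os. ident CV (ident C1 X)),
        cmp = (\<lambda>(H1, \<theta>, H2) (G1, \<eta>, G2).
          if (H1, \<theta>, H2) \<in> arr CV \<and> (G1, \<eta>, G2) \<in> arr CV \<and> th (G1, \<eta>, G2) = sh (H1, \<theta>, H2)
          then
            (H1 \<cdot>\<^bsub>C1\<^esub> G1,
             \<lambda>x \<in> obj (U (src C1 G1)).
               \<theta> (omap (u (fst (snd G2))) x) \<cdot>\<^bsub>U (trg C1 H1)\<^esub> amap (u (fst (snd H1))) (\<eta> x),
             H2 \<cdot>\<^bsub>C1\<^esub> G2)
          else undefined)\<rparr>\<rparr>)"

type_synonym ('v, 'w, 'o, 'a) pairs_two_cat =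
  "(('v, 'w, 'o, 'a) pair,
    (('v, 'w, 'o, 'a) pair, ('v, 'o, 'a) pair_mor) cell1,
    (('v, 'w, 'o, 'a) pair, ('v, 'o, 'a) pair_mor, 'o, 'a) cell2) two_cat"

type_synonym ('v, 'w, 'o, 'a) umm_two_cat =
  "(('v, 'w, 'o, 'a) umm_cat,
    (('v, 'w, 'o, 'a) umm_cat, ('v, 'o, 'a) umm_functor) cell1,
    (('v, 'w, 'o, 'a) umm_cat, ('v, 'o, 'a) umm_functor, 'o, 'a) cell2) two_cat"

definition Pairs :: "('v, 'w) braided_cat \<Rightarrow> ('v, 'w, 'o, 'a) pairs_two_cat" where
  "Pairs V =
    concrete_two_cat {P. pair_over V P} (\<lambda>P Q. {G. pair_morphism V P Q G})
      (id_pair_mor V) (\<lambda>P Q R. comp_pair_mor V P R) (pair_trans V) pcat gfun"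

definition UModMonCat :: "('v, 'w) braided_cat \<Rightarrow> ('v, 'w, 'o, 'a) umm_two_cat" where
  "UModMonCat V =
    concrete_two_cat {M. umm_category V M} (\<lambda>M N. {F. umm_functor V M N F})
      (id_umm_functor V) (\<lambda>M N R. comp_umm_functor V M R) (umm_trans V) ucat ufun"

end

theory Submission
  imports Defs
begin

text \<open>
  A pair is a central action. If \<open>F\<close> is a braided central functor into
  \<open>T\<close>, then \<open>V\<close> acts on \<open>T\<close> by \<open>v \<rhd> x = F v
  \<otimes> x\<close>. The associator is \<open>\<alpha>1\<close>, and moving \<open>F v\<close>
  to the left past \<open>x\<close> with the inverse half-braiding is \<open>\<alpha>2\<close>;
  the hexagon of the half-braiding, its multiplicativity in \<open>v\<close> and the
  compatibility of \<open>F\<close> with the braidings are exactly what the axioms on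
  \<open>\<alpha>2\<close> ask for (\<open>central_functor.induced_umm\<close>). Conversely, a
  module monoidal category contains the free objects \<open>v \<rhd> \<I>\<close>, and absorbing
  the unit in \<open>\<alpha>1\<close> and \<open>\<alpha>2\<close> gives isomorphisms
  \<open>act_left v x : (v \<rhd> \<I>) \<otimes> x \<rightarrow> v \<rhd> x\<close> and
  \<open>act_right v x : x \<otimes> (v \<rhd> \<I>) \<rightarrow> v \<rhd> x\<close>. The
  composite of the first with the inverse of the second is a half-braiding on \<open>v \<rhd>
  \<I>\<close>, and \<open>v \<mapsto> v \<rhd> \<I>\<close> becomes a central functor (locale
  \<open>umm\<close>).

  On 1-cells, \<open>\<gamma>\<close> determines the strength \<open>s (v, x) = phi2 G (F v, x)
  \<cdot> (\<gamma> v \<otimes> G x)\<close>, and a strength determines \<open>\<gamma> v = s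
  (v, \<I>) \<cdot> (v \<rhd> phi0)\<close>. That the second assignment is compatible with the
  half-braidings and that both are mutually inverse up to the isomorphisms below rests on one
  identity, \<open>umm_functor.strength_act_left\<close>, and its mirror image: modulo
  \<open>\<gamma>\<close> and \<open>s\<close>, a module monoidal functor preserves
  \<open>act_left\<close> and \<open>act_right\<close>.

  Starting from a pair, the round trip replaces \<open>F v\<close> by \<open>F v \<otimes>
  \<I>\<close>, so the right unit constraints form the natural isomorphism from the identity.
  Starting from a module monoidal category, it replaces \<open>v \<rhd> x\<close> by \<open>(v
  \<rhd> \<I>) \<otimes> x\<close>, and the inverses of \<open>act_left\<close> form the natural
  isomorphism to the identity. Both have the identity as underlying monoidal functor.

  Neither construction touches the underlying monoidal categories, monoidal functors and natural
  transformations. All statements about 2-cells therefore hold because the same families of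
  arrows remain 2-cells, and 2-functoriality and 2-naturality reduce to equations between
  1-cells (locales \<open>structure_two_functor\<close> and
  \<open>structure_two_natural_iso\<close>).

  The equations between arrows are diagram chases. They are carried out for arrows lifted to an
  option type, on which composition is total and associative, so that the simplifier can
  rebracket composites and apply naturality without proving typing conditions at each step.
\<close>

section \<open>Diagram chasing with a total composition\<close>

named_theorems chase "expansion of composites into single lifted arrows, nested to the right"

text \<open>
  Composition of arrows is associative only under typing premises, which every rewrite step
  would have to discharge. After lifting arrows to options, with \<open>None\<close> as the
  value of an ill-typed composite, the composition is associative unconditionally, and an
  equation between lifted well-typed arrows can be read back as an equation between the arrows.
\<close>

definition lift :: "('o, 'a, 'z) category_scheme \<Rightarrow> 'a \<Rightarrow> 'a option"
  ("\<lfloor>_\<rfloor>\<index>") where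
  "lift C f = (if f \<in> arr C then Some f else None)"

definition ocmp ::
  "('o, 'a, 'z) category_scheme \<Rightarrow> 'a option \<Rightarrow> 'a option \<Rightarrow> 'a option" (infixr "\<odot>\<index>" 55) where
  "ocmp C G F = (case F of None \<Rightarrow> None | Some f \<Rightarrow> (case G of None \<Rightarrow> None | Some g \<Rightarrow>
     if f \<in> arr C \<and> g \<in> arr C \<and> trg C f = src C g then Some (g \<cdot>\<^bsub>C\<^esub> f) else None))"

context category
begin

lemma src_in [simp]: "f \<in> arr C \<Longrightarrow> src C f \<in> obj C"
  and trg_in [simp]: "f \<in> arr C \<Longrightarrow> trg C f \<in> obj C"
  using src_obj trg_obj by auto

lemma ident_typ [simp]:
  assumes "x \<in> obj C"
  shows "ident C x \<in> arr C" "src C (ident C x) = x" "trg C (ident C x) = x"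
  using ident_hom[OF assms] by (auto simp: hom_def)

lemma cmp_typ [simp]:
  assumes "f \<in> arr C" "g \<in> arr C" "trg C f = src C g"
  shows "g \<cdot> f \<in> arr C" "src C (g \<cdot> f) = src C f" "trg C (g \<cdot> f) = trg C g"
  using cmp_hom[of f "src C f" "trg C f" g "trg C g"] assms by (auto simp: hom_def)

lemma ident_right [simp]: "f \<in> arr C \<Longrightarrow> src C f = x \<Longrightarrow> f \<cdot> ident C x = f"
  and ident_left [simp]: "f \<in> arr C \<Longrightarrow> trg C f = x \<Longrightarrow> ident C x \<cdot> f = f"
  using cmp_ident_right[of f "src C f" "trg C f"] cmp_ident_left[of f "src C f" "trg C f"]
  by (auto simp: hom_def)

lemma assoc_arr:
  "f \<in> arr C \<Longrightarrow> g \<in> arr C \<Longrightarrow> h \<in> arr C \<Longrightarrow> trg C f = src C g \<Longrightarrow> trg C g = src C h \<Longrightarrow>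
   (h \<cdot> g) \<cdot> f = h \<cdot> (g \<cdot> f)"
  using cmp_assoc[of f "src C f" "trg C f" g "trg C g" h "trg C h"] by (auto simp: hom_def)

lemma ocmp_assoc [chase]: "(H \<odot> G) \<odot> F = H \<odot> (G \<odot> F)"
  by (auto simp: ocmp_def assoc_arr split: option.splits)

lemma lift_cmp [chase]: "f \<in> arr C \<Longrightarrow> g \<in> arr C \<Longrightarrow> trg C f = src C g \<Longrightarrow>
    \<lfloor>g \<cdot> f\<rfloor> = \<lfloor>g\<rfloor> \<odot> \<lfloor>f\<rfloor>"
  by (simp add: ocmp_def lift_def)

lemma lift_eqI: "\<lfloor>f\<rfloor> = \<lfloor>g\<rfloor> \<Longrightarrow> f \<in> arr C \<Longrightarrow> f = g"
  by (auto simp: lift_def split: if_splits)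

lemma up: "f = g \<Longrightarrow> \<lfloor>f\<rfloor> = \<lfloor>g\<rfloor>"
  by simp

text \<open>
  Composites are nested to the right, so a law for a composite of two, three or four arrows has
  to be extended by an arbitrary tail before it can rewrite in the middle of a chase.
\<close>

lemma re: "G \<odot> F = R \<Longrightarrow> G \<odot> (F \<odot> Q) = R \<odot> Q"
  by (simp add: ocmp_assoc [symmetric])

lemma re3: "H \<odot> (G \<odot> F) = R \<Longrightarrow> H \<odot> (G \<odot> (F \<odot> Q)) = R \<odot> Q"
  by (metis ocmp_assoc)

lemma re4: "K \<odot> (H \<odot> (G \<odot> F)) = R \<Longrightarrow> K \<odot> (H \<odot> (G \<odot> (F \<odot> Q))) = R \<odot> Q"
  by (metis ocmp_assoc)

lemma ocmp_ident_left [simp]: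
  "f \<in> arr C \<Longrightarrow> trg C f = x \<Longrightarrow> \<lfloor>ident C x\<rfloor> \<odot> \<lfloor>f\<rfloor> = \<lfloor>f\<rfloor>"
  "f \<in> arr C \<Longrightarrow> trg C f = x \<Longrightarrow> \<lfloor>ident C x\<rfloor> \<odot> (\<lfloor>f\<rfloor> \<odot> Q) = \<lfloor>f\<rfloor> \<odot> Q"
proof -
  show *: "f \<in> arr C \<Longrightarrow> trg C f = x \<Longrightarrow> \<lfloor>ident C x\<rfloor> \<odot> \<lfloor>f\<rfloor> = \<lfloor>f\<rfloor>" for f x
    by (subst lift_cmp [symmetric]) auto
  show "f \<in> arr C \<Longrightarrow> trg C f = x \<Longrightarrow> \<lfloor>ident C x\<rfloor> \<odot> (\<lfloor>f\<rfloor> \<odot> Q) = \<lfloor>f\<rfloor> \<odot> Q"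
    by (metis * ocmp_assoc)
qed

lemma ocmp_ident_right [simp]:
  "f \<in> arr C \<Longrightarrow> src C f = x \<Longrightarrow> \<lfloor>f\<rfloor> \<odot> \<lfloor>ident C x\<rfloor> = \<lfloor>f\<rfloor>"
  "f \<in> arr C \<Longrightarrow> src C f = x \<Longrightarrow> \<lfloor>f\<rfloor> \<odot> (\<lfloor>ident C x\<rfloor> \<odot> Q) = \<lfloor>f\<rfloor> \<odot> Q"
proof -
  show *: "f \<in> arr C \<Longrightarrow> src C f = x \<Longrightarrow> \<lfloor>f\<rfloor> \<odot> \<lfloor>ident C x\<rfloor> = \<lfloor>f\<rfloor>" for f x
    by (subst lift_cmp [symmetric]) auto
  show "f \<in> arr C \<Longrightarrow> src C f = x \<Longrightarrow> \<lfloor>f\<rfloor> \<odot> (\<lfloor>ident C x\<rfloor> \<odot> Q) = \<lfloor>f\<rfloor> \<odot> Q"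
    by (metis * ocmp_assoc)
qed

lemma ident_idem [simp]: "x \<in> obj C \<Longrightarrow> ident C x \<cdot> ident C x = ident C x"
  by simp

lemma inverse_unique:
  assumes "inverse_arrows C f g" "inverse_arrows C f h"
  shows "g = h"
proof -
  have "g \<cdot> (f \<cdot> h) = (g \<cdot> f) \<cdot> h"
    using assms by (intro assoc_arr [symmetric]) (auto simp: inverse_arrows_def hom_def)
  with assms show ?thesis
    by (auto simp: inverse_arrows_def hom_def)
qed

lemma inv_arr_eq: "inverse_arrows C f g \<Longrightarrow> inv_arr C f = g"
  unfolding inv_arr_def using inverse_unique by blast

lemma inverse_inv: "iso_arr C f \<Longrightarrow> inverse_arrows C f (inv_arr C f)"
  using inv_arr_eq by (auto simp: iso_arr_def)

lemma inverse_sym: "inverse_arrows C f g \<Longrightarrow> inverse_arrows C g f"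
  by (auto simp: inverse_arrows_def hom_def)

lemma iso_in: "iso_arr C f \<Longrightarrow> f \<in> arr C"
  by (auto simp: iso_arr_def inverse_arrows_def)

lemma inv_typ [simp]:
  assumes "iso_arr C f"
  shows "inv_arr C f \<in> arr C" "src C (inv_arr C f) = trg C f" "trg C (inv_arr C f) = src C f"
    "inv_arr C f \<cdot> f = ident C (src C f)" "f \<cdot> inv_arr C f = ident C (trg C f)"
    "iso_arr C (inv_arr C f)" "inv_arr C (inv_arr C f) = f"
  using inverse_inv[OF assms] inverse_sym[OF inverse_inv[OF assms]] inv_arr_eq
  by (auto simp: inverse_arrows_def hom_def iso_arr_def)

lemma ident_iso [simp]: "x \<in> obj C \<Longrightarrow> iso_arr C (ident C x)" "x \<in> obj C \<Longrightarrow> inv_arr C (ident C x) = ident C x"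
proof -
  assume "x \<in> obj C"
  then have "inverse_arrows C (ident C x) (ident C x)"
    by (simp add: inverse_arrows_def hom_def)
  then show "iso_arr C (ident C x)" "inv_arr C (ident C x) = ident C x"
    using inv_arr_eq by (auto simp: iso_arr_def)
qed

lemma iso_cancel [simp]:
  assumes "iso_arr C f"
  shows "\<lfloor>inv_arr C f\<rfloor> \<odot> \<lfloor>f\<rfloor> = \<lfloor>ident C (src C f)\<rfloor>"
    "\<lfloor>f\<rfloor> \<odot> \<lfloor>inv_arr C f\<rfloor> = \<lfloor>ident C (trg C f)\<rfloor>"
    "\<lfloor>inv_arr C f\<rfloor> \<odot> (\<lfloor>f\<rfloor> \<odot> Q) = \<lfloor>ident C (src C f)\<rfloor> \<odot> Q"
    "\<lfloor>f\<rfloor> \<odot> (\<lfloor>inv_arr C f\<rfloor> \<odot> Q) = \<lfloor>ident C (trg C f)\<rfloor> \<odot> Q"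
proof -
  have "f \<in> arr C" using assms by (rule iso_in)
  then show *: "\<lfloor>inv_arr C f\<rfloor> \<odot> \<lfloor>f\<rfloor> = \<lfloor>ident C (src C f)\<rfloor>"
    "\<lfloor>f\<rfloor> \<odot> \<lfloor>inv_arr C f\<rfloor> = \<lfloor>ident C (trg C f)\<rfloor>"
    using lift_cmp[of f "inv_arr C f"] lift_cmp[of "inv_arr C f" f] assms by simp_all
  show "\<lfloor>inv_arr C f\<rfloor> \<odot> (\<lfloor>f\<rfloor> \<odot> Q) = \<lfloor>ident C (src C f)\<rfloor> \<odot> Q"
    "\<lfloor>f\<rfloor> \<odot> (\<lfloor>inv_arr C f\<rfloor> \<odot> Q) = \<lfloor>ident C (trg C f)\<rfloor> \<odot> Q"
    by (rule re[OF *(1)], rule re[OF *(2)])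
qed

lemma cmp_inverse:
  assumes "iso_arr C f" "iso_arr C g" "trg C f = src C g"
  shows "inverse_arrows C (g \<cdot> f) (inv_arr C f \<cdot> inv_arr C g)"
proof -
  note [simp] = assms iso_in[OF assms(1)] iso_in[OF assms(2)]
  have "(inv_arr C f \<cdot> inv_arr C g) \<cdot> (g \<cdot> f) = ident C (src C f)"
    by (rule lift_eqI) (simp_all add: lift_cmp ocmp_assoc)
  moreover have "(g \<cdot> f) \<cdot> (inv_arr C f \<cdot> inv_arr C g) = ident C (trg C g)"
    by (rule lift_eqI) (simp_all add: lift_cmp ocmp_assoc flip: assms(3))
  ultimately show ?thesis
    by (simp add: inverse_arrows_def hom_def)
qed

lemma
  assumes "iso_arr C f" "iso_arr C g" "trg C f = src C g"
  shows cmp_iso [simp]: "iso_arr C (g \<cdot> f)" and inv_cmp [chase]: "inv_arr C (g \<cdot> f) = inv_arr C f \<cdot> inv_arr C g"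
  using cmp_inverse[OF assms] inv_arr_eq by (auto simp: iso_arr_def)

text \<open>
  Turning a commuting square around: this transfers naturality and coherence laws from a
  constraint to its inverse.
\<close>

lemma iso_flip:
  assumes "\<lfloor>n'\<rfloor> \<odot> \<lfloor>p\<rfloor> = \<lfloor>q\<rfloor> \<odot> \<lfloor>n\<rfloor>" "iso_arr C n" "iso_arr C n'"
    "p \<in> arr C" "q \<in> arr C" "trg C p = src C n'" "src C q = trg C n"
  shows "\<lfloor>p\<rfloor> \<odot> \<lfloor>inv_arr C n\<rfloor> = \<lfloor>inv_arr C n'\<rfloor> \<odot> \<lfloor>q\<rfloor>"
proof -
  have "\<lfloor>inv_arr C n'\<rfloor> \<odot> (\<lfloor>n'\<rfloor> \<odot> \<lfloor>p\<rfloor>) \<odot> \<lfloor>inv_arr C n\<rfloor> = \<lfloor>inv_arr C n'\<rfloor> \<odot> (\<lfloor>q\<rfloor> \<odot> \<lfloor>n\<rfloor>) \<odot> \<lfloor>inv_arr C n\<rfloor>"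
    using assms(1) by simp
  with assms(2-) show ?thesis
    by (simp add: ocmp_assoc)
qed

lemma iso_left_cancel:
  assumes "\<lfloor>h\<rfloor> \<odot> \<lfloor>f\<rfloor> = \<lfloor>h\<rfloor> \<odot> \<lfloor>g\<rfloor>" "iso_arr C h" "f \<in> arr C" "g \<in> arr C" "trg C f = src C h" "trg C g = src C h"
  shows "f = g"
proof -
  have "\<lfloor>inv_arr C h\<rfloor> \<odot> \<lfloor>h\<rfloor> \<odot> \<lfloor>f\<rfloor> = \<lfloor>inv_arr C h\<rfloor> \<odot> \<lfloor>h\<rfloor> \<odot> \<lfloor>g\<rfloor>"
    using assms(1) by simp
  with assms(2-) show ?thesis
    by (intro lift_eqI) simp_all
qed

lemma iso_right_cancel:
  assumes "\<lfloor>f\<rfloor> \<odot> \<lfloor>h\<rfloor> = \<lfloor>g\<rfloor> \<odot> \<lfloor>h\<rfloor>" "iso_arr C h" "f \<in> arr C" "g \<in> arr C" "src C f = trg C h" "src C g = trg C h"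
  shows "f = g"
proof -
  have "(\<lfloor>f\<rfloor> \<odot> \<lfloor>h\<rfloor>) \<odot> \<lfloor>inv_arr C h\<rfloor> = (\<lfloor>g\<rfloor> \<odot> \<lfloor>h\<rfloor>) \<odot> \<lfloor>inv_arr C h\<rfloor>"
    using assms(1) by simp
  with assms(2-) show ?thesis
    by (intro lift_eqI) (simp_all add: ocmp_assoc)
qed

end

lemma (in cat_functor) map_typ [simp]:
  "x \<in> obj C \<Longrightarrow> omap F x \<in> obj D"
  "f \<in> arr C \<Longrightarrow> amap F f \<in> arr D"
  "f \<in> arr C \<Longrightarrow> src D (amap F f) = omap F (src C f)"
  "f \<in> arr C \<Longrightarrow> trg D (amap F f) = omap F (trg C f)"
  "x \<in> obj C \<Longrightarrow> amap F (ident C x) = ident D (omap F x)"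
  using omap_obj amap_hom[of f "src C f" "trg C f"] amap_ident by (auto simp: hom_def)

lemma (in cat_functor) map_cmp:
  "f \<in> arr C \<Longrightarrow> g \<in> arr C \<Longrightarrow> trg C f = src C g \<Longrightarrow> amap F (g \<cdot>\<^bsub>C\<^esub> f) = amap F g \<cdot>\<^bsub>D\<^esub> amap F f"
  using amap_cmp[of f "src C f" "trg C f" g "trg C g"] by (auto simp: hom_def)

lemma (in cat_functor) map_inverse:
  assumes "iso_arr C f"
  shows "inverse_arrows D (amap F f) (amap F (inv_arr C f))"
  using assms C.iso_in[OF assms] by (simp add: inverse_arrows_def hom_def flip: map_cmp)

lemma (in cat_functor) map_iso [simp]:
  assumes "iso_arr C f"
  shows "iso_arr D (amap F f)" "amap F (inv_arr C f) = inv_arr D (amap F f)"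
  using map_inverse[OF assms] D.inv_arr_eq by (auto simp: iso_arr_def)

lemma prod_cat_simps [simp]:
  "obj (C \<times>\<^sub>C D) = obj C \<times> obj D"
  "arr (C \<times>\<^sub>C D) = arr C \<times> arr D"
  "f \<in> arr C \<Longrightarrow> g \<in> arr D \<Longrightarrow> src (C \<times>\<^sub>C D) (f, g) = (src C f, src D g)"
  "f \<in> arr C \<Longrightarrow> g \<in> arr D \<Longrightarrow> trg (C \<times>\<^sub>C D) (f, g) = (trg C f, trg D g)"
  "x \<in> obj C \<Longrightarrow> y \<in> obj D \<Longrightarrow> ident (C \<times>\<^sub>C D) (x, y) = (ident C x, ident D y)"
  "f \<in> arr C \<Longrightarrow> f' \<in> arr C \<Longrightarrow> g \<in> arr D \<Longrightarrow> g' \<in> arr D \<Longrightarrow> trg C f = src C f' \<Longrightarrow> trg D g = src D g' \<Longrightarrow>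
     (f', g') \<cdot>\<^bsub>C \<times>\<^sub>C D\<^esub> (f, g) = (f' \<cdot>\<^bsub>C\<^esub> f, g' \<cdot>\<^bsub>D\<^esub> g)"
  by (auto simp: prod_cat_def)

lemma prod_category:
  assumes "category C" "category D"
  shows "category (C \<times>\<^sub>C D)"
proof -
  interpret C: category C by fact
  interpret D: category D by fact
  show ?thesis
    by unfold_locales
      (auto simp: hom_def C.assoc_arr D.assoc_arr, auto simp: prod_cat_def extensional_def split: if_splits)
qed

lemma prod_inverse:
  assumes "category C" "category D"
    and "inverse_arrows C f f'" "inverse_arrows D g g'"
  shows "inverse_arrows (C \<times>\<^sub>C D) (f, g) (f', g')"
proof -
  interpret C: category C by fact
  interpret D: category D by fact
  show ?thesis
    using assms(3,4) by (auto simp: inverse_arrows_def hom_def)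
qed

text \<open>Tensor products and actions are both functors of two variables; their whiskering laws are the same.\<close>

locale bifunctor = A: category C + B: category D + E: category E + cat_functor "C \<times>\<^sub>C D" E F
  for C :: "('o, 'a, 'x) category_scheme" and D :: "('p, 'b, 'y) category_scheme"
    and E :: "('q, 'c, 'z) category_scheme" (structure) and F :: "('o \<times> 'p, 'a \<times> 'b, 'q, 'c, 'w) cat_functor_scheme"
begin

lemma bimap_typ [simp]:
  "x \<in> obj C \<Longrightarrow> y \<in> obj D \<Longrightarrow> omap F (x, y) \<in> obj E"
  "f \<in> arr C \<Longrightarrow> g \<in> arr D \<Longrightarrow> amap F (f, g) \<in> arr E"
  "f \<in> arr C \<Longrightarrow> g \<in> arr D \<Longrightarrow> src E (amap F (f, g)) = omap F (src C f, src D g)"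
  "f \<in> arr C \<Longrightarrow> g \<in> arr D \<Longrightarrow> trg E (amap F (f, g)) = omap F (trg C f, trg D g)"
  "x \<in> obj C \<Longrightarrow> y \<in> obj D \<Longrightarrow> amap F (ident C x, ident D y) = ident E (omap F (x, y))"
  using map_typ(1)[of "(x, y)"] map_typ(2-4)[of "(f, g)"] map_typ(5)[of "(x, y)"] by auto

lemma bimap_cmp:
  assumes "f \<in> arr C" "f' \<in> arr C" "trg C f = src C f'" "g \<in> arr D" "g' \<in> arr D" "trg D g = src D g'"
  shows "amap F (f' \<cdot>\<^bsub>C\<^esub> f, g' \<cdot>\<^bsub>D\<^esub> g) = amap F (f', g') \<cdot> amap F (f, g)"
  using map_cmp[of "(f, g)" "(f', g')"] assms by simp

lemma bimap_left [chase]: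
  assumes "f \<in> arr C" "f' \<in> arr C" "trg C f = src C f'" "y \<in> obj D"
  shows "amap F (f' \<cdot>\<^bsub>C\<^esub> f, ident D y) = amap F (f', ident D y) \<cdot> amap F (f, ident D y)"
  using bimap_cmp[of f f' "ident D y" "ident D y"] assms by simp

lemma bimap_right [chase]:
  assumes "x \<in> obj C" "g \<in> arr D" "g' \<in> arr D" "trg D g = src D g'"
  shows "amap F (ident C x, g' \<cdot>\<^bsub>D\<^esub> g) = amap F (ident C x, g') \<cdot> amap F (ident C x, g)"
  using bimap_cmp[of "ident C x" "ident C x" g g'] assms by simp

lemma bimap_iso [simp]:
  assumes "iso_arr C f" "iso_arr D g"
  shows "iso_arr E (amap F (f, g))" "amap F (inv_arr C f, inv_arr D g) = inv_arr E (amap F (f, g))"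
proof -
  have *: "inverse_arrows (C \<times>\<^sub>C D) (f, g) (inv_arr C f, inv_arr D g)"
    by (rule prod_inverse[OF A.category_axioms B.category_axioms A.inverse_inv[OF assms(1)] B.inverse_inv[OF assms(2)]])
  then have "iso_arr (C \<times>\<^sub>C D) (f, g)" "inv_arr (C \<times>\<^sub>C D) (f, g) = (inv_arr C f, inv_arr D g)"
    using C.inv_arr_eq by (auto simp: iso_arr_def)
  then show "iso_arr E (amap F (f, g))" "amap F (inv_arr C f, inv_arr D g) = inv_arr E (amap F (f, g))"
    using map_iso[of "(f, g)"] by auto
qed

lemma bimap_inv [simp]:
  "iso_arr C f \<Longrightarrow> y \<in> obj D \<Longrightarrow> amap F (inv_arr C f, ident D y) = inv_arr E (amap F (f, ident D y))"
  "x \<in> obj C \<Longrightarrow> iso_arr D g \<Longrightarrow> amap F (ident C x, inv_arr D g) = inv_arr E (amap F (ident C x, g))"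
  using bimap_iso(2)[of f "ident D y"] bimap_iso(2)[of "ident C x" g] by auto

lemma bimap_merge:
  assumes "f \<in> arr C" "g \<in> arr D"
  shows "amap F (f, ident D (trg D g)) \<cdot> amap F (ident C (src C f), g) = amap F (f, g)"
    "amap F (ident C (trg C f), g) \<cdot> amap F (f, ident D (src D g)) = amap F (f, g)"
  using bimap_cmp[of "ident C (src C f)" f g "ident D (trg D g)"]
    bimap_cmp[of f "ident C (trg C f)" "ident D (src D g)" g] assms by auto

text \<open>
  Interchange is needed in both orientations: which of the two whiskered arrows has to come
  first depends on the law that is to be applied next.
\<close>

lemma slide:
  assumes "f \<in> arr C" "g \<in> arr D" "src C f = x" "trg D g = y'"
  shows "\<lfloor>amap F (f, ident D y')\<rfloor> \<odot> \<lfloor>amap F (ident C x, g)\<rfloor> =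
      \<lfloor>amap F (ident C (trg C f), g)\<rfloor> \<odot> \<lfloor>amap F (f, ident D (src D g))\<rfloor>"
    "\<lfloor>amap F (f, ident D y')\<rfloor> \<odot> (\<lfloor>amap F (ident C x, g)\<rfloor> \<odot> Q) =
      \<lfloor>amap F (ident C (trg C f), g)\<rfloor> \<odot> (\<lfloor>amap F (f, ident D (src D g))\<rfloor> \<odot> Q)"
proof -
  show *: "\<lfloor>amap F (f, ident D y')\<rfloor> \<odot> \<lfloor>amap F (ident C x, g)\<rfloor> =
      \<lfloor>amap F (ident C (trg C f), g)\<rfloor> \<odot> \<lfloor>amap F (f, ident D (src D g))\<rfloor>"
    using assms bimap_merge[OF assms(1,2)] by (auto simp flip: E.lift_cmp)
  show "\<lfloor>amap F (f, ident D y')\<rfloor> \<odot> (\<lfloor>amap F (ident C x, g)\<rfloor> \<odot> Q) =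
      \<lfloor>amap F (ident C (trg C f), g)\<rfloor> \<odot> (\<lfloor>amap F (f, ident D (src D g))\<rfloor> \<odot> Q)"
    using E.re[OF *] by (simp add: E.ocmp_assoc)
qed

lemma slide':
  assumes "f \<in> arr C" "g \<in> arr D" "trg C f = x'" "src D g = y"
  shows "\<lfloor>amap F (ident C x', g)\<rfloor> \<odot> \<lfloor>amap F (f, ident D y)\<rfloor> =
      \<lfloor>amap F (f, ident D (trg D g))\<rfloor> \<odot> \<lfloor>amap F (ident C (src C f), g)\<rfloor>"
    "\<lfloor>amap F (ident C x', g)\<rfloor> \<odot> (\<lfloor>amap F (f, ident D y)\<rfloor> \<odot> Q) =
      \<lfloor>amap F (f, ident D (trg D g))\<rfloor> \<odot> (\<lfloor>amap F (ident C (src C f), g)\<rfloor> \<odot> Q)"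
  using slide[of f g "src C f" "trg D g"] assms by simp_all

lemma bimap_ocmp:
  assumes "f \<in> arr C" "f' \<in> arr C" "trg C f = src C f'" "g \<in> arr D" "g' \<in> arr D" "trg D g = src D g'"
  shows "\<lfloor>amap F (f', g')\<rfloor> \<odot> \<lfloor>amap F (f, g)\<rfloor> = \<lfloor>amap F (f' \<cdot>\<^bsub>C\<^esub> f, g' \<cdot>\<^bsub>D\<^esub> g)\<rfloor>"
  using assms by (simp add: bimap_cmp E.lift_cmp)

end

text \<open>The constraints have iterated product categories as domains; these rules unfold them.\<close>

lemma nat_isoI:
  assumes "\<eta> \<in> extensional (obj C)"
    and "\<And>x. x \<in> obj C \<Longrightarrow> iso_arr D (\<eta> x) \<and> \<eta> x \<in> hom D (omap F x) (omap G x)"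
    and "\<And>f. f \<in> arr C \<Longrightarrow> amap G f \<cdot>\<^bsub>D\<^esub> \<eta> (src C f) = \<eta> (trg C f) \<cdot>\<^bsub>D\<^esub> amap F f"
  shows "nat_iso C D F G \<eta>"
  using assms by (auto simp: nat_iso_def nat_trans_def)

lemma nat_isoI2:
  assumes "\<eta> \<in> extensional (obj A \<times> obj B)"
    and "\<And>x y. x \<in> obj A \<Longrightarrow> y \<in> obj B \<Longrightarrow> iso_arr D (\<eta> (x, y)) \<and> \<eta> (x, y) \<in> hom D (omap F (x, y)) (omap G (x, y))"
    and "\<And>f g. f \<in> arr A \<Longrightarrow> g \<in> arr B \<Longrightarrow>
      amap G (f, g) \<cdot>\<^bsub>D\<^esub> \<eta> (src A f, src B g) = \<eta> (trg A f, trg B g) \<cdot>\<^bsub>D\<^esub> amap F (f, g)"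
  shows "nat_iso (A \<times>\<^sub>C B) D F G \<eta>"
  using assms by (auto simp: nat_iso_def nat_trans_def)

lemma nat_isoI3:
  assumes "\<eta> \<in> extensional (obj A \<times> obj B \<times> obj C)"
    and "\<And>x y z. x \<in> obj A \<Longrightarrow> y \<in> obj B \<Longrightarrow> z \<in> obj C \<Longrightarrow>
      iso_arr D (\<eta> (x, y, z)) \<and> \<eta> (x, y, z) \<in> hom D (omap F (x, y, z)) (omap G (x, y, z))"
    and "\<And>f g h. f \<in> arr A \<Longrightarrow> g \<in> arr B \<Longrightarrow> h \<in> arr C \<Longrightarrow>
      amap G (f, g, h) \<cdot>\<^bsub>D\<^esub> \<eta> (src A f, src B g, src C h) = \<eta> (trg A f, trg B g, trg C h) \<cdot>\<^bsub>D\<^esub> amap F (f, g, h)"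
  shows "nat_iso (A \<times>\<^sub>C B \<times>\<^sub>C C) D F G \<eta>"
  using assms by (auto simp: nat_iso_def nat_trans_def)

lemma nat_isoD:
  assumes "nat_iso C D F G \<eta>"
  shows "\<eta> \<in> extensional (obj C)"
    "x \<in> obj C \<Longrightarrow> \<eta> x \<in> arr D" "x \<in> obj C \<Longrightarrow> src D (\<eta> x) = omap F x" "x \<in> obj C \<Longrightarrow> trg D (\<eta> x) = omap G x"
    "x \<in> obj C \<Longrightarrow> iso_arr D (\<eta> x)"
    "f \<in> arr C \<Longrightarrow> amap G f \<cdot>\<^bsub>D\<^esub> \<eta> (src C f) = \<eta> (trg C f) \<cdot>\<^bsub>D\<^esub> amap F f"
  using assms by (auto simp: nat_iso_def nat_trans_def hom_def)

section \<open>Monoidal categories\<close>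

context monoidal_category
begin

lemma tens_bifunctor: "bifunctor C C C (tens C)"
  by (intro bifunctor.intro category_axioms tens_functor)

end

sublocale monoidal_category \<subseteq> tens: bifunctor C C C "tens C"
  by (rule tens_bifunctor)

context monoidal_category
begin

lemma unit_in [simp]: "\<I> \<in> obj C"
  by (rule unit_obj)

lemma assoc_typ [simp]:
  assumes "x \<in> obj C" "y \<in> obj C" "z \<in> obj C"
  shows "assoc C (x, y, z) \<in> arr C" "src C (assoc C (x, y, z)) = (x \<otimes> y) \<otimes> z"
    "trg C (assoc C (x, y, z)) = x \<otimes> (y \<otimes> z)" "iso_arr C (assoc C (x, y, z))"
  using nat_isoD(2-5)[OF assoc_iso, of "(x, y, z)"] assms by auto

lemma lunit_typ [simp]:
  assumes "x \<in> obj C"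
  shows "lunit C x \<in> arr C" "src C (lunit C x) = \<I> \<otimes> x" "trg C (lunit C x) = x" "iso_arr C (lunit C x)"
  using nat_isoD(2-5)[OF lunit_iso, of x] assms by auto

lemma runit_typ [simp]:
  assumes "x \<in> obj C"
  shows "runit C x \<in> arr C" "src C (runit C x) = x \<otimes> \<I>" "trg C (runit C x) = x" "iso_arr C (runit C x)"
  using nat_isoD(2-5)[OF runit_iso, of x] assms by auto

lemma assoc_nat:
  assumes "f \<in> arr C" "g \<in> arr C" "h \<in> arr C"
  shows "(f \<otimes>\<^sub>a (g \<otimes>\<^sub>a h)) \<cdot> assoc C (src C f, src C g, src C h) = assoc C (trg C f, trg C g, trg C h) \<cdot> ((f \<otimes>\<^sub>a g) \<otimes>\<^sub>a h)"
  using nat_isoD(6)[OF assoc_iso, of "(f, g, h)"] assms by simp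

lemma lunit_nat:
  assumes "f \<in> arr C"
  shows "f \<cdot> lunit C (src C f) = lunit C (trg C f) \<cdot> (ident C \<I> \<otimes>\<^sub>a f)"
  using nat_isoD(6)[OF lunit_iso, of f] assms by simp

lemma runit_nat:
  assumes "f \<in> arr C"
  shows "f \<cdot> runit C (src C f) = runit C (trg C f) \<cdot> (f \<otimes>\<^sub>a ident C \<I>)"
  using nat_isoD(6)[OF runit_iso, of f] assms by simp

text \<open>
  Rewrite rules that move the constraints outwards (towards the target) past whiskered arrows;
  the variants ending in \<open>in\<close> move them inwards.
\<close>

lemma assoc_out:
  assumes "y \<in> obj C" "z \<in> obj C" "f \<in> arr C"
  shows "src C f = x \<Longrightarrow> \<lfloor>f \<otimes>\<^sub>a ident C (y \<otimes> z)\<rfloor> \<odot> \<lfloor>assoc C (x, y, z)\<rfloor> = \<lfloor>assoc C (trg C f, y, z)\<rfloor> \<odot> \<lfloor>(f \<otimes>\<^sub>a ident C y) \<otimes>\<^sub>a ident C z\<rfloor>"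
    "src C f = x \<Longrightarrow> \<lfloor>ident C y \<otimes>\<^sub>a (f \<otimes>\<^sub>a ident C z)\<rfloor> \<odot> \<lfloor>assoc C (y, x, z)\<rfloor> = \<lfloor>assoc C (y, trg C f, z)\<rfloor> \<odot> \<lfloor>(ident C y \<otimes>\<^sub>a f) \<otimes>\<^sub>a ident C z\<rfloor>"
    "src C f = x \<Longrightarrow> \<lfloor>ident C y \<otimes>\<^sub>a (ident C z \<otimes>\<^sub>a f)\<rfloor> \<odot> \<lfloor>assoc C (y, z, x)\<rfloor> = \<lfloor>assoc C (y, z, trg C f)\<rfloor> \<odot> \<lfloor>ident C (y \<otimes> z) \<otimes>\<^sub>a f\<rfloor>"
  using assoc_nat[of f "ident C y" "ident C z", THEN up] assoc_nat[of "ident C y" f "ident C z", THEN up]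
    assoc_nat[of "ident C y" "ident C z" f, THEN up] assms by (auto simp: chase)

lemmas assoc_out_re = assoc_out[THEN re]

lemma assoc_in:
  assumes "y \<in> obj C" "z \<in> obj C" "f \<in> arr C"
  shows "trg C f = x' \<Longrightarrow> \<lfloor>assoc C (x', y, z)\<rfloor> \<odot> \<lfloor>(f \<otimes>\<^sub>a ident C y) \<otimes>\<^sub>a ident C z\<rfloor> = \<lfloor>f \<otimes>\<^sub>a ident C (y \<otimes> z)\<rfloor> \<odot> \<lfloor>assoc C (src C f, y, z)\<rfloor>"
    "trg C f = x' \<Longrightarrow> \<lfloor>assoc C (y, x', z)\<rfloor> \<odot> \<lfloor>(ident C y \<otimes>\<^sub>a f) \<otimes>\<^sub>a ident C z\<rfloor> = \<lfloor>ident C y \<otimes>\<^sub>a (f \<otimes>\<^sub>a ident C z)\<rfloor> \<odot> \<lfloor>assoc C (y, src C f, z)\<rfloor>"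
    "trg C f = x' \<Longrightarrow> \<lfloor>assoc C (y, z, x')\<rfloor> \<odot> \<lfloor>ident C (y \<otimes> z) \<otimes>\<^sub>a f\<rfloor> = \<lfloor>ident C y \<otimes>\<^sub>a (ident C z \<otimes>\<^sub>a f)\<rfloor> \<odot> \<lfloor>assoc C (y, z, src C f)\<rfloor>"
  using assoc_out assms by simp_all

lemmas assoc_in_re = assoc_in[THEN re]

lemma assoc_inv_out:
  assumes "y \<in> obj C" "z \<in> obj C" "f \<in> arr C"
  shows "src C f = x \<Longrightarrow> \<lfloor>(f \<otimes>\<^sub>a ident C y) \<otimes>\<^sub>a ident C z\<rfloor> \<odot> \<lfloor>inv_arr C (assoc C (x, y, z))\<rfloor> = \<lfloor>inv_arr C (assoc C (trg C f, y, z))\<rfloor> \<odot> \<lfloor>f \<otimes>\<^sub>a ident C (y \<otimes> z)\<rfloor>"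
    "src C f = x \<Longrightarrow> \<lfloor>(ident C y \<otimes>\<^sub>a f) \<otimes>\<^sub>a ident C z\<rfloor> \<odot> \<lfloor>inv_arr C (assoc C (y, x, z))\<rfloor> = \<lfloor>inv_arr C (assoc C (y, trg C f, z))\<rfloor> \<odot> \<lfloor>ident C y \<otimes>\<^sub>a (f \<otimes>\<^sub>a ident C z)\<rfloor>"
    "src C f = x \<Longrightarrow> \<lfloor>ident C (y \<otimes> z) \<otimes>\<^sub>a f\<rfloor> \<odot> \<lfloor>inv_arr C (assoc C (y, z, x))\<rfloor> = \<lfloor>inv_arr C (assoc C (y, z, trg C f))\<rfloor> \<odot> \<lfloor>ident C y \<otimes>\<^sub>a (ident C z \<otimes>\<^sub>a f)\<rfloor>"
  by (rule iso_flip; use assms in \<open>auto simp: assoc_in\<close>)+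

lemmas assoc_inv_out_re = assoc_inv_out[THEN re]

lemma unit_out:
  "f \<in> arr C \<Longrightarrow> src C f = x \<Longrightarrow> \<lfloor>f\<rfloor> \<odot> \<lfloor>lunit C x\<rfloor> = \<lfloor>lunit C (trg C f)\<rfloor> \<odot> \<lfloor>ident C \<I> \<otimes>\<^sub>a f\<rfloor>"
  "f \<in> arr C \<Longrightarrow> src C f = x \<Longrightarrow> \<lfloor>f\<rfloor> \<odot> \<lfloor>runit C x\<rfloor> = \<lfloor>runit C (trg C f)\<rfloor> \<odot> \<lfloor>f \<otimes>\<^sub>a ident C \<I>\<rfloor>"
  using lunit_nat[of f, THEN up] runit_nat[of f, THEN up] by (auto simp: chase)

lemma unit_in_rules:
  "f \<in> arr C \<Longrightarrow> trg C f = x' \<Longrightarrow> \<lfloor>lunit C x'\<rfloor> \<odot> \<lfloor>ident C \<I> \<otimes>\<^sub>a f\<rfloor> = \<lfloor>f\<rfloor> \<odot> \<lfloor>lunit C (src C f)\<rfloor>"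
  "f \<in> arr C \<Longrightarrow> trg C f = x' \<Longrightarrow> \<lfloor>runit C x'\<rfloor> \<odot> \<lfloor>f \<otimes>\<^sub>a ident C \<I>\<rfloor> = \<lfloor>f\<rfloor> \<odot> \<lfloor>runit C (src C f)\<rfloor>"
  using unit_out by auto

lemmas unit_in_re = unit_in_rules[THEN re]

text \<open>
  Tensoring with the unit is naturally isomorphic to the identity functor, hence faithful. Unit
  laws may therefore be verified after whiskering with the unit, where the triangle axiom
  applies.
\<close>

lemma lunit_faithful:
  assumes "ident C \<I> \<otimes>\<^sub>a f = ident C \<I> \<otimes>\<^sub>a g" "f \<in> arr C" "g \<in> arr C" "src C f = src C g" "trg C f = trg C g"
  shows "f = g"
proof (rule iso_right_cancel)
  show "\<lfloor>f\<rfloor> \<odot> \<lfloor>lunit C (src C g)\<rfloor> = \<lfloor>g\<rfloor> \<odot> \<lfloor>lunit C (src C g)\<rfloor>"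
    using assms by (simp add: unit_out)
qed (use assms in auto)

lemma runit_faithful:
  assumes "f \<otimes>\<^sub>a ident C \<I> = g \<otimes>\<^sub>a ident C \<I>" "f \<in> arr C" "g \<in> arr C" "src C f = src C g" "trg C f = trg C g"
  shows "f = g"
proof (rule iso_right_cancel)
  show "\<lfloor>f\<rfloor> \<odot> \<lfloor>runit C (src C g)\<rfloor> = \<lfloor>g\<rfloor> \<odot> \<lfloor>runit C (src C g)\<rfloor>"
    using assms by (simp add: unit_out)
qed (use assms in auto)

end

text \<open>
  The combinatorial core of Kelly's argument that unit coherence follows from the pentagon and a single triangle.
  \<open>FM\<close> plays the role of a whiskered associator, \<open>s1\<close> and \<open>s2\<close> are naturality squares of the
  constraint \<open>s\<close>, and \<open>tri\<close>, \<open>tri'\<close> are two instances of the triangle. All unit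
  laws for tensor products, actions, \<open>\<alpha>1\<close> and \<open>\<alpha>2\<close> are instances, once the unit that
  whiskers both sides is removed by faithfulness.
\<close>

lemma (in category) kelly:
  assumes FM: "\<lfloor>FM\<rfloor> \<odot> \<lfloor>s2\<rfloor> = \<lfloor>s1\<rfloor> \<odot> \<lfloor>Es\<rfloor> \<odot> \<lfloor>m'\<rfloor>"
    and s1: "\<lfloor>FEL\<rfloor> \<odot> \<lfloor>s1\<rfloor> = \<lfloor>s\<rfloor> \<odot> \<lfloor>EL\<rfloor>"
    and tri: "\<lfloor>FEL\<rfloor> \<odot> \<lfloor>FM\<rfloor> = \<lfloor>R\<rfloor>"
    and s2: "\<lfloor>R\<rfloor> \<odot> \<lfloor>s2\<rfloor> = \<lfloor>s\<rfloor> \<odot> \<lfloor>R'\<rfloor>"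
    and tri': "\<lfloor>EL'\<rfloor> \<odot> \<lfloor>m'\<rfloor> = \<lfloor>R'\<rfloor>"
    and iso: "iso_arr C s" "iso_arr C m'"
    and ty: "EL \<in> arr C" "Es \<in> arr C" "trg C Es = src C EL" "EL' \<in> arr C"
      "trg C EL = src C s" "trg C EL' = src C s" "src C Es = trg C m'" "src C EL' = trg C m'"
  shows "EL \<cdot> Es = EL'"
proof (rule iso_right_cancel[OF _ iso(2)])
  have [simp]: "s \<in> arr C" "m' \<in> arr C"
    using iso by (auto intro: iso_in)
  have "\<lfloor>s\<rfloor> \<odot> \<lfloor>EL \<cdot> Es \<cdot> m'\<rfloor> = (\<lfloor>s\<rfloor> \<odot> \<lfloor>EL\<rfloor>) \<odot> \<lfloor>Es\<rfloor> \<odot> \<lfloor>m'\<rfloor>"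
    using ty by (simp add: chase)
  also have "\<dots> = \<lfloor>FEL\<rfloor> \<odot> (\<lfloor>s1\<rfloor> \<odot> \<lfloor>Es\<rfloor> \<odot> \<lfloor>m'\<rfloor>)"
    by (simp add: chase flip: s1)
  also have "\<dots> = (\<lfloor>FEL\<rfloor> \<odot> \<lfloor>FM\<rfloor>) \<odot> \<lfloor>s2\<rfloor>"
    by (simp add: chase flip: FM)
  also have "\<dots> = \<lfloor>s\<rfloor> \<odot> \<lfloor>EL' \<cdot> m'\<rfloor>"
    using ty by (simp add: tri s2 lift_cmp flip: tri')
  finally have "EL \<cdot> Es \<cdot> m' = EL' \<cdot> m'"
    by (rule iso_left_cancel) (use iso ty in auto)
  from up[OF this] show "\<lfloor>EL \<cdot> Es\<rfloor> \<odot> \<lfloor>m'\<rfloor> = \<lfloor>EL'\<rfloor> \<odot> \<lfloor>m'\<rfloor>"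
    using ty by (simp add: chase)
qed (use ty in auto)

context monoidal_category
begin

lemma pentagon_l:
  assumes [simp]: "u \<in> obj C" "v \<in> obj C" "w \<in> obj C" "x \<in> obj C"
  shows "\<lfloor>assoc C (u, v, w \<otimes> x)\<rfloor> \<odot> \<lfloor>assoc C (u \<otimes> v, w, x)\<rfloor> =
    \<lfloor>ident C u \<otimes>\<^sub>a assoc C (v, w, x)\<rfloor> \<odot> \<lfloor>assoc C (u, v \<otimes> w, x)\<rfloor> \<odot> \<lfloor>assoc C (u, v, w) \<otimes>\<^sub>a ident C x\<rfloor>"
  using pentagon[of u v w x, THEN up] by (simp add: chase)

lemma triangle_l:
  assumes [simp]: "v \<in> obj C" "w \<in> obj C"
  shows "\<lfloor>ident C v \<otimes>\<^sub>a lunit C w\<rfloor> \<odot> \<lfloor>assoc C (v, \<I>, w)\<rfloor> = \<lfloor>runit C v \<otimes>\<^sub>a ident C w\<rfloor>"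
  using triangle[of v w, THEN up] by (simp add: chase)

lemma triangle_inv:
  assumes [simp]: "v \<in> obj C" "w \<in> obj C"
  shows "\<lfloor>runit C v \<otimes>\<^sub>a ident C w\<rfloor> \<odot> \<lfloor>inv_arr C (assoc C (v, \<I>, w))\<rfloor> = \<lfloor>ident C v \<otimes>\<^sub>a lunit C w\<rfloor>"
  by (simp flip: triangle_l add: ocmp_assoc)

lemma pentagon_inv:
  assumes [simp]: "u \<in> obj C" "v \<in> obj C" "w \<in> obj C" "x \<in> obj C"
  shows "\<lfloor>assoc C (u, v, w) \<otimes>\<^sub>a ident C x\<rfloor> \<odot> \<lfloor>inv_arr C (assoc C (u \<otimes> v, w, x))\<rfloor> =
    \<lfloor>inv_arr C (assoc C (u, v \<otimes> w, x))\<rfloor> \<odot> \<lfloor>inv_arr C (ident C u \<otimes>\<^sub>a assoc C (v, w, x))\<rfloor> \<odot> \<lfloor>assoc C (u, v, w \<otimes> x)\<rfloor>"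
    (is "?E \<odot> ?B = ?D \<odot> ?F \<odot> ?A")
  using arg_cong[OF pentagon_l[of u v w x], of "\<lambda>t. ?D \<odot> ?F \<odot> t \<odot> ?B"] by (simp add: chase)

text \<open>
  The unit laws that Mac Lane's original list of axioms contained; they follow from the pentagon
  and the triangle.
\<close>

lemma lunit_tens:
  assumes [simp]: "x \<in> obj C" "y \<in> obj C"
  shows "lunit C (x \<otimes> y) \<cdot> assoc C (\<I>, x, y) = lunit C x \<otimes>\<^sub>a ident C y"
proof -
  have "(ident C \<I> \<otimes>\<^sub>a (lunit C x \<otimes>\<^sub>a ident C y)) \<cdot> (ident C \<I> \<otimes>\<^sub>a inv_arr C (assoc C (\<I>, x, y))) = ident C \<I> \<otimes>\<^sub>a lunit C (x \<otimes> y)"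
  proof (rule kelly)
    show "\<lfloor>assoc C (\<I>, \<I>, x) \<otimes>\<^sub>a ident C y\<rfloor> \<odot> \<lfloor>inv_arr C (assoc C (\<I> \<otimes> \<I>, x, y))\<rfloor> =
        \<lfloor>inv_arr C (assoc C (\<I>, \<I> \<otimes> x, y))\<rfloor> \<odot> \<lfloor>ident C \<I> \<otimes>\<^sub>a inv_arr C (assoc C (\<I>, x, y))\<rfloor> \<odot> \<lfloor>assoc C (\<I>, \<I>, x \<otimes> y)\<rfloor>"
      by (simp add: pentagon_inv)
    show "\<lfloor>(ident C \<I> \<otimes>\<^sub>a lunit C x) \<otimes>\<^sub>a ident C y\<rfloor> \<odot> \<lfloor>inv_arr C (assoc C (\<I>, \<I> \<otimes> x, y))\<rfloor> =
        \<lfloor>inv_arr C (assoc C (\<I>, x, y))\<rfloor> \<odot> \<lfloor>ident C \<I> \<otimes>\<^sub>a (lunit C x \<otimes>\<^sub>a ident C y)\<rfloor>"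
      by (simp add: assoc_inv_out)
    show "\<lfloor>(ident C \<I> \<otimes>\<^sub>a lunit C x) \<otimes>\<^sub>a ident C y\<rfloor> \<odot> \<lfloor>assoc C (\<I>, \<I>, x) \<otimes>\<^sub>a ident C y\<rfloor> =
        \<lfloor>(runit C \<I> \<otimes>\<^sub>a ident C x) \<otimes>\<^sub>a ident C y\<rfloor>"
      using arg_cong[OF triangle[of \<I> x], of "\<lambda>t. \<lfloor>t \<otimes>\<^sub>a ident C y\<rfloor>"] by (simp add: chase)
    show "\<lfloor>(runit C \<I> \<otimes>\<^sub>a ident C x) \<otimes>\<^sub>a ident C y\<rfloor> \<odot> \<lfloor>inv_arr C (assoc C (\<I> \<otimes> \<I>, x, y))\<rfloor> =
        \<lfloor>inv_arr C (assoc C (\<I>, x, y))\<rfloor> \<odot> \<lfloor>runit C \<I> \<otimes>\<^sub>a ident C (x \<otimes> y)\<rfloor>"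
      by (simp add: assoc_inv_out)
    show "\<lfloor>ident C \<I> \<otimes>\<^sub>a lunit C (x \<otimes> y)\<rfloor> \<odot> \<lfloor>assoc C (\<I>, \<I>, x \<otimes> y)\<rfloor> = \<lfloor>runit C \<I> \<otimes>\<^sub>a ident C (x \<otimes> y)\<rfloor>"
      by (simp add: triangle_l)
  qed simp_all
  then have "ident C \<I> \<otimes>\<^sub>a ((lunit C x \<otimes>\<^sub>a ident C y) \<cdot> inv_arr C (assoc C (\<I>, x, y))) = ident C \<I> \<otimes>\<^sub>a lunit C (x \<otimes> y)"
    by (simp add: chase)
  then have "(lunit C x \<otimes>\<^sub>a ident C y) \<cdot> inv_arr C (assoc C (\<I>, x, y)) = lunit C (x \<otimes> y)"
    by (rule lunit_faithful) simp_all
  then show ?thesis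
    by (simp add: assoc_arr flip: \<open>_ = lunit C (x \<otimes> y)\<close>)
qed

lemma runit_tens:
  assumes [simp]: "x \<in> obj C" "y \<in> obj C"
  shows "(ident C x \<otimes>\<^sub>a runit C y) \<cdot> assoc C (x, y, \<I>) = runit C (x \<otimes> y)"
proof -
  have "((ident C x \<otimes>\<^sub>a runit C y) \<otimes>\<^sub>a ident C \<I>) \<cdot> (assoc C (x, y, \<I>) \<otimes>\<^sub>a ident C \<I>) = runit C (x \<otimes> y) \<otimes>\<^sub>a ident C \<I>"
  proof (rule kelly)
    show "\<lfloor>inv_arr C (ident C x \<otimes>\<^sub>a assoc C (y, \<I>, \<I>))\<rfloor> \<odot> \<lfloor>assoc C (x, y, \<I> \<otimes> \<I>)\<rfloor> =
        \<lfloor>assoc C (x, y \<otimes> \<I>, \<I>)\<rfloor> \<odot> \<lfloor>assoc C (x, y, \<I>) \<otimes>\<^sub>a ident C \<I>\<rfloor> \<odot> \<lfloor>inv_arr C (assoc C (x \<otimes> y, \<I>, \<I>))\<rfloor>"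
      by (simp add: pentagon_inv chase)
    show "\<lfloor>ident C x \<otimes>\<^sub>a (runit C y \<otimes>\<^sub>a ident C \<I>)\<rfloor> \<odot> \<lfloor>assoc C (x, y \<otimes> \<I>, \<I>)\<rfloor> =
        \<lfloor>assoc C (x, y, \<I>)\<rfloor> \<odot> \<lfloor>(ident C x \<otimes>\<^sub>a runit C y) \<otimes>\<^sub>a ident C \<I>\<rfloor>"
      by (simp add: assoc_out)
    show "\<lfloor>ident C x \<otimes>\<^sub>a (runit C y \<otimes>\<^sub>a ident C \<I>)\<rfloor> \<odot> \<lfloor>inv_arr C (ident C x \<otimes>\<^sub>a assoc C (y, \<I>, \<I>))\<rfloor> =
        \<lfloor>ident C x \<otimes>\<^sub>a (ident C y \<otimes>\<^sub>a lunit C \<I>)\<rfloor>"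
      using arg_cong[OF triangle[of y \<I>], of "\<lambda>t. \<lfloor>ident C x \<otimes>\<^sub>a t\<rfloor>", symmetric] by (simp add: chase)
    show "\<lfloor>ident C x \<otimes>\<^sub>a (ident C y \<otimes>\<^sub>a lunit C \<I>)\<rfloor> \<odot> \<lfloor>assoc C (x, y, \<I> \<otimes> \<I>)\<rfloor> =
        \<lfloor>assoc C (x, y, \<I>)\<rfloor> \<odot> \<lfloor>ident C (x \<otimes> y) \<otimes>\<^sub>a lunit C \<I>\<rfloor>"
      by (simp add: assoc_out)
    show "\<lfloor>runit C (x \<otimes> y) \<otimes>\<^sub>a ident C \<I>\<rfloor> \<odot> \<lfloor>inv_arr C (assoc C (x \<otimes> y, \<I>, \<I>))\<rfloor> = \<lfloor>ident C (x \<otimes> y) \<otimes>\<^sub>a lunit C \<I>\<rfloor>"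
      by (simp add: triangle_inv)
  qed simp_all
  then have "((ident C x \<otimes>\<^sub>a runit C y) \<cdot> assoc C (x, y, \<I>)) \<otimes>\<^sub>a ident C \<I> = runit C (x \<otimes> y) \<otimes>\<^sub>a ident C \<I>"
    by (simp add: chase)
  then show ?thesis
    by (rule runit_faithful) simp_all
qed

lemma lunit_unit: "lunit C \<I> = runit C \<I>"
proof (rule runit_faithful)
  have "\<lfloor>lunit C \<I>\<rfloor> \<odot> \<lfloor>lunit C (\<I> \<otimes> \<I>)\<rfloor> = \<lfloor>lunit C \<I>\<rfloor> \<odot> \<lfloor>ident C \<I> \<otimes>\<^sub>a lunit C \<I>\<rfloor>"
    by (simp add: unit_out)
  then have "lunit C (\<I> \<otimes> \<I>) = ident C \<I> \<otimes>\<^sub>a lunit C \<I>"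
    by (rule iso_left_cancel) simp_all
  with lunit_tens[of \<I> \<I>] triangle[of \<I> \<I>]
  show "lunit C \<I> \<otimes>\<^sub>a ident C \<I> = runit C \<I> \<otimes>\<^sub>a ident C \<I>"
    by simp
qed simp_all

end

section \<open>Half-braidings\<close>

locale natural_half_braiding = monoidal_category C
  for C :: "('o, 'a, 'z) mon_cat_scheme" (structure) +
  fixes t :: 'o and \<beta> :: "'o \<Rightarrow> 'a"
  assumes t_obj [simp]: "t \<in> obj C"
    and \<beta>_iso: "nat_iso C C \<lparr>omap = \<lambda>x. t \<otimes> x, amap = \<lambda>f. ident C t \<otimes>\<^sub>a f\<rparr>
       \<lparr>omap = \<lambda>x. x \<otimes> t, amap = \<lambda>f. f \<otimes>\<^sub>a ident C t\<rparr> \<beta>"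
begin

lemma \<beta>_typ [simp]:
  assumes "x \<in> obj C"
  shows "\<beta> x \<in> arr C" "src C (\<beta> x) = t \<otimes> x" "trg C (\<beta> x) = x \<otimes> t" "iso_arr C (\<beta> x)"
  using nat_isoD(2-5)[OF \<beta>_iso assms] by auto

lemma \<beta>_out:
  "f \<in> arr C \<Longrightarrow> src C f = x \<Longrightarrow> \<lfloor>f \<otimes>\<^sub>a ident C t\<rfloor> \<odot> \<lfloor>\<beta> x\<rfloor> = \<lfloor>\<beta> (trg C f)\<rfloor> \<odot> \<lfloor>ident C t \<otimes>\<^sub>a f\<rfloor>"
  using nat_isoD(6)[OF \<beta>_iso, of f, THEN up] by (auto simp: chase)

lemmas \<beta>_out_re = \<beta>_out[THEN re]

text \<open>
  The half-braiding acting on the first two of three right-nested factors. Chases with tails stay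
  right-nested throughout, and \<open>\<alpha>2\<close> of the module structure of a pair is the inverse of a tail.
\<close>

definition tail :: "'o \<Rightarrow> 'o \<Rightarrow> 'a" where
  "tail x z = assoc C (x, t, z) \<cdot> (\<beta> x \<otimes>\<^sub>a ident C z) \<cdot> inv_arr C (assoc C (t, x, z))"

lemma tail_typ [simp]:
  assumes "x \<in> obj C" "z \<in> obj C"
  shows "tail x z \<in> arr C" "src C (tail x z) = t \<otimes> (x \<otimes> z)" "trg C (tail x z) = x \<otimes> (t \<otimes> z)"
    "iso_arr C (tail x z)"
  using assms by (simp_all add: tail_def)

lemma tail_assoc:
  assumes [simp]: "x \<in> obj C" "z \<in> obj C"
  shows "tail x z \<cdot> assoc C (t, x, z) = assoc C (x, t, z) \<cdot> (\<beta> x \<otimes>\<^sub>a ident C z)"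
  by (rule lift_eqI) (simp_all add: tail_def chase)

lemma tail_assoc_l:
  assumes [simp]: "x \<in> obj C" "z \<in> obj C"
  shows "\<lfloor>tail x z\<rfloor> \<odot> \<lfloor>assoc C (t, x, z)\<rfloor> = \<lfloor>assoc C (x, t, z)\<rfloor> \<odot> \<lfloor>\<beta> x \<otimes>\<^sub>a ident C z\<rfloor>"
  using tail_assoc[THEN up, of x z] by (simp add: chase)

lemmas tail_assoc_re = tail_assoc_l[THEN re]

lemma tail_out:
  assumes "f \<in> arr C" "z \<in> obj C"
  shows "src C f = x \<Longrightarrow> \<lfloor>f \<otimes>\<^sub>a ident C (t \<otimes> z)\<rfloor> \<odot> \<lfloor>tail x z\<rfloor> = \<lfloor>tail (trg C f) z\<rfloor> \<odot> \<lfloor>ident C t \<otimes>\<^sub>a (f \<otimes>\<^sub>a ident C z)\<rfloor>"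
    "src C f = x \<Longrightarrow> \<lfloor>ident C z \<otimes>\<^sub>a (ident C t \<otimes>\<^sub>a f)\<rfloor> \<odot> \<lfloor>tail z x\<rfloor> = \<lfloor>tail z (trg C f)\<rfloor> \<odot> \<lfloor>ident C t \<otimes>\<^sub>a (ident C z \<otimes>\<^sub>a f)\<rfloor>"
proof -
  note [simp] = assms
  have w: "\<lfloor>(f \<otimes>\<^sub>a ident C t) \<otimes>\<^sub>a ident C z\<rfloor> \<odot> \<lfloor>\<beta> x \<otimes>\<^sub>a ident C z\<rfloor> =
      \<lfloor>\<beta> (trg C f) \<otimes>\<^sub>a ident C z\<rfloor> \<odot> \<lfloor>(ident C t \<otimes>\<^sub>a f) \<otimes>\<^sub>a ident C z\<rfloor>" if "src C f = x" for x
    using arg_cong[OF nat_isoD(6)[OF \<beta>_iso, of f], of "\<lambda>h. \<lfloor>h \<otimes>\<^sub>a ident C z\<rfloor>"] that by (auto simp: chase)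
  show "src C f = x \<Longrightarrow> \<lfloor>f \<otimes>\<^sub>a ident C (t \<otimes> z)\<rfloor> \<odot> \<lfloor>tail x z\<rfloor> = \<lfloor>tail (trg C f) z\<rfloor> \<odot> \<lfloor>ident C t \<otimes>\<^sub>a (f \<otimes>\<^sub>a ident C z)\<rfloor>"
    by (auto simp: tail_def chase assoc_out assoc_out_re w w[THEN re] assoc_inv_out)
  show "src C f = x \<Longrightarrow> \<lfloor>ident C z \<otimes>\<^sub>a (ident C t \<otimes>\<^sub>a f)\<rfloor> \<odot> \<lfloor>tail z x\<rfloor> = \<lfloor>tail z (trg C f)\<rfloor> \<odot> \<lfloor>ident C t \<otimes>\<^sub>a (ident C z \<otimes>\<^sub>a f)\<rfloor>"
    by (auto simp: tail_def chase assoc_out assoc_out_re assoc_inv_out tens.slide')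
qed

lemmas tail_out_re = tail_out[THEN re]

text \<open>
  Two applications of the pentagon: moving \<open>t\<close> past \<open>x\<close> does not see
  how the rest is bracketed.
\<close>

lemma tail_tens:
  assumes [simp]: "x \<in> obj C" "y \<in> obj C" "z \<in> obj C"
  shows "tail x (y \<otimes> z) \<cdot> (ident C t \<otimes>\<^sub>a assoc C (x, y, z)) \<cdot> assoc C (t, x \<otimes> y, z) =
    (ident C x \<otimes>\<^sub>a assoc C (t, y, z)) \<cdot> assoc C (x, t \<otimes> y, z) \<cdot> (tail x y \<otimes>\<^sub>a ident C z)" (is "?f = ?g")
proof (rule iso_right_cancel)
  have w: "\<lfloor>tail x y \<otimes>\<^sub>a ident C z\<rfloor> \<odot> \<lfloor>assoc C (t, x, y) \<otimes>\<^sub>a ident C z\<rfloor> =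
      \<lfloor>assoc C (x, t, y) \<otimes>\<^sub>a ident C z\<rfloor> \<odot> \<lfloor>(\<beta> x \<otimes>\<^sub>a ident C y) \<otimes>\<^sub>a ident C z\<rfloor>"
    using arg_cong[OF tail_assoc[of x y], of "\<lambda>h. \<lfloor>h \<otimes>\<^sub>a ident C z\<rfloor>"] by (simp add: chase)
  show "\<lfloor>?f\<rfloor> \<odot> \<lfloor>assoc C (t, x, y) \<otimes>\<^sub>a ident C z\<rfloor> = \<lfloor>?g\<rfloor> \<odot> \<lfloor>assoc C (t, x, y) \<otimes>\<^sub>a ident C z\<rfloor>"
    by (simp add: chase w tail_assoc_re assoc_out pentagon_l[symmetric] pentagon_l[symmetric, THEN re3])
qed simp_all

text \<open>
  Up to invertible associators, the two sides of the hexagon for tails are the two sides of the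
  hexagon for the half-braiding, tensored with the last factor.
\<close>

abbreviation (input) "hexagon_lhs x y \<equiv> assoc C (x, y, t) \<cdot> \<beta> (x \<otimes> y) \<cdot> assoc C (t, x, y)"
abbreviation (input) "hexagon_rhs x y \<equiv> (ident C x \<otimes>\<^sub>a \<beta> y) \<cdot> assoc C (x, t, y) \<cdot> (\<beta> x \<otimes>\<^sub>a ident C y)"

lemma tail_hexagon_lhs:
  assumes [simp]: "x \<in> obj C" "y \<in> obj C" "z \<in> obj C"
  shows "\<lfloor>assoc C (x, y, t \<otimes> z) \<cdot> tail (x \<otimes> y) z\<rfloor> \<odot> \<lfloor>assoc C (t, x \<otimes> y, z) \<cdot> (assoc C (t, x, y) \<otimes>\<^sub>a ident C z)\<rfloor> =
    \<lfloor>(ident C x \<otimes>\<^sub>a assoc C (y, t, z)) \<cdot> assoc C (x, y \<otimes> t, z)\<rfloor> \<odot> \<lfloor>hexagon_lhs x y \<otimes>\<^sub>a ident C z\<rfloor>"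
  by (simp add: chase tail_assoc_re pentagon_l[THEN re])

lemma tail_hexagon_rhs:
  assumes [simp]: "x \<in> obj C" "y \<in> obj C" "z \<in> obj C"
  shows "\<lfloor>(ident C x \<otimes>\<^sub>a tail y z) \<cdot> tail x (y \<otimes> z) \<cdot> (ident C t \<otimes>\<^sub>a assoc C (x, y, z))\<rfloor> \<odot>
      \<lfloor>assoc C (t, x \<otimes> y, z) \<cdot> (assoc C (t, x, y) \<otimes>\<^sub>a ident C z)\<rfloor> =
    \<lfloor>(ident C x \<otimes>\<^sub>a assoc C (y, t, z)) \<cdot> assoc C (x, y \<otimes> t, z)\<rfloor> \<odot> \<lfloor>hexagon_rhs x y \<otimes>\<^sub>a ident C z\<rfloor>"
proof -
  have w: "\<lfloor>ident C x \<otimes>\<^sub>a tail y z\<rfloor> \<odot> \<lfloor>ident C x \<otimes>\<^sub>a assoc C (t, y, z)\<rfloor> =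
      \<lfloor>ident C x \<otimes>\<^sub>a assoc C (y, t, z)\<rfloor> \<odot> \<lfloor>ident C x \<otimes>\<^sub>a (\<beta> y \<otimes>\<^sub>a ident C z)\<rfloor>"
    using arg_cong[OF tail_assoc[of y z], of "\<lambda>h. \<lfloor>ident C x \<otimes>\<^sub>a h\<rfloor>"] by (simp add: chase)
  have "\<lfloor>ident C x \<otimes>\<^sub>a tail y z\<rfloor> \<odot> \<lfloor>tail x (y \<otimes> z)\<rfloor> \<odot> \<lfloor>ident C t \<otimes>\<^sub>a assoc C (x, y, z)\<rfloor> \<odot>
      \<lfloor>assoc C (t, x \<otimes> y, z)\<rfloor> \<odot> \<lfloor>assoc C (t, x, y) \<otimes>\<^sub>a ident C z\<rfloor> =
     \<lfloor>ident C x \<otimes>\<^sub>a tail y z\<rfloor> \<odot> \<lfloor>assoc C (x, t, y \<otimes> z)\<rfloor> \<odot> \<lfloor>assoc C (x \<otimes> t, y, z)\<rfloor> \<odot> \<lfloor>(\<beta> x \<otimes>\<^sub>a ident C y) \<otimes>\<^sub>a ident C z\<rfloor>"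
    by (simp add: pentagon_l[symmetric] tail_assoc_re assoc_out ocmp_assoc)
  also have "\<dots> = \<lfloor>ident C x \<otimes>\<^sub>a tail y z\<rfloor> \<odot> \<lfloor>ident C x \<otimes>\<^sub>a assoc C (t, y, z)\<rfloor> \<odot> \<lfloor>assoc C (x, t \<otimes> y, z)\<rfloor> \<odot>
     \<lfloor>assoc C (x, t, y) \<otimes>\<^sub>a ident C z\<rfloor> \<odot> \<lfloor>(\<beta> x \<otimes>\<^sub>a ident C y) \<otimes>\<^sub>a ident C z\<rfloor>"
    by (simp add: pentagon_l[THEN re] ocmp_assoc)
  finally show ?thesis
    by (simp add: chase w[THEN re] assoc_out_re)
qed

lemma tail_hexagon_iff:
  assumes [simp]: "x \<in> obj C" "y \<in> obj C" "z \<in> obj C"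
  shows "assoc C (x, y, t \<otimes> z) \<cdot> tail (x \<otimes> y) z = (ident C x \<otimes>\<^sub>a tail y z) \<cdot> tail x (y \<otimes> z) \<cdot> (ident C t \<otimes>\<^sub>a assoc C (x, y, z))
    \<longleftrightarrow> hexagon_lhs x y \<otimes>\<^sub>a ident C z = hexagon_rhs x y \<otimes>\<^sub>a ident C z" (is "?L = ?R \<longleftrightarrow> ?l = ?r")
proof
  assume "?L = ?R"
  with tail_hexagon_lhs[OF assms] tail_hexagon_rhs[OF assms]
  have "\<lfloor>(ident C x \<otimes>\<^sub>a assoc C (y, t, z)) \<cdot> assoc C (x, y \<otimes> t, z)\<rfloor> \<odot> \<lfloor>?l\<rfloor> =
    \<lfloor>(ident C x \<otimes>\<^sub>a assoc C (y, t, z)) \<cdot> assoc C (x, y \<otimes> t, z)\<rfloor> \<odot> \<lfloor>?r\<rfloor>"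
    by metis
  then show "?l = ?r"
    by (rule iso_left_cancel) simp_all
next
  assume "?l = ?r"
  with tail_hexagon_lhs[OF assms] tail_hexagon_rhs[OF assms]
  have "\<lfloor>?L\<rfloor> \<odot> \<lfloor>assoc C (t, x \<otimes> y, z) \<cdot> (assoc C (t, x, y) \<otimes>\<^sub>a ident C z)\<rfloor> =
    \<lfloor>?R\<rfloor> \<odot> \<lfloor>assoc C (t, x \<otimes> y, z) \<cdot> (assoc C (t, x, y) \<otimes>\<^sub>a ident C z)\<rfloor>"
    by metis
  then show "?L = ?R"
    by (rule iso_right_cancel) simp_all
qed

end

lemma (in monoidal_category) half_braiding_iff:
  "half_braiding C t \<beta> \<longleftrightarrow> natural_half_braiding C t \<beta> \<and>
    (\<forall>x \<in> obj C. \<forall>y \<in> obj C. assoc C (x, y, t) \<cdot> \<beta> (x \<otimes> y) \<cdot> assoc C (t, x, y) =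
        (ident C x \<otimes>\<^sub>a \<beta> y) \<cdot> assoc C (x, t, y) \<cdot> (\<beta> x \<otimes>\<^sub>a ident C y))"
  by (auto simp: half_braiding_def natural_half_braiding_def natural_half_braiding_axioms_def monoidal_category_axioms)

locale half_braided = monoidal_category C
  for C :: "('o, 'a, 'z) mon_cat_scheme" (structure) +
  fixes t :: 'o and \<beta> :: "'o \<Rightarrow> 'a"
  assumes hb: "half_braiding C t \<beta>"

sublocale half_braided \<subseteq> natural_half_braiding C t \<beta>
  using hb by (simp add: half_braiding_iff)

context half_braided
begin

lemma half_hexagon:
  assumes "x \<in> obj C" "y \<in> obj C"
  shows "hexagon_lhs x y = hexagon_rhs x y"
  using hb assms by (auto simp: half_braiding_iff)

lemma half_hexagon_l:
  assumes [simp]: "x \<in> obj C" "y \<in> obj C"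
  shows "\<lfloor>assoc C (x, y, t)\<rfloor> \<odot> \<lfloor>\<beta> (x \<otimes> y)\<rfloor> \<odot> \<lfloor>assoc C (t, x, y)\<rfloor> =
    \<lfloor>ident C x \<otimes>\<^sub>a \<beta> y\<rfloor> \<odot> \<lfloor>assoc C (x, t, y)\<rfloor> \<odot> \<lfloor>\<beta> x \<otimes>\<^sub>a ident C y\<rfloor>"
  using half_hexagon[THEN up, of x y] by (simp add: chase)

lemma tail_hexagon:
  assumes "x \<in> obj C" "y \<in> obj C" "z \<in> obj C"
  shows "assoc C (x, y, t \<otimes> z) \<cdot> tail (x \<otimes> y) z = (ident C x \<otimes>\<^sub>a tail y z) \<cdot> tail x (y \<otimes> z) \<cdot> (ident C t \<otimes>\<^sub>a assoc C (x, y, z))"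
  using tail_hexagon_iff[OF assms] half_hexagon[of x y] assms by simp

lemma tail_hexagon_l:
  assumes [simp]: "x \<in> obj C" "y \<in> obj C" "z \<in> obj C"
  shows "\<lfloor>assoc C (x, y, t \<otimes> z)\<rfloor> \<odot> \<lfloor>tail (x \<otimes> y) z\<rfloor> = \<lfloor>ident C x \<otimes>\<^sub>a tail y z\<rfloor> \<odot> \<lfloor>tail x (y \<otimes> z)\<rfloor> \<odot> \<lfloor>ident C t \<otimes>\<^sub>a assoc C (x, y, z)\<rfloor>"
  using tail_hexagon[THEN up, of x y z] by (simp add: chase)

end

text \<open>
  Tails with the unit as last factor suffice, because tensoring with the unit is faithful.
\<close>

lemma (in natural_half_braiding) half_braidedI:
  assumes "\<And>x y. x \<in> obj C \<Longrightarrow> y \<in> obj C \<Longrightarrow>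
    assoc C (x, y, t \<otimes> \<I>) \<cdot> tail (x \<otimes> y) \<I> = (ident C x \<otimes>\<^sub>a tail y \<I>) \<cdot> tail x (y \<otimes> \<I>) \<cdot> (ident C t \<otimes>\<^sub>a assoc C (x, y, \<I>))"
  shows "half_braiding C t \<beta>"
  unfolding half_braiding_iff
proof (intro conjI ballI)
  fix x y assume [simp]: "x \<in> obj C" "y \<in> obj C"
  show "hexagon_lhs x y = hexagon_rhs x y"
    by (rule runit_faithful) (use assms[of x y] in \<open>simp_all add: tail_hexagon_iff\<close>)
qed (rule natural_half_braiding_axioms)

subsection \<open>The tensor product of half-braidings\<close>

definition tens_half_braid ::
  "('o, 'a, 'z) mon_cat_scheme \<Rightarrow> 'o \<Rightarrow> ('o \<Rightarrow> 'a) \<Rightarrow> 'o \<Rightarrow> ('o \<Rightarrow> 'a) \<Rightarrow> 'o \<Rightarrow> 'a" where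
  "tens_half_braid C t \<beta> t' \<beta>' = snd (center_tens_obj C (t, \<beta>) (t', \<beta>'))"

locale two_natural_half_braidings = monoidal_category C +
  X: natural_half_braiding C t \<beta> + Y: natural_half_braiding C t' \<beta>'
  for C :: "('o, 'a, 'z) mon_cat_scheme" (structure) and t \<beta> t' \<beta>'
begin

abbreviation "\<beta>2 \<equiv> tens_half_braid C t \<beta> t' \<beta>'"

lemma \<beta>2_eq: "x \<in> obj C \<Longrightarrow> \<beta>2 x = assoc C (x, t, t') \<cdot> (\<beta> x \<otimes>\<^sub>a ident C t') \<cdot> inv_arr C (assoc C (t, x, t'))
          \<cdot> (ident C t \<otimes>\<^sub>a \<beta>' x) \<cdot> assoc C (t, t', x)"
  by (simp add: tens_half_braid_def center_tens_obj_def Let_def)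

lemma tens_natural_half_braiding: "natural_half_braiding C (t \<otimes> t') \<beta>2"
proof (unfold_locales, simp, rule nat_isoI, goal_cases)
  case 1
  show ?case by (simp add: tens_half_braid_def center_tens_obj_def Let_def)
next
  case (2 x)
  then show ?case by (simp add: \<beta>2_eq hom_def)
next
  case (3 f)
  then have [simp]: "f \<in> arr C" .
  have w: "\<lfloor>(f \<otimes>\<^sub>a ident C t) \<otimes>\<^sub>a ident C t'\<rfloor> \<odot> \<lfloor>\<beta> (src C f) \<otimes>\<^sub>a ident C t'\<rfloor> =
      \<lfloor>\<beta> (trg C f) \<otimes>\<^sub>a ident C t'\<rfloor> \<odot> \<lfloor>(ident C t \<otimes>\<^sub>a f) \<otimes>\<^sub>a ident C t'\<rfloor>"
    using arg_cong[OF nat_isoD(6)[OF X.\<beta>_iso, of f], of "\<lambda>h. \<lfloor>h \<otimes>\<^sub>a ident C t'\<rfloor>"] by (simp add: chase)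
  have w': "\<lfloor>ident C t \<otimes>\<^sub>a (f \<otimes>\<^sub>a ident C t')\<rfloor> \<odot> \<lfloor>ident C t \<otimes>\<^sub>a \<beta>' (src C f)\<rfloor> =
      \<lfloor>ident C t \<otimes>\<^sub>a \<beta>' (trg C f)\<rfloor> \<odot> \<lfloor>ident C t \<otimes>\<^sub>a (ident C t' \<otimes>\<^sub>a f)\<rfloor>"
    using arg_cong[OF nat_isoD(6)[OF Y.\<beta>_iso, of f], of "\<lambda>h. \<lfloor>ident C t \<otimes>\<^sub>a h\<rfloor>"] by (simp add: chase)
  show ?case
    by (rule lift_eqI) (simp_all add: \<beta>2_eq chase w[THEN re] w'[THEN re] assoc_out assoc_out_re assoc_inv_out_re)
qed

end

sublocale two_natural_half_braidings \<subseteq> XY: natural_half_braiding C "t \<otimes> t'" \<beta>2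
  by (rule tens_natural_half_braiding)

context two_natural_half_braidings
begin

text \<open>
  In terms of tails the half-braiding of \<open>t \<otimes> t'\<close> is the plain composite of
  the two half-braidings; the associators in its definition disappear.
\<close>

lemma tail_tens_obj:
  assumes [simp]: "x \<in> obj C" "z \<in> obj C"
  shows "(ident C x \<otimes>\<^sub>a assoc C (t, t', z)) \<cdot> XY.tail x z = X.tail x (t' \<otimes> z) \<cdot> (ident C t \<otimes>\<^sub>a Y.tail x z) \<cdot> assoc C (t, t', x \<otimes> z)"
    (is "?f = ?g")
proof (rule iso_right_cancel)
  have w: "\<lfloor>ident C t \<otimes>\<^sub>a Y.tail x z\<rfloor> \<odot> \<lfloor>ident C t \<otimes>\<^sub>a assoc C (t', x, z)\<rfloor> =
      \<lfloor>ident C t \<otimes>\<^sub>a assoc C (x, t', z)\<rfloor> \<odot> \<lfloor>ident C t \<otimes>\<^sub>a (\<beta>' x \<otimes>\<^sub>a ident C z)\<rfloor>"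
    using arg_cong[OF Y.tail_assoc[of x z], of "\<lambda>h. \<lfloor>ident C t \<otimes>\<^sub>a h\<rfloor>"] by (simp add: chase)
  have p: "\<lfloor>ident C t \<otimes>\<^sub>a assoc C (x, t', z)\<rfloor> \<odot> \<lfloor>assoc C (t, x \<otimes> t', z)\<rfloor> =
     \<lfloor>assoc C (t, x, t' \<otimes> z)\<rfloor> \<odot> \<lfloor>assoc C (t \<otimes> x, t', z)\<rfloor> \<odot> \<lfloor>inv_arr C (assoc C (t, x, t') \<otimes>\<^sub>a ident C z)\<rfloor>"
    using pentagon_l[of t x t' z, THEN re, of "\<lfloor>inv_arr C (assoc C (t, x, t') \<otimes>\<^sub>a ident C z)\<rfloor>"] by (simp add: ocmp_assoc)
  have "\<lfloor>?f\<rfloor> \<odot> \<lfloor>assoc C (t \<otimes> t', x, z)\<rfloor> =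
      \<lfloor>assoc C (x, t, t' \<otimes> z)\<rfloor> \<odot> \<lfloor>assoc C (x \<otimes> t, t', z)\<rfloor> \<odot> \<lfloor>(\<beta> x \<otimes>\<^sub>a ident C t') \<otimes>\<^sub>a ident C z\<rfloor> \<odot>
      \<lfloor>inv_arr C (assoc C (t, x, t') \<otimes>\<^sub>a ident C z)\<rfloor> \<odot> \<lfloor>(ident C t \<otimes>\<^sub>a \<beta>' x) \<otimes>\<^sub>a ident C z\<rfloor> \<odot> \<lfloor>assoc C (t, t', x) \<otimes>\<^sub>a ident C z\<rfloor>"
    by (simp add: chase XY.tail_assoc_l \<beta>2_eq pentagon_l[symmetric, THEN re3])
  also have "\<dots> = \<lfloor>X.tail x (t' \<otimes> z)\<rfloor> \<odot> \<lfloor>ident C t \<otimes>\<^sub>a assoc C (x, t', z)\<rfloor> \<odot> \<lfloor>assoc C (t, x \<otimes> t', z)\<rfloor> \<odot>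
      \<lfloor>(ident C t \<otimes>\<^sub>a \<beta>' x) \<otimes>\<^sub>a ident C z\<rfloor> \<odot> \<lfloor>assoc C (t, t', x) \<otimes>\<^sub>a ident C z\<rfloor>"
    by (simp add: p[THEN re] ocmp_assoc X.tail_assoc_re assoc_out_re)
  also have "\<dots> = \<lfloor>?g\<rfloor> \<odot> \<lfloor>assoc C (t \<otimes> t', x, z)\<rfloor>"
    by (simp add: chase pentagon_l w[THEN re] assoc_out_re)
  finally show "\<lfloor>?f\<rfloor> \<odot> \<lfloor>assoc C (t \<otimes> t', x, z)\<rfloor> = \<lfloor>?g\<rfloor> \<odot> \<lfloor>assoc C (t \<otimes> t', x, z)\<rfloor>" .
qed simp_all

lemma tail_tens_obj_l:
  assumes [simp]: "x \<in> obj C" "z \<in> obj C"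
  shows "\<lfloor>ident C x \<otimes>\<^sub>a assoc C (t, t', z)\<rfloor> \<odot> \<lfloor>XY.tail x z\<rfloor> = \<lfloor>X.tail x (t' \<otimes> z)\<rfloor> \<odot> \<lfloor>ident C t \<otimes>\<^sub>a Y.tail x z\<rfloor> \<odot> \<lfloor>assoc C (t, t', x \<otimes> z)\<rfloor>"
  using tail_tens_obj[THEN up, of x z] by (simp add: chase)

lemmas tail_tens_obj_re = tail_tens_obj_l[THEN re]

end

locale two_half_braidings = monoidal_category C +
  X: half_braided C t \<beta> + Y: half_braided C t' \<beta>'
  for C :: "('o, 'a, 'z) mon_cat_scheme" (structure) and t \<beta> t' \<beta>'

sublocale two_half_braidings \<subseteq> two_natural_half_braidings C t \<beta> t' \<beta>' ..

context two_half_braidings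
begin

text \<open>
  The hexagons of the factors can be stacked: \<open>t'\<close> passes \<open>x\<close> and
  \<open>y\<close> first, then \<open>t\<close> does, and naturality interchanges the passage of
  \<open>t\<close> past \<open>x\<close> with that of \<open>t'\<close> past \<open>y\<close>.
\<close>

lemma tens_half_braiding: "half_braiding C (t \<otimes> t') \<beta>2"
proof (rule XY.half_braidedI, rule iso_left_cancel)
  fix x y assume [simp]: "x \<in> obj C" "y \<in> obj C"
  have t6: "\<lfloor>ident C x \<otimes>\<^sub>a (ident C y \<otimes>\<^sub>a assoc C (t, t', \<I>))\<rfloor> \<odot> \<lfloor>ident C x \<otimes>\<^sub>a XY.tail y \<I>\<rfloor> =
     \<lfloor>ident C x \<otimes>\<^sub>a X.tail y (t' \<otimes> \<I>)\<rfloor> \<odot> \<lfloor>ident C x \<otimes>\<^sub>a (ident C t \<otimes>\<^sub>a Y.tail y \<I>)\<rfloor> \<odot> \<lfloor>ident C x \<otimes>\<^sub>a assoc C (t, t', y \<otimes> \<I>)\<rfloor>"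
    using arg_cong[OF tail_tens_obj[of y \<I>], of "\<lambda>h. \<lfloor>ident C x \<otimes>\<^sub>a h\<rfloor>"] by (simp add: chase)
  have t5: "\<lfloor>ident C t \<otimes>\<^sub>a assoc C (x, y, t' \<otimes> \<I>)\<rfloor> \<odot> \<lfloor>ident C t \<otimes>\<^sub>a Y.tail (x \<otimes> y) \<I>\<rfloor> =
     \<lfloor>ident C t \<otimes>\<^sub>a (ident C x \<otimes>\<^sub>a Y.tail y \<I>)\<rfloor> \<odot> \<lfloor>ident C t \<otimes>\<^sub>a Y.tail x (y \<otimes> \<I>)\<rfloor> \<odot> \<lfloor>ident C t \<otimes>\<^sub>a (ident C t' \<otimes>\<^sub>a assoc C (x, y, \<I>))\<rfloor>"
    using arg_cong[OF Y.tail_hexagon[of x y \<I>], of "\<lambda>h. \<lfloor>ident C t \<otimes>\<^sub>a h\<rfloor>"] by (simp add: chase)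
  show "\<lfloor>ident C x \<otimes>\<^sub>a (ident C y \<otimes>\<^sub>a assoc C (t, t', \<I>))\<rfloor> \<odot> \<lfloor>assoc C (x, y, t \<otimes> t' \<otimes> \<I>) \<cdot> XY.tail (x \<otimes> y) \<I>\<rfloor> =
    \<lfloor>ident C x \<otimes>\<^sub>a (ident C y \<otimes>\<^sub>a assoc C (t, t', \<I>))\<rfloor> \<odot>
    \<lfloor>(ident C x \<otimes>\<^sub>a XY.tail y \<I>) \<cdot> XY.tail x (y \<otimes> \<I>) \<cdot> (ident C (t \<otimes> t') \<otimes>\<^sub>a assoc C (x, y, \<I>))\<rfloor>"
    by (simp add: chase t6[THEN re] t5[THEN re] assoc_out assoc_out_re tail_tens_obj_l tail_tens_obj_re
      X.tail_out_re X.tail_hexagon_l[THEN re])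
qed simp_all

end

section \<open>The Drinfeld center is a braided monoidal category\<close>

lemma hom_cat_simps [simp]:
  "obj (hom_cat Os H i c) = Os"
  "(x, f, y) \<in> arr (hom_cat Os H i c) \<longleftrightarrow> x \<in> Os \<and> y \<in> Os \<and> f \<in> H x y"
  "x \<in> Os \<Longrightarrow> y \<in> Os \<Longrightarrow> f \<in> H x y \<Longrightarrow> src (hom_cat Os H i c) (x, f, y) = x"
  "x \<in> Os \<Longrightarrow> y \<in> Os \<Longrightarrow> f \<in> H x y \<Longrightarrow> trg (hom_cat Os H i c) (x, f, y) = y"
  "x \<in> Os \<Longrightarrow> ident (hom_cat Os H i c) x = (x, i x, x)"
  "x \<in> Os \<Longrightarrow> y \<in> Os \<Longrightarrow> z \<in> Os \<Longrightarrow> f \<in> H x y \<Longrightarrow> g \<in> H y z \<Longrightarrow>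
    (y, g, z) \<cdot>\<^bsub>hom_cat Os H i c\<^esub> (x, f, y) = (x, c x y z g f, z)"
  by (auto simp: hom_cat_def Let_def)

lemma hom_cat_category:
  assumes "\<And>x. x \<in> Os \<Longrightarrow> i x \<in> H x x"
    and "\<And>x y z f g. x \<in> Os \<Longrightarrow> y \<in> Os \<Longrightarrow> z \<in> Os \<Longrightarrow> f \<in> H x y \<Longrightarrow> g \<in> H y z \<Longrightarrow> c x y z g f \<in> H x z"
    and "\<And>x y f. x \<in> Os \<Longrightarrow> y \<in> Os \<Longrightarrow> f \<in> H x y \<Longrightarrow> c x x y f (i x) = f"
    and "\<And>x y f. x \<in> Os \<Longrightarrow> y \<in> Os \<Longrightarrow> f \<in> H x y \<Longrightarrow> c x y y (i y) f = f"
    and "\<And>w x y z f g h. w \<in> Os \<Longrightarrow> x \<in> Os \<Longrightarrow> y \<in> Os \<Longrightarrow> z \<in> Os \<Longrightarrow> f \<in> H w x \<Longrightarrow> g \<in> H x y \<Longrightarrow> h \<in> H y z \<Longrightarrow>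
      c w x z (c x y z h g) f = c w y z h (c w x y g f)"
  shows "category (hom_cat Os H i c)"
proof
  fix f g assume "\<not> (f \<in> arr (hom_cat Os H i c) \<and> g \<in> arr (hom_cat Os H i c) \<and> trg (hom_cat Os H i c) f = src (hom_cat Os H i c) g)"
  then show "g \<cdot>\<^bsub>hom_cat Os H i c\<^esub> f = undefined"
    by (cases f; cases g) (auto simp: hom_cat_def Let_def)
qed (use assms in \<open>auto simp: hom_def\<close>, auto simp: hom_cat_def Let_def)

lemma category_cong:
  assumes "category C" "obj D = obj C" "arr D = arr C" "src D = src C" "trg D = trg C" "ident D = ident C" "cmp D = cmp C"
  shows "category D"
  using assms by (simp add: category_def hom_def)

context monoidal_category
begin

lemma center_cat_fields:
  "obj (center C) = {(t, \<beta>). half_braiding C t \<beta>}"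
  "arr (center C) = arr (center_cat C)" "src (center C) = src (center_cat C)" "trg (center C) = trg (center_cat C)"
  "ident (center C) = ident (center_cat C)" "cmp (center C) = cmp (center_cat C)"
  by (simp_all add: center_def Let_def center_cat_def)

lemma center_simps:
  "X \<in> obj (center C) \<longleftrightarrow> half_braiding C (fst X) (snd X)"
  "(X, f, Y) \<in> arr (center C) \<longleftrightarrow> X \<in> obj (center C) \<and> Y \<in> obj (center C) \<and> f \<in> center_hom C X Y"
  "(X, f, Y) \<in> arr (center C) \<Longrightarrow> src (center C) (X, f, Y) = X"
  "(X, f, Y) \<in> arr (center C) \<Longrightarrow> trg (center C) (X, f, Y) = Y"
  "X \<in> obj (center C) \<Longrightarrow> ident (center C) X = (X, ident C (fst X), X)"
  "(X, f, Y) \<in> arr (center C) \<Longrightarrow> (Y, g, W) \<in> arr (center C) \<Longrightarrow> (Y, g, W) \<cdot>\<^bsub>center C\<^esub> (X, f, Y) = (X, g \<cdot> f, W)"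
  by (auto simp: center_cat_fields, auto simp: center_cat_def)

lemma center_objD: "X \<in> obj (center C) \<Longrightarrow> half_braided C (fst X) (snd X)"
  by (simp add: center_simps half_braided_def half_braided_axioms_def monoidal_category_axioms)

lemma center_obj_typ [simp]: "X \<in> obj (center C) \<Longrightarrow> fst X \<in> obj C"
  "X \<in> obj (center C) \<Longrightarrow> x \<in> obj C \<Longrightarrow> snd X x \<in> arr C"
  "X \<in> obj (center C) \<Longrightarrow> x \<in> obj C \<Longrightarrow> src C (snd X x) = fst X \<otimes> x"
  "X \<in> obj (center C) \<Longrightarrow> x \<in> obj C \<Longrightarrow> trg C (snd X x) = x \<otimes> fst X"
  "X \<in> obj (center C) \<Longrightarrow> x \<in> obj C \<Longrightarrow> iso_arr C (snd X x)"
proof -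
  assume "X \<in> obj (center C)"
  then interpret X: half_braided C "fst X" "snd X" by (rule center_objD)
  show "fst X \<in> obj C" by simp
  assume "x \<in> obj C"
  then show "snd X x \<in> arr C" "src C (snd X x) = fst X \<otimes> x" "trg C (snd X x) = x \<otimes> fst X" "iso_arr C (snd X x)"
    by simp_all
qed

lemma center_hom_iff:
  assumes "X \<in> obj (center C)" "Y \<in> obj (center C)"
  shows "f \<in> center_hom C X Y \<longleftrightarrow> f \<in> arr C \<and> src C f = fst X \<and> trg C f = fst Y \<and>
    (\<forall>x \<in> obj C. \<lfloor>ident C x \<otimes>\<^sub>a f\<rfloor> \<odot> \<lfloor>snd X x\<rfloor> = \<lfloor>snd Y x\<rfloor> \<odot> \<lfloor>f \<otimes>\<^sub>a ident C x\<rfloor>)"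
proof -
  have "(ident C x \<otimes>\<^sub>a f) \<cdot> snd X x = snd Y x \<cdot> (f \<otimes>\<^sub>a ident C x) \<longleftrightarrow>
      \<lfloor>ident C x \<otimes>\<^sub>a f\<rfloor> \<odot> \<lfloor>snd X x\<rfloor> = \<lfloor>snd Y x\<rfloor> \<odot> \<lfloor>f \<otimes>\<^sub>a ident C x\<rfloor>"
    if "f \<in> arr C" "src C f = fst X" "trg C f = fst Y" "x \<in> obj C" for x
    using that assms lift_eqI[of "(ident C x \<otimes>\<^sub>a f) \<cdot> snd X x" "snd Y x \<cdot> (f \<otimes>\<^sub>a ident C x)"]
    by (auto simp flip: lift_cmp)
  then show ?thesis
    by (auto simp: center_hom_def hom_def)
qed

lemma center_hom_typ:
  assumes "f \<in> center_hom C X Y" "X \<in> obj (center C)" "Y \<in> obj (center C)"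
  shows "f \<in> arr C" "src C f = fst X" "trg C f = fst Y"
  using assms by (auto simp: center_hom_iff)

lemma center_hom_cmp:
  assumes "X \<in> obj (center C)" "Y \<in> obj (center C)" "W \<in> obj (center C)" "f \<in> center_hom C X Y" "g \<in> center_hom C Y W"
  shows "g \<cdot> f \<in> center_hom C X W"
proof -
  have h: "\<lfloor>ident C x \<otimes>\<^sub>a f\<rfloor> \<odot> \<lfloor>snd X x\<rfloor> = \<lfloor>snd Y x\<rfloor> \<odot> \<lfloor>f \<otimes>\<^sub>a ident C x\<rfloor>"
    "\<lfloor>ident C x \<otimes>\<^sub>a g\<rfloor> \<odot> \<lfloor>snd Y x\<rfloor> = \<lfloor>snd W x\<rfloor> \<odot> \<lfloor>g \<otimes>\<^sub>a ident C x\<rfloor>" if "x \<in> obj C" for x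
    using that assms by (auto simp: center_hom_iff)
  show ?thesis
    using assms h h[THEN re] by (simp add: center_hom_iff chase)
qed

lemma center_hom_ident: "X \<in> obj (center C) \<Longrightarrow> ident C (fst X) \<in> center_hom C X X"
  by (simp add: center_hom_iff)

lemma center_category: "category (center C)"
proof (rule category_cong)
  note [simp] = center_simps[unfolded center_cat_fields, simplified]
  show "category (center_cat C)"
    unfolding center_cat_def
    using center_hom_cmp center_hom_ident center_hom_typ
    by (intro hom_cat_category; simp add: center_cat_fields(1)) (auto simp: assoc_arr)
qed (simp_all add: center_cat_fields, simp add: center_cat_def)

end

sublocale monoidal_category \<subseteq> Z: category "center C"
  by (rule center_category)

context monoidal_category
begin

lemma center_hom_inv:
  assumes "f \<in> center_hom C X Y" "X \<in> obj (center C)" "Y \<in> obj (center C)" "iso_arr C f"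
  shows "inv_arr C f \<in> center_hom C Y X"
proof -
  note [simp] = assms(2-4) center_hom_typ[OF assms(1-3)]
  have "\<lfloor>ident C x \<otimes>\<^sub>a inv_arr C f\<rfloor> \<odot> \<lfloor>snd Y x\<rfloor> = \<lfloor>snd X x\<rfloor> \<odot> \<lfloor>inv_arr C f \<otimes>\<^sub>a ident C x\<rfloor>" if [simp]: "x \<in> obj C" for x
  proof -
    have "\<lfloor>ident C x \<otimes>\<^sub>a f\<rfloor> \<odot> \<lfloor>snd X x\<rfloor> = \<lfloor>snd Y x\<rfloor> \<odot> \<lfloor>f \<otimes>\<^sub>a ident C x\<rfloor>"
      using assms by (simp add: center_hom_iff)
    from iso_flip[OF this] show ?thesis by simp
  qed
  then show ?thesis
    by (simp add: center_hom_iff)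
qed

lemma center_inverse:
  assumes "(X, f, Y) \<in> arr (center C)" "iso_arr C f"
  shows "inverse_arrows (center C) (X, f, Y) (Y, inv_arr C f, X)"
  using assms center_hom_inv[of f X Y] center_hom_typ[of f X Y]
  by (simp add: inverse_arrows_def hom_def center_simps(2-))

lemma center_iso:
  assumes "(X, f, Y) \<in> arr (center C)" "iso_arr C f"
  shows "iso_arr (center C) (X, f, Y)" "inv_arr (center C) (X, f, Y) = (Y, inv_arr C f, X)"
  using center_inverse[OF assms] Z.inv_arr_eq[OF center_inverse[OF assms]] unfolding iso_arr_def by blast+

lemma center_tens_fst [simp]: "fst (center_tens_obj C X Y) = fst X \<otimes> fst Y"
  by (simp add: center_tens_obj_def Let_def)

lemma center_tens_in [simp]:
  assumes "X \<in> obj (center C)" "Y \<in> obj (center C)"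
  shows "center_tens_obj C X Y \<in> obj (center C)"
proof -
  interpret X: half_braided C "fst X" "snd X" using assms(1) by (rule center_objD)
  interpret Y: half_braided C "fst Y" "snd Y" using assms(2) by (rule center_objD)
  interpret two_half_braidings C "fst X" "snd X" "fst Y" "snd Y" ..
  show ?thesis using tens_half_braiding by (simp add: center_simps tens_half_braid_def)
qed

lemma center_tens_snd': "snd (center_tens_obj C X Y) = tens_half_braid C (fst X) (snd X) (fst Y) (snd Y)"
  by (simp add: tens_half_braid_def)

lemma center_tens_snd:
  "x \<in> obj C \<Longrightarrow> snd (center_tens_obj C X Y) x = assoc C (x, fst X, fst Y) \<cdot> (snd X x \<otimes>\<^sub>a ident C (fst Y)) \<cdot>
     inv_arr C (assoc C (fst X, x, fst Y)) \<cdot> (ident C (fst X) \<otimes>\<^sub>a snd Y x) \<cdot> assoc C (fst X, fst Y, x)"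
  by (simp add: center_tens_obj_def Let_def)

lemma center_unit_fst [simp]: "fst (center_unit C) = \<I>"
  by (simp add: center_unit_def)

lemma center_unit_snd [simp]: "x \<in> obj C \<Longrightarrow> snd (center_unit C) x = inv_arr C (runit C x) \<cdot> lunit C x"
  by (simp add: center_unit_def)

lemma lunit_tens_l:
  assumes [simp]: "x \<in> obj C" "y \<in> obj C"
  shows "\<lfloor>lunit C (x \<otimes> y)\<rfloor> \<odot> \<lfloor>assoc C (\<I>, x, y)\<rfloor> = \<lfloor>lunit C x \<otimes>\<^sub>a ident C y\<rfloor>"
  using lunit_tens[THEN up, of x y] by (simp add: chase)

lemma runit_tens_l:
  assumes [simp]: "x \<in> obj C" "y \<in> obj C"
  shows "\<lfloor>ident C x \<otimes>\<^sub>a runit C y\<rfloor> \<odot> \<lfloor>assoc C (x, y, \<I>)\<rfloor> = \<lfloor>runit C (x \<otimes> y)\<rfloor>"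
  using runit_tens[THEN up, of x y] by (simp add: chase)

lemma lunit_tens_inv:
  assumes [simp]: "x \<in> obj C" "y \<in> obj C"
  shows "\<lfloor>lunit C x \<otimes>\<^sub>a ident C y\<rfloor> \<odot> \<lfloor>inv_arr C (assoc C (\<I>, x, y))\<rfloor> = \<lfloor>lunit C (x \<otimes> y)\<rfloor>"
  by (simp flip: lunit_tens_l add: ocmp_assoc)

lemma runit_tens_inv:
  assumes [simp]: "x \<in> obj C" "y \<in> obj C"
  shows "\<lfloor>runit C (x \<otimes> y)\<rfloor> \<odot> \<lfloor>inv_arr C (assoc C (x, y, \<I>))\<rfloor> = \<lfloor>ident C x \<otimes>\<^sub>a runit C y\<rfloor>"
  by (simp flip: runit_tens_l add: ocmp_assoc)

lemma center_unit_in [simp]: "center_unit C \<in> obj (center C)"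
proof -
  have "natural_half_braiding C \<I> (snd (center_unit C))"
  proof (unfold_locales, simp, rule nat_isoI, goal_cases)
    case 1
    show ?case by (simp add: center_unit_def)
  next
    case (2 x)
    then show ?case by (simp add: hom_def)
  next
    case (3 f)
    then have [simp]: "f \<in> arr C" .
    have n: "\<lfloor>f \<otimes>\<^sub>a ident C \<I>\<rfloor> \<odot> \<lfloor>inv_arr C (runit C (src C f))\<rfloor> = \<lfloor>inv_arr C (runit C (trg C f))\<rfloor> \<odot> \<lfloor>f\<rfloor>"
      by (rule iso_flip) (simp_all add: unit_in_rules)
    show ?case
      by (rule lift_eqI) (simp_all add: chase n[THEN re] unit_out(1)[of f])
  qed
  moreover have "assoc C (x, y, \<I>) \<cdot> (inv_arr C (runit C (x \<otimes> y)) \<cdot> lunit C (x \<otimes> y)) \<cdot> assoc C (\<I>, x, y) =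
        (ident C x \<otimes>\<^sub>a (inv_arr C (runit C y) \<cdot> lunit C y)) \<cdot> assoc C (x, \<I>, y) \<cdot> ((inv_arr C (runit C x) \<cdot> lunit C x) \<otimes>\<^sub>a ident C y)"
    if [simp]: "x \<in> obj C" "y \<in> obj C" for x y
  proof -
    have n: "\<lfloor>assoc C (x, y, \<I>)\<rfloor> \<odot> \<lfloor>inv_arr C (runit C (x \<otimes> y))\<rfloor> = \<lfloor>inv_arr C (ident C x \<otimes>\<^sub>a runit C y)\<rfloor> \<odot> \<lfloor>ident C (x \<otimes> y)\<rfloor>"
      by (rule iso_flip) (simp_all add: runit_tens_l)
    show ?thesis
      by (rule lift_eqI) (simp_all add: chase n[THEN re] lunit_tens_l triangle_l[THEN re])
  qed
  ultimately show ?thesis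
    by (simp add: center_simps half_braiding_iff)
qed

text \<open>The structure maps of the center are morphisms of half-braidings.\<close>

lemma center_hom_tens_left:
  assumes f: "f \<in> center_hom C X Y" and [simp]: "X \<in> obj (center C)" "Y \<in> obj (center C)" "W \<in> obj (center C)"
  shows "f \<otimes>\<^sub>a ident C (fst W) \<in> center_hom C (center_tens_obj C X W) (center_tens_obj C Y W)"
proof -
  note [simp] = center_hom_typ[OF f assms(2,3)]
  have "\<lfloor>ident C x \<otimes>\<^sub>a (f \<otimes>\<^sub>a ident C (fst W))\<rfloor> \<odot> \<lfloor>snd (center_tens_obj C X W) x\<rfloor> =
      \<lfloor>snd (center_tens_obj C Y W) x\<rfloor> \<odot> \<lfloor>(f \<otimes>\<^sub>a ident C (fst W)) \<otimes>\<^sub>a ident C x\<rfloor>" if [simp]: "x \<in> obj C" for x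
  proof -
    have "(ident C x \<otimes>\<^sub>a f) \<cdot> snd X x = snd Y x \<cdot> (f \<otimes>\<^sub>a ident C x)"
      using f by (simp add: center_hom_def)
    from arg_cong[OF this, of "\<lambda>h. \<lfloor>h \<otimes>\<^sub>a ident C (fst W)\<rfloor>"]
    have w: "\<lfloor>(ident C x \<otimes>\<^sub>a f) \<otimes>\<^sub>a ident C (fst W)\<rfloor> \<odot> \<lfloor>snd X x \<otimes>\<^sub>a ident C (fst W)\<rfloor> =
        \<lfloor>snd Y x \<otimes>\<^sub>a ident C (fst W)\<rfloor> \<odot> \<lfloor>(f \<otimes>\<^sub>a ident C x) \<otimes>\<^sub>a ident C (fst W)\<rfloor>"
      by (simp add: chase)
    show ?thesis
      by (simp add: center_tens_snd chase assoc_out assoc_out_re w[THEN re] assoc_inv_out_re tens.slide)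
  qed
  then show ?thesis
    by (simp add: center_hom_iff)
qed

lemma center_hom_tens_right:
  assumes f: "f \<in> center_hom C X Y" and [simp]: "X \<in> obj (center C)" "Y \<in> obj (center C)" "W \<in> obj (center C)"
  shows "ident C (fst W) \<otimes>\<^sub>a f \<in> center_hom C (center_tens_obj C W X) (center_tens_obj C W Y)"
proof -
  note [simp] = center_hom_typ[OF f assms(2,3)]
  have "\<lfloor>ident C x \<otimes>\<^sub>a (ident C (fst W) \<otimes>\<^sub>a f)\<rfloor> \<odot> \<lfloor>snd (center_tens_obj C W X) x\<rfloor> =
      \<lfloor>snd (center_tens_obj C W Y) x\<rfloor> \<odot> \<lfloor>(ident C (fst W) \<otimes>\<^sub>a f) \<otimes>\<^sub>a ident C x\<rfloor>" if [simp]: "x \<in> obj C" for x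
  proof -
    have "(ident C x \<otimes>\<^sub>a f) \<cdot> snd X x = snd Y x \<cdot> (f \<otimes>\<^sub>a ident C x)"
      using f by (simp add: center_hom_def)
    from arg_cong[OF this, of "\<lambda>h. \<lfloor>ident C (fst W) \<otimes>\<^sub>a h\<rfloor>"]
    have w: "\<lfloor>ident C (fst W) \<otimes>\<^sub>a (ident C x \<otimes>\<^sub>a f)\<rfloor> \<odot> \<lfloor>ident C (fst W) \<otimes>\<^sub>a snd X x\<rfloor> =
        \<lfloor>ident C (fst W) \<otimes>\<^sub>a snd Y x\<rfloor> \<odot> \<lfloor>ident C (fst W) \<otimes>\<^sub>a (f \<otimes>\<^sub>a ident C x)\<rfloor>"
      by (simp add: chase)
    show ?thesis
      by (simp add: center_tens_snd chase assoc_out assoc_out_re w[THEN re] assoc_inv_out_re tens.slide')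
  qed
  then show ?thesis
    by (simp add: center_hom_iff)
qed

lemma center_hom_tens:
  assumes f: "f \<in> center_hom C X Y" "g \<in> center_hom C X' Y'"
    and [simp]: "X \<in> obj (center C)" "Y \<in> obj (center C)" "X' \<in> obj (center C)" "Y' \<in> obj (center C)"
  shows "f \<otimes>\<^sub>a g \<in> center_hom C (center_tens_obj C X X') (center_tens_obj C Y Y')"
proof -
  note [simp] = center_hom_typ[OF f(1) assms(3,4)] center_hom_typ[OF f(2) assms(5,6)]
  have "(f \<otimes>\<^sub>a ident C (fst Y')) \<cdot> (ident C (fst X) \<otimes>\<^sub>a g) \<in> center_hom C (center_tens_obj C X X') (center_tens_obj C Y Y')"
    using f by (intro center_hom_cmp[of _ "center_tens_obj C X Y'"] center_hom_tens_left center_hom_tens_right) auto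
  then show ?thesis
    using tens.bimap_merge[of f g] by simp
qed

text \<open>
  For morphisms too it suffices to look at tails with the unit as last factor, again because
  tensoring with the unit is faithful.
\<close>

lemma center_hom_tail:
  assumes [simp]: "X \<in> obj (center C)" "Y \<in> obj (center C)" "f \<in> arr C" "src C f = fst X" "trg C f = fst Y"
    and t: "\<And>x. x \<in> obj C \<Longrightarrow> \<lfloor>ident C x \<otimes>\<^sub>a (f \<otimes>\<^sub>a ident C \<I>)\<rfloor> \<odot> \<lfloor>natural_half_braiding.tail C (fst X) (snd X) x \<I>\<rfloor> =
      \<lfloor>natural_half_braiding.tail C (fst Y) (snd Y) x \<I>\<rfloor> \<odot> \<lfloor>f \<otimes>\<^sub>a ident C (x \<otimes> \<I>)\<rfloor>"
  shows "f \<in> center_hom C X Y"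
proof -
  interpret X: half_braided C "fst X" "snd X" using assms(1) by (rule center_objD)
  interpret Y: half_braided C "fst Y" "snd Y" using assms(2) by (rule center_objD)
  have "(ident C x \<otimes>\<^sub>a f) \<cdot> snd X x = snd Y x \<cdot> (f \<otimes>\<^sub>a ident C x)" (is "?f = ?g") if [simp]: "x \<in> obj C" for x
  proof (rule runit_faithful, rule iso_left_cancel)
    have "\<lfloor>assoc C (x, fst Y, \<I>)\<rfloor> \<odot> \<lfloor>?f \<otimes>\<^sub>a ident C \<I>\<rfloor> =
        (\<lfloor>ident C x \<otimes>\<^sub>a (f \<otimes>\<^sub>a ident C \<I>)\<rfloor> \<odot> \<lfloor>X.tail x \<I>\<rfloor>) \<odot> \<lfloor>assoc C (fst X, x, \<I>)\<rfloor>"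
      by (simp add: chase X.tail_assoc_l assoc_out_re)
    also have "\<dots> = \<lfloor>assoc C (x, fst Y, \<I>)\<rfloor> \<odot> \<lfloor>?g \<otimes>\<^sub>a ident C \<I>\<rfloor>"
      by (simp add: chase t assoc_out Y.tail_assoc_re)
    finally show "\<lfloor>assoc C (x, fst Y, \<I>)\<rfloor> \<odot> \<lfloor>?f \<otimes>\<^sub>a ident C \<I>\<rfloor> = \<lfloor>assoc C (x, fst Y, \<I>)\<rfloor> \<odot> \<lfloor>?g \<otimes>\<^sub>a ident C \<I>\<rfloor>" .
  qed simp_all
  then show ?thesis
    by (auto simp: center_hom_def hom_def)
qed

text \<open>
  On tails, the half-braidings of both bracketings become the same composite of three tails, one
  for each factor; the pentagon accounts for the remaining associators.
\<close>

lemma center_hom_assoc: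
  assumes [simp]: "X \<in> obj (center C)" "Y \<in> obj (center C)" "W \<in> obj (center C)"
  shows "assoc C (fst X, fst Y, fst W) \<in>
    center_hom C (center_tens_obj C (center_tens_obj C X Y) W) (center_tens_obj C X (center_tens_obj C Y W))"
proof -
  let ?t = "fst X" and ?u = "fst Y" and ?w = "fst W"
  interpret X: half_braided C ?t "snd X" by (rule center_objD) simp
  interpret Y: half_braided C ?u "snd Y" by (rule center_objD) simp
  interpret W: half_braided C ?w "snd W" by (rule center_objD) simp
  interpret XY: two_half_braidings C ?t "snd X" ?u "snd Y" ..
  interpret YW: two_half_braidings C ?u "snd Y" ?w "snd W" ..
  interpret XY': half_braided C "?t \<otimes> ?u" XY.\<beta>2
    by unfold_locales (rule XY.tens_half_braiding)
  interpret YW': half_braided C "?u \<otimes> ?w" YW.\<beta>2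
    by unfold_locales (rule YW.tens_half_braiding)
  interpret L: two_half_braidings C "?t \<otimes> ?u" XY.\<beta>2 ?w "snd W" ..
  interpret R: two_half_braidings C ?t "snd X" "?u \<otimes> ?w" YW.\<beta>2 ..
  have "\<lfloor>ident C x \<otimes>\<^sub>a (assoc C (?t, ?u, ?w) \<otimes>\<^sub>a ident C z)\<rfloor> \<odot> \<lfloor>L.XY.tail x z\<rfloor> =
    \<lfloor>R.XY.tail x z\<rfloor> \<odot> \<lfloor>assoc C (?t, ?u, ?w) \<otimes>\<^sub>a ident C (x \<otimes> z)\<rfloor>" if [simp]: "x \<in> obj C" "z \<in> obj C" for x z
  proof -
    let ?a = "ident C x \<otimes>\<^sub>a ((ident C ?t \<otimes>\<^sub>a assoc C (?u, ?w, z)) \<cdot> assoc C (?t, ?u \<otimes> ?w, z))"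
    have p: "\<lfloor>ident C x \<otimes>\<^sub>a (ident C ?t \<otimes>\<^sub>a assoc C (?u, ?w, z))\<rfloor> \<odot> \<lfloor>ident C x \<otimes>\<^sub>a assoc C (?t, ?u \<otimes> ?w, z)\<rfloor> \<odot>
        \<lfloor>ident C x \<otimes>\<^sub>a (assoc C (?t, ?u, ?w) \<otimes>\<^sub>a ident C z)\<rfloor> =
        \<lfloor>ident C x \<otimes>\<^sub>a assoc C (?t, ?u, ?w \<otimes> z)\<rfloor> \<odot> \<lfloor>ident C x \<otimes>\<^sub>a assoc C (?t \<otimes> ?u, ?w, z)\<rfloor>"
      using arg_cong[OF pentagon[of ?t ?u ?w z], of "\<lambda>h. \<lfloor>ident C x \<otimes>\<^sub>a h\<rfloor>"] by (simp add: chase)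
    have w: "\<lfloor>ident C ?t \<otimes>\<^sub>a (ident C x \<otimes>\<^sub>a assoc C (?u, ?w, z))\<rfloor> \<odot> \<lfloor>ident C ?t \<otimes>\<^sub>a YW.XY.tail x z\<rfloor> =
        \<lfloor>ident C ?t \<otimes>\<^sub>a Y.tail x (?w \<otimes> z)\<rfloor> \<odot> \<lfloor>ident C ?t \<otimes>\<^sub>a (ident C ?u \<otimes>\<^sub>a W.tail x z)\<rfloor> \<odot> \<lfloor>ident C ?t \<otimes>\<^sub>a assoc C (?u, ?w, x \<otimes> z)\<rfloor>"
      using arg_cong[OF YW.tail_tens_obj[of x z], of "\<lambda>h. \<lfloor>ident C ?t \<otimes>\<^sub>a h\<rfloor>"] by (simp add: chase)
    have "\<lfloor>?a\<rfloor> \<odot> \<lfloor>(ident C x \<otimes>\<^sub>a (assoc C (?t, ?u, ?w) \<otimes>\<^sub>a ident C z)) \<cdot> L.XY.tail x z\<rfloor> =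
        \<lfloor>ident C x \<otimes>\<^sub>a assoc C (?t, ?u, ?w \<otimes> z)\<rfloor> \<odot> \<lfloor>XY.XY.tail x (?w \<otimes> z)\<rfloor> \<odot> \<lfloor>ident C (?t \<otimes> ?u) \<otimes>\<^sub>a W.tail x z\<rfloor> \<odot> \<lfloor>assoc C (?t \<otimes> ?u, ?w, x \<otimes> z)\<rfloor>"
      by (simp add: chase p[THEN re3] L.tail_tens_obj_l)
    also have "\<dots> = \<lfloor>X.tail x (?u \<otimes> (?w \<otimes> z))\<rfloor> \<odot> \<lfloor>ident C ?t \<otimes>\<^sub>a Y.tail x (?w \<otimes> z)\<rfloor> \<odot>
        \<lfloor>ident C ?t \<otimes>\<^sub>a (ident C ?u \<otimes>\<^sub>a W.tail x z)\<rfloor> \<odot> \<lfloor>assoc C (?t, ?u, ?w \<otimes> (x \<otimes> z))\<rfloor> \<odot> \<lfloor>assoc C (?t \<otimes> ?u, ?w, x \<otimes> z)\<rfloor>"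
      by (simp add: XY.tail_tens_obj_re ocmp_assoc assoc_in_re)
    also have "\<dots> = \<lfloor>?a\<rfloor> \<odot> \<lfloor>R.XY.tail x z \<cdot> (assoc C (?t, ?u, ?w) \<otimes>\<^sub>a ident C (x \<otimes> z))\<rfloor>"
      by (simp add: chase R.tail_tens_obj_re w[THEN re] pentagon_l X.tail_out_re)
    finally have "(ident C x \<otimes>\<^sub>a (assoc C (?t, ?u, ?w) \<otimes>\<^sub>a ident C z)) \<cdot> L.XY.tail x z = R.XY.tail x z \<cdot> (assoc C (?t, ?u, ?w) \<otimes>\<^sub>a ident C (x \<otimes> z))"
      by (rule iso_left_cancel) simp_all
    from up[OF this] show ?thesis by (simp add: chase)
  qed
  then show ?thesis
    by (intro center_hom_tail) (simp_all add: center_tens_snd')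
qed

lemma center_hom_lunit:
  assumes [simp]: "X \<in> obj (center C)"
  shows "lunit C (fst X) \<in> center_hom C (center_tens_obj C (center_unit C) X) X"
proof -
  have "\<lfloor>ident C x \<otimes>\<^sub>a lunit C (fst X)\<rfloor> \<odot> \<lfloor>snd (center_tens_obj C (center_unit C) X) x\<rfloor> = \<lfloor>snd X x\<rfloor> \<odot> \<lfloor>lunit C (fst X) \<otimes>\<^sub>a ident C x\<rfloor>"
    if [simp]: "x \<in> obj C" for x
    by (simp add: center_tens_snd chase triangle_l[THEN re] lunit_tens_inv[THEN re] unit_in_re lunit_tens_l)
  then show ?thesis by (simp add: center_hom_iff)
qed

lemma center_hom_runit:
  assumes [simp]: "X \<in> obj (center C)"
  shows "runit C (fst X) \<in> center_hom C (center_tens_obj C X (center_unit C)) X"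
proof -
  have "\<lfloor>ident C x \<otimes>\<^sub>a runit C (fst X)\<rfloor> \<odot> \<lfloor>snd (center_tens_obj C X (center_unit C)) x\<rfloor> = \<lfloor>snd X x\<rfloor> \<odot> \<lfloor>runit C (fst X) \<otimes>\<^sub>a ident C x\<rfloor>"
    if [simp]: "x \<in> obj C" for x
    by (simp add: center_tens_snd chase runit_tens_l[THEN re] runit_tens_inv[THEN re] unit_in_re triangle_l)
  then show ?thesis by (simp add: center_hom_iff)
qed

text \<open>
  The half-braiding of \<open>X\<close> is natural with respect to the half-braiding of
  \<open>Y\<close>. Its two hexagons, for \<open>x \<otimes> Y\<close> and for \<open>Y
  \<otimes> x\<close>, turn this naturality square into compatibility with the half-braidings of
  the two products.
\<close>

lemma center_hom_braid:
  assumes [simp]: "X \<in> obj (center C)" "Y \<in> obj (center C)"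
  shows "snd X (fst Y) \<in> center_hom C (center_tens_obj C X Y) (center_tens_obj C Y X)"
proof -
  interpret X: half_braided C "fst X" "snd X" by (rule center_objD) simp
  interpret Y: half_braided C "fst Y" "snd Y" by (rule center_objD) simp
  have "\<lfloor>ident C x \<otimes>\<^sub>a snd X (fst Y)\<rfloor> \<odot> \<lfloor>snd (center_tens_obj C X Y) x\<rfloor> = \<lfloor>snd (center_tens_obj C Y X) x\<rfloor> \<odot> \<lfloor>snd X (fst Y) \<otimes>\<^sub>a ident C x\<rfloor>"
    if [simp]: "x \<in> obj C" for x
  proof -
    have "\<lfloor>ident C x \<otimes>\<^sub>a snd X (fst Y)\<rfloor> \<odot> \<lfloor>snd (center_tens_obj C X Y) x\<rfloor> =
       (\<lfloor>ident C x \<otimes>\<^sub>a snd X (fst Y)\<rfloor> \<odot> \<lfloor>assoc C (x, fst X, fst Y)\<rfloor> \<odot> \<lfloor>snd X x \<otimes>\<^sub>a ident C (fst Y)\<rfloor>) \<odot>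
       \<lfloor>inv_arr C (assoc C (fst X, x, fst Y))\<rfloor> \<odot> \<lfloor>ident C (fst X) \<otimes>\<^sub>a snd Y x\<rfloor> \<odot> \<lfloor>assoc C (fst X, fst Y, x)\<rfloor>"
      by (simp add: center_tens_snd chase)
    also have "\<dots> = \<lfloor>assoc C (x, fst Y, fst X)\<rfloor> \<odot> \<lfloor>snd X (x \<otimes> fst Y)\<rfloor> \<odot> \<lfloor>ident C (fst X) \<otimes>\<^sub>a snd Y x\<rfloor> \<odot> \<lfloor>assoc C (fst X, fst Y, x)\<rfloor>"
      by (simp add: ocmp_assoc flip: X.half_hexagon_l)
    also have "\<dots> = \<lfloor>assoc C (x, fst Y, fst X)\<rfloor> \<odot> \<lfloor>snd Y x \<otimes>\<^sub>a ident C (fst X)\<rfloor> \<odot> \<lfloor>snd X (fst Y \<otimes> x)\<rfloor> \<odot> \<lfloor>assoc C (fst X, fst Y, x)\<rfloor>"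
      by (simp add: X.\<beta>_out_re ocmp_assoc)
    also have "\<dots> = \<lfloor>assoc C (x, fst Y, fst X)\<rfloor> \<odot> \<lfloor>snd Y x \<otimes>\<^sub>a ident C (fst X)\<rfloor> \<odot> \<lfloor>inv_arr C (assoc C (fst Y, x, fst X))\<rfloor> \<odot>
        (\<lfloor>assoc C (fst Y, x, fst X)\<rfloor> \<odot> \<lfloor>snd X (fst Y \<otimes> x)\<rfloor> \<odot> \<lfloor>assoc C (fst X, fst Y, x)\<rfloor>)"
      by simp
    also have "\<dots> = \<lfloor>snd (center_tens_obj C Y X) x\<rfloor> \<odot> \<lfloor>snd X (fst Y) \<otimes>\<^sub>a ident C x\<rfloor>"
      by (simp only: X.half_hexagon_l that center_obj_typ assms) (simp add: center_tens_snd chase)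
    finally show ?thesis .
  qed
  then show ?thesis by (simp add: center_hom_iff)
qed

lemma center_rec [simp]:
  "X \<in> obj (center C) \<Longrightarrow> Y \<in> obj (center C) \<Longrightarrow> omap (tens (center C)) (X, Y) = center_tens_obj C X Y"
  "(X, f, Y) \<in> arr (center C) \<Longrightarrow> (X', f', Y') \<in> arr (center C) \<Longrightarrow>
    amap (tens (center C)) ((X, f, Y), (X', f', Y')) = (center_tens_obj C X X', f \<otimes>\<^sub>a f', center_tens_obj C Y Y')"
  "unit_obj (center C) = center_unit C"
  "X \<in> obj (center C) \<Longrightarrow> Y \<in> obj (center C) \<Longrightarrow> W \<in> obj (center C) \<Longrightarrow>
    assoc (center C) (X, Y, W) = (center_tens_obj C (center_tens_obj C X Y) W, assoc C (fst X, fst Y, fst W), center_tens_obj C X (center_tens_obj C Y W))"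
  "X \<in> obj (center C) \<Longrightarrow> lunit (center C) X = (center_tens_obj C (center_unit C) X, lunit C (fst X), X)"
  "X \<in> obj (center C) \<Longrightarrow> runit (center C) X = (center_tens_obj C X (center_unit C), runit C (fst X), X)"
  "X \<in> obj (center C) \<Longrightarrow> Y \<in> obj (center C) \<Longrightarrow>
    braid (center C) (X, Y) = (center_tens_obj C X Y, snd X (fst Y), center_tens_obj C Y X)"
  by (simp_all add: center_def Let_def)

lemma center_rec_ext:
  "omap (tens (center C)) \<in> extensional (obj (center C) \<times> obj (center C))"
  "amap (tens (center C)) \<in> extensional (arr (center C) \<times> arr (center C))"
  "assoc (center C) \<in> extensional (obj (center C) \<times> obj (center C) \<times> obj (center C))"
  "lunit (center C) \<in> extensional (obj (center C))"
  "runit (center C) \<in> extensional (obj (center C))"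
  "braid (center C) \<in> extensional (obj (center C) \<times> obj (center C))"
  by (simp_all add: center_def Let_def)

lemma center_arr_cases:
  assumes "a \<in> arr (center C)"
  obtains X f Y where "a = (X, f, Y)" "X \<in> obj (center C)" "Y \<in> obj (center C)" "f \<in> center_hom C X Y"
    "f \<in> arr C" "src C f = fst X" "trg C f = fst Y"
  using assms center_hom_typ by (metis center_simps(2) prod_cases3)

lemma center_arr_typ [simp]:
  assumes "X \<in> obj (center C)" "Y \<in> obj (center C)" "f \<in> center_hom C X Y"
  shows "(X, f, Y) \<in> arr (center C)" "src (center C) (X, f, Y) = X" "trg (center C) (X, f, Y) = Y"
  using assms by (simp_all add: center_simps(2-4))

lemma center_cmp_simp [simp]:
  assumes "X \<in> obj (center C)" "Y \<in> obj (center C)" "W \<in> obj (center C)" "f \<in> center_hom C X Y" "g \<in> center_hom C Y W"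
  shows "(Y, g, W) \<cdot>\<^bsub>center C\<^esub> (X, f, Y) = (X, g \<cdot> f, W)"
  using assms by (simp add: center_simps(2,6))

lemmas [simp] = center_simps(5) center_hom_ident center_hom_assoc center_hom_lunit center_hom_runit center_hom_braid
  center_hom_tens

lemma center_hom_lw [simp]:
  assumes "f \<in> center_hom C X Y" "X \<in> obj (center C)" "Y \<in> obj (center C)" "W \<in> obj (center C)"
  shows "ident C (fst W) \<otimes>\<^sub>a f \<in> center_hom C (center_tens_obj C W X) (center_tens_obj C W Y)"
    "f \<otimes>\<^sub>a ident C (fst W) \<in> center_hom C (center_tens_obj C X W) (center_tens_obj C Y W)"
  using assms center_hom_tens_left center_hom_tens_right by auto

lemma center_unit_ident [simp]: "ident C \<I> \<in> center_hom C (center_unit C) (center_unit C)"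
  using center_hom_ident[of "center_unit C"] by simp

text \<open>
  Composition, tensor product and constraints of the center are those of \<open>C\<close> on
  underlying arrows, so each of its axioms follows from the one in \<open>C\<close>; only
  membership of the structure maps needed an argument.
\<close>

lemma center_tens_functor: "cat_functor (center C \<times>\<^sub>C center C) (center C) (tens (center C))"
proof (intro cat_functor.intro cat_functor_axioms.intro prod_category center_category, goal_cases)
  case 1
  show ?case using center_rec_ext(1) by (auto simp: PiE_def simp del: split_paired_All)
next
  case 2
  show ?case using center_rec_ext(2) by simp
next
  case (3 F A B)
  then obtain f g where F: "F = (f, g)" "f \<in> arr (center C)" "g \<in> arr (center C)" by (auto simp: hom_def)
  from F(2) obtain X f' Y where f: "f = (X, f', Y)" "X \<in> obj (center C)" "Y \<in> obj (center C)" "f' \<in> center_hom C X Y"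
    by (rule center_arr_cases)
  from F(3) obtain X' g' Y' where g: "g = (X', g', Y')" "X' \<in> obj (center C)" "Y' \<in> obj (center C)" "g' \<in> center_hom C X' Y'"
    by (rule center_arr_cases)
  from 3 F f g have "A = (X, X')" "B = (Y, Y')" by (auto simp: hom_def)
  with F f g show ?case by (simp add: hom_def)
next
  case (4 A)
  then obtain X Y where "A = (X, Y)" "X \<in> obj (center C)" "Y \<in> obj (center C)" by auto
  then show ?case by simp
next
  case (5 F A B G D)
  then obtain f g where F: "F = (f, g)" "f \<in> arr (center C)" "g \<in> arr (center C)" by (auto simp: hom_def)
  from F(2) obtain X f' Y where f: "f = (X, f', Y)" "X \<in> obj (center C)" "Y \<in> obj (center C)" "f' \<in> center_hom C X Y"
    "f' \<in> arr C" "src C f' = fst X" "trg C f' = fst Y"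
    by (rule center_arr_cases)
  from F(3) obtain X' g' Y' where g: "g = (X', g', Y')" "X' \<in> obj (center C)" "Y' \<in> obj (center C)" "g' \<in> center_hom C X' Y'"
    "g' \<in> arr C" "src C g' = fst X'" "trg C g' = fst Y'"
    by (rule center_arr_cases)
  from 5 obtain h k where G: "G = (h, k)" "h \<in> arr (center C)" "k \<in> arr (center C)" by (auto simp: hom_def)
  from G(2) obtain U h' W where h: "h = (U, h', W)" "U \<in> obj (center C)" "W \<in> obj (center C)" "h' \<in> center_hom C U W"
    "h' \<in> arr C" "src C h' = fst U" "trg C h' = fst W"
    by (rule center_arr_cases)
  from G(3) obtain U' k' W' where k: "k = (U', k', W')" "U' \<in> obj (center C)" "W' \<in> obj (center C)" "k' \<in> center_hom C U' W'"
    "k' \<in> arr C" "src C k' = fst U'" "trg C k' = fst W'"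
    by (rule center_arr_cases)
  from 5 F f g G h k have "U = Y" "U' = Y'" by (auto simp: hom_def)
  with F f g G h k show ?case by (simp add: tens.bimap_cmp center_hom_cmp[of _ Y] center_hom_cmp[of _ Y'])
qed

lemma center_monoidal: "monoidal_category (center C)"
proof (intro monoidal_category.intro monoidal_category_axioms.intro center_category, goal_cases)
  case 1
  show ?case by (rule center_tens_functor)
next
  case 2
  show ?case by simp
next
  case 3
  show ?case
  proof (rule nat_isoI3, goal_cases)
    case 1
    show ?case by (rule center_rec_ext)
  next
    case (2 X Y W)
    then show ?case by (simp add: hom_def center_iso)
  next
    case (3 f g h)
    from 3(1) obtain X f' Y where [simp]: "f = (X, f', Y)" "X \<in> obj (center C)" "Y \<in> obj (center C)" "f' \<in> center_hom C X Y"
      "f' \<in> arr C" "src C f' = fst X" "trg C f' = fst Y"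
      by (rule center_arr_cases)
    from 3(2) obtain X' g' Y' where [simp]: "g = (X', g', Y')" "X' \<in> obj (center C)" "Y' \<in> obj (center C)" "g' \<in> center_hom C X' Y'"
      "g' \<in> arr C" "src C g' = fst X'" "trg C g' = fst Y'"
      by (rule center_arr_cases)
    from 3(3) obtain U h' W where [simp]: "h = (U, h', W)" "U \<in> obj (center C)" "W \<in> obj (center C)" "h' \<in> center_hom C U W"
      "h' \<in> arr C" "src C h' = fst U" "trg C h' = fst W"
      by (rule center_arr_cases)
    show ?case using assoc_nat[of f' g' h'] by simp
  qed
next
  case 4
  show ?case
  proof (rule nat_isoI, goal_cases)
    case 1
    show ?case by (rule center_rec_ext)
  next
    case (2 X)
    then show ?case by (simp add: hom_def center_iso)
  next
    case (3 f)
    from 3(1) obtain X f' Y where [simp]: "f = (X, f', Y)" "X \<in> obj (center C)" "Y \<in> obj (center C)" "f' \<in> center_hom C X Y"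
      "f' \<in> arr C" "src C f' = fst X" "trg C f' = fst Y"
      by (rule center_arr_cases)
    have [simp]: "ident C \<I> \<otimes>\<^sub>a f' \<in> center_hom C (center_tens_obj C (center_unit C) X) (center_tens_obj C (center_unit C) Y)"
      using center_hom_lw(1)[of f' X Y "center_unit C"] by simp
    show ?case using lunit_nat[of f'] by simp
  qed
next
  case 5
  show ?case
  proof (rule nat_isoI, goal_cases)
    case 1
    show ?case by (rule center_rec_ext)
  next
    case (2 X)
    then show ?case by (simp add: hom_def center_iso)
  next
    case (3 f)
    from 3(1) obtain X f' Y where [simp]: "f = (X, f', Y)" "X \<in> obj (center C)" "Y \<in> obj (center C)" "f' \<in> center_hom C X Y"
      "f' \<in> arr C" "src C f' = fst X" "trg C f' = fst Y"
      by (rule center_arr_cases)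
    have [simp]: "f' \<otimes>\<^sub>a ident C \<I> \<in> center_hom C (center_tens_obj C X (center_unit C)) (center_tens_obj C Y (center_unit C))"
      using center_hom_lw(2)[of f' X Y "center_unit C"] by simp
    show ?case using runit_nat[of f'] by simp
  qed
next
  case (6 U X Y W)
  note [simp] = 6
  have [simp]: "assoc C (fst U, fst X \<otimes> fst Y, fst W) \<in> center_hom C (center_tens_obj C (center_tens_obj C U (center_tens_obj C X Y)) W) (center_tens_obj C U (center_tens_obj C (center_tens_obj C X Y) W))"
    "assoc C (fst U, fst X, fst Y \<otimes> fst W) \<in> center_hom C (center_tens_obj C (center_tens_obj C U X) (center_tens_obj C Y W)) (center_tens_obj C U (center_tens_obj C X (center_tens_obj C Y W)))"
    "assoc C (fst U \<otimes> fst X, fst Y, fst W) \<in> center_hom C (center_tens_obj C (center_tens_obj C (center_tens_obj C U X) Y) W) (center_tens_obj C (center_tens_obj C U X) (center_tens_obj C Y W))"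
    using center_hom_assoc[of U "center_tens_obj C X Y" W] center_hom_assoc[of U X "center_tens_obj C Y W"]
      center_hom_assoc[of "center_tens_obj C U X" Y W] by simp_all
  show ?case
    using pentagon[of "fst U" "fst X" "fst Y" "fst W"]
    by (simp add: center_hom_cmp[of "center_tens_obj C (center_tens_obj C (center_tens_obj C U X) Y) W" "center_tens_obj C (center_tens_obj C U (center_tens_obj C X Y)) W"])
next
  case (7 X Y)
  note [simp] = 7
  have [simp]: "assoc C (fst X, \<I>, fst Y) \<in> center_hom C (center_tens_obj C (center_tens_obj C X (center_unit C)) Y) (center_tens_obj C X (center_tens_obj C (center_unit C) Y))"
    using center_hom_assoc[of X "center_unit C" Y] by simp
  show ?case
    using triangle[of "fst X" "fst Y"] by simp
qed

lemma center_braided: "braided_category (center C)"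
proof (intro braided_category.intro braided_category_axioms.intro center_monoidal, goal_cases)
  case 1
  show ?case
  proof (rule nat_isoI2, goal_cases)
    case 1
    show ?case by (rule center_rec_ext)
  next
    case (2 X Y)
    then show ?case by (simp add: hom_def center_iso)
  next
    case (3 f g)
    from 3(1) obtain X f' Y where [simp]: "f = (X, f', Y)" "X \<in> obj (center C)" "Y \<in> obj (center C)" "f' \<in> center_hom C X Y"
      "f' \<in> arr C" "src C f' = fst X" "trg C f' = fst Y"
      by (rule center_arr_cases)
    from 3(2) obtain X' g' Y' where [simp]: "g = (X', g', Y')" "X' \<in> obj (center C)" "Y' \<in> obj (center C)" "g' \<in> center_hom C X' Y'"
      "g' \<in> arr C" "src C g' = fst X'" "trg C g' = fst Y'"
      by (rule center_arr_cases)
    interpret X: half_braided C "fst X" "snd X" by (rule center_objD) simp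
    interpret Y: half_braided C "fst Y" "snd Y" by (rule center_objD) simp
    have c: "\<lfloor>ident C x \<otimes>\<^sub>a f'\<rfloor> \<odot> \<lfloor>snd X x\<rfloor> = \<lfloor>snd Y x\<rfloor> \<odot> \<lfloor>f' \<otimes>\<^sub>a ident C x\<rfloor>" if "x \<in> obj C" for x
      using that center_hom_iff[of X Y f'] by simp
    have "(g' \<otimes>\<^sub>a f') \<cdot> snd X (fst X') = snd Y (fst Y') \<cdot> (f' \<otimes>\<^sub>a g')"
    proof (rule lift_eqI)
      have "\<lfloor>(g' \<otimes>\<^sub>a f') \<cdot> snd X (fst X')\<rfloor> = \<lfloor>ident C (fst Y') \<otimes>\<^sub>a f'\<rfloor> \<odot> \<lfloor>g' \<otimes>\<^sub>a ident C (fst X)\<rfloor> \<odot> \<lfloor>snd X (fst X')\<rfloor>"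
        using tens.bimap_merge(2)[of g' f'] by (simp add: chase tens.bimap_ocmp[THEN re])
      also have "\<dots> = \<lfloor>snd Y (fst Y')\<rfloor> \<odot> \<lfloor>f' \<otimes>\<^sub>a ident C (fst Y')\<rfloor> \<odot> \<lfloor>ident C (fst X) \<otimes>\<^sub>a g'\<rfloor>"
        by (simp add: X.\<beta>_out c[THEN re] ocmp_assoc)
      also have "\<dots> = \<lfloor>snd Y (fst Y') \<cdot> (f' \<otimes>\<^sub>a g')\<rfloor>"
        by (simp add: chase tens.bimap_ocmp)
      finally show "\<lfloor>(g' \<otimes>\<^sub>a f') \<cdot> snd X (fst X')\<rfloor> = \<lfloor>snd Y (fst Y') \<cdot> (f' \<otimes>\<^sub>a g')\<rfloor>" .
    qed simp
    then show ?case by simp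
  qed
next
  case (2 X Y W)
  note [simp] = 2
  interpret X: half_braided C "fst X" "snd X" by (rule center_objD) simp
  have [simp]: "snd X (fst Y \<otimes> fst W) \<in> center_hom C (center_tens_obj C X (center_tens_obj C Y W)) (center_tens_obj C (center_tens_obj C Y W) X)"
    using center_hom_braid[of X "center_tens_obj C Y W"] by simp
  show ?case
    using X.half_hexagon[of "fst Y" "fst W"]
    by (simp add: center_hom_cmp[of "center_tens_obj C (center_tens_obj C X Y) W" "center_tens_obj C (center_tens_obj C Y X) W"]
      center_hom_cmp[of "center_tens_obj C (center_tens_obj C X Y) W" "center_tens_obj C X (center_tens_obj C Y W)"])
next
  case (3 X Y W)
  note [simp] = 3
  let ?A = "assoc C (fst W, fst X, fst Y)"
  have [simp]: "snd (center_tens_obj C X Y) (fst W) \<in> center_hom C (center_tens_obj C (center_tens_obj C X Y) W) (center_tens_obj C W (center_tens_obj C X Y))"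
    using center_hom_braid[of "center_tens_obj C X Y" W] by simp
  have [simp]: "inv_arr C (assoc C (fst X, fst Y, fst W)) \<in> center_hom C (center_tens_obj C X (center_tens_obj C Y W)) (center_tens_obj C (center_tens_obj C X Y) W)"
    if "X \<in> obj (center C)" "Y \<in> obj (center C)" "W \<in> obj (center C)" for X Y W
    using that by (intro center_hom_inv) simp_all
  have "inv_arr C ?A \<cdot> snd (center_tens_obj C X Y) (fst W) \<cdot> inv_arr C (assoc C (fst X, fst Y, fst W)) =
    (snd X (fst W) \<otimes>\<^sub>a ident C (fst Y)) \<cdot> inv_arr C (assoc C (fst X, fst W, fst Y)) \<cdot> (ident C (fst X) \<otimes>\<^sub>a snd Y (fst W))"
    by (rule lift_eqI) (simp_all add: chase center_tens_snd)
  then show ?case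
    by (simp add: center_iso center_hom_cmp[of "center_tens_obj C X (center_tens_obj C Y W)" "center_tens_obj C (center_tens_obj C X Y) W"]
      center_hom_cmp[of "center_tens_obj C X (center_tens_obj C Y W)" "center_tens_obj C X (center_tens_obj C W Y)"])
qed

end

section \<open>Module monoidal categories\<close>

sublocale module_category \<subseteq> act: bifunctor V M M "act A"
  by (intro bifunctor.intro V.category_axioms M.category_axioms act_functor)

context module_category
begin

lemma massoc_typ [simp]:
  assumes "v \<in> obj V" "w \<in> obj V" "x \<in> obj M"
  shows "massoc A (v, w, x) \<in> arr M" "src M (massoc A (v, w, x)) = (v \<otimes>\<^bsub>V\<^esub> w) \<rhd>\<^bsub>A\<^esub> x"
    "trg M (massoc A (v, w, x)) = v \<rhd>\<^bsub>A\<^esub> (w \<rhd>\<^bsub>A\<^esub> x)" "iso_arr M (massoc A (v, w, x))"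
  using nat_isoD(2-5)[OF massoc_iso, of "(v, w, x)"] assms by auto

lemma munit_typ [simp]:
  assumes "x \<in> obj M"
  shows "munit A x \<in> arr M" "src M (munit A x) = \<I>\<^bsub>V\<^esub> \<rhd>\<^bsub>A\<^esub> x" "trg M (munit A x) = x" "iso_arr M (munit A x)"
  using nat_isoD(2-5)[OF munit_iso, of x] assms by auto

lemma massoc_nat:
  assumes "f \<in> arr V" "g \<in> arr V" "h \<in> arr M"
  shows "(f \<rhd>\<^sub>a\<^bsub>A\<^esub> (g \<rhd>\<^sub>a\<^bsub>A\<^esub> h)) \<cdot>\<^bsub>M\<^esub> massoc A (src V f, src V g, src M h) =
    massoc A (trg V f, trg V g, trg M h) \<cdot>\<^bsub>M\<^esub> ((f \<otimes>\<^sub>a\<^bsub>V\<^esub> g) \<rhd>\<^sub>a\<^bsub>A\<^esub> h)"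
  using nat_isoD(6)[OF massoc_iso, of "(f, g, h)"] assms by simp

lemma munit_nat:
  assumes "f \<in> arr M"
  shows "f \<cdot>\<^bsub>M\<^esub> munit A (src M f) = munit A (trg M f) \<cdot>\<^bsub>M\<^esub> (ident V \<I>\<^bsub>V\<^esub> \<rhd>\<^sub>a\<^bsub>A\<^esub> f)"
  using nat_isoD(6)[OF munit_iso, of f] assms by simp

lemma munit_out:
  "f \<in> arr M \<Longrightarrow> src M f = x \<Longrightarrow> \<lfloor>f\<rfloor>\<^bsub>M\<^esub> \<odot>\<^bsub>M\<^esub> \<lfloor>munit A x\<rfloor>\<^bsub>M\<^esub> = \<lfloor>munit A (trg M f)\<rfloor>\<^bsub>M\<^esub> \<odot>\<^bsub>M\<^esub> \<lfloor>ident V \<I>\<^bsub>V\<^esub> \<rhd>\<^sub>a\<^bsub>A\<^esub> f\<rfloor>\<^bsub>M\<^esub>"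
  using munit_nat[of f, THEN M.up] by (auto simp: chase)

lemma munit_in:
  "f \<in> arr M \<Longrightarrow> trg M f = x' \<Longrightarrow> \<lfloor>munit A x'\<rfloor>\<^bsub>M\<^esub> \<odot>\<^bsub>M\<^esub> \<lfloor>ident V \<I>\<^bsub>V\<^esub> \<rhd>\<^sub>a\<^bsub>A\<^esub> f\<rfloor>\<^bsub>M\<^esub> = \<lfloor>f\<rfloor>\<^bsub>M\<^esub> \<odot>\<^bsub>M\<^esub> \<lfloor>munit A (src M f)\<rfloor>\<^bsub>M\<^esub>"
  using munit_out by auto

lemma massoc_out:
  assumes "v \<in> obj V"
  shows "w \<in> obj V \<Longrightarrow> f \<in> arr M \<Longrightarrow> src M f = x \<Longrightarrow>
      \<lfloor>ident V v \<rhd>\<^sub>a\<^bsub>A\<^esub> (ident V w \<rhd>\<^sub>a\<^bsub>A\<^esub> f)\<rfloor>\<^bsub>M\<^esub> \<odot>\<^bsub>M\<^esub> \<lfloor>massoc A (v, w, x)\<rfloor>\<^bsub>M\<^esub> =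
      \<lfloor>massoc A (v, w, trg M f)\<rfloor>\<^bsub>M\<^esub> \<odot>\<^bsub>M\<^esub> \<lfloor>ident V (v \<otimes>\<^bsub>V\<^esub> w) \<rhd>\<^sub>a\<^bsub>A\<^esub> f\<rfloor>\<^bsub>M\<^esub>"
    "x \<in> obj M \<Longrightarrow> g \<in> arr V \<Longrightarrow> src V g = w \<Longrightarrow>
      \<lfloor>ident V v \<rhd>\<^sub>a\<^bsub>A\<^esub> (g \<rhd>\<^sub>a\<^bsub>A\<^esub> ident M x)\<rfloor>\<^bsub>M\<^esub> \<odot>\<^bsub>M\<^esub> \<lfloor>massoc A (v, w, x)\<rfloor>\<^bsub>M\<^esub> =
      \<lfloor>massoc A (v, trg V g, x)\<rfloor>\<^bsub>M\<^esub> \<odot>\<^bsub>M\<^esub> \<lfloor>(ident V v \<otimes>\<^sub>a\<^bsub>V\<^esub> g) \<rhd>\<^sub>a\<^bsub>A\<^esub> ident M x\<rfloor>\<^bsub>M\<^esub>"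
    "x \<in> obj M \<Longrightarrow> g \<in> arr V \<Longrightarrow> src V g = w \<Longrightarrow>
      \<lfloor>g \<rhd>\<^sub>a\<^bsub>A\<^esub> ident M (v \<rhd>\<^bsub>A\<^esub> x)\<rfloor>\<^bsub>M\<^esub> \<odot>\<^bsub>M\<^esub> \<lfloor>massoc A (w, v, x)\<rfloor>\<^bsub>M\<^esub> =
      \<lfloor>massoc A (trg V g, v, x)\<rfloor>\<^bsub>M\<^esub> \<odot>\<^bsub>M\<^esub> \<lfloor>(g \<otimes>\<^sub>a\<^bsub>V\<^esub> ident V v) \<rhd>\<^sub>a\<^bsub>A\<^esub> ident M x\<rfloor>\<^bsub>M\<^esub>"
  using massoc_nat[of "ident V v" "ident V w" f, THEN M.up] massoc_nat[of "ident V v" g "ident M x", THEN M.up]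
    massoc_nat[of g "ident V v" "ident M x", THEN M.up] assms by (auto simp: chase)

lemma massoc_in:
  assumes "v \<in> obj V"
  shows "w \<in> obj V \<Longrightarrow> f \<in> arr M \<Longrightarrow> trg M f = x \<Longrightarrow>
      \<lfloor>massoc A (v, w, x)\<rfloor>\<^bsub>M\<^esub> \<odot>\<^bsub>M\<^esub> \<lfloor>ident V (v \<otimes>\<^bsub>V\<^esub> w) \<rhd>\<^sub>a\<^bsub>A\<^esub> f\<rfloor>\<^bsub>M\<^esub> =
      \<lfloor>ident V v \<rhd>\<^sub>a\<^bsub>A\<^esub> (ident V w \<rhd>\<^sub>a\<^bsub>A\<^esub> f)\<rfloor>\<^bsub>M\<^esub> \<odot>\<^bsub>M\<^esub> \<lfloor>massoc A (v, w, src M f)\<rfloor>\<^bsub>M\<^esub>"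
    "x \<in> obj M \<Longrightarrow> g \<in> arr V \<Longrightarrow> trg V g = w \<Longrightarrow>
      \<lfloor>massoc A (v, w, x)\<rfloor>\<^bsub>M\<^esub> \<odot>\<^bsub>M\<^esub> \<lfloor>(ident V v \<otimes>\<^sub>a\<^bsub>V\<^esub> g) \<rhd>\<^sub>a\<^bsub>A\<^esub> ident M x\<rfloor>\<^bsub>M\<^esub> =
      \<lfloor>ident V v \<rhd>\<^sub>a\<^bsub>A\<^esub> (g \<rhd>\<^sub>a\<^bsub>A\<^esub> ident M x)\<rfloor>\<^bsub>M\<^esub> \<odot>\<^bsub>M\<^esub> \<lfloor>massoc A (v, src V g, x)\<rfloor>\<^bsub>M\<^esub>"
    "x \<in> obj M \<Longrightarrow> g \<in> arr V \<Longrightarrow> trg V g = w \<Longrightarrow>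
      \<lfloor>massoc A (w, v, x)\<rfloor>\<^bsub>M\<^esub> \<odot>\<^bsub>M\<^esub> \<lfloor>(g \<otimes>\<^sub>a\<^bsub>V\<^esub> ident V v) \<rhd>\<^sub>a\<^bsub>A\<^esub> ident M x\<rfloor>\<^bsub>M\<^esub> =
      \<lfloor>g \<rhd>\<^sub>a\<^bsub>A\<^esub> ident M (v \<rhd>\<^bsub>A\<^esub> x)\<rfloor>\<^bsub>M\<^esub> \<odot>\<^bsub>M\<^esub> \<lfloor>massoc A (src V g, v, x)\<rfloor>\<^bsub>M\<^esub>"
  using massoc_out assms by simp_all

lemma massoc_inv_out:
  assumes "v \<in> obj V"
  shows "w \<in> obj V \<Longrightarrow> f \<in> arr M \<Longrightarrow> src M f = x \<Longrightarrow>
      \<lfloor>ident V (v \<otimes>\<^bsub>V\<^esub> w) \<rhd>\<^sub>a\<^bsub>A\<^esub> f\<rfloor>\<^bsub>M\<^esub> \<odot>\<^bsub>M\<^esub> \<lfloor>inv_arr M (massoc A (v, w, x))\<rfloor>\<^bsub>M\<^esub> =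
      \<lfloor>inv_arr M (massoc A (v, w, trg M f))\<rfloor>\<^bsub>M\<^esub> \<odot>\<^bsub>M\<^esub> \<lfloor>ident V v \<rhd>\<^sub>a\<^bsub>A\<^esub> (ident V w \<rhd>\<^sub>a\<^bsub>A\<^esub> f)\<rfloor>\<^bsub>M\<^esub>"
    "x \<in> obj M \<Longrightarrow> g \<in> arr V \<Longrightarrow> src V g = w \<Longrightarrow>
      \<lfloor>(ident V v \<otimes>\<^sub>a\<^bsub>V\<^esub> g) \<rhd>\<^sub>a\<^bsub>A\<^esub> ident M x\<rfloor>\<^bsub>M\<^esub> \<odot>\<^bsub>M\<^esub> \<lfloor>inv_arr M (massoc A (v, w, x))\<rfloor>\<^bsub>M\<^esub> =
      \<lfloor>inv_arr M (massoc A (v, trg V g, x))\<rfloor>\<^bsub>M\<^esub> \<odot>\<^bsub>M\<^esub> \<lfloor>ident V v \<rhd>\<^sub>a\<^bsub>A\<^esub> (g \<rhd>\<^sub>a\<^bsub>A\<^esub> ident M x)\<rfloor>\<^bsub>M\<^esub>"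
    "x \<in> obj M \<Longrightarrow> g \<in> arr V \<Longrightarrow> src V g = w \<Longrightarrow>
      \<lfloor>(g \<otimes>\<^sub>a\<^bsub>V\<^esub> ident V v) \<rhd>\<^sub>a\<^bsub>A\<^esub> ident M x\<rfloor>\<^bsub>M\<^esub> \<odot>\<^bsub>M\<^esub> \<lfloor>inv_arr M (massoc A (w, v, x))\<rfloor>\<^bsub>M\<^esub> =
      \<lfloor>inv_arr M (massoc A (trg V g, v, x))\<rfloor>\<^bsub>M\<^esub> \<odot>\<^bsub>M\<^esub> \<lfloor>g \<rhd>\<^sub>a\<^bsub>A\<^esub> ident M (v \<rhd>\<^bsub>A\<^esub> x)\<rfloor>\<^bsub>M\<^esub>"
  by (rule M.iso_flip; use assms in \<open>auto simp: massoc_in\<close>)+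

lemma munit_faithful:
  assumes "ident V \<I>\<^bsub>V\<^esub> \<rhd>\<^sub>a\<^bsub>A\<^esub> f = ident V \<I>\<^bsub>V\<^esub> \<rhd>\<^sub>a\<^bsub>A\<^esub> g" "f \<in> arr M" "g \<in> arr M" "src M f = src M g" "trg M f = trg M g"
  shows "f = g"
proof (rule M.iso_right_cancel)
  show "\<lfloor>f\<rfloor>\<^bsub>M\<^esub> \<odot>\<^bsub>M\<^esub> \<lfloor>munit A (src M g)\<rfloor>\<^bsub>M\<^esub> = \<lfloor>g\<rfloor>\<^bsub>M\<^esub> \<odot>\<^bsub>M\<^esub> \<lfloor>munit A (src M g)\<rfloor>\<^bsub>M\<^esub>"
    using assms by (simp add: munit_out)
qed (use assms in auto)

lemma mod_pentagon_l:
  assumes [simp]: "u \<in> obj V" "v \<in> obj V" "w \<in> obj V" "x \<in> obj M"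
  shows "\<lfloor>massoc A (u, v, w \<rhd>\<^bsub>A\<^esub> x)\<rfloor>\<^bsub>M\<^esub> \<odot>\<^bsub>M\<^esub> \<lfloor>massoc A (u \<otimes>\<^bsub>V\<^esub> v, w, x)\<rfloor>\<^bsub>M\<^esub> =
    \<lfloor>ident V u \<rhd>\<^sub>a\<^bsub>A\<^esub> massoc A (v, w, x)\<rfloor>\<^bsub>M\<^esub> \<odot>\<^bsub>M\<^esub> \<lfloor>massoc A (u, v \<otimes>\<^bsub>V\<^esub> w, x)\<rfloor>\<^bsub>M\<^esub> \<odot>\<^bsub>M\<^esub> \<lfloor>assoc V (u, v, w) \<rhd>\<^sub>a\<^bsub>A\<^esub> ident M x\<rfloor>\<^bsub>M\<^esub>"
  using mod_pentagon[of u v w x, THEN M.up] by (simp add: chase)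

lemma mod_triangle_l:
  assumes [simp]: "v \<in> obj V" "x \<in> obj M"
  shows "\<lfloor>ident V v \<rhd>\<^sub>a\<^bsub>A\<^esub> munit A x\<rfloor>\<^bsub>M\<^esub> \<odot>\<^bsub>M\<^esub> \<lfloor>massoc A (v, \<I>\<^bsub>V\<^esub>, x)\<rfloor>\<^bsub>M\<^esub> = \<lfloor>runit V v \<rhd>\<^sub>a\<^bsub>A\<^esub> ident M x\<rfloor>\<^bsub>M\<^esub>"
  using mod_triangle[of v x, THEN M.up] by (simp add: chase)

text \<open>
  The analogue of \<open>lunit_tens\<close> for actions: Kelly's argument with the module
  pentagon in place of the pentagon.
\<close>

lemma munit_act:
  assumes [simp]: "v \<in> obj V" "x \<in> obj M"
  shows "munit A (v \<rhd>\<^bsub>A\<^esub> x) \<cdot>\<^bsub>M\<^esub> massoc A (\<I>\<^bsub>V\<^esub>, v, x) = lunit V v \<rhd>\<^sub>a\<^bsub>A\<^esub> ident M x"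
proof -
  let ?I = "\<I>\<^bsub>V\<^esub>" and ?i = "ident V \<I>\<^bsub>V\<^esub>"
  have "(?i \<rhd>\<^sub>a\<^bsub>A\<^esub> (lunit V v \<rhd>\<^sub>a\<^bsub>A\<^esub> ident M x)) \<cdot>\<^bsub>M\<^esub> (?i \<rhd>\<^sub>a\<^bsub>A\<^esub> inv_arr M (massoc A (?I, v, x))) = ?i \<rhd>\<^sub>a\<^bsub>A\<^esub> munit A (v \<rhd>\<^bsub>A\<^esub> x)"
  proof (rule M.kelly)
    have "\<lfloor>assoc V (?I, ?I, v) \<rhd>\<^sub>a\<^bsub>A\<^esub> ident M x\<rfloor>\<^bsub>M\<^esub> \<odot>\<^bsub>M\<^esub> \<lfloor>inv_arr M (massoc A (?I \<otimes>\<^bsub>V\<^esub> ?I, v, x))\<rfloor>\<^bsub>M\<^esub> =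
       \<lfloor>inv_arr M (massoc A (?I, ?I \<otimes>\<^bsub>V\<^esub> v, x))\<rfloor>\<^bsub>M\<^esub> \<odot>\<^bsub>M\<^esub> \<lfloor>inv_arr M (?i \<rhd>\<^sub>a\<^bsub>A\<^esub> massoc A (?I, v, x))\<rfloor>\<^bsub>M\<^esub> \<odot>\<^bsub>M\<^esub> \<lfloor>massoc A (?I, ?I, v \<rhd>\<^bsub>A\<^esub> x)\<rfloor>\<^bsub>M\<^esub>"
      (is "?E \<odot>\<^bsub>M\<^esub> ?B = ?D \<odot>\<^bsub>M\<^esub> ?F \<odot>\<^bsub>M\<^esub> ?A")
      using arg_cong[OF mod_pentagon_l[of ?I ?I v x], of "\<lambda>t. ?D \<odot>\<^bsub>M\<^esub> ?F \<odot>\<^bsub>M\<^esub> t \<odot>\<^bsub>M\<^esub> ?B"] by (simp add: chase)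
    then show "?E \<odot>\<^bsub>M\<^esub> ?B = ?D \<odot>\<^bsub>M\<^esub> \<lfloor>?i \<rhd>\<^sub>a\<^bsub>A\<^esub> inv_arr M (massoc A (?I, v, x))\<rfloor>\<^bsub>M\<^esub> \<odot>\<^bsub>M\<^esub> ?A" by simp
    show "\<lfloor>(?i \<otimes>\<^sub>a\<^bsub>V\<^esub> lunit V v) \<rhd>\<^sub>a\<^bsub>A\<^esub> ident M x\<rfloor>\<^bsub>M\<^esub> \<odot>\<^bsub>M\<^esub> ?D =
        \<lfloor>inv_arr M (massoc A (?I, v, x))\<rfloor>\<^bsub>M\<^esub> \<odot>\<^bsub>M\<^esub> \<lfloor>?i \<rhd>\<^sub>a\<^bsub>A\<^esub> (lunit V v \<rhd>\<^sub>a\<^bsub>A\<^esub> ident M x)\<rfloor>\<^bsub>M\<^esub>"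
      by (simp add: massoc_inv_out)
    show "\<lfloor>(?i \<otimes>\<^sub>a\<^bsub>V\<^esub> lunit V v) \<rhd>\<^sub>a\<^bsub>A\<^esub> ident M x\<rfloor>\<^bsub>M\<^esub> \<odot>\<^bsub>M\<^esub> ?E = \<lfloor>(runit V ?I \<otimes>\<^sub>a\<^bsub>V\<^esub> ident V v) \<rhd>\<^sub>a\<^bsub>A\<^esub> ident M x\<rfloor>\<^bsub>M\<^esub>"
      using arg_cong[OF V.triangle[of ?I v], of "\<lambda>t. \<lfloor>t \<rhd>\<^sub>a\<^bsub>A\<^esub> ident M x\<rfloor>\<^bsub>M\<^esub>"] by (simp add: chase)
    show "\<lfloor>(runit V ?I \<otimes>\<^sub>a\<^bsub>V\<^esub> ident V v) \<rhd>\<^sub>a\<^bsub>A\<^esub> ident M x\<rfloor>\<^bsub>M\<^esub> \<odot>\<^bsub>M\<^esub> ?B =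
        \<lfloor>inv_arr M (massoc A (?I, v, x))\<rfloor>\<^bsub>M\<^esub> \<odot>\<^bsub>M\<^esub> \<lfloor>runit V ?I \<rhd>\<^sub>a\<^bsub>A\<^esub> ident M (v \<rhd>\<^bsub>A\<^esub> x)\<rfloor>\<^bsub>M\<^esub>"
      by (simp add: massoc_inv_out)
    show "\<lfloor>?i \<rhd>\<^sub>a\<^bsub>A\<^esub> munit A (v \<rhd>\<^bsub>A\<^esub> x)\<rfloor>\<^bsub>M\<^esub> \<odot>\<^bsub>M\<^esub> ?A = \<lfloor>runit V ?I \<rhd>\<^sub>a\<^bsub>A\<^esub> ident M (v \<rhd>\<^bsub>A\<^esub> x)\<rfloor>\<^bsub>M\<^esub>"
      by (simp add: mod_triangle_l)
  qed simp_all
  then have "?i \<rhd>\<^sub>a\<^bsub>A\<^esub> ((lunit V v \<rhd>\<^sub>a\<^bsub>A\<^esub> ident M x) \<cdot>\<^bsub>M\<^esub> inv_arr M (massoc A (?I, v, x))) = ?i \<rhd>\<^sub>a\<^bsub>A\<^esub> munit A (v \<rhd>\<^bsub>A\<^esub> x)"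
    by (simp add: chase)
  then have *: "(lunit V v \<rhd>\<^sub>a\<^bsub>A\<^esub> ident M x) \<cdot>\<^bsub>M\<^esub> inv_arr M (massoc A (?I, v, x)) = munit A (v \<rhd>\<^bsub>A\<^esub> x)"
    by (rule munit_faithful) simp_all
  show ?thesis
    by (simp add: M.assoc_arr flip: *)
qed

end

context module_monoidal_category
begin

lemma \<alpha>1_typ [simp]:
  assumes "v \<in> obj V" "x \<in> obj C" "y \<in> obj C"
  shows "\<alpha>1 (v, x, y) \<in> arr C" "src C (\<alpha>1 (v, x, y)) = (v \<rhd>\<^bsub>A\<^esub> x) \<otimes> y"
    "trg C (\<alpha>1 (v, x, y)) = v \<rhd>\<^bsub>A\<^esub> (x \<otimes> y)" "iso_arr C (\<alpha>1 (v, x, y))"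
  using nat_isoD(2-5)[OF \<alpha>1_iso, of "(v, x, y)"] assms by auto

lemma \<alpha>2_typ [simp]:
  assumes "v \<in> obj V" "x \<in> obj C" "y \<in> obj C"
  shows "\<alpha>2 (v, x, y) \<in> arr C" "src C (\<alpha>2 (v, x, y)) = x \<otimes> (v \<rhd>\<^bsub>A\<^esub> y)"
    "trg C (\<alpha>2 (v, x, y)) = v \<rhd>\<^bsub>A\<^esub> (x \<otimes> y)" "iso_arr C (\<alpha>2 (v, x, y))"
  using nat_isoD(2-5)[OF \<alpha>2_iso, of "(v, x, y)"] assms by auto

lemma \<alpha>1_nat:
  assumes "f \<in> arr V" "g \<in> arr C" "h \<in> arr C"
  shows "(f \<rhd>\<^sub>a\<^bsub>A\<^esub> (g \<otimes>\<^sub>a h)) \<cdot> \<alpha>1 (src V f, src C g, src C h) = \<alpha>1 (trg V f, trg C g, trg C h) \<cdot> ((f \<rhd>\<^sub>a\<^bsub>A\<^esub> g) \<otimes>\<^sub>a h)"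
  using nat_isoD(6)[OF \<alpha>1_iso, of "(f, g, h)"] assms by simp

lemma \<alpha>2_nat:
  assumes "f \<in> arr V" "g \<in> arr C" "h \<in> arr C"
  shows "(f \<rhd>\<^sub>a\<^bsub>A\<^esub> (g \<otimes>\<^sub>a h)) \<cdot> \<alpha>2 (src V f, src C g, src C h) = \<alpha>2 (trg V f, trg C g, trg C h) \<cdot> (g \<otimes>\<^sub>a (f \<rhd>\<^sub>a\<^bsub>A\<^esub> h))"
  using nat_isoD(6)[OF \<alpha>2_iso, of "(f, g, h)"] assms by simp

lemma \<alpha>1_out:
  assumes "x \<in> obj C"
  shows "y \<in> obj C \<Longrightarrow> f \<in> arr V \<Longrightarrow> src V f = v \<Longrightarrow> \<lfloor>f \<rhd>\<^sub>a\<^bsub>A\<^esub> ident C (x \<otimes> y)\<rfloor> \<odot> \<lfloor>\<alpha>1 (v, x, y)\<rfloor> = \<lfloor>\<alpha>1 (trg V f, x, y)\<rfloor> \<odot> \<lfloor>(f \<rhd>\<^sub>a\<^bsub>A\<^esub> ident C x) \<otimes>\<^sub>a ident C y\<rfloor>"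
    "v \<in> obj V \<Longrightarrow> g \<in> arr C \<Longrightarrow> src C g = y \<Longrightarrow> \<lfloor>ident V v \<rhd>\<^sub>a\<^bsub>A\<^esub> (g \<otimes>\<^sub>a ident C x)\<rfloor> \<odot> \<lfloor>\<alpha>1 (v, y, x)\<rfloor> = \<lfloor>\<alpha>1 (v, trg C g, x)\<rfloor> \<odot> \<lfloor>(ident V v \<rhd>\<^sub>a\<^bsub>A\<^esub> g) \<otimes>\<^sub>a ident C x\<rfloor>"
    "v \<in> obj V \<Longrightarrow> g \<in> arr C \<Longrightarrow> src C g = y \<Longrightarrow> \<lfloor>ident V v \<rhd>\<^sub>a\<^bsub>A\<^esub> (ident C x \<otimes>\<^sub>a g)\<rfloor> \<odot> \<lfloor>\<alpha>1 (v, x, y)\<rfloor> = \<lfloor>\<alpha>1 (v, x, trg C g)\<rfloor> \<odot> \<lfloor>ident C (v \<rhd>\<^bsub>A\<^esub> x) \<otimes>\<^sub>a g\<rfloor>"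
  using \<alpha>1_nat[of f "ident C x" "ident C y", THEN C.up] \<alpha>1_nat[of "ident V v" g "ident C x", THEN C.up]
    \<alpha>1_nat[of "ident V v" "ident C x" g, THEN C.up] assms by (auto simp: chase)

lemma \<alpha>2_out:
  assumes "x \<in> obj C"
  shows "y \<in> obj C \<Longrightarrow> f \<in> arr V \<Longrightarrow> src V f = v \<Longrightarrow> \<lfloor>f \<rhd>\<^sub>a\<^bsub>A\<^esub> ident C (x \<otimes> y)\<rfloor> \<odot> \<lfloor>\<alpha>2 (v, x, y)\<rfloor> = \<lfloor>\<alpha>2 (trg V f, x, y)\<rfloor> \<odot> \<lfloor>ident C x \<otimes>\<^sub>a (f \<rhd>\<^sub>a\<^bsub>A\<^esub> ident C y)\<rfloor>"
    "v \<in> obj V \<Longrightarrow> g \<in> arr C \<Longrightarrow> src C g = y \<Longrightarrow> \<lfloor>ident V v \<rhd>\<^sub>a\<^bsub>A\<^esub> (g \<otimes>\<^sub>a ident C x)\<rfloor> \<odot> \<lfloor>\<alpha>2 (v, y, x)\<rfloor> = \<lfloor>\<alpha>2 (v, trg C g, x)\<rfloor> \<odot> \<lfloor>g \<otimes>\<^sub>a ident C (v \<rhd>\<^bsub>A\<^esub> x)\<rfloor>"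
    "v \<in> obj V \<Longrightarrow> g \<in> arr C \<Longrightarrow> src C g = y \<Longrightarrow> \<lfloor>ident V v \<rhd>\<^sub>a\<^bsub>A\<^esub> (ident C x \<otimes>\<^sub>a g)\<rfloor> \<odot> \<lfloor>\<alpha>2 (v, x, y)\<rfloor> = \<lfloor>\<alpha>2 (v, x, trg C g)\<rfloor> \<odot> \<lfloor>ident C x \<otimes>\<^sub>a (ident V v \<rhd>\<^sub>a\<^bsub>A\<^esub> g)\<rfloor>"
  using \<alpha>2_nat[of f "ident C x" "ident C y", THEN C.up] \<alpha>2_nat[of "ident V v" g "ident C x", THEN C.up]
    \<alpha>2_nat[of "ident V v" "ident C x" g, THEN C.up] assms by (auto simp: chase)

lemma \<alpha>1_in:
  assumes "x \<in> obj C"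
  shows "y \<in> obj C \<Longrightarrow> f \<in> arr V \<Longrightarrow> trg V f = v \<Longrightarrow> \<lfloor>\<alpha>1 (v, x, y)\<rfloor> \<odot> \<lfloor>(f \<rhd>\<^sub>a\<^bsub>A\<^esub> ident C x) \<otimes>\<^sub>a ident C y\<rfloor> = \<lfloor>f \<rhd>\<^sub>a\<^bsub>A\<^esub> ident C (x \<otimes> y)\<rfloor> \<odot> \<lfloor>\<alpha>1 (src V f, x, y)\<rfloor>"
    "v \<in> obj V \<Longrightarrow> g \<in> arr C \<Longrightarrow> trg C g = y \<Longrightarrow> \<lfloor>\<alpha>1 (v, y, x)\<rfloor> \<odot> \<lfloor>(ident V v \<rhd>\<^sub>a\<^bsub>A\<^esub> g) \<otimes>\<^sub>a ident C x\<rfloor> = \<lfloor>ident V v \<rhd>\<^sub>a\<^bsub>A\<^esub> (g \<otimes>\<^sub>a ident C x)\<rfloor> \<odot> \<lfloor>\<alpha>1 (v, src C g, x)\<rfloor>"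
    "v \<in> obj V \<Longrightarrow> g \<in> arr C \<Longrightarrow> trg C g = y \<Longrightarrow> \<lfloor>\<alpha>1 (v, x, y)\<rfloor> \<odot> \<lfloor>ident C (v \<rhd>\<^bsub>A\<^esub> x) \<otimes>\<^sub>a g\<rfloor> = \<lfloor>ident V v \<rhd>\<^sub>a\<^bsub>A\<^esub> (ident C x \<otimes>\<^sub>a g)\<rfloor> \<odot> \<lfloor>\<alpha>1 (v, x, src C g)\<rfloor>"
  using \<alpha>1_out assms by simp_all

lemma \<alpha>2_in:
  assumes "x \<in> obj C"
  shows "y \<in> obj C \<Longrightarrow> f \<in> arr V \<Longrightarrow> trg V f = v \<Longrightarrow> \<lfloor>\<alpha>2 (v, x, y)\<rfloor> \<odot> \<lfloor>ident C x \<otimes>\<^sub>a (f \<rhd>\<^sub>a\<^bsub>A\<^esub> ident C y)\<rfloor> = \<lfloor>f \<rhd>\<^sub>a\<^bsub>A\<^esub> ident C (x \<otimes> y)\<rfloor> \<odot> \<lfloor>\<alpha>2 (src V f, x, y)\<rfloor>"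
    "v \<in> obj V \<Longrightarrow> g \<in> arr C \<Longrightarrow> trg C g = y \<Longrightarrow> \<lfloor>\<alpha>2 (v, y, x)\<rfloor> \<odot> \<lfloor>g \<otimes>\<^sub>a ident C (v \<rhd>\<^bsub>A\<^esub> x)\<rfloor> = \<lfloor>ident V v \<rhd>\<^sub>a\<^bsub>A\<^esub> (g \<otimes>\<^sub>a ident C x)\<rfloor> \<odot> \<lfloor>\<alpha>2 (v, src C g, x)\<rfloor>"
    "v \<in> obj V \<Longrightarrow> g \<in> arr C \<Longrightarrow> trg C g = y \<Longrightarrow> \<lfloor>\<alpha>2 (v, x, y)\<rfloor> \<odot> \<lfloor>ident C x \<otimes>\<^sub>a (ident V v \<rhd>\<^sub>a\<^bsub>A\<^esub> g)\<rfloor> = \<lfloor>ident V v \<rhd>\<^sub>a\<^bsub>A\<^esub> (ident C x \<otimes>\<^sub>a g)\<rfloor> \<odot> \<lfloor>\<alpha>2 (v, x, src C g)\<rfloor>"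
  using \<alpha>2_out assms by simp_all

lemma \<alpha>1_inv_out:
  assumes "x \<in> obj C"
  shows "y \<in> obj C \<Longrightarrow> f \<in> arr V \<Longrightarrow> src V f = v \<Longrightarrow> \<lfloor>(f \<rhd>\<^sub>a\<^bsub>A\<^esub> ident C x) \<otimes>\<^sub>a ident C y\<rfloor> \<odot> \<lfloor>inv_arr C (\<alpha>1 (v, x, y))\<rfloor> = \<lfloor>inv_arr C (\<alpha>1 (trg V f, x, y))\<rfloor> \<odot> \<lfloor>f \<rhd>\<^sub>a\<^bsub>A\<^esub> ident C (x \<otimes> y)\<rfloor>"
    "v \<in> obj V \<Longrightarrow> g \<in> arr C \<Longrightarrow> src C g = y \<Longrightarrow> \<lfloor>(ident V v \<rhd>\<^sub>a\<^bsub>A\<^esub> g) \<otimes>\<^sub>a ident C x\<rfloor> \<odot> \<lfloor>inv_arr C (\<alpha>1 (v, y, x))\<rfloor> = \<lfloor>inv_arr C (\<alpha>1 (v, trg C g, x))\<rfloor> \<odot> \<lfloor>ident V v \<rhd>\<^sub>a\<^bsub>A\<^esub> (g \<otimes>\<^sub>a ident C x)\<rfloor>"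
  by (rule C.iso_flip; use assms in \<open>auto simp: \<alpha>1_in\<close>)+

lemma \<alpha>2_inv_out:
  assumes "x \<in> obj C"
  shows "y \<in> obj C \<Longrightarrow> f \<in> arr V \<Longrightarrow> src V f = v \<Longrightarrow> \<lfloor>ident C x \<otimes>\<^sub>a (f \<rhd>\<^sub>a\<^bsub>A\<^esub> ident C y)\<rfloor> \<odot> \<lfloor>inv_arr C (\<alpha>2 (v, x, y))\<rfloor> = \<lfloor>inv_arr C (\<alpha>2 (trg V f, x, y))\<rfloor> \<odot> \<lfloor>f \<rhd>\<^sub>a\<^bsub>A\<^esub> ident C (x \<otimes> y)\<rfloor>"
    "v \<in> obj V \<Longrightarrow> g \<in> arr C \<Longrightarrow> src C g = y \<Longrightarrow> \<lfloor>ident C x \<otimes>\<^sub>a (ident V v \<rhd>\<^sub>a\<^bsub>A\<^esub> g)\<rfloor> \<odot> \<lfloor>inv_arr C (\<alpha>2 (v, x, y))\<rfloor> = \<lfloor>inv_arr C (\<alpha>2 (v, x, trg C g))\<rfloor> \<odot> \<lfloor>ident V v \<rhd>\<^sub>a\<^bsub>A\<^esub> (ident C x \<otimes>\<^sub>a g)\<rfloor>"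
  by (rule C.iso_flip; use assms in \<open>auto simp: \<alpha>2_in\<close>)+

lemma \<alpha>1_assoc_l:
  assumes [simp]: "v \<in> obj V" "x \<in> obj C" "y \<in> obj C" "z \<in> obj C"
  shows "\<lfloor>\<alpha>1 (v, x, y \<otimes> z)\<rfloor> \<odot> \<lfloor>assoc C (v \<rhd>\<^bsub>A\<^esub> x, y, z)\<rfloor> =
      \<lfloor>ident V v \<rhd>\<^sub>a\<^bsub>A\<^esub> assoc C (x, y, z)\<rfloor> \<odot> \<lfloor>\<alpha>1 (v, x \<otimes> y, z)\<rfloor> \<odot> \<lfloor>\<alpha>1 (v, x, y) \<otimes>\<^sub>a ident C z\<rfloor>"
  using \<alpha>1_assoc[of v x y z, THEN C.up] by (simp add: chase)

lemma \<alpha>1_massoc_l: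
  assumes [simp]: "v \<in> obj V" "w \<in> obj V" "x \<in> obj C" "y \<in> obj C"
  shows "\<lfloor>massoc A (v, w, x \<otimes> y)\<rfloor> \<odot> \<lfloor>\<alpha>1 (v \<otimes>\<^bsub>V\<^esub> w, x, y)\<rfloor> =
      \<lfloor>ident V v \<rhd>\<^sub>a\<^bsub>A\<^esub> \<alpha>1 (w, x, y)\<rfloor> \<odot> \<lfloor>\<alpha>1 (v, w \<rhd>\<^bsub>A\<^esub> x, y)\<rfloor> \<odot> \<lfloor>massoc A (v, w, x) \<otimes>\<^sub>a ident C y\<rfloor>"
  using \<alpha>1_massoc[of v w x y, THEN C.up] by (simp add: chase)

lemma \<alpha>2_assoc_l:
  assumes [simp]: "v \<in> obj V" "x \<in> obj C" "y \<in> obj C" "z \<in> obj C"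
  shows "\<lfloor>ident V v \<rhd>\<^sub>a\<^bsub>A\<^esub> assoc C (x, y, z)\<rfloor> \<odot> \<lfloor>\<alpha>2 (v, x \<otimes> y, z)\<rfloor> =
      \<lfloor>\<alpha>2 (v, x, y \<otimes> z)\<rfloor> \<odot> \<lfloor>ident C x \<otimes>\<^sub>a \<alpha>2 (v, y, z)\<rfloor> \<odot> \<lfloor>assoc C (x, y, v \<rhd>\<^bsub>A\<^esub> z)\<rfloor>"
  using \<alpha>2_assoc[of v x y z, THEN C.up] by (simp add: chase)

lemma \<alpha>2_massoc_l:
  assumes [simp]: "v \<in> obj V" "w \<in> obj V" "x \<in> obj C" "y \<in> obj C"
  shows "\<lfloor>massoc A (v, w, x \<otimes> y)\<rfloor> \<odot> \<lfloor>\<alpha>2 (v \<otimes>\<^bsub>V\<^esub> w, x, y)\<rfloor> =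
      \<lfloor>ident V v \<rhd>\<^sub>a\<^bsub>A\<^esub> \<alpha>2 (w, x, y)\<rfloor> \<odot> \<lfloor>\<alpha>2 (v, x, w \<rhd>\<^bsub>A\<^esub> y)\<rfloor> \<odot> \<lfloor>ident C x \<otimes>\<^sub>a massoc A (v, w, y)\<rfloor>"
  using \<alpha>2_massoc[of v w x y, THEN C.up] by (simp add: chase)

lemma \<alpha>1_\<alpha>2_assoc_l:
  assumes [simp]: "v \<in> obj V" "x \<in> obj C" "y \<in> obj C" "z \<in> obj C"
  shows "\<lfloor>ident V v \<rhd>\<^sub>a\<^bsub>A\<^esub> assoc C (x, y, z)\<rfloor> \<odot> \<lfloor>\<alpha>1 (v, x \<otimes> y, z)\<rfloor> \<odot> \<lfloor>\<alpha>2 (v, x, y) \<otimes>\<^sub>a ident C z\<rfloor> =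
      \<lfloor>\<alpha>2 (v, x, y \<otimes> z)\<rfloor> \<odot> \<lfloor>ident C x \<otimes>\<^sub>a \<alpha>1 (v, y, z)\<rfloor> \<odot> \<lfloor>assoc C (x, v \<rhd>\<^bsub>A\<^esub> y, z)\<rfloor>"
  using \<alpha>1_\<alpha>2_assoc[of v x y z, THEN C.up] by (simp add: chase)

subsection \<open>Compatibility with units\<close>

text \<open>
  The axioms relate \<open>\<alpha>1\<close> and \<open>\<alpha>2\<close> to associators only,
  not to unit constraints. The four unit laws are consequences, each by Kelly's argument:
  whiskering with the unit gives an instance of an axiom whose other parts are triangles.
\<close>

lemma munit_\<alpha>1:
  assumes [simp]: "x \<in> obj C" "y \<in> obj C"
  shows "munit A (x \<otimes> y) \<cdot> \<alpha>1 (\<I>\<^bsub>V\<^esub>, x, y) = munit A x \<otimes>\<^sub>a ident C y"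
proof -
  let ?I = "\<I>\<^bsub>V\<^esub>" and ?i = "ident V \<I>\<^bsub>V\<^esub>"
  have "(?i \<rhd>\<^sub>a\<^bsub>A\<^esub> (munit A x \<otimes>\<^sub>a ident C y)) \<cdot> (?i \<rhd>\<^sub>a\<^bsub>A\<^esub> inv_arr C (\<alpha>1 (?I, x, y))) = ?i \<rhd>\<^sub>a\<^bsub>A\<^esub> munit A (x \<otimes> y)"
  proof (rule C.kelly)
    have "\<lfloor>massoc A (?I, ?I, x) \<otimes>\<^sub>a ident C y\<rfloor> \<odot> \<lfloor>inv_arr C (\<alpha>1 (?I \<otimes>\<^bsub>V\<^esub> ?I, x, y))\<rfloor> =
       \<lfloor>inv_arr C (\<alpha>1 (?I, ?I \<rhd>\<^bsub>A\<^esub> x, y))\<rfloor> \<odot> \<lfloor>inv_arr C (?i \<rhd>\<^sub>a\<^bsub>A\<^esub> \<alpha>1 (?I, x, y))\<rfloor> \<odot> \<lfloor>massoc A (?I, ?I, x \<otimes> y)\<rfloor>"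
      (is "?E \<odot> ?B = ?D \<odot> ?F \<odot> ?A")
      using arg_cong[OF \<alpha>1_massoc_l[of ?I ?I x y], of "\<lambda>t. ?D \<odot> ?F \<odot> t \<odot> ?B"] by (simp add: chase)
    then show "?E \<odot> ?B = ?D \<odot> \<lfloor>?i \<rhd>\<^sub>a\<^bsub>A\<^esub> inv_arr C (\<alpha>1 (?I, x, y))\<rfloor> \<odot> ?A" by simp
    show "\<lfloor>(?i \<rhd>\<^sub>a\<^bsub>A\<^esub> munit A x) \<otimes>\<^sub>a ident C y\<rfloor> \<odot> ?D =
        \<lfloor>inv_arr C (\<alpha>1 (?I, x, y))\<rfloor> \<odot> \<lfloor>?i \<rhd>\<^sub>a\<^bsub>A\<^esub> (munit A x \<otimes>\<^sub>a ident C y)\<rfloor>"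
      by (simp add: \<alpha>1_inv_out)
    show "\<lfloor>(?i \<rhd>\<^sub>a\<^bsub>A\<^esub> munit A x) \<otimes>\<^sub>a ident C y\<rfloor> \<odot> ?E = \<lfloor>(runit V ?I \<rhd>\<^sub>a\<^bsub>A\<^esub> ident C x) \<otimes>\<^sub>a ident C y\<rfloor>"
      using arg_cong[OF mod_triangle[of ?I x], of "\<lambda>t. \<lfloor>t \<otimes>\<^sub>a ident C y\<rfloor>"] by (simp add: chase)
    show "\<lfloor>(runit V ?I \<rhd>\<^sub>a\<^bsub>A\<^esub> ident C x) \<otimes>\<^sub>a ident C y\<rfloor> \<odot> ?B =
        \<lfloor>inv_arr C (\<alpha>1 (?I, x, y))\<rfloor> \<odot> \<lfloor>runit V ?I \<rhd>\<^sub>a\<^bsub>A\<^esub> ident C (x \<otimes> y)\<rfloor>"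
      by (simp add: \<alpha>1_inv_out)
    show "\<lfloor>?i \<rhd>\<^sub>a\<^bsub>A\<^esub> munit A (x \<otimes> y)\<rfloor> \<odot> ?A = \<lfloor>runit V ?I \<rhd>\<^sub>a\<^bsub>A\<^esub> ident C (x \<otimes> y)\<rfloor>"
      by (simp add: mod_triangle_l)
  qed simp_all
  then have "?i \<rhd>\<^sub>a\<^bsub>A\<^esub> ((munit A x \<otimes>\<^sub>a ident C y) \<cdot> inv_arr C (\<alpha>1 (?I, x, y))) = ?i \<rhd>\<^sub>a\<^bsub>A\<^esub> munit A (x \<otimes> y)"
    by (simp add: chase)
  then have *: "(munit A x \<otimes>\<^sub>a ident C y) \<cdot> inv_arr C (\<alpha>1 (?I, x, y)) = munit A (x \<otimes> y)"
    by (rule munit_faithful) simp_all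
  show ?thesis
    by (simp add: C.assoc_arr flip: *)
qed

lemma munit_\<alpha>2:
  assumes [simp]: "x \<in> obj C" "y \<in> obj C"
  shows "munit A (x \<otimes> y) \<cdot> \<alpha>2 (\<I>\<^bsub>V\<^esub>, x, y) = ident C x \<otimes>\<^sub>a munit A y"
proof -
  let ?I = "\<I>\<^bsub>V\<^esub>" and ?i = "ident V \<I>\<^bsub>V\<^esub>"
  have "(?i \<rhd>\<^sub>a\<^bsub>A\<^esub> (ident C x \<otimes>\<^sub>a munit A y)) \<cdot> (?i \<rhd>\<^sub>a\<^bsub>A\<^esub> inv_arr C (\<alpha>2 (?I, x, y))) = ?i \<rhd>\<^sub>a\<^bsub>A\<^esub> munit A (x \<otimes> y)"
  proof (rule C.kelly)
    have "\<lfloor>ident C x \<otimes>\<^sub>a massoc A (?I, ?I, y)\<rfloor> \<odot> \<lfloor>inv_arr C (\<alpha>2 (?I \<otimes>\<^bsub>V\<^esub> ?I, x, y))\<rfloor> =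
       \<lfloor>inv_arr C (\<alpha>2 (?I, x, ?I \<rhd>\<^bsub>A\<^esub> y))\<rfloor> \<odot> \<lfloor>inv_arr C (?i \<rhd>\<^sub>a\<^bsub>A\<^esub> \<alpha>2 (?I, x, y))\<rfloor> \<odot> \<lfloor>massoc A (?I, ?I, x \<otimes> y)\<rfloor>"
      (is "?E \<odot> ?B = ?D \<odot> ?F \<odot> ?A")
      using arg_cong[OF \<alpha>2_massoc_l[of ?I ?I x y], of "\<lambda>t. ?D \<odot> ?F \<odot> t \<odot> ?B"] by (simp add: chase)
    then show "?E \<odot> ?B = ?D \<odot> \<lfloor>?i \<rhd>\<^sub>a\<^bsub>A\<^esub> inv_arr C (\<alpha>2 (?I, x, y))\<rfloor> \<odot> ?A" by simp
    show "\<lfloor>ident C x \<otimes>\<^sub>a (?i \<rhd>\<^sub>a\<^bsub>A\<^esub> munit A y)\<rfloor> \<odot> ?D =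
        \<lfloor>inv_arr C (\<alpha>2 (?I, x, y))\<rfloor> \<odot> \<lfloor>?i \<rhd>\<^sub>a\<^bsub>A\<^esub> (ident C x \<otimes>\<^sub>a munit A y)\<rfloor>"
      by (simp add: \<alpha>2_inv_out)
    show "\<lfloor>ident C x \<otimes>\<^sub>a (?i \<rhd>\<^sub>a\<^bsub>A\<^esub> munit A y)\<rfloor> \<odot> ?E = \<lfloor>ident C x \<otimes>\<^sub>a (runit V ?I \<rhd>\<^sub>a\<^bsub>A\<^esub> ident C y)\<rfloor>"
      using arg_cong[OF mod_triangle[of ?I y], of "\<lambda>t. \<lfloor>ident C x \<otimes>\<^sub>a t\<rfloor>"] by (simp add: chase)
    show "\<lfloor>ident C x \<otimes>\<^sub>a (runit V ?I \<rhd>\<^sub>a\<^bsub>A\<^esub> ident C y)\<rfloor> \<odot> ?B =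
        \<lfloor>inv_arr C (\<alpha>2 (?I, x, y))\<rfloor> \<odot> \<lfloor>runit V ?I \<rhd>\<^sub>a\<^bsub>A\<^esub> ident C (x \<otimes> y)\<rfloor>"
      by (simp add: \<alpha>2_inv_out)
    show "\<lfloor>?i \<rhd>\<^sub>a\<^bsub>A\<^esub> munit A (x \<otimes> y)\<rfloor> \<odot> ?A = \<lfloor>runit V ?I \<rhd>\<^sub>a\<^bsub>A\<^esub> ident C (x \<otimes> y)\<rfloor>"
      by (simp add: mod_triangle_l)
  qed simp_all
  then have "?i \<rhd>\<^sub>a\<^bsub>A\<^esub> ((ident C x \<otimes>\<^sub>a munit A y) \<cdot> inv_arr C (\<alpha>2 (?I, x, y))) = ?i \<rhd>\<^sub>a\<^bsub>A\<^esub> munit A (x \<otimes> y)"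
    by (simp add: chase)
  then have *: "(ident C x \<otimes>\<^sub>a munit A y) \<cdot> inv_arr C (\<alpha>2 (?I, x, y)) = munit A (x \<otimes> y)"
    by (rule munit_faithful) simp_all
  show ?thesis
    by (simp add: C.assoc_arr flip: *)
qed

lemma \<alpha>1_runit:
  assumes [simp]: "v \<in> obj V" "x \<in> obj C"
  shows "(ident V v \<rhd>\<^sub>a\<^bsub>A\<^esub> runit C x) \<cdot> \<alpha>1 (v, x, \<I>) = runit C (v \<rhd>\<^bsub>A\<^esub> x)"
proof -
  have "((ident V v \<rhd>\<^sub>a\<^bsub>A\<^esub> runit C x) \<otimes>\<^sub>a ident C \<I>) \<cdot> (\<alpha>1 (v, x, \<I>) \<otimes>\<^sub>a ident C \<I>) = runit C (v \<rhd>\<^bsub>A\<^esub> x) \<otimes>\<^sub>a ident C \<I>"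
  proof (rule C.kelly)
    show "\<lfloor>inv_arr C (ident V v \<rhd>\<^sub>a\<^bsub>A\<^esub> assoc C (x, \<I>, \<I>))\<rfloor> \<odot> \<lfloor>\<alpha>1 (v, x, \<I> \<otimes> \<I>)\<rfloor> =
        \<lfloor>\<alpha>1 (v, x \<otimes> \<I>, \<I>)\<rfloor> \<odot> \<lfloor>\<alpha>1 (v, x, \<I>) \<otimes>\<^sub>a ident C \<I>\<rfloor> \<odot> \<lfloor>inv_arr C (assoc C (v \<rhd>\<^bsub>A\<^esub> x, \<I>, \<I>))\<rfloor>"
      (is "?FM \<odot> ?s2 = ?s1 \<odot> ?Es \<odot> ?m")
      using arg_cong[OF \<alpha>1_assoc_l[of v x \<I> \<I>], of "\<lambda>t. ?FM \<odot> t \<odot> ?m"] by (simp add: chase)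
    show "\<lfloor>ident V v \<rhd>\<^sub>a\<^bsub>A\<^esub> (runit C x \<otimes>\<^sub>a ident C \<I>)\<rfloor> \<odot> ?s1 =
        \<lfloor>\<alpha>1 (v, x, \<I>)\<rfloor> \<odot> \<lfloor>(ident V v \<rhd>\<^sub>a\<^bsub>A\<^esub> runit C x) \<otimes>\<^sub>a ident C \<I>\<rfloor>"
      by (simp add: \<alpha>1_out)
    show "\<lfloor>ident V v \<rhd>\<^sub>a\<^bsub>A\<^esub> (runit C x \<otimes>\<^sub>a ident C \<I>)\<rfloor> \<odot> ?FM = \<lfloor>ident V v \<rhd>\<^sub>a\<^bsub>A\<^esub> (ident C x \<otimes>\<^sub>a lunit C \<I>)\<rfloor>"
      using arg_cong[OF C.triangle[of x \<I>], of "\<lambda>t. \<lfloor>ident V v \<rhd>\<^sub>a\<^bsub>A\<^esub> t\<rfloor>", symmetric] by (simp add: chase)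
    show "\<lfloor>ident V v \<rhd>\<^sub>a\<^bsub>A\<^esub> (ident C x \<otimes>\<^sub>a lunit C \<I>)\<rfloor> \<odot> ?s2 =
        \<lfloor>\<alpha>1 (v, x, \<I>)\<rfloor> \<odot> \<lfloor>ident C (v \<rhd>\<^bsub>A\<^esub> x) \<otimes>\<^sub>a lunit C \<I>\<rfloor>"
      by (simp add: \<alpha>1_out)
    show "\<lfloor>runit C (v \<rhd>\<^bsub>A\<^esub> x) \<otimes>\<^sub>a ident C \<I>\<rfloor> \<odot> ?m = \<lfloor>ident C (v \<rhd>\<^bsub>A\<^esub> x) \<otimes>\<^sub>a lunit C \<I>\<rfloor>"
      by (simp add: C.triangle_inv)
  qed simp_all
  then have "((ident V v \<rhd>\<^sub>a\<^bsub>A\<^esub> runit C x) \<cdot> \<alpha>1 (v, x, \<I>)) \<otimes>\<^sub>a ident C \<I> = runit C (v \<rhd>\<^bsub>A\<^esub> x) \<otimes>\<^sub>a ident C \<I>"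
    by (simp add: chase)
  then show ?thesis
    by (rule C.runit_faithful) simp_all
qed

lemma \<alpha>2_lunit:
  assumes [simp]: "v \<in> obj V" "y \<in> obj C"
  shows "(ident V v \<rhd>\<^sub>a\<^bsub>A\<^esub> lunit C y) \<cdot> \<alpha>2 (v, \<I>, y) = lunit C (v \<rhd>\<^bsub>A\<^esub> y)"
proof -
  have "(ident C \<I> \<otimes>\<^sub>a (ident V v \<rhd>\<^sub>a\<^bsub>A\<^esub> lunit C y)) \<cdot> (ident C \<I> \<otimes>\<^sub>a \<alpha>2 (v, \<I>, y)) = ident C \<I> \<otimes>\<^sub>a lunit C (v \<rhd>\<^bsub>A\<^esub> y)"
  proof (rule C.kelly)
    show "\<lfloor>ident V v \<rhd>\<^sub>a\<^bsub>A\<^esub> assoc C (\<I>, \<I>, y)\<rfloor> \<odot> \<lfloor>\<alpha>2 (v, \<I> \<otimes> \<I>, y)\<rfloor> =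
        \<lfloor>\<alpha>2 (v, \<I>, \<I> \<otimes> y)\<rfloor> \<odot> \<lfloor>ident C \<I> \<otimes>\<^sub>a \<alpha>2 (v, \<I>, y)\<rfloor> \<odot> \<lfloor>assoc C (\<I>, \<I>, v \<rhd>\<^bsub>A\<^esub> y)\<rfloor>"
      (is "?FM \<odot> ?s2 = ?s1 \<odot> ?Es \<odot> ?m")
      by (simp add: \<alpha>2_assoc_l)
    show "\<lfloor>ident V v \<rhd>\<^sub>a\<^bsub>A\<^esub> (ident C \<I> \<otimes>\<^sub>a lunit C y)\<rfloor> \<odot> ?s1 =
        \<lfloor>\<alpha>2 (v, \<I>, y)\<rfloor> \<odot> \<lfloor>ident C \<I> \<otimes>\<^sub>a (ident V v \<rhd>\<^sub>a\<^bsub>A\<^esub> lunit C y)\<rfloor>"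
      by (simp add: \<alpha>2_out)
    show "\<lfloor>ident V v \<rhd>\<^sub>a\<^bsub>A\<^esub> (ident C \<I> \<otimes>\<^sub>a lunit C y)\<rfloor> \<odot> ?FM = \<lfloor>ident V v \<rhd>\<^sub>a\<^bsub>A\<^esub> (runit C \<I> \<otimes>\<^sub>a ident C y)\<rfloor>"
      using arg_cong[OF C.triangle[of \<I> y], of "\<lambda>t. \<lfloor>ident V v \<rhd>\<^sub>a\<^bsub>A\<^esub> t\<rfloor>"] by (simp add: chase)
    show "\<lfloor>ident V v \<rhd>\<^sub>a\<^bsub>A\<^esub> (runit C \<I> \<otimes>\<^sub>a ident C y)\<rfloor> \<odot> ?s2 =
        \<lfloor>\<alpha>2 (v, \<I>, y)\<rfloor> \<odot> \<lfloor>runit C \<I> \<otimes>\<^sub>a ident C (v \<rhd>\<^bsub>A\<^esub> y)\<rfloor>"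
      by (simp add: \<alpha>2_out)
    show "\<lfloor>ident C \<I> \<otimes>\<^sub>a lunit C (v \<rhd>\<^bsub>A\<^esub> y)\<rfloor> \<odot> ?m = \<lfloor>runit C \<I> \<otimes>\<^sub>a ident C (v \<rhd>\<^bsub>A\<^esub> y)\<rfloor>"
      by (simp add: C.triangle_l)
  qed simp_all
  then have "ident C \<I> \<otimes>\<^sub>a ((ident V v \<rhd>\<^sub>a\<^bsub>A\<^esub> lunit C y) \<cdot> \<alpha>2 (v, \<I>, y)) = ident C \<I> \<otimes>\<^sub>a lunit C (v \<rhd>\<^bsub>A\<^esub> y)"
    by (simp add: chase)
  then show ?thesis
    by (rule C.lunit_faithful) simp_all
qed

end

section \<open>Central functors\<close>

declare (in cat_functor) map_cmp [chase]

context monoidal_functor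
begin

lemma phi2_typ [simp]:
  assumes "x \<in> obj C" "y \<in> obj C"
  shows "phi2 F (x, y) \<in> arr D" "src D (phi2 F (x, y)) = omap F x \<otimes>\<^bsub>D\<^esub> omap F y"
    "trg D (phi2 F (x, y)) = omap F (x \<otimes>\<^bsub>C\<^esub> y)" "iso_arr D (phi2 F (x, y))"
  using nat_isoD(2-5)[OF phi2_iso, of "(x, y)"] assms by auto

lemma phi0_typ [simp]:
  "phi0 F \<in> arr D" "src D (phi0 F) = \<I>\<^bsub>D\<^esub>" "trg D (phi0 F) = omap F \<I>\<^bsub>C\<^esub>" "iso_arr D (phi0 F)"
  using phi0_hom phi0_iso by (auto simp: hom_def)

lemma phi2_nat:
  assumes "f \<in> arr C" "g \<in> arr C"
  shows "amap F (f \<otimes>\<^sub>a\<^bsub>C\<^esub> g) \<cdot>\<^bsub>D\<^esub> phi2 F (src C f, src C g) = phi2 F (trg C f, trg C g) \<cdot>\<^bsub>D\<^esub> (amap F f \<otimes>\<^sub>a\<^bsub>D\<^esub> amap F g)"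
  using nat_isoD(6)[OF phi2_iso, of "(f, g)"] assms by simp

lemma phi2_out:
  assumes "y \<in> obj C" "f \<in> arr C"
  shows "src C f = x \<Longrightarrow> \<lfloor>amap F (f \<otimes>\<^sub>a\<^bsub>C\<^esub> ident C y)\<rfloor>\<^bsub>D\<^esub> \<odot>\<^bsub>D\<^esub> \<lfloor>phi2 F (x, y)\<rfloor>\<^bsub>D\<^esub> =
      \<lfloor>phi2 F (trg C f, y)\<rfloor>\<^bsub>D\<^esub> \<odot>\<^bsub>D\<^esub> \<lfloor>amap F f \<otimes>\<^sub>a\<^bsub>D\<^esub> ident D (omap F y)\<rfloor>\<^bsub>D\<^esub>"
    "src C f = x \<Longrightarrow> \<lfloor>amap F (ident C y \<otimes>\<^sub>a\<^bsub>C\<^esub> f)\<rfloor>\<^bsub>D\<^esub> \<odot>\<^bsub>D\<^esub> \<lfloor>phi2 F (y, x)\<rfloor>\<^bsub>D\<^esub> =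
      \<lfloor>phi2 F (y, trg C f)\<rfloor>\<^bsub>D\<^esub> \<odot>\<^bsub>D\<^esub> \<lfloor>ident D (omap F y) \<otimes>\<^sub>a\<^bsub>D\<^esub> amap F f\<rfloor>\<^bsub>D\<^esub>"
  using phi2_nat[of f "ident C y", THEN D.up] phi2_nat[of "ident C y" f, THEN D.up] assms by (auto simp: chase)

lemma phi2_in:
  assumes "y \<in> obj C" "f \<in> arr C"
  shows "trg C f = x \<Longrightarrow> \<lfloor>phi2 F (x, y)\<rfloor>\<^bsub>D\<^esub> \<odot>\<^bsub>D\<^esub> \<lfloor>amap F f \<otimes>\<^sub>a\<^bsub>D\<^esub> ident D (omap F y)\<rfloor>\<^bsub>D\<^esub> =
      \<lfloor>amap F (f \<otimes>\<^sub>a\<^bsub>C\<^esub> ident C y)\<rfloor>\<^bsub>D\<^esub> \<odot>\<^bsub>D\<^esub> \<lfloor>phi2 F (src C f, y)\<rfloor>\<^bsub>D\<^esub>"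
    "trg C f = x \<Longrightarrow> \<lfloor>phi2 F (y, x)\<rfloor>\<^bsub>D\<^esub> \<odot>\<^bsub>D\<^esub> \<lfloor>ident D (omap F y) \<otimes>\<^sub>a\<^bsub>D\<^esub> amap F f\<rfloor>\<^bsub>D\<^esub> =
      \<lfloor>amap F (ident C y \<otimes>\<^sub>a\<^bsub>C\<^esub> f)\<rfloor>\<^bsub>D\<^esub> \<odot>\<^bsub>D\<^esub> \<lfloor>phi2 F (y, src C f)\<rfloor>\<^bsub>D\<^esub>"
  using phi2_out assms by simp_all

lemma phi2_assoc_l:
  assumes [simp]: "u \<in> obj C" "v \<in> obj C" "w \<in> obj C"
  shows "\<lfloor>amap F (assoc C (u, v, w))\<rfloor>\<^bsub>D\<^esub> \<odot>\<^bsub>D\<^esub> \<lfloor>phi2 F (u \<otimes>\<^bsub>C\<^esub> v, w)\<rfloor>\<^bsub>D\<^esub>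
        \<odot>\<^bsub>D\<^esub> \<lfloor>phi2 F (u, v) \<otimes>\<^sub>a\<^bsub>D\<^esub> ident D (omap F w)\<rfloor>\<^bsub>D\<^esub> =
      \<lfloor>phi2 F (u, v \<otimes>\<^bsub>C\<^esub> w)\<rfloor>\<^bsub>D\<^esub> \<odot>\<^bsub>D\<^esub> \<lfloor>ident D (omap F u) \<otimes>\<^sub>a\<^bsub>D\<^esub> phi2 F (v, w)\<rfloor>\<^bsub>D\<^esub>
        \<odot>\<^bsub>D\<^esub> \<lfloor>assoc D (omap F u, omap F v, omap F w)\<rfloor>\<^bsub>D\<^esub>"
  using phi2_assoc[of u v w, THEN D.up] by (simp add: chase)

lemma phi0_left_l:
  assumes [simp]: "v \<in> obj C"
  shows "\<lfloor>amap F (lunit C v)\<rfloor>\<^bsub>D\<^esub> \<odot>\<^bsub>D\<^esub> \<lfloor>phi2 F (\<I>\<^bsub>C\<^esub>, v)\<rfloor>\<^bsub>D\<^esub> \<odot>\<^bsub>D\<^esub> \<lfloor>phi0 F \<otimes>\<^sub>a\<^bsub>D\<^esub> ident D (omap F v)\<rfloor>\<^bsub>D\<^esub> =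
      \<lfloor>lunit D (omap F v)\<rfloor>\<^bsub>D\<^esub>"
  using phi0_left[of v, THEN D.up] by (simp add: chase)

lemma phi0_right_l:
  assumes [simp]: "v \<in> obj C"
  shows "\<lfloor>amap F (runit C v)\<rfloor>\<^bsub>D\<^esub> \<odot>\<^bsub>D\<^esub> \<lfloor>phi2 F (v, \<I>\<^bsub>C\<^esub>)\<rfloor>\<^bsub>D\<^esub> \<odot>\<^bsub>D\<^esub> \<lfloor>ident D (omap F v) \<otimes>\<^sub>a\<^bsub>D\<^esub> phi0 F\<rfloor>\<^bsub>D\<^esub> =
      \<lfloor>runit D (omap F v)\<rfloor>\<^bsub>D\<^esub>"
  using phi0_right[of v, THEN D.up] by (simp add: chase)

end

lemma mon_functor_eqI:
  fixes F G :: "('o, 'a, 'p, 'b) mon_functor"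
  shows "omap F = omap G \<Longrightarrow> amap F = amap G \<Longrightarrow> phi2 F = phi2 G \<Longrightarrow> phi0 F = phi0 G \<Longrightarrow> F = G"
  by simp

lemma comp_mon_functor_sel:
  "omap (comp_mon_functor C E G F) = (\<lambda>x \<in> obj C. omap G (omap F x))"
  "amap (comp_mon_functor C E G F) = (\<lambda>f \<in> arr C. amap G (amap F f))"
  "phi2 (comp_mon_functor C E G F) = (\<lambda>(x, y) \<in> obj C \<times> obj C. amap G (phi2 F (x, y)) \<cdot>\<^bsub>E\<^esub> phi2 G (omap F x, omap F y))"
  "phi0 (comp_mon_functor C E G F) = amap G (phi0 F) \<cdot>\<^bsub>E\<^esub> phi0 G"
  by (simp_all add: comp_mon_functor_def)

definition central_lift ::
  "('v, 'w, 'x) mon_cat_scheme \<Rightarrow> ('o, 'a, 'y) mon_cat_scheme \<Rightarrow> ('v, 'w, 'o, 'a) mon_functor \<Rightarrow> ('v \<Rightarrow> 'o \<Rightarrow> 'a) \<Rightarrow>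
   ('v, 'w, ('o, 'a) center_obj, ('o, 'a) center_arr) mon_functor" where
  "central_lift V C F B =
    (let c = (\<lambda>v. (omap F v, B v)) in
    \<lparr>omap = (\<lambda>v \<in> obj V. c v),
     amap = (\<lambda>f \<in> arr V. (c (src V f), amap F f, c (trg V f))),
     phi2 = (\<lambda>(v, w) \<in> obj V \<times> obj V. (center_tens_obj C (c v) (c w), phi2 F (v, w), c (v \<otimes>\<^bsub>V\<^esub> w))),
     phi0 = (center_unit C, phi0 F, c \<I>\<^bsub>V\<^esub>)\<rparr>)"

text \<open>
  A braided functor into the center whose underlying functor is \<open>F\<close> amounts to a
  half-braiding on each \<open>F v\<close>, subject to conditions on arrows of \<open>C\<close>
  alone. This locale states them, which keeps the tagged arrows of the center out of the later
  arguments.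
\<close>

locale central_functor = V: braided_category V + monoidal_functor V C F
  for V :: "('v, 'w) braided_cat" and C :: "('o, 'a) mon_cat" (structure) and F :: "('v, 'w, 'o, 'a) mon_functor" +
  fixes B :: "'v \<Rightarrow> 'o \<Rightarrow> 'a"
  assumes B_half: "v \<in> obj V \<Longrightarrow> half_braiding C (omap F v) (B v)"
    and B_nat: "f \<in> arr V \<Longrightarrow> amap F f \<in> center_hom C (omap F (src V f), B (src V f)) (omap F (trg V f), B (trg V f))"
    and B_tens: "v \<in> obj V \<Longrightarrow> w \<in> obj V \<Longrightarrow>
      phi2 F (v, w) \<in> center_hom C (center_tens_obj C (omap F v, B v) (omap F w, B w)) (omap F (v \<otimes>\<^bsub>V\<^esub> w), B (v \<otimes>\<^bsub>V\<^esub> w))"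
    and B_unit: "phi0 F \<in> center_hom C (center_unit C) (omap F \<I>\<^bsub>V\<^esub>, B \<I>\<^bsub>V\<^esub>)"
    and B_braid: "v \<in> obj V \<Longrightarrow> w \<in> obj V \<Longrightarrow>
      phi2 F (w, v) \<cdot> B v (omap F w) = amap F (braid V (v, w)) \<cdot> phi2 F (v, w)"
begin

abbreviation "c v \<equiv> (omap F v, B v)"
abbreviation "L \<equiv> central_lift V C F B"

lemma c_in [simp]: "v \<in> obj V \<Longrightarrow> c v \<in> obj (center C)"
  using B_half by (simp add: D.center_simps(1))

lemma lift_simps [simp]:
  "v \<in> obj V \<Longrightarrow> omap L v = c v"
  "f \<in> arr V \<Longrightarrow> amap L f = (c (src V f), amap F f, c (trg V f))"
  "v \<in> obj V \<Longrightarrow> w \<in> obj V \<Longrightarrow> phi2 L (v, w) = (center_tens_obj C (c v) (c w), phi2 F (v, w), c (v \<otimes>\<^bsub>V\<^esub> w))"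
  "phi0 L = (center_unit C, phi0 F, c \<I>\<^bsub>V\<^esub>)"
  by (simp_all add: central_lift_def Let_def)

lemma lift_ext:
  "omap L \<in> extensional (obj V)" "amap L \<in> extensional (arr V)" "phi2 L \<in> extensional (obj V \<times> obj V)"
  by (simp_all add: central_lift_def Let_def)

lemmas [simp] = B_nat B_tens B_unit

text \<open>
  The structure maps of the lift have those of \<open>F\<close> as underlying arrows; each law
  is the corresponding law of \<open>F\<close>.
\<close>

lemma central_lift_braided: "braided_functor V (center C) L"
proof -
  interpret Z: braided_category "center C" by (rule D.center_braided)
  interpret L: cat_functor V "center C" L
  proof (unfold_locales, goal_cases)
    case 1
    show ?case using lift_ext(1) by (auto simp: PiE_def simp del: split_paired_All)
  next
    case 2
    show ?case by (rule lift_ext)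
  next
    case (3 f x y)
    then show ?case by (auto simp: hom_def simp del: split_paired_All)
  next
    case (4 x)
    then show ?case by simp
  next
    case (5 f x y g z)
    then show ?case using B_nat[of f] B_nat[of g] D.center_hom_cmp[of "c x" "c y" "c z" "amap F f" "amap F g"]
      by (auto simp: hom_def map_cmp)
  qed
  have lw: "ident C (omap F u) \<otimes>\<^sub>a f \<in> center_hom C (center_tens_obj C (c u) X) (center_tens_obj C (c u) Y)"
    and rw: "f \<otimes>\<^sub>a ident C (omap F u) \<in> center_hom C (center_tens_obj C X (c u)) (center_tens_obj C Y (c u))"
    if "u \<in> obj V" "X \<in> obj (center C)" "Y \<in> obj (center C)" "f \<in> center_hom C X Y" for X Y u f
    using that D.center_hom_lw[of f X Y "c u"] by auto
  have as: "assoc C (omap F u, omap F v, omap F w) \<in>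
      center_hom C (center_tens_obj C (center_tens_obj C (c u) (c v)) (c w)) (center_tens_obj C (c u) (center_tens_obj C (c v) (c w)))"
    if "u \<in> obj V" "v \<in> obj V" "w \<in> obj V" for u v w
    using that D.center_hom_assoc[of "c u" "c v" "c w"] by simp
  have nat: "amap F f \<in> center_hom C (c x) (c y)" if "f \<in> arr V" "src V f = x" "trg V f = y" for f x y
    using that B_nat[of f] by auto
  have [simp]: "ident C (omap F u) \<in> center_hom C (c u) (c u)" if "u \<in> obj V" for u
    using that D.center_hom_ident[of "c u"] by simp
  note comps = D.center_hom_cmp[OF _ _ _ B_tens nat] D.center_hom_cmp[OF _ _ _ _ B_tens]
  show ?thesis
  proof (unfold_locales, goal_cases)
    case 1
    show ?case
    proof (rule nat_isoI2, goal_cases)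
      case 1
      show ?case by (rule lift_ext)
    next
      case (2 x y)
      then show ?case by (simp add: hom_def D.center_iso)
    next
      case (3 f g)
      then show ?case using phi2_nat[of f g] nat[of "f \<otimes>\<^sub>a\<^bsub>V\<^esub> g"] by simp
    qed
  next
    case 2
    show ?case by (simp add: hom_def)
  next
    case 3
    show ?case by (simp add: D.center_iso)
  next
    case (4 u v w)
    then show ?case using phi2_assoc[of u v w]
      by (simp add: lw rw as nat comps D.center_hom_cmp[where Y="center_tens_obj C (c (u \<otimes>\<^bsub>V\<^esub> v)) (c w)"]
        D.center_hom_cmp[where Y="center_tens_obj C (c u) (center_tens_obj C (c v) (c w))"])
  next
    case (5 v)
    have l: "lunit C (omap F v) \<in> center_hom C (center_tens_obj C (center_unit C) (c v)) (c v)"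
      using 5 D.center_hom_lunit[of "c v"] by simp
    from 5 show ?case using phi0_left[of v]
      by (simp add: lw rw l nat comps D.center_hom_cmp[where Y="center_tens_obj C (c \<I>\<^bsub>V\<^esub>) (c v)"])
  next
    case (6 v)
    have l: "runit C (omap F v) \<in> center_hom C (center_tens_obj C (c v) (center_unit C)) (c v)"
      using 6 D.center_hom_runit[of "c v"] by simp
    from 6 show ?case using phi0_right[of v]
      by (simp add: lw rw l nat comps D.center_hom_cmp[where Y="center_tens_obj C (c v) (c \<I>\<^bsub>V\<^esub>)"])
  next
    case (7 v w)
    have l: "B v (omap F w) \<in> center_hom C (center_tens_obj C (c v) (c w)) (center_tens_obj C (c w) (c v))"
      using 7 D.center_hom_braid[of "c v" "c w"] by simp
    from 7 show ?case using B_braid[of v w] nat_isoD(2-4)[OF V.braid_iso, of "(v, w)"]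
      by (simp add: l nat)
  qed
qed

lemma forget_central_lift: "F = comp_mon_functor V C (forget C) L"
proof -
  have o: "omap F \<in> extensional (obj V)" and a: "amap F \<in> extensional (arr V)" and p: "phi2 F \<in> extensional (obj V \<times> obj V)"
    using omap_obj amap_ext nat_isoD(1)[OF phi2_iso] by (auto simp: PiE_def)
  have "omap F = (\<lambda>v \<in> obj V. omap (forget C) (omap L v))"
    by (rule extensionalityI[OF o]) (auto simp: forget_def)
  moreover have "amap F = (\<lambda>f \<in> arr V. amap (forget C) (amap L f))"
    by (rule extensionalityI[OF a]) (auto simp: forget_def)
  moreover have "phi2 F = (\<lambda>(v, w) \<in> obj V \<times> obj V. amap (forget C) (phi2 L (v, w)) \<cdot> phi2 (forget C) (omap L v, omap L w))"
    by (rule extensionalityI[OF p]) (auto simp: forget_def)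
  moreover have "phi0 F = amap (forget C) (phi0 L) \<cdot> phi0 (forget C)"
    by (simp add: forget_def)
  ultimately show ?thesis
    by (intro mon_functor_eqI) (simp_all only: comp_mon_functor_sel)
qed

lemma pair_over_central: "pair_over V \<lparr>pcat = C, pfun = F, pcen = L\<rparr>"
  unfolding pair_over_def pair_over_axioms_def
  using central_lift_braided forget_central_lift V.braided_category_axioms D.monoidal_category_axioms monoidal_functor_axioms
  by simp

end

section \<open>The pair of a module monoidal category\<close>

context module_monoidal_category
begin

text \<open>
  The action of \<open>v\<close> is tensoring with the free object \<open>v \<rhd> \<I>\<close>,
  from the left as well as from the right; these are the isomorphisms that identify the three.
\<close>

definition act_left :: "'v \<Rightarrow> 'o \<Rightarrow> 'a" where
  "act_left v x = (ident V v \<rhd>\<^sub>a\<^bsub>A\<^esub> lunit C x) \<cdot> \<alpha>1 (v, \<I>, x)"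

definition act_right :: "'v \<Rightarrow> 'o \<Rightarrow> 'a" where
  "act_right v x = (ident V v \<rhd>\<^sub>a\<^bsub>A\<^esub> runit C x) \<cdot> \<alpha>2 (v, x, \<I>)"

lemma act_left_typ [simp]:
  assumes "v \<in> obj V" "x \<in> obj C"
  shows "act_left v x \<in> arr C" "src C (act_left v x) = (v \<rhd>\<^bsub>A\<^esub> \<I>) \<otimes> x" "trg C (act_left v x) = v \<rhd>\<^bsub>A\<^esub> x"
    "iso_arr C (act_left v x)"
  using assms by (simp_all add: act_left_def)

lemma act_right_typ [simp]:
  assumes "v \<in> obj V" "x \<in> obj C"
  shows "act_right v x \<in> arr C" "src C (act_right v x) = x \<otimes> (v \<rhd>\<^bsub>A\<^esub> \<I>)" "trg C (act_right v x) = v \<rhd>\<^bsub>A\<^esub> x"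
    "iso_arr C (act_right v x)"
  using assms by (simp_all add: act_right_def)

lemma act_left_out:
  "x \<in> obj C \<Longrightarrow> f \<in> arr V \<Longrightarrow> src V f = v \<Longrightarrow> \<lfloor>f \<rhd>\<^sub>a\<^bsub>A\<^esub> ident C x\<rfloor> \<odot> \<lfloor>act_left v x\<rfloor> =
    \<lfloor>act_left (trg V f) x\<rfloor> \<odot> \<lfloor>(f \<rhd>\<^sub>a\<^bsub>A\<^esub> ident C \<I>) \<otimes>\<^sub>a ident C x\<rfloor>"
  "v \<in> obj V \<Longrightarrow> g \<in> arr C \<Longrightarrow> src C g = x \<Longrightarrow> \<lfloor>ident V v \<rhd>\<^sub>a\<^bsub>A\<^esub> g\<rfloor> \<odot> \<lfloor>act_left v x\<rfloor> =
    \<lfloor>act_left v (trg C g)\<rfloor> \<odot> \<lfloor>ident C (v \<rhd>\<^bsub>A\<^esub> \<I>) \<otimes>\<^sub>a g\<rfloor>"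
proof -
  show "x \<in> obj C \<Longrightarrow> f \<in> arr V \<Longrightarrow> src V f = v \<Longrightarrow> \<lfloor>f \<rhd>\<^sub>a\<^bsub>A\<^esub> ident C x\<rfloor> \<odot> \<lfloor>act_left v x\<rfloor> =
    \<lfloor>act_left (trg V f) x\<rfloor> \<odot> \<lfloor>(f \<rhd>\<^sub>a\<^bsub>A\<^esub> ident C \<I>) \<otimes>\<^sub>a ident C x\<rfloor>"
    by (auto simp: act_left_def chase act.slide \<alpha>1_out)
  assume a: "v \<in> obj V" "g \<in> arr C" "src C g = x"
  then have [simp]: "x \<in> obj C" by auto
  from a have w: "\<lfloor>ident V v \<rhd>\<^sub>a\<^bsub>A\<^esub> g\<rfloor> \<odot> \<lfloor>ident V v \<rhd>\<^sub>a\<^bsub>A\<^esub> lunit C x\<rfloor> = \<lfloor>ident V v \<rhd>\<^sub>a\<^bsub>A\<^esub> lunit C (trg C g)\<rfloor> \<odot> \<lfloor>ident V v \<rhd>\<^sub>a\<^bsub>A\<^esub> (ident C \<I> \<otimes>\<^sub>a g)\<rfloor>"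
    using arg_cong[OF C.lunit_nat[of g], of "\<lambda>t. \<lfloor>ident V v \<rhd>\<^sub>a\<^bsub>A\<^esub> t\<rfloor>"] by (auto simp: chase)
  from a show "\<lfloor>ident V v \<rhd>\<^sub>a\<^bsub>A\<^esub> g\<rfloor> \<odot> \<lfloor>act_left v x\<rfloor> = \<lfloor>act_left v (trg C g)\<rfloor> \<odot> \<lfloor>ident C (v \<rhd>\<^bsub>A\<^esub> \<I>) \<otimes>\<^sub>a g\<rfloor>"
    by (simp add: act_left_def chase w[THEN C.re] \<alpha>1_out)
qed

lemma act_right_out:
  "x \<in> obj C \<Longrightarrow> f \<in> arr V \<Longrightarrow> src V f = v \<Longrightarrow> \<lfloor>f \<rhd>\<^sub>a\<^bsub>A\<^esub> ident C x\<rfloor> \<odot> \<lfloor>act_right v x\<rfloor> =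
    \<lfloor>act_right (trg V f) x\<rfloor> \<odot> \<lfloor>ident C x \<otimes>\<^sub>a (f \<rhd>\<^sub>a\<^bsub>A\<^esub> ident C \<I>)\<rfloor>"
  "v \<in> obj V \<Longrightarrow> g \<in> arr C \<Longrightarrow> src C g = x \<Longrightarrow> \<lfloor>ident V v \<rhd>\<^sub>a\<^bsub>A\<^esub> g\<rfloor> \<odot> \<lfloor>act_right v x\<rfloor> =
    \<lfloor>act_right v (trg C g)\<rfloor> \<odot> \<lfloor>g \<otimes>\<^sub>a ident C (v \<rhd>\<^bsub>A\<^esub> \<I>)\<rfloor>"
proof -
  show "x \<in> obj C \<Longrightarrow> f \<in> arr V \<Longrightarrow> src V f = v \<Longrightarrow> \<lfloor>f \<rhd>\<^sub>a\<^bsub>A\<^esub> ident C x\<rfloor> \<odot> \<lfloor>act_right v x\<rfloor> =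
    \<lfloor>act_right (trg V f) x\<rfloor> \<odot> \<lfloor>ident C x \<otimes>\<^sub>a (f \<rhd>\<^sub>a\<^bsub>A\<^esub> ident C \<I>)\<rfloor>"
    by (auto simp: act_right_def chase act.slide \<alpha>2_out)
  assume a: "v \<in> obj V" "g \<in> arr C" "src C g = x"
  then have [simp]: "x \<in> obj C" by auto
  from a have w: "\<lfloor>ident V v \<rhd>\<^sub>a\<^bsub>A\<^esub> g\<rfloor> \<odot> \<lfloor>ident V v \<rhd>\<^sub>a\<^bsub>A\<^esub> runit C x\<rfloor> = \<lfloor>ident V v \<rhd>\<^sub>a\<^bsub>A\<^esub> runit C (trg C g)\<rfloor> \<odot> \<lfloor>ident V v \<rhd>\<^sub>a\<^bsub>A\<^esub> (g \<otimes>\<^sub>a ident C \<I>)\<rfloor>"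
    using arg_cong[OF C.runit_nat[of g], of "\<lambda>t. \<lfloor>ident V v \<rhd>\<^sub>a\<^bsub>A\<^esub> t\<rfloor>"] by (auto simp: chase)
  from a show "\<lfloor>ident V v \<rhd>\<^sub>a\<^bsub>A\<^esub> g\<rfloor> \<odot> \<lfloor>act_right v x\<rfloor> = \<lfloor>act_right v (trg C g)\<rfloor> \<odot> \<lfloor>g \<otimes>\<^sub>a ident C (v \<rhd>\<^bsub>A\<^esub> \<I>)\<rfloor>"
    by (simp add: act_right_def chase w[THEN C.re] \<alpha>2_out)
qed

lemma act_left_in:
  "v \<in> obj V \<Longrightarrow> g \<in> arr C \<Longrightarrow> trg C g = x \<Longrightarrow> \<lfloor>act_left v x\<rfloor> \<odot> \<lfloor>ident C (v \<rhd>\<^bsub>A\<^esub> \<I>) \<otimes>\<^sub>a g\<rfloor> =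
    \<lfloor>ident V v \<rhd>\<^sub>a\<^bsub>A\<^esub> g\<rfloor> \<odot> \<lfloor>act_left v (src C g)\<rfloor>"
  using act_left_out(2) by auto

lemma act_right_in:
  "v \<in> obj V \<Longrightarrow> g \<in> arr C \<Longrightarrow> trg C g = x \<Longrightarrow> \<lfloor>act_right v x\<rfloor> \<odot> \<lfloor>g \<otimes>\<^sub>a ident C (v \<rhd>\<^bsub>A\<^esub> \<I>)\<rfloor> =
    \<lfloor>ident V v \<rhd>\<^sub>a\<^bsub>A\<^esub> g\<rfloor> \<odot> \<lfloor>act_right v (src C g)\<rfloor>"
  using act_right_out(2) by auto

lemma act_left_tens:
  assumes [simp]: "v \<in> obj V" "x \<in> obj C" "y \<in> obj C"
  shows "act_left v (x \<otimes> y) \<cdot> assoc C (v \<rhd>\<^bsub>A\<^esub> \<I>, x, y) = \<alpha>1 (v, x, y) \<cdot> (act_left v x \<otimes>\<^sub>a ident C y)"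
proof -
  have w: "\<lfloor>ident V v \<rhd>\<^sub>a\<^bsub>A\<^esub> lunit C (x \<otimes> y)\<rfloor> \<odot> \<lfloor>ident V v \<rhd>\<^sub>a\<^bsub>A\<^esub> assoc C (\<I>, x, y)\<rfloor> = \<lfloor>ident V v \<rhd>\<^sub>a\<^bsub>A\<^esub> (lunit C x \<otimes>\<^sub>a ident C y)\<rfloor>"
    using arg_cong[OF C.lunit_tens[of x y], of "\<lambda>t. \<lfloor>ident V v \<rhd>\<^sub>a\<^bsub>A\<^esub> t\<rfloor>"] by (simp add: chase)
  show ?thesis
    by (rule C.lift_eqI) (simp_all add: act_left_def chase \<alpha>1_assoc_l w[THEN C.re] \<alpha>1_out \<alpha>1_out[THEN C.re])
qed

lemma act_left_unit:
  assumes [simp]: "v \<in> obj V"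
  shows "act_left v \<I> = runit C (v \<rhd>\<^bsub>A\<^esub> \<I>)"
  using \<alpha>1_runit[of v \<I>] by (simp add: act_left_def C.lunit_unit)

lemma act_right_tens:
  assumes [simp]: "v \<in> obj V" "x \<in> obj C" "y \<in> obj C"
  shows "act_right v (x \<otimes> y) = \<alpha>2 (v, x, y) \<cdot> (ident C x \<otimes>\<^sub>a act_right v y) \<cdot> assoc C (x, y, v \<rhd>\<^bsub>A\<^esub> \<I>)"
proof -
  have w: "\<lfloor>ident V v \<rhd>\<^sub>a\<^bsub>A\<^esub> runit C (x \<otimes> y)\<rfloor> = \<lfloor>ident V v \<rhd>\<^sub>a\<^bsub>A\<^esub> (ident C x \<otimes>\<^sub>a runit C y)\<rfloor> \<odot> \<lfloor>ident V v \<rhd>\<^sub>a\<^bsub>A\<^esub> assoc C (x, y, \<I>)\<rfloor>"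
    using arg_cong[OF C.runit_tens[of x y], of "\<lambda>t. \<lfloor>ident V v \<rhd>\<^sub>a\<^bsub>A\<^esub> t\<rfloor>"] by (simp add: chase)
  show ?thesis
    by (rule C.lift_eqI) (simp_all add: act_right_def chase w \<alpha>2_assoc_l \<alpha>2_out[THEN C.re])
qed

text \<open>
  Axiom five, on \<open>\<alpha>1\<close> and \<open>\<alpha>2\<close>, with the unit as middle
  object: the triangle identifies the two ways of absorbing it. This is the bridge between
  \<open>act_left\<close> and \<open>act_right\<close> that makes the half-braiding below a
  half-braiding.
\<close>

lemma act_right_left:
  assumes [simp]: "v \<in> obj V" "x \<in> obj C" "z \<in> obj C"
  shows "\<alpha>1 (v, x, z) \<cdot> (act_right v x \<otimes>\<^sub>a ident C z) = \<alpha>2 (v, x, z) \<cdot> (ident C x \<otimes>\<^sub>a act_left v z) \<cdot> assoc C (x, v \<rhd>\<^bsub>A\<^esub> \<I>, z)"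
proof (rule C.lift_eqI)
  have w: "\<lfloor>ident V v \<rhd>\<^sub>a\<^bsub>A\<^esub> (ident C x \<otimes>\<^sub>a lunit C z)\<rfloor> \<odot> \<lfloor>ident V v \<rhd>\<^sub>a\<^bsub>A\<^esub> assoc C (x, \<I>, z)\<rfloor> = \<lfloor>ident V v \<rhd>\<^sub>a\<^bsub>A\<^esub> (runit C x \<otimes>\<^sub>a ident C z)\<rfloor>"
    using arg_cong[OF C.triangle[of x z], of "\<lambda>t. \<lfloor>ident V v \<rhd>\<^sub>a\<^bsub>A\<^esub> t\<rfloor>"] by (simp add: chase)
  have "\<lfloor>\<alpha>1 (v, x, z) \<cdot> (act_right v x \<otimes>\<^sub>a ident C z)\<rfloor> =
      \<lfloor>ident V v \<rhd>\<^sub>a\<^bsub>A\<^esub> (runit C x \<otimes>\<^sub>a ident C z)\<rfloor> \<odot> \<lfloor>\<alpha>1 (v, x \<otimes> \<I>, z)\<rfloor> \<odot> \<lfloor>\<alpha>2 (v, x, \<I>) \<otimes>\<^sub>a ident C z\<rfloor>"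
    by (simp add: act_right_def chase \<alpha>1_in[THEN C.re])
  also have "\<dots> = \<lfloor>ident V v \<rhd>\<^sub>a\<^bsub>A\<^esub> (ident C x \<otimes>\<^sub>a lunit C z)\<rfloor> \<odot> \<lfloor>\<alpha>2 (v, x, \<I> \<otimes> z)\<rfloor> \<odot> \<lfloor>ident C x \<otimes>\<^sub>a \<alpha>1 (v, \<I>, z)\<rfloor> \<odot> \<lfloor>assoc C (x, v \<rhd>\<^bsub>A\<^esub> \<I>, z)\<rfloor>"
    by (simp add: C.ocmp_assoc flip: w \<alpha>1_\<alpha>2_assoc_l)
  also have "\<dots> = \<lfloor>\<alpha>2 (v, x, z) \<cdot> (ident C x \<otimes>\<^sub>a act_left v z) \<cdot> assoc C (x, v \<rhd>\<^bsub>A\<^esub> \<I>, z)\<rfloor>"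
    by (simp add: act_left_def chase \<alpha>2_out[THEN C.re])
  finally show "\<lfloor>\<alpha>1 (v, x, z) \<cdot> (act_right v x \<otimes>\<^sub>a ident C z)\<rfloor> = \<lfloor>\<alpha>2 (v, x, z) \<cdot> (ident C x \<otimes>\<^sub>a act_left v z) \<cdot> assoc C (x, v \<rhd>\<^bsub>A\<^esub> \<I>, z)\<rfloor>" .
qed simp

lemma act_left_tens_l:
  assumes [simp]: "v \<in> obj V" "x \<in> obj C" "y \<in> obj C"
  shows "\<lfloor>act_left v (x \<otimes> y)\<rfloor> \<odot> \<lfloor>assoc C (v \<rhd>\<^bsub>A\<^esub> \<I>, x, y)\<rfloor> = \<lfloor>\<alpha>1 (v, x, y)\<rfloor> \<odot> \<lfloor>act_left v x \<otimes>\<^sub>a ident C y\<rfloor>"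
  using act_left_tens[THEN C.up, of v x y] by (simp add: chase)

lemma act_right_tens_l:
  assumes [simp]: "v \<in> obj V" "x \<in> obj C" "y \<in> obj C"
  shows "\<lfloor>act_right v (x \<otimes> y)\<rfloor> = \<lfloor>\<alpha>2 (v, x, y)\<rfloor> \<odot> \<lfloor>ident C x \<otimes>\<^sub>a act_right v y\<rfloor> \<odot> \<lfloor>assoc C (x, y, v \<rhd>\<^bsub>A\<^esub> \<I>)\<rfloor>"
  using act_right_tens[THEN C.up, of v x y] by (simp add: chase)

lemma act_right_left_l:
  assumes [simp]: "v \<in> obj V" "x \<in> obj C" "z \<in> obj C"
  shows "\<lfloor>\<alpha>1 (v, x, z)\<rfloor> \<odot> \<lfloor>act_right v x \<otimes>\<^sub>a ident C z\<rfloor> = \<lfloor>\<alpha>2 (v, x, z)\<rfloor> \<odot> \<lfloor>ident C x \<otimes>\<^sub>a act_left v z\<rfloor> \<odot> \<lfloor>assoc C (x, v \<rhd>\<^bsub>A\<^esub> \<I>, z)\<rfloor>"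
  using act_right_left[THEN C.up, of v x z] by (simp add: chase)

text \<open>The multiplication constraint of \<open>v \<mapsto> v \<rhd> \<I>\<close>.\<close>

definition free_tens :: "'v \<Rightarrow> 'v \<Rightarrow> 'a" where
  "free_tens v w = inv_arr C (massoc A (v, w, \<I>)) \<cdot> act_left v (w \<rhd>\<^bsub>A\<^esub> \<I>)"

lemma free_tens_typ [simp]:
  assumes "v \<in> obj V" "w \<in> obj V"
  shows "free_tens v w \<in> arr C" "src C (free_tens v w) = (v \<rhd>\<^bsub>A\<^esub> \<I>) \<otimes> (w \<rhd>\<^bsub>A\<^esub> \<I>)"
    "trg C (free_tens v w) = (v \<otimes>\<^bsub>V\<^esub> w) \<rhd>\<^bsub>A\<^esub> \<I>" "iso_arr C (free_tens v w)"
  using assms by (simp_all add: free_tens_def)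

lemma massoc_free_tens:
  assumes [simp]: "v \<in> obj V" "w \<in> obj V"
  shows "massoc A (v, w, \<I>) \<cdot> free_tens v w = act_left v (w \<rhd>\<^bsub>A\<^esub> \<I>)"
  by (rule C.lift_eqI) (simp_all add: free_tens_def chase)

lemma massoc_free_tens_l:
  assumes [simp]: "v \<in> obj V" "w \<in> obj V"
  shows "\<lfloor>massoc A (v, w, \<I>)\<rfloor> \<odot> \<lfloor>free_tens v w\<rfloor> = \<lfloor>act_left v (w \<rhd>\<^bsub>A\<^esub> \<I>)\<rfloor>"
  using massoc_free_tens[THEN C.up, of v w] by (simp add: chase)

text \<open>
  \<open>act_left\<close> identifies the given action with tensoring by free objects, including
  the associativity constraints. The same identity is the multiplicativity of the half-braiding
  on one side and, later, the module functor law of the counit.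
\<close>

lemma act_left_massoc:
  assumes [simp]: "v \<in> obj V" "w \<in> obj V" "x \<in> obj C"
  shows "massoc A (v, w, x) \<cdot> act_left (v \<otimes>\<^bsub>V\<^esub> w) x \<cdot> (free_tens v w \<otimes>\<^sub>a ident C x) =
    act_left v (w \<rhd>\<^bsub>A\<^esub> x) \<cdot> (ident C (v \<rhd>\<^bsub>A\<^esub> \<I>) \<otimes>\<^sub>a act_left w x) \<cdot> assoc C (v \<rhd>\<^bsub>A\<^esub> \<I>, w \<rhd>\<^bsub>A\<^esub> \<I>, x)" (is "?f = ?g")
proof (rule C.lift_eqI)
  have w: "\<lfloor>massoc A (v, w, \<I>) \<otimes>\<^sub>a ident C x\<rfloor> \<odot> \<lfloor>free_tens v w \<otimes>\<^sub>a ident C x\<rfloor> = \<lfloor>act_left v (w \<rhd>\<^bsub>A\<^esub> \<I>) \<otimes>\<^sub>a ident C x\<rfloor>"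
    using arg_cong[OF massoc_free_tens[of v w], of "\<lambda>t. \<lfloor>t \<otimes>\<^sub>a ident C x\<rfloor>"] by (simp add: chase)
  have "\<lfloor>?f\<rfloor> = \<lfloor>ident V v \<rhd>\<^sub>a\<^bsub>A\<^esub> act_left w x\<rfloor> \<odot> \<lfloor>\<alpha>1 (v, w \<rhd>\<^bsub>A\<^esub> \<I>, x)\<rfloor> \<odot> \<lfloor>act_left v (w \<rhd>\<^bsub>A\<^esub> \<I>) \<otimes>\<^sub>a ident C x\<rfloor>"
    by (simp add: act_left_def[of w] act_left_def[of "v \<otimes>\<^bsub>V\<^esub> w"] chase massoc_in[THEN C.re] \<alpha>1_massoc_l[THEN C.re] w)
  also have "\<dots> = \<lfloor>?g\<rfloor>"
    by (simp add: chase act_left_in[THEN C.re] act_left_tens_l)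
  finally show "\<lfloor>?f\<rfloor> = \<lfloor>?g\<rfloor>" .
qed simp

lemma act_left_massoc_l:
  assumes [simp]: "v \<in> obj V" "w \<in> obj V" "x \<in> obj C"
  shows "\<lfloor>massoc A (v, w, x)\<rfloor> \<odot> \<lfloor>act_left (v \<otimes>\<^bsub>V\<^esub> w) x\<rfloor> \<odot> \<lfloor>free_tens v w \<otimes>\<^sub>a ident C x\<rfloor> =
    \<lfloor>act_left v (w \<rhd>\<^bsub>A\<^esub> x)\<rfloor> \<odot> \<lfloor>ident C (v \<rhd>\<^bsub>A\<^esub> \<I>) \<otimes>\<^sub>a act_left w x\<rfloor> \<odot> \<lfloor>assoc C (v \<rhd>\<^bsub>A\<^esub> \<I>, w \<rhd>\<^bsub>A\<^esub> \<I>, x)\<rfloor>"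
  using act_left_massoc[THEN C.up, of v w x] by (simp add: chase)

lemma act_left_munit:
  assumes [simp]: "x \<in> obj C"
  shows "munit A x \<cdot> act_left \<I>\<^bsub>V\<^esub> x = lunit C x \<cdot> (munit A \<I> \<otimes>\<^sub>a ident C x)"
  by (rule C.lift_eqI)
    (use munit_\<alpha>1[of \<I> x, THEN C.up] in \<open>simp_all add: act_left_def chase munit_in[THEN C.re]\<close>)

lemma act_right_munit:
  assumes [simp]: "x \<in> obj C"
  shows "munit A x \<cdot> act_right \<I>\<^bsub>V\<^esub> x = runit C x \<cdot> (ident C x \<otimes>\<^sub>a munit A \<I>)"
  by (rule C.lift_eqI)
    (use munit_\<alpha>2[of x \<I>, THEN C.up] in \<open>simp_all add: act_right_def chase munit_in[THEN C.re]\<close>)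

lemma act_right_massoc_l:
  assumes [simp]: "v \<in> obj V" "w \<in> obj V" "x \<in> obj C"
  shows "\<lfloor>massoc A (v, w, x)\<rfloor> \<odot> \<lfloor>act_right (v \<otimes>\<^bsub>V\<^esub> w) x\<rfloor> \<odot> \<lfloor>ident C x \<otimes>\<^sub>a free_tens v w\<rfloor> =
    \<lfloor>ident V v \<rhd>\<^sub>a\<^bsub>A\<^esub> act_right w x\<rfloor> \<odot> \<lfloor>\<alpha>2 (v, x, w \<rhd>\<^bsub>A\<^esub> \<I>)\<rfloor> \<odot> \<lfloor>ident C x \<otimes>\<^sub>a act_left v (w \<rhd>\<^bsub>A\<^esub> \<I>)\<rfloor>"
proof -
  have w: "\<lfloor>ident C x \<otimes>\<^sub>a massoc A (v, w, \<I>)\<rfloor> \<odot> \<lfloor>ident C x \<otimes>\<^sub>a free_tens v w\<rfloor> = \<lfloor>ident C x \<otimes>\<^sub>a act_left v (w \<rhd>\<^bsub>A\<^esub> \<I>)\<rfloor>"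
    using arg_cong[OF massoc_free_tens[of v w], of "\<lambda>t. \<lfloor>ident C x \<otimes>\<^sub>a t\<rfloor>"] by (simp add: chase)
  show ?thesis
    by (simp add: act_right_def[of w] act_right_def[of "v \<otimes>\<^bsub>V\<^esub> w"] chase massoc_in[THEN C.re] \<alpha>2_massoc_l[THEN C.re] w)
qed

definition free_braid :: "'v \<Rightarrow> 'o \<Rightarrow> 'a" where
  "free_braid v = (\<lambda>x \<in> obj C. inv_arr C (act_right v x) \<cdot> act_left v x)"

lemma free_braid_typ [simp]:
  assumes "v \<in> obj V" "x \<in> obj C"
  shows "free_braid v x \<in> arr C" "src C (free_braid v x) = (v \<rhd>\<^bsub>A\<^esub> \<I>) \<otimes> x"
    "trg C (free_braid v x) = x \<otimes> (v \<rhd>\<^bsub>A\<^esub> \<I>)" "iso_arr C (free_braid v x)"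
  using assms by (simp_all add: free_braid_def)

lemma act_right_free_braid:
  assumes [simp]: "v \<in> obj V" "x \<in> obj C"
  shows "act_right v x \<cdot> free_braid v x = act_left v x"
  by (rule C.lift_eqI) (simp_all add: free_braid_def chase)

lemma act_right_free_braid_l:
  assumes [simp]: "v \<in> obj V" "x \<in> obj C"
  shows "\<lfloor>act_right v x\<rfloor> \<odot> \<lfloor>free_braid v x\<rfloor> = \<lfloor>act_left v x\<rfloor>"
  using act_right_free_braid[THEN C.up, of v x] by (simp add: chase)

lemma free_braid_natural: "v \<in> obj V \<Longrightarrow> natural_half_braiding C (v \<rhd>\<^bsub>A\<^esub> \<I>) (free_braid v)"
proof (unfold_locales, simp, rule nat_isoI, goal_cases)
  case 1
  show ?case by (simp add: free_braid_def)
next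
  case (2 x)
  then show ?case by (simp add: hom_def)
next
  case (3 f)
  note [simp] = 3
  show ?case
  proof (rule C.iso_left_cancel)
    show "\<lfloor>act_right v (trg C f)\<rfloor> \<odot> \<lfloor>amap \<lparr>omap = \<lambda>x. x \<otimes> (v \<rhd>\<^bsub>A\<^esub> \<I>), amap = \<lambda>f. f \<otimes>\<^sub>a ident C (v \<rhd>\<^bsub>A\<^esub> \<I>)\<rparr> f \<cdot> free_braid v (src C f)\<rfloor> =
      \<lfloor>act_right v (trg C f)\<rfloor> \<odot> \<lfloor>free_braid v (trg C f) \<cdot> amap \<lparr>omap = \<lambda>x. (v \<rhd>\<^bsub>A\<^esub> \<I>) \<otimes> x, amap = \<lambda>f. ident C (v \<rhd>\<^bsub>A\<^esub> \<I>) \<otimes>\<^sub>a f\<rparr> f\<rfloor>"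
      by (simp add: chase act_right_in[THEN C.re] act_right_free_braid_l act_right_free_braid_l[THEN C.re] act_left_in)
  qed simp_all
qed

text \<open>
  Both sides are compared after moving everything into \<open>v \<rhd> (x \<otimes> y)\<close>,
  where the half-braiding turns \<open>act_left\<close> into \<open>act_right\<close>; then
  \<open>act_right_left\<close> exchanges them.
\<close>

lemma free_braid_half:
  assumes [simp]: "v \<in> obj V"
  shows "half_braiding C (v \<rhd>\<^bsub>A\<^esub> \<I>) (free_braid v)"
  unfolding C.half_braiding_iff
proof (intro conjI ballI free_braid_natural assms)
  let ?t = "v \<rhd>\<^bsub>A\<^esub> \<I>"
  fix x y assume [simp]: "x \<in> obj C" "y \<in> obj C"
  show "assoc C (x, y, ?t) \<cdot> free_braid v (x \<otimes> y) \<cdot> assoc C (?t, x, y) =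
    (ident C x \<otimes>\<^sub>a free_braid v y) \<cdot> assoc C (x, ?t, y) \<cdot> (free_braid v x \<otimes>\<^sub>a ident C y)" (is "?f = ?g")
  proof (rule C.iso_left_cancel)
    have w: "\<lfloor>ident C x \<otimes>\<^sub>a act_right v y\<rfloor> \<odot> \<lfloor>ident C x \<otimes>\<^sub>a free_braid v y\<rfloor> = \<lfloor>ident C x \<otimes>\<^sub>a act_left v y\<rfloor>"
      "\<lfloor>act_right v x \<otimes>\<^sub>a ident C y\<rfloor> \<odot> \<lfloor>free_braid v x \<otimes>\<^sub>a ident C y\<rfloor> = \<lfloor>act_left v x \<otimes>\<^sub>a ident C y\<rfloor>"
      using arg_cong[OF act_right_free_braid[of v y], of "\<lambda>t. \<lfloor>ident C x \<otimes>\<^sub>a t\<rfloor>"]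
        arg_cong[OF act_right_free_braid[of v x], of "\<lambda>t. \<lfloor>t \<otimes>\<^sub>a ident C y\<rfloor>"] by (simp_all add: chase)
    have "\<lfloor>\<alpha>2 (v, x, y) \<cdot> (ident C x \<otimes>\<^sub>a act_right v y)\<rfloor> \<odot> \<lfloor>?f\<rfloor> = \<lfloor>act_right v (x \<otimes> y)\<rfloor> \<odot> \<lfloor>free_braid v (x \<otimes> y)\<rfloor> \<odot> \<lfloor>assoc C (?t, x, y)\<rfloor>"
      by (simp add: act_right_tens_l chase)
    also have "\<dots> = (\<lfloor>\<alpha>1 (v, x, y)\<rfloor> \<odot> \<lfloor>act_right v x \<otimes>\<^sub>a ident C y\<rfloor>) \<odot> \<lfloor>free_braid v x \<otimes>\<^sub>a ident C y\<rfloor>"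
      by (simp add: act_right_free_braid_l[THEN C.re] act_left_tens_l C.ocmp_assoc w)
    also have "\<dots> = \<lfloor>\<alpha>2 (v, x, y) \<cdot> (ident C x \<otimes>\<^sub>a act_right v y)\<rfloor> \<odot> \<lfloor>?g\<rfloor>"
      by (simp add: act_right_left_l chase w[THEN C.re])
    finally show "\<lfloor>\<alpha>2 (v, x, y) \<cdot> (ident C x \<otimes>\<^sub>a act_right v y)\<rfloor> \<odot> \<lfloor>?f\<rfloor> = \<lfloor>\<alpha>2 (v, x, y) \<cdot> (ident C x \<otimes>\<^sub>a act_right v y)\<rfloor> \<odot> \<lfloor>?g\<rfloor>" .
  qed simp_all
qed

lemma free_braid_center [simp]: "v \<in> obj V \<Longrightarrow> (v \<rhd>\<^bsub>A\<^esub> \<I>, free_braid v) \<in> obj (center C)"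
  using free_braid_half by (simp add: C.center_simps(1))

definition free_functor :: "('v, 'w, 'o, 'a) mon_functor" where
  "free_functor =
    \<lparr>omap = (\<lambda>v \<in> obj V. v \<rhd>\<^bsub>A\<^esub> \<I>),
     amap = (\<lambda>f \<in> arr V. f \<rhd>\<^sub>a\<^bsub>A\<^esub> ident C \<I>),
     phi2 = (\<lambda>(v, w) \<in> obj V \<times> obj V. free_tens v w),
     phi0 = inv_arr C (munit A \<I>)\<rparr>"

lemma free_functor_simps [simp]:
  "v \<in> obj V \<Longrightarrow> omap free_functor v = v \<rhd>\<^bsub>A\<^esub> \<I>"
  "f \<in> arr V \<Longrightarrow> amap free_functor f = f \<rhd>\<^sub>a\<^bsub>A\<^esub> ident C \<I>"
  "v \<in> obj V \<Longrightarrow> w \<in> obj V \<Longrightarrow> phi2 free_functor (v, w) = free_tens v w"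
  "phi0 free_functor = inv_arr C (munit A \<I>)"
  by (simp_all add: free_functor_def)

lemma free_tens_nat:
  assumes [simp]: "f \<in> arr V" "g \<in> arr V"
  shows "((f \<otimes>\<^sub>a\<^bsub>V\<^esub> g) \<rhd>\<^sub>a\<^bsub>A\<^esub> ident C \<I>) \<cdot> free_tens (src V f) (src V g) =
    free_tens (trg V f) (trg V g) \<cdot> ((f \<rhd>\<^sub>a\<^bsub>A\<^esub> ident C \<I>) \<otimes>\<^sub>a (g \<rhd>\<^sub>a\<^bsub>A\<^esub> ident C \<I>))" (is "?f = ?g")
proof (rule C.iso_left_cancel)
  let ?m = "massoc A (trg V f, trg V g, \<I>)" and ?F = "f \<rhd>\<^sub>a\<^bsub>A\<^esub> ident C \<I>" and ?G = "g \<rhd>\<^sub>a\<^bsub>A\<^esub> ident C \<I>"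
  have n: "\<lfloor>?m\<rfloor> \<odot> \<lfloor>(f \<otimes>\<^sub>a\<^bsub>V\<^esub> g) \<rhd>\<^sub>a\<^bsub>A\<^esub> ident C \<I>\<rfloor> = \<lfloor>f \<rhd>\<^sub>a\<^bsub>A\<^esub> ?G\<rfloor> \<odot> \<lfloor>massoc A (src V f, src V g, \<I>)\<rfloor>"
    using massoc_nat[of f g "ident C \<I>", THEN C.up] by (simp add: chase)
  have "\<lfloor>?m\<rfloor> \<odot> \<lfloor>?f\<rfloor> = \<lfloor>f \<rhd>\<^sub>a\<^bsub>A\<^esub> ?G\<rfloor> \<odot> \<lfloor>act_left (src V f) (src V g \<rhd>\<^bsub>A\<^esub> \<I>)\<rfloor>"
    by (simp add: chase n[THEN C.re] massoc_free_tens_l)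
  also have "\<lfloor>f \<rhd>\<^sub>a\<^bsub>A\<^esub> ?G\<rfloor> = \<lfloor>f \<rhd>\<^sub>a\<^bsub>A\<^esub> ident C (trg V g \<rhd>\<^bsub>A\<^esub> \<I>)\<rfloor> \<odot> \<lfloor>ident V (src V f) \<rhd>\<^sub>a\<^bsub>A\<^esub> ?G\<rfloor>"
    using act.bimap_merge(1)[of f ?G, THEN C.up] by (simp add: chase)
  also have "(\<lfloor>f \<rhd>\<^sub>a\<^bsub>A\<^esub> ident C (trg V g \<rhd>\<^bsub>A\<^esub> \<I>)\<rfloor> \<odot> \<lfloor>ident V (src V f) \<rhd>\<^sub>a\<^bsub>A\<^esub> ?G\<rfloor>) \<odot> \<lfloor>act_left (src V f) (src V g \<rhd>\<^bsub>A\<^esub> \<I>)\<rfloor> =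
      \<lfloor>act_left (trg V f) (trg V g \<rhd>\<^bsub>A\<^esub> \<I>)\<rfloor> \<odot> \<lfloor>?F \<otimes>\<^sub>a ident C (trg V g \<rhd>\<^bsub>A\<^esub> \<I>)\<rfloor> \<odot> \<lfloor>ident C (src V f \<rhd>\<^bsub>A\<^esub> \<I>) \<otimes>\<^sub>a ?G\<rfloor>"
    by (simp add: C.ocmp_assoc act_left_out act_left_out[THEN C.re])
  also have "\<lfloor>?F \<otimes>\<^sub>a ident C (trg V g \<rhd>\<^bsub>A\<^esub> \<I>)\<rfloor> \<odot> \<lfloor>ident C (src V f \<rhd>\<^bsub>A\<^esub> \<I>) \<otimes>\<^sub>a ?G\<rfloor> = \<lfloor>?F \<otimes>\<^sub>a ?G\<rfloor>"
    using C.tens.bimap_merge(1)[of ?F ?G, THEN C.up] by (simp add: chase)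
  finally show "\<lfloor>?m\<rfloor> \<odot> \<lfloor>?f\<rfloor> = \<lfloor>?m\<rfloor> \<odot> \<lfloor>?g\<rfloor>"
    by (simp add: chase massoc_free_tens_l[THEN C.re])
qed simp_all

lemma free_functor_monoidal: "monoidal_functor V C free_functor"
proof (unfold_locales, goal_cases)
  case 1
  show ?case by (auto simp: free_functor_def)
next
  case 2
  show ?case by (simp add: free_functor_def)
next
  case (3 f x y)
  then show ?case by (auto simp: hom_def)
next
  case (4 x)
  then show ?case by simp
next
  case (5 f x y g z)
  then show ?case by (auto simp: hom_def act.bimap_left)
next
  case 6
  show ?case
  proof (rule nat_isoI2, goal_cases)
    case 1
    show ?case by (simp add: free_functor_def)
  next
    case (2 x y)
    then show ?case by (simp add: hom_def)
  next
    case (3 f g)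
    then show ?case using free_tens_nat[of f g] by simp
  qed
next
  case 7
  show ?case by (simp add: hom_def)
next
  case 8
  show ?case by simp
next
  case (9 u v w)
  note [simp] = 9
  let ?F = "\<lambda>v. v \<rhd>\<^bsub>A\<^esub> \<I>"
  have "(assoc V (u, v, w) \<rhd>\<^sub>a\<^bsub>A\<^esub> ident C \<I>) \<cdot> free_tens (u \<otimes>\<^bsub>V\<^esub> v) w \<cdot> (free_tens u v \<otimes>\<^sub>a ident C (?F w)) =
    free_tens u (v \<otimes>\<^bsub>V\<^esub> w) \<cdot> (ident C (?F u) \<otimes>\<^sub>a free_tens v w) \<cdot> assoc C (?F u, ?F v, ?F w)" (is "?f = ?g")
  proof (rule C.iso_left_cancel)
    let ?h = "(ident V u \<rhd>\<^sub>a\<^bsub>A\<^esub> massoc A (v, w, \<I>)) \<cdot> massoc A (u, v \<otimes>\<^bsub>V\<^esub> w, \<I>)"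
    have e: "\<lfloor>ident C (?F u) \<otimes>\<^sub>a massoc A (v, w, \<I>)\<rfloor> \<odot> \<lfloor>ident C (?F u) \<otimes>\<^sub>a free_tens v w\<rfloor> = \<lfloor>ident C (?F u) \<otimes>\<^sub>a act_left v (?F w)\<rfloor>"
      using arg_cong[OF massoc_free_tens[of v w], of "\<lambda>t. \<lfloor>ident C (?F u) \<otimes>\<^sub>a t\<rfloor>"] by (simp add: chase)
    have "\<lfloor>?h\<rfloor> \<odot> \<lfloor>?f\<rfloor> = \<lfloor>massoc A (u, v, ?F w)\<rfloor> \<odot> \<lfloor>act_left (u \<otimes>\<^bsub>V\<^esub> v) (?F w)\<rfloor> \<odot> \<lfloor>free_tens u v \<otimes>\<^sub>a ident C (?F w)\<rfloor>"
      by (simp add: chase mod_pentagon_l[symmetric, THEN C.re3] massoc_free_tens_l[THEN C.re])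
    also have "\<dots> = \<lfloor>?h\<rfloor> \<odot> \<lfloor>?g\<rfloor>"
      by (simp add: chase act_left_massoc_l massoc_free_tens_l[THEN C.re] act_left_out[THEN C.re] e[THEN C.re])
    finally show "\<lfloor>?h\<rfloor> \<odot> \<lfloor>?f\<rfloor> = \<lfloor>?h\<rfloor> \<odot> \<lfloor>?g\<rfloor>" .
  qed simp_all
  then show ?case by simp
next
  case (10 v)
  note [simp] = 10
  have u: "\<lfloor>lunit V v \<rhd>\<^sub>a\<^bsub>A\<^esub> ident C \<I>\<rfloor> = \<lfloor>munit A (v \<rhd>\<^bsub>A\<^esub> \<I>)\<rfloor> \<odot> \<lfloor>massoc A (\<I>\<^bsub>V\<^esub>, v, \<I>)\<rfloor>"
    using munit_act[of v \<I>, THEN C.up] by (simp add: chase)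
  have m: "\<lfloor>munit A (v \<rhd>\<^bsub>A\<^esub> \<I>)\<rfloor> \<odot> \<lfloor>act_left \<I>\<^bsub>V\<^esub> (v \<rhd>\<^bsub>A\<^esub> \<I>)\<rfloor> = \<lfloor>lunit C (v \<rhd>\<^bsub>A\<^esub> \<I>)\<rfloor> \<odot> \<lfloor>munit A \<I> \<otimes>\<^sub>a ident C (v \<rhd>\<^bsub>A\<^esub> \<I>)\<rfloor>"
    using act_left_munit[of "v \<rhd>\<^bsub>A\<^esub> \<I>", THEN C.up] by (simp add: chase)
  show ?case
    by (rule C.lift_eqI) (simp_all add: chase u massoc_free_tens_l[THEN C.re] m[THEN C.re])
next
  case (11 v)
  note [simp] = 11
  have u: "\<lfloor>runit V v \<rhd>\<^sub>a\<^bsub>A\<^esub> ident C \<I>\<rfloor> = \<lfloor>ident V v \<rhd>\<^sub>a\<^bsub>A\<^esub> munit A \<I>\<rfloor> \<odot> \<lfloor>massoc A (v, \<I>\<^bsub>V\<^esub>, \<I>)\<rfloor>"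
    using mod_triangle[of v \<I>, THEN C.up] by (simp add: chase)
  show ?case
    by (rule C.lift_eqI) (simp_all add: chase u massoc_free_tens_l[THEN C.re] act_left_out[THEN C.re] act_left_unit)
qed

lemma free_braid_nat:
  assumes [simp]: "f \<in> arr V"
  shows "f \<rhd>\<^sub>a\<^bsub>A\<^esub> ident C \<I> \<in> center_hom C (src V f \<rhd>\<^bsub>A\<^esub> \<I>, free_braid (src V f)) (trg V f \<rhd>\<^bsub>A\<^esub> \<I>, free_braid (trg V f))"
proof -
  have "(ident C x \<otimes>\<^sub>a (f \<rhd>\<^sub>a\<^bsub>A\<^esub> ident C \<I>)) \<cdot> free_braid (src V f) x = free_braid (trg V f) x \<cdot> ((f \<rhd>\<^sub>a\<^bsub>A\<^esub> ident C \<I>) \<otimes>\<^sub>a ident C x)"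
    if [simp]: "x \<in> obj C" for x
  proof (rule C.iso_left_cancel)
    have "\<lfloor>act_right (trg V f) x\<rfloor> \<odot> \<lfloor>(ident C x \<otimes>\<^sub>a (f \<rhd>\<^sub>a\<^bsub>A\<^esub> ident C \<I>)) \<cdot> free_braid (src V f) x\<rfloor> =
        \<lfloor>f \<rhd>\<^sub>a\<^bsub>A\<^esub> ident C x\<rfloor> \<odot> \<lfloor>act_right (src V f) x\<rfloor> \<odot> \<lfloor>free_braid (src V f) x\<rfloor>"
      by (simp add: chase act_right_out(1)[THEN C.re])
    also have "\<dots> = \<lfloor>act_right (trg V f) x\<rfloor> \<odot> \<lfloor>free_braid (trg V f) x \<cdot> ((f \<rhd>\<^sub>a\<^bsub>A\<^esub> ident C \<I>) \<otimes>\<^sub>a ident C x)\<rfloor>"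
      by (simp add: chase act_right_free_braid_l act_right_free_braid_l[THEN C.re] act_left_out)
    finally show "\<lfloor>act_right (trg V f) x\<rfloor> \<odot> \<lfloor>(ident C x \<otimes>\<^sub>a (f \<rhd>\<^sub>a\<^bsub>A\<^esub> ident C \<I>)) \<cdot> free_braid (src V f) x\<rfloor> =
       \<lfloor>act_right (trg V f) x\<rfloor> \<odot> \<lfloor>free_braid (trg V f) x \<cdot> ((f \<rhd>\<^sub>a\<^bsub>A\<^esub> ident C \<I>) \<otimes>\<^sub>a ident C x)\<rfloor>" .
  qed simp_all
  then show ?thesis by (auto simp: center_hom_def hom_def)
qed

text \<open>
  Both sides are compared in \<open>v \<rhd> w \<rhd> x\<close>. There
  \<open>act_right_massoc_l\<close> and \<open>act_left_massoc_l\<close> express the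
  multiplication through \<open>act_right\<close> and \<open>act_left\<close>, and
  \<open>act_right_left\<close> lets the two free objects pass \<open>x\<close> one after the
  other.
\<close>

lemma free_braid_tens:
  assumes [simp]: "v \<in> obj V" "w \<in> obj V"
  shows "free_tens v w \<in> center_hom C (center_tens_obj C (v \<rhd>\<^bsub>A\<^esub> \<I>, free_braid v) (w \<rhd>\<^bsub>A\<^esub> \<I>, free_braid w)) ((v \<otimes>\<^bsub>V\<^esub> w) \<rhd>\<^bsub>A\<^esub> \<I>, free_braid (v \<otimes>\<^bsub>V\<^esub> w))"
proof -
  let ?v = "v \<rhd>\<^bsub>A\<^esub> \<I>" and ?w = "w \<rhd>\<^bsub>A\<^esub> \<I>"
  let ?B = "snd (center_tens_obj C (?v, free_braid v) (?w, free_braid w))"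
  have "(ident C x \<otimes>\<^sub>a free_tens v w) \<cdot> ?B x = free_braid (v \<otimes>\<^bsub>V\<^esub> w) x \<cdot> (free_tens v w \<otimes>\<^sub>a ident C x)" (is "?f = ?g")
    if [simp]: "x \<in> obj C" for x
  proof (rule C.iso_left_cancel)
    let ?h = "massoc A (v, w, x) \<cdot> act_right (v \<otimes>\<^bsub>V\<^esub> w) x"
    have e: "\<lfloor>ident C ?v \<otimes>\<^sub>a act_right w x\<rfloor> \<odot> \<lfloor>ident C ?v \<otimes>\<^sub>a free_braid w x\<rfloor> = \<lfloor>ident C ?v \<otimes>\<^sub>a act_left w x\<rfloor>"
      "\<lfloor>act_right v x \<otimes>\<^sub>a ident C ?w\<rfloor> \<odot> \<lfloor>free_braid v x \<otimes>\<^sub>a ident C ?w\<rfloor> = \<lfloor>act_left v x \<otimes>\<^sub>a ident C ?w\<rfloor>"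
      using arg_cong[OF act_right_free_braid[of w x], of "\<lambda>t. \<lfloor>ident C ?v \<otimes>\<^sub>a t\<rfloor>"]
        arg_cong[OF act_right_free_braid[of v x], of "\<lambda>t. \<lfloor>t \<otimes>\<^sub>a ident C ?w\<rfloor>"] by (simp_all add: chase)
    have "\<lfloor>?h\<rfloor> \<odot> \<lfloor>?f\<rfloor> = \<lfloor>ident V v \<rhd>\<^sub>a\<^bsub>A\<^esub> act_right w x\<rfloor> \<odot> (\<lfloor>\<alpha>2 (v, x, ?w)\<rfloor> \<odot> \<lfloor>ident C x \<otimes>\<^sub>a act_left v ?w\<rfloor> \<odot> \<lfloor>assoc C (x, ?v, ?w)\<rfloor>) \<odot>
        \<lfloor>free_braid v x \<otimes>\<^sub>a ident C ?w\<rfloor> \<odot> \<lfloor>inv_arr C (assoc C (?v, x, ?w))\<rfloor> \<odot> \<lfloor>ident C ?v \<otimes>\<^sub>a free_braid w x\<rfloor> \<odot> \<lfloor>assoc C (?v, ?w, x)\<rfloor>"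
      by (simp add: chase C.center_tens_snd act_right_massoc_l[THEN C.re3])
    also have "\<dots> = \<lfloor>ident V v \<rhd>\<^sub>a\<^bsub>A\<^esub> act_right w x\<rfloor> \<odot> (\<lfloor>\<alpha>1 (v, x, ?w)\<rfloor> \<odot> \<lfloor>act_left v x \<otimes>\<^sub>a ident C ?w\<rfloor>) \<odot>
        \<lfloor>inv_arr C (assoc C (?v, x, ?w))\<rfloor> \<odot> \<lfloor>ident C ?v \<otimes>\<^sub>a free_braid w x\<rfloor> \<odot> \<lfloor>assoc C (?v, ?w, x)\<rfloor>"
      by (simp add: C.ocmp_assoc e[THEN C.re] flip: act_right_left_l)
    also have "\<dots> = \<lfloor>act_left v (w \<rhd>\<^bsub>A\<^esub> x)\<rfloor> \<odot> \<lfloor>ident C ?v \<otimes>\<^sub>a act_left w x\<rfloor> \<odot> \<lfloor>assoc C (?v, ?w, x)\<rfloor>"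
      by (simp add: C.ocmp_assoc act_left_out[THEN C.re] e[THEN C.re] flip: act_left_tens_l)
    also have "\<dots> = \<lfloor>?h\<rfloor> \<odot> \<lfloor>?g\<rfloor>"
      by (simp add: chase act_right_free_braid_l[THEN C.re] act_left_massoc_l)
    finally show "\<lfloor>?h\<rfloor> \<odot> \<lfloor>?f\<rfloor> = \<lfloor>?h\<rfloor> \<odot> \<lfloor>?g\<rfloor>" .
  qed (simp_all add: C.center_tens_snd)
  then show ?thesis by (auto simp: center_hom_def hom_def)
qed

lemma free_braid_unit: "inv_arr C (munit A \<I>) \<in> center_hom C (center_unit C) (\<I>\<^bsub>V\<^esub> \<rhd>\<^bsub>A\<^esub> \<I>, free_braid \<I>\<^bsub>V\<^esub>)"
proof -
  have "(ident C x \<otimes>\<^sub>a inv_arr C (munit A \<I>)) \<cdot> (inv_arr C (runit C x) \<cdot> lunit C x) =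
      free_braid \<I>\<^bsub>V\<^esub> x \<cdot> (inv_arr C (munit A \<I>) \<otimes>\<^sub>a ident C x)" (is "?f = ?g")
    if [simp]: "x \<in> obj C" for x
  proof (rule C.iso_left_cancel)
    let ?h = "munit A x \<cdot> act_right \<I>\<^bsub>V\<^esub> x"
    have e: "\<lfloor>munit A x\<rfloor> \<odot> \<lfloor>act_right \<I>\<^bsub>V\<^esub> x\<rfloor> = \<lfloor>runit C x\<rfloor> \<odot> \<lfloor>ident C x \<otimes>\<^sub>a munit A \<I>\<rfloor>"
      using act_right_munit[of x, THEN C.up] by (simp add: chase)
    have e': "\<lfloor>munit A x\<rfloor> \<odot> \<lfloor>act_left \<I>\<^bsub>V\<^esub> x\<rfloor> = \<lfloor>lunit C x\<rfloor> \<odot> \<lfloor>munit A \<I> \<otimes>\<^sub>a ident C x\<rfloor>"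
      using act_left_munit[of x, THEN C.up] by (simp add: chase)
    have "\<lfloor>?h\<rfloor> \<odot> \<lfloor>?f\<rfloor> = \<lfloor>lunit C x\<rfloor>"
      by (simp add: chase e[THEN C.re])
    also have "\<dots> = \<lfloor>?h\<rfloor> \<odot> \<lfloor>?g\<rfloor>"
      by (simp add: chase act_right_free_braid_l[THEN C.re] e'[THEN C.re])
    finally show "\<lfloor>?h\<rfloor> \<odot> \<lfloor>?f\<rfloor> = \<lfloor>?h\<rfloor> \<odot> \<lfloor>?g\<rfloor>" .
  qed simp_all
  then show ?thesis by (auto simp: center_hom_def hom_def)
qed

text \<open>
  The sixth axiom with \<open>x = y = \<I>\<close>, after the unit laws have removed the units.
\<close>

lemma free_braid_braid:
  assumes [simp]: "v \<in> obj V" "w \<in> obj V"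
  shows "free_tens w v \<cdot> free_braid v (w \<rhd>\<^bsub>A\<^esub> \<I>) = (braid V (v, w) \<rhd>\<^sub>a\<^bsub>A\<^esub> ident C \<I>) \<cdot> free_tens v w"
proof (rule C.lift_eqI)
  let ?v = "v \<rhd>\<^bsub>A\<^esub> \<I>" and ?w = "w \<rhd>\<^bsub>A\<^esub> \<I>" and ?b = "braid V (v, w)"
  have [simp]: "?b \<in> arr V" "src V ?b = v \<otimes>\<^bsub>V\<^esub> w" "trg V ?b = w \<otimes>\<^bsub>V\<^esub> v"
    using nat_isoD(2-4)[OF V.braid_iso, of "(v, w)"] by auto
  have w1: "\<lfloor>ident V v \<rhd>\<^sub>a\<^bsub>A\<^esub> runit C ?w\<rfloor> = \<lfloor>ident V v \<rhd>\<^sub>a\<^bsub>A\<^esub> (ident V w \<rhd>\<^sub>a\<^bsub>A\<^esub> runit C \<I>)\<rfloor> \<odot> \<lfloor>ident V v \<rhd>\<^sub>a\<^bsub>A\<^esub> \<alpha>1 (w, \<I>, \<I>)\<rfloor>"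
    using arg_cong[OF \<alpha>1_runit[of w \<I>], of "\<lambda>t. \<lfloor>ident V v \<rhd>\<^sub>a\<^bsub>A\<^esub> t\<rfloor>"] by (simp add: chase)
  have w2: "\<lfloor>ident V w \<rhd>\<^sub>a\<^bsub>A\<^esub> lunit C ?v\<rfloor> = \<lfloor>ident V w \<rhd>\<^sub>a\<^bsub>A\<^esub> (ident V v \<rhd>\<^sub>a\<^bsub>A\<^esub> runit C \<I>)\<rfloor> \<odot> \<lfloor>ident V w \<rhd>\<^sub>a\<^bsub>A\<^esub> \<alpha>2 (v, \<I>, \<I>)\<rfloor>"
    using arg_cong[OF \<alpha>2_lunit[of v \<I>], of "\<lambda>t. \<lfloor>ident V w \<rhd>\<^sub>a\<^bsub>A\<^esub> t\<rfloor>"] by (simp add: chase C.lunit_unit)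
  have ax: "\<lfloor>?b \<rhd>\<^sub>a\<^bsub>A\<^esub> ident C (\<I> \<otimes> \<I>)\<rfloor> \<odot> \<lfloor>inv_arr C (massoc A (v, w, \<I> \<otimes> \<I>))\<rfloor> \<odot> \<lfloor>ident V v \<rhd>\<^sub>a\<^bsub>A\<^esub> \<alpha>1 (w, \<I>, \<I>)\<rfloor> \<odot> \<lfloor>\<alpha>2 (v, ?w, \<I>)\<rfloor> =
      \<lfloor>inv_arr C (massoc A (w, v, \<I> \<otimes> \<I>))\<rfloor> \<odot> \<lfloor>ident V w \<rhd>\<^sub>a\<^bsub>A\<^esub> \<alpha>2 (v, \<I>, \<I>)\<rfloor> \<odot> \<lfloor>\<alpha>1 (w, \<I>, ?v)\<rfloor>"
    using \<alpha>1_\<alpha>2_braid[of v w \<I> \<I>, THEN C.up] by (simp add: chase)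
  \<comment> \<open>the content of the sixth axiom: braiding after absorbing on the right is absorbing on the left\<close>
  have key: "\<lfloor>?b \<rhd>\<^sub>a\<^bsub>A\<^esub> ident C \<I>\<rfloor> \<odot> \<lfloor>inv_arr C (massoc A (v, w, \<I>))\<rfloor> \<odot> \<lfloor>act_right v ?w\<rfloor> = \<lfloor>free_tens w v\<rfloor>"
  proof -
    have "\<lfloor>?b \<rhd>\<^sub>a\<^bsub>A\<^esub> ident C \<I>\<rfloor> \<odot> \<lfloor>inv_arr C (massoc A (v, w, \<I>))\<rfloor> \<odot> \<lfloor>act_right v ?w\<rfloor> =
       \<lfloor>?b \<rhd>\<^sub>a\<^bsub>A\<^esub> ident C \<I>\<rfloor> \<odot> \<lfloor>ident V (v \<otimes>\<^bsub>V\<^esub> w) \<rhd>\<^sub>a\<^bsub>A\<^esub> runit C \<I>\<rfloor> \<odot> \<lfloor>inv_arr C (massoc A (v, w, \<I> \<otimes> \<I>))\<rfloor> \<odot> \<lfloor>ident V v \<rhd>\<^sub>a\<^bsub>A\<^esub> \<alpha>1 (w, \<I>, \<I>)\<rfloor> \<odot> \<lfloor>\<alpha>2 (v, ?w, \<I>)\<rfloor>"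
      by (simp add: act_right_def chase w1 massoc_inv_out[THEN C.re])
    also have "\<dots> = \<lfloor>ident V (w \<otimes>\<^bsub>V\<^esub> v) \<rhd>\<^sub>a\<^bsub>A\<^esub> runit C \<I>\<rfloor> \<odot> \<lfloor>?b \<rhd>\<^sub>a\<^bsub>A\<^esub> ident C (\<I> \<otimes> \<I>)\<rfloor> \<odot> \<lfloor>inv_arr C (massoc A (v, w, \<I> \<otimes> \<I>))\<rfloor> \<odot> \<lfloor>ident V v \<rhd>\<^sub>a\<^bsub>A\<^esub> \<alpha>1 (w, \<I>, \<I>)\<rfloor> \<odot> \<lfloor>\<alpha>2 (v, ?w, \<I>)\<rfloor>"
      by (simp add: act.slide)
    also have "\<dots> = \<lfloor>free_tens w v\<rfloor>"
      by (simp add: ax massoc_inv_out[THEN C.re] free_tens_def act_left_def chase w2)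
    finally show ?thesis .
  qed
  have "\<lfloor>free_tens w v \<cdot> free_braid v ?w\<rfloor> = \<lfloor>?b \<rhd>\<^sub>a\<^bsub>A\<^esub> ident C \<I>\<rfloor> \<odot> \<lfloor>inv_arr C (massoc A (v, w, \<I>))\<rfloor> \<odot> \<lfloor>act_left v ?w\<rfloor>"
    by (simp add: chase key[symmetric] act_right_free_braid_l)
  also have "\<dots> = \<lfloor>(?b \<rhd>\<^sub>a\<^bsub>A\<^esub> ident C \<I>) \<cdot> free_tens v w\<rfloor>"
    by (simp add: free_tens_def chase)
  finally show "\<lfloor>free_tens w v \<cdot> free_braid v ?w\<rfloor> = \<lfloor>(?b \<rhd>\<^sub>a\<^bsub>A\<^esub> ident C \<I>) \<cdot> free_tens v w\<rfloor>" .
qed simp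

end

locale umm = module_monoidal_category V C A \<alpha>1 \<alpha>2
  for V :: "('v, 'w) braided_cat" and C :: "('o, 'a) mon_cat" (structure)
    and A :: "('v, 'w, 'o, 'a) mod_struct" and \<alpha>1 \<alpha>2

sublocale umm \<subseteq> free: central_functor V C free_functor free_braid
  using free_functor_monoidal free_braid_half free_braid_nat free_braid_tens free_braid_unit free_braid_braid
    V.braided_category_axioms nat_isoD(2-4)[OF V.braid_iso]
  by (simp add: central_functor_def central_functor_axioms_def)

section \<open>The module monoidal category of a pair\<close>

text \<open>
  Morphisms of half-braidings are compatible with tails, for an arbitrary last factor.
\<close>

lemma (in monoidal_category) center_hom_tail_nat:
  assumes X: "half_braiding C t \<beta>" and Y: "half_braiding C u \<beta>'"
    and f: "f \<in> center_hom C (t, \<beta>) (u, \<beta>')" and [simp]: "x \<in> obj C" "z \<in> obj C"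
  shows "\<lfloor>ident C x \<otimes>\<^sub>a (f \<otimes>\<^sub>a ident C z)\<rfloor> \<odot> \<lfloor>natural_half_braiding.tail C t \<beta> x z\<rfloor> =
    \<lfloor>natural_half_braiding.tail C u \<beta>' x z\<rfloor> \<odot> \<lfloor>f \<otimes>\<^sub>a ident C (x \<otimes> z)\<rfloor>"
proof -
  interpret X: half_braided C t \<beta> by unfold_locales (rule X)
  interpret Y: half_braided C u \<beta>' by unfold_locales (rule Y)
  have [simp]: "f \<in> arr C" "src C f = t" "trg C f = u"
    using f by (auto simp: center_hom_def hom_def)
  have "(ident C x \<otimes>\<^sub>a f) \<cdot> \<beta> x = \<beta>' x \<cdot> (f \<otimes>\<^sub>a ident C x)"
    using f by (simp add: center_hom_def)
  from arg_cong[OF this, of "\<lambda>h. \<lfloor>h \<otimes>\<^sub>a ident C z\<rfloor>"]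
  have w: "\<lfloor>(ident C x \<otimes>\<^sub>a f) \<otimes>\<^sub>a ident C z\<rfloor> \<odot> \<lfloor>\<beta> x \<otimes>\<^sub>a ident C z\<rfloor> = \<lfloor>\<beta>' x \<otimes>\<^sub>a ident C z\<rfloor> \<odot> \<lfloor>(f \<otimes>\<^sub>a ident C x) \<otimes>\<^sub>a ident C z\<rfloor>"
    by (simp add: chase)
  show ?thesis
    by (simp add: X.tail_def Y.tail_def chase assoc_out assoc_out_re w[THEN re] assoc_inv_out)
qed

context central_functor
begin

lemma half: "v \<in> obj V \<Longrightarrow> half_braided C (omap F v) (B v)"
  using B_half by (simp add: half_braided_def half_braided_axioms_def D.monoidal_category_axioms)

lemma nhalf: "v \<in> obj V \<Longrightarrow> natural_half_braiding C (omap F v) (B v)"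
  using B_half by (simp add: D.half_braiding_iff)

lemma B_typ [simp]:
  assumes "v \<in> obj V" "x \<in> obj C"
  shows "B v x \<in> arr C" "src C (B v x) = omap F v \<otimes> x" "trg C (B v x) = x \<otimes> omap F v" "iso_arr C (B v x)"
  using natural_half_braiding.\<beta>_typ[OF nhalf] assms by auto

lemma braid_typ [simp]:
  assumes "v \<in> obj V" "w \<in> obj V"
  shows "braid V (v, w) \<in> arr V" "src V (braid V (v, w)) = v \<otimes>\<^bsub>V\<^esub> w" "trg V (braid V (v, w)) = w \<otimes>\<^bsub>V\<^esub> v"
  using nat_isoD(2-4)[OF V.braid_iso, of "(v, w)"] assms by auto

definition bt :: "'v \<Rightarrow> 'o \<Rightarrow> 'o \<Rightarrow> 'a" where
  "bt v = natural_half_braiding.tail C (omap F v) (B v)"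

lemma bt_typ [simp]:
  assumes "v \<in> obj V" "x \<in> obj C" "z \<in> obj C"
  shows "bt v x z \<in> arr C" "src C (bt v x z) = omap F v \<otimes> (x \<otimes> z)"
    "trg C (bt v x z) = x \<otimes> (omap F v \<otimes> z)" "iso_arr C (bt v x z)"
  using natural_half_braiding.tail_typ[OF nhalf] assms by (auto simp: bt_def)

lemma bt_assoc:
  assumes "v \<in> obj V" "x \<in> obj C" "z \<in> obj C"
  shows "\<lfloor>bt v x z\<rfloor> \<odot> \<lfloor>assoc C (omap F v, x, z)\<rfloor> = \<lfloor>assoc C (x, omap F v, z)\<rfloor> \<odot> \<lfloor>B v x \<otimes>\<^sub>a ident C z\<rfloor>"
  using natural_half_braiding.tail_assoc_l[OF nhalf] assms by (auto simp: bt_def)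

lemma bt_out:
  assumes "v \<in> obj V" "f \<in> arr C" "z \<in> obj C"
  shows "src C f = x \<Longrightarrow> \<lfloor>f \<otimes>\<^sub>a ident C (omap F v \<otimes> z)\<rfloor> \<odot> \<lfloor>bt v x z\<rfloor> =
      \<lfloor>bt v (trg C f) z\<rfloor> \<odot> \<lfloor>ident C (omap F v) \<otimes>\<^sub>a (f \<otimes>\<^sub>a ident C z)\<rfloor>"
    "src C f = x \<Longrightarrow> \<lfloor>ident C z \<otimes>\<^sub>a (ident C (omap F v) \<otimes>\<^sub>a f)\<rfloor> \<odot> \<lfloor>bt v z x\<rfloor> =
      \<lfloor>bt v z (trg C f)\<rfloor> \<odot> \<lfloor>ident C (omap F v) \<otimes>\<^sub>a (ident C z \<otimes>\<^sub>a f)\<rfloor>"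
  using natural_half_braiding.tail_out[OF nhalf] assms by (auto simp: bt_def)

lemma bt_hom:
  assumes "f \<in> arr V" "x \<in> obj C" "z \<in> obj C"
  shows "src V f = v \<Longrightarrow> \<lfloor>ident C x \<otimes>\<^sub>a (amap F f \<otimes>\<^sub>a ident C z)\<rfloor> \<odot> \<lfloor>bt v x z\<rfloor> =
    \<lfloor>bt (trg V f) x z\<rfloor> \<odot> \<lfloor>amap F f \<otimes>\<^sub>a ident C (x \<otimes> z)\<rfloor>"
  using D.center_hom_tail_nat[OF B_half B_half B_nat] assms by (auto simp: bt_def)

lemma bt_hexagon:
  assumes "v \<in> obj V" "x \<in> obj C" "y \<in> obj C" "z \<in> obj C"
  shows "\<lfloor>assoc C (x, y, omap F v \<otimes> z)\<rfloor> \<odot> \<lfloor>bt v (x \<otimes> y) z\<rfloor> =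
    \<lfloor>ident C x \<otimes>\<^sub>a bt v y z\<rfloor> \<odot> \<lfloor>bt v x (y \<otimes> z)\<rfloor> \<odot> \<lfloor>ident C (omap F v) \<otimes>\<^sub>a assoc C (x, y, z)\<rfloor>"
  using half_braided.tail_hexagon_l[OF half] assms by (auto simp: bt_def)

lemma bt_tens:
  assumes [simp]: "v \<in> obj V" "x \<in> obj C" "y \<in> obj C" "z \<in> obj C"
  shows "\<lfloor>bt v x (y \<otimes> z)\<rfloor> \<odot> \<lfloor>ident C (omap F v) \<otimes>\<^sub>a assoc C (x, y, z)\<rfloor> \<odot> \<lfloor>assoc C (omap F v, x \<otimes> y, z)\<rfloor> =
    \<lfloor>ident C x \<otimes>\<^sub>a assoc C (omap F v, y, z)\<rfloor> \<odot> \<lfloor>assoc C (x, omap F v \<otimes> y, z)\<rfloor> \<odot> \<lfloor>bt v x y \<otimes>\<^sub>a ident C z\<rfloor>"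
  using natural_half_braiding.tail_tens[OF nhalf, THEN D.up, of v x y z, folded bt_def] by (simp add: chase)

text \<open>
  Compatibility of \<open>phi2 F\<close> with the half-braidings, in the form in which the axiom
  relating \<open>\<alpha>2\<close> and \<open>massoc\<close> requires it.
\<close>

lemma bt_mult:
  assumes [simp]: "v \<in> obj V" "w \<in> obj V" "x \<in> obj C" "y \<in> obj C"
  shows "\<lfloor>bt v x (omap F w \<otimes> y)\<rfloor> \<odot> \<lfloor>ident C (omap F v) \<otimes>\<^sub>a bt w x y\<rfloor> \<odot>
      \<lfloor>assoc C (omap F v, omap F w, x \<otimes> y)\<rfloor> \<odot> \<lfloor>inv_arr C (phi2 F (v, w) \<otimes>\<^sub>a ident C (x \<otimes> y))\<rfloor> =
    \<lfloor>ident C x \<otimes>\<^sub>a assoc C (omap F v, omap F w, y)\<rfloor> \<odot> \<lfloor>inv_arr C (ident C x \<otimes>\<^sub>a (phi2 F (v, w) \<otimes>\<^sub>a ident C y))\<rfloor> \<odot> \<lfloor>bt (v \<otimes>\<^bsub>V\<^esub> w) x y\<rfloor>"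
proof -
  interpret X: half_braided C "omap F v" "B v" by (rule half) simp
  interpret Y: half_braided C "omap F w" "B w" by (rule half) simp
  interpret XY: two_half_braidings C "omap F v" "B v" "omap F w" "B w" ..
  have h: "center_tens_obj C (c v) (c w) = (omap F v \<otimes> omap F w, XY.\<beta>2)"
    by (simp add: prod_eq_iff tens_half_braid_def)
  have n: "\<lfloor>ident C x \<otimes>\<^sub>a (phi2 F (v, w) \<otimes>\<^sub>a ident C y)\<rfloor> \<odot> \<lfloor>XY.XY.tail x y\<rfloor> =
    \<lfloor>bt (v \<otimes>\<^bsub>V\<^esub> w) x y\<rfloor> \<odot> \<lfloor>phi2 F (v, w) \<otimes>\<^sub>a ident C (x \<otimes> y)\<rfloor>"
    unfolding bt_def using D.center_hom_tail_nat[OF XY.tens_half_braiding B_half, of "v \<otimes>\<^bsub>V\<^esub> w" "phi2 F (v, w)" x y] B_tens[of v w]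
    unfolding h by simp
  have n': "\<lfloor>XY.XY.tail x y\<rfloor> \<odot> \<lfloor>inv_arr C (phi2 F (v, w) \<otimes>\<^sub>a ident C (x \<otimes> y))\<rfloor> =
     \<lfloor>inv_arr C (ident C x \<otimes>\<^sub>a (phi2 F (v, w) \<otimes>\<^sub>a ident C y))\<rfloor> \<odot> \<lfloor>bt (v \<otimes>\<^bsub>V\<^esub> w) x y\<rfloor>"
    by (rule D.iso_flip) (simp_all add: n)
  have m: "\<lfloor>bt v x (omap F w \<otimes> y)\<rfloor> \<odot> \<lfloor>ident C (omap F v) \<otimes>\<^sub>a bt w x y\<rfloor> \<odot> \<lfloor>assoc C (omap F v, omap F w, x \<otimes> y)\<rfloor> =
    \<lfloor>ident C x \<otimes>\<^sub>a assoc C (omap F v, omap F w, y)\<rfloor> \<odot> \<lfloor>XY.XY.tail x y\<rfloor>"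
    using XY.tail_tens_obj_l[of x y] by (simp add: bt_def)
  show ?thesis
    by (simp add: m[THEN D.re3] D.ocmp_assoc n')
qed

text \<open>
  \<open>v\<close> acts by tensoring with \<open>F v\<close>. The inverses arise because
  \<open>massoc\<close> and \<open>\<alpha>2\<close> point away from \<open>F (v \<otimes>
  w)\<close> and from \<open>x \<otimes> (F v \<otimes> y)\<close>, whereas \<open>phi2
  F\<close> and the half-braiding point the other way.
\<close>

definition induced_act :: "('v, 'w, 'o, 'a) mod_struct" where
  "induced_act =
    \<lparr>act = \<lparr>omap = (\<lambda>(v, x) \<in> obj V \<times> obj C. omap F v \<otimes> x), amap = (\<lambda>(f, g) \<in> arr V \<times> arr C. amap F f \<otimes>\<^sub>a g)\<rparr>,
     massoc = (\<lambda>(v, w, x) \<in> obj V \<times> obj V \<times> obj C. assoc C (omap F v, omap F w, x) \<cdot> inv_arr C (phi2 F (v, w) \<otimes>\<^sub>a ident C x)),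
     munit = (\<lambda>x \<in> obj C. lunit C x \<cdot> inv_arr C (phi0 F \<otimes>\<^sub>a ident C x))\<rparr>"

definition induced_\<alpha>1 :: "'v \<times> 'o \<times> 'o \<Rightarrow> 'a" where
  "induced_\<alpha>1 = (\<lambda>(v, x, y) \<in> obj V \<times> obj C \<times> obj C. assoc C (omap F v, x, y))"

definition induced_\<alpha>2 :: "'v \<times> 'o \<times> 'o \<Rightarrow> 'a" where
  "induced_\<alpha>2 = (\<lambda>(v, x, y) \<in> obj V \<times> obj C \<times> obj C. inv_arr C (bt v x y))"

lemma induced_simps [simp]:
  "v \<in> obj V \<Longrightarrow> x \<in> obj C \<Longrightarrow> v \<rhd>\<^bsub>induced_act\<^esub> x = omap F v \<otimes> x"
  "f \<in> arr V \<Longrightarrow> g \<in> arr C \<Longrightarrow> f \<rhd>\<^sub>a\<^bsub>induced_act\<^esub> g = amap F f \<otimes>\<^sub>a g"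
  "v \<in> obj V \<Longrightarrow> w \<in> obj V \<Longrightarrow> x \<in> obj C \<Longrightarrow> massoc induced_act (v, w, x) =
    assoc C (omap F v, omap F w, x) \<cdot> inv_arr C (phi2 F (v, w) \<otimes>\<^sub>a ident C x)"
  "x \<in> obj C \<Longrightarrow> munit induced_act x = lunit C x \<cdot> inv_arr C (phi0 F \<otimes>\<^sub>a ident C x)"
  "v \<in> obj V \<Longrightarrow> x \<in> obj C \<Longrightarrow> y \<in> obj C \<Longrightarrow> induced_\<alpha>1 (v, x, y) = assoc C (omap F v, x, y)"
  "v \<in> obj V \<Longrightarrow> x \<in> obj C \<Longrightarrow> y \<in> obj C \<Longrightarrow> induced_\<alpha>2 (v, x, y) = inv_arr C (bt v x y)"
  by (simp_all add: induced_act_def induced_\<alpha>1_def induced_\<alpha>2_def)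

lemma induced_module: "module_category V C induced_act"
proof (intro module_category.intro module_category_axioms.intro V.monoidal_category_axioms D.category_axioms, goal_cases)
  case 1
  show ?case
  proof (intro cat_functor.intro cat_functor_axioms.intro prod_category V.category_axioms D.category_axioms, goal_cases)
    case 1
    show ?case by (auto simp: induced_act_def)
  next
    case 2
    show ?case by (simp add: induced_act_def)
  next
    case (3 h X Y)
    then show ?case by (auto simp: hom_def)
  next
    case (4 X)
    then show ?case by auto
  next
    case (5 h X Y h' W)
    then obtain f g f' g' where "h = (f, g)" "h' = (f', g')" "f \<in> arr V" "g \<in> arr C" "f' \<in> arr V" "g' \<in> arr C"
      by (cases h; cases h') (auto simp: hom_def)
    with 5 show ?case by (auto simp: hom_def map_cmp D.tens.bimap_cmp)
  qed
next
  case 2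
  show ?case
  proof (rule nat_isoI3, goal_cases)
    case 1
    show ?case by (simp add: induced_act_def)
  next
    case (2 v w x)
    then show ?case by (simp add: hom_def)
  next
    case (3 f g h)
    note [simp] = 3
    have n: "\<lfloor>(amap F f \<otimes>\<^sub>a amap F g) \<otimes>\<^sub>a h\<rfloor> \<odot> \<lfloor>inv_arr C (phi2 F (src V f, src V g) \<otimes>\<^sub>a ident C (src C h))\<rfloor> =
       \<lfloor>inv_arr C (phi2 F (trg V f, trg V g) \<otimes>\<^sub>a ident C (trg C h))\<rfloor> \<odot> \<lfloor>amap F (f \<otimes>\<^sub>a\<^bsub>V\<^esub> g) \<otimes>\<^sub>a h\<rfloor>"
      by (rule D.iso_flip) (simp_all add: D.tens.bimap_ocmp phi2_nat)
    have a: "\<lfloor>amap F f \<otimes>\<^sub>a (amap F g \<otimes>\<^sub>a h)\<rfloor> \<odot> \<lfloor>assoc C (omap F (src V f), omap F (src V g), src C h)\<rfloor> =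
       \<lfloor>assoc C (omap F (trg V f), omap F (trg V g), trg C h)\<rfloor> \<odot> \<lfloor>(amap F f \<otimes>\<^sub>a amap F g) \<otimes>\<^sub>a h\<rfloor>"
      using D.assoc_nat[of "amap F f" "amap F g" h, THEN D.up] by (simp add: chase)
    show ?case
      by (rule D.lift_eqI) (simp_all add: chase a[THEN D.re] n)
  qed
next
  case 3
  show ?case
  proof (rule nat_isoI, goal_cases)
    case 1
    show ?case by (simp add: induced_act_def)
  next
    case (2 x)
    then show ?case by (simp add: hom_def)
  next
    case (3 f)
    note [simp] = 3
    have n: "\<lfloor>ident C \<I> \<otimes>\<^sub>a f\<rfloor> \<odot> \<lfloor>inv_arr C (phi0 F \<otimes>\<^sub>a ident C (src C f))\<rfloor> =
       \<lfloor>inv_arr C (phi0 F \<otimes>\<^sub>a ident C (trg C f))\<rfloor> \<odot> \<lfloor>ident C (omap F \<I>\<^bsub>V\<^esub>) \<otimes>\<^sub>a f\<rfloor>"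
      by (rule D.iso_flip) (simp_all add: D.tens.slide)
    show ?case
      by (rule D.lift_eqI) (simp_all add: chase D.unit_out(1)[of f, THEN D.re] n)
  qed
next
  case (4 u v w x)
  note [simp] = 4
  let ?u = "omap F u" and ?v = "omap F v" and ?w = "omap F w"
  have p: "\<lfloor>amap F (assoc V (u, v, w)) \<otimes>\<^sub>a ident C x\<rfloor> \<odot> \<lfloor>phi2 F (u \<otimes>\<^bsub>V\<^esub> v, w) \<otimes>\<^sub>a ident C x\<rfloor> \<odot> \<lfloor>(phi2 F (u, v) \<otimes>\<^sub>a ident C ?w) \<otimes>\<^sub>a ident C x\<rfloor> =
      \<lfloor>phi2 F (u, v \<otimes>\<^bsub>V\<^esub> w) \<otimes>\<^sub>a ident C x\<rfloor> \<odot> \<lfloor>(ident C ?u \<otimes>\<^sub>a phi2 F (v, w)) \<otimes>\<^sub>a ident C x\<rfloor> \<odot> \<lfloor>assoc C (?u, ?v, ?w) \<otimes>\<^sub>a ident C x\<rfloor>"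
    using arg_cong[OF phi2_assoc[of u v w], of "\<lambda>h. \<lfloor>h \<otimes>\<^sub>a ident C x\<rfloor>"] by (simp add: chase)
  show ?case
  proof (rule D.iso_right_cancel)
    let ?h = "(phi2 F (u \<otimes>\<^bsub>V\<^esub> v, w) \<otimes>\<^sub>a ident C x) \<cdot> ((phi2 F (u, v) \<otimes>\<^sub>a ident C ?w) \<otimes>\<^sub>a ident C x)"
    show "\<lfloor>massoc induced_act (u, v, w \<rhd>\<^bsub>induced_act\<^esub> x) \<cdot> massoc induced_act (u \<otimes>\<^bsub>V\<^esub> v, w, x)\<rfloor> \<odot> \<lfloor>?h\<rfloor> =
      \<lfloor>(ident V u \<rhd>\<^sub>a\<^bsub>induced_act\<^esub> massoc induced_act (v, w, x)) \<cdot> massoc induced_act (u, v \<otimes>\<^bsub>V\<^esub> w, x) \<cdot>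
        (assoc V (u, v, w) \<rhd>\<^sub>a\<^bsub>induced_act\<^esub> ident C x)\<rfloor> \<odot> \<lfloor>?h\<rfloor>"
      by (simp add: chase p D.assoc_in D.assoc_in_re D.pentagon_l)
  qed simp_all
next
  case (5 v x)
  note [simp] = 5
  let ?v = "omap F v"
  have p: "\<lfloor>amap F (runit V v) \<otimes>\<^sub>a ident C x\<rfloor> \<odot> \<lfloor>phi2 F (v, \<I>\<^bsub>V\<^esub>) \<otimes>\<^sub>a ident C x\<rfloor> \<odot> \<lfloor>(ident C ?v \<otimes>\<^sub>a phi0 F) \<otimes>\<^sub>a ident C x\<rfloor> =
      \<lfloor>runit C ?v \<otimes>\<^sub>a ident C x\<rfloor>"
    using arg_cong[OF phi0_right[of v], of "\<lambda>h. \<lfloor>h \<otimes>\<^sub>a ident C x\<rfloor>"] by (simp add: chase)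
  show ?case
  proof (rule D.iso_right_cancel)
    let ?h = "(phi2 F (v, \<I>\<^bsub>V\<^esub>) \<otimes>\<^sub>a ident C x) \<cdot> ((ident C ?v \<otimes>\<^sub>a phi0 F) \<otimes>\<^sub>a ident C x)"
    show "\<lfloor>(ident V v \<rhd>\<^sub>a\<^bsub>induced_act\<^esub> munit induced_act x) \<cdot> massoc induced_act (v, \<I>\<^bsub>V\<^esub>, x)\<rfloor> \<odot> \<lfloor>?h\<rfloor> =
      \<lfloor>runit V v \<rhd>\<^sub>a\<^bsub>induced_act\<^esub> ident C x\<rfloor> \<odot> \<lfloor>?h\<rfloor>"
      by (simp add: chase p D.assoc_in D.triangle_l)
  qed simp_all
qed

text \<open>
  The axioms in terms of \<open>F\<close>: those on \<open>\<alpha>1\<close> alone are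
  pentagons; the hexagon, the multiplicativity of the half-braiding and \<open>bt_tens\<close>
  give those on \<open>\<alpha>2\<close>; the last one is the compatibility of \<open>F\<close>
  with braidings together with the hexagon.
\<close>

lemma induced_umm: "module_monoidal_category V C induced_act induced_\<alpha>1 induced_\<alpha>2"
proof (intro module_monoidal_category.intro module_monoidal_category_axioms.intro
    V.braided_category_axioms D.monoidal_category_axioms induced_module, goal_cases)
  case 1
  show ?case
  proof (rule nat_isoI3, goal_cases)
    case 1
    show ?case by (simp add: induced_\<alpha>1_def)
  next
    case (2 v x y)
    then show ?case by (simp add: hom_def)
  next
    case (3 f g h)
    then show ?case using D.assoc_nat[of "amap F f" g h] by simp
  qed
next
  case 2
  show ?case
  proof (rule nat_isoI3, goal_cases)
    case 1
    show ?case by (simp add: induced_\<alpha>2_def)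
  next
    case (2 v x y)
    then show ?case by (simp add: hom_def)
  next
    case (3 f g h)
    note [simp] = 3
    let ?v = "omap F (src V f)" and ?v' = "omap F (trg V f)"
    have e1: "\<lfloor>g \<otimes>\<^sub>a (amap F f \<otimes>\<^sub>a h)\<rfloor> = \<lfloor>g \<otimes>\<^sub>a ident C (?v' \<otimes> trg C h)\<rfloor> \<odot>
        \<lfloor>ident C (src C g) \<otimes>\<^sub>a (amap F f \<otimes>\<^sub>a ident C (trg C h))\<rfloor> \<odot> \<lfloor>ident C (src C g) \<otimes>\<^sub>a (ident C ?v \<otimes>\<^sub>a h)\<rfloor>"
      by (simp add: D.tens.bimap_ocmp D.tens.bimap_merge D.tens.bimap_merge(1)[of "amap F f" h, simplified])
    have e2: "\<lfloor>amap F f \<otimes>\<^sub>a (g \<otimes>\<^sub>a h)\<rfloor> = \<lfloor>ident C ?v' \<otimes>\<^sub>a (g \<otimes>\<^sub>a ident C (trg C h))\<rfloor> \<odot>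
        \<lfloor>amap F f \<otimes>\<^sub>a ident C (src C g \<otimes> trg C h)\<rfloor> \<odot> \<lfloor>ident C ?v \<otimes>\<^sub>a (ident C (src C g) \<otimes>\<^sub>a h)\<rfloor>"
      by (simp add: D.tens.bimap_ocmp D.tens.bimap_merge D.tens.bimap_merge(1)[of "amap F f" h, simplified])
    have n: "\<lfloor>amap F f \<otimes>\<^sub>a (g \<otimes>\<^sub>a h)\<rfloor> \<odot> \<lfloor>inv_arr C (bt (src V f) (src C g) (src C h))\<rfloor> =
      \<lfloor>inv_arr C (bt (trg V f) (trg C g) (trg C h))\<rfloor> \<odot> \<lfloor>g \<otimes>\<^sub>a (amap F f \<otimes>\<^sub>a h)\<rfloor>"
    proof (rule D.iso_flip)
      show "\<lfloor>bt (trg V f) (trg C g) (trg C h)\<rfloor> \<odot> \<lfloor>amap F f \<otimes>\<^sub>a (g \<otimes>\<^sub>a h)\<rfloor> =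
        \<lfloor>g \<otimes>\<^sub>a (amap F f \<otimes>\<^sub>a h)\<rfloor> \<odot> \<lfloor>bt (src V f) (src C g) (src C h)\<rfloor>"
        unfolding e1 e2 by (simp add: D.ocmp_assoc bt_out bt_out[THEN D.re] bt_hom bt_hom[THEN D.re])
    qed simp_all
    show ?case
      by (rule D.lift_eqI) (simp_all add: chase n)
  qed
next
  case (3 v x y z)
  then show ?case using D.pentagon[of "omap F v" x y z] by simp
next
  case (4 v w x y)
  note [simp] = 4
  show ?case
  proof (rule D.iso_right_cancel)
    let ?h = "(phi2 F (v, w) \<otimes>\<^sub>a ident C x) \<otimes>\<^sub>a ident C y"
    show "\<lfloor>massoc induced_act (v, w, x \<otimes> y) \<cdot> induced_\<alpha>1 (v \<otimes>\<^bsub>V\<^esub> w, x, y)\<rfloor> \<odot> \<lfloor>?h\<rfloor> =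
      \<lfloor>(ident V v \<rhd>\<^sub>a\<^bsub>induced_act\<^esub> induced_\<alpha>1 (w, x, y)) \<cdot> induced_\<alpha>1 (v, w \<rhd>\<^bsub>induced_act\<^esub> x, y) \<cdot>
        (massoc induced_act (v, w, x) \<otimes>\<^sub>a ident C y)\<rfloor> \<odot> \<lfloor>?h\<rfloor>"
      by (simp add: chase D.assoc_in D.pentagon_l)
  qed simp_all
next
  case (5 v x y z)
  note [simp] = 5
  show ?case
  proof (rule D.iso_left_cancel)
    let ?h = "(ident C x \<otimes>\<^sub>a bt v y z) \<cdot> bt v x (y \<otimes> z)"
    show "\<lfloor>?h\<rfloor> \<odot> \<lfloor>(ident V v \<rhd>\<^sub>a\<^bsub>induced_act\<^esub> assoc C (x, y, z)) \<cdot> induced_\<alpha>2 (v, x \<otimes> y, z)\<rfloor> =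
      \<lfloor>?h\<rfloor> \<odot> \<lfloor>induced_\<alpha>2 (v, x, y \<otimes> z) \<cdot> (ident C x \<otimes>\<^sub>a induced_\<alpha>2 (v, y, z)) \<cdot> assoc C (x, y, v \<rhd>\<^bsub>induced_act\<^esub> z)\<rfloor>"
      by (simp add: chase bt_hexagon[symmetric, THEN D.re3])
  qed simp_all
next
  case (6 v w x y)
  note [simp] = 6
  show ?case
  proof (rule D.iso_left_cancel)
    let ?h = "bt v x (omap F w \<otimes> y) \<cdot> (ident C (omap F v) \<otimes>\<^sub>a bt w x y)"
    show "\<lfloor>?h\<rfloor> \<odot> \<lfloor>massoc induced_act (v, w, x \<otimes> y) \<cdot> induced_\<alpha>2 (v \<otimes>\<^bsub>V\<^esub> w, x, y)\<rfloor> =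
      \<lfloor>?h\<rfloor> \<odot> \<lfloor>(ident V v \<rhd>\<^sub>a\<^bsub>induced_act\<^esub> induced_\<alpha>2 (w, x, y)) \<cdot> induced_\<alpha>2 (v, x, w \<rhd>\<^bsub>induced_act\<^esub> y) \<cdot>
        (ident C x \<otimes>\<^sub>a massoc induced_act (v, w, y))\<rfloor>"
      by (simp add: chase bt_mult[THEN D.re4])
  qed simp_all
next
  case (7 v x y z)
  note [simp] = 7
  show ?case
  proof (rule D.iso_left_cancel)
    let ?h = "bt v x (y \<otimes> z)"
    show "\<lfloor>?h\<rfloor> \<odot> \<lfloor>(ident V v \<rhd>\<^sub>a\<^bsub>induced_act\<^esub> assoc C (x, y, z)) \<cdot> induced_\<alpha>1 (v, x \<otimes> y, z) \<cdot> (induced_\<alpha>2 (v, x, y) \<otimes>\<^sub>a ident C z)\<rfloor> =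
      \<lfloor>?h\<rfloor> \<odot> \<lfloor>induced_\<alpha>2 (v, x, y \<otimes> z) \<cdot> (ident C x \<otimes>\<^sub>a induced_\<alpha>1 (v, y, z)) \<cdot> assoc C (x, v \<rhd>\<^bsub>induced_act\<^esub> y, z)\<rfloor>"
      by (simp add: chase bt_tens[THEN D.re3])
  qed simp_all
next
  case (8 v w x y)
  note [simp] = 8
  let ?v = "omap F v" and ?w = "omap F w"
  have b: "\<lfloor>amap F (braid V (v, w)) \<otimes>\<^sub>a ident C (x \<otimes> y)\<rfloor> \<odot> \<lfloor>phi2 F (v, w) \<otimes>\<^sub>a ident C (x \<otimes> y)\<rfloor> =
      \<lfloor>phi2 F (w, v) \<otimes>\<^sub>a ident C (x \<otimes> y)\<rfloor> \<odot> \<lfloor>B v ?w \<otimes>\<^sub>a ident C (x \<otimes> y)\<rfloor>"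
    using arg_cong[OF B_braid[of v w], of "\<lambda>h. \<lfloor>h \<otimes>\<^sub>a ident C (x \<otimes> y)\<rfloor>", symmetric] by (simp add: chase)
  have t: "\<lfloor>B v ?w \<otimes>\<^sub>a ident C (x \<otimes> y)\<rfloor> \<odot> \<lfloor>inv_arr C (assoc C (?v, ?w, x \<otimes> y))\<rfloor> =
      \<lfloor>inv_arr C (assoc C (?w, ?v, x \<otimes> y))\<rfloor> \<odot> \<lfloor>bt v ?w (x \<otimes> y)\<rfloor>"
    by (rule D.iso_flip) (simp_all add: bt_assoc)
  have hx: "\<lfloor>bt v ?w (x \<otimes> y) \<cdot> (ident C ?v \<otimes>\<^sub>a assoc C (?w, x, y))\<rfloor> \<odot> \<lfloor>inv_arr C (bt v (?w \<otimes> x) y)\<rfloor> =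
      \<lfloor>inv_arr C (ident C ?w \<otimes>\<^sub>a bt v x y)\<rfloor> \<odot> \<lfloor>assoc C (?w, x, ?v \<otimes> y)\<rfloor>"
    by (rule D.iso_flip) (simp_all add: chase bt_hexagon)
  then have hx': "\<lfloor>bt v ?w (x \<otimes> y)\<rfloor> \<odot> \<lfloor>ident C ?v \<otimes>\<^sub>a assoc C (?w, x, y)\<rfloor> \<odot> \<lfloor>inv_arr C (bt v (?w \<otimes> x) y)\<rfloor> =
      \<lfloor>inv_arr C (ident C ?w \<otimes>\<^sub>a bt v x y)\<rfloor> \<odot> \<lfloor>assoc C (?w, x, ?v \<otimes> y)\<rfloor>"
    by (simp add: chase)
  show ?case
    by (rule D.lift_eqI) (simp_all add: chase b[THEN D.re] t[THEN D.re] hx')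
qed

end

text \<open>
  Conversely to \<open>pair_over_central\<close>: since \<open>F\<close> is the forgetful
  functor after the lift, arrows and structure maps of the lift are determined by those of
  \<open>F\<close>, and their membership in the center is what the locale asks for.
\<close>

lemma (in pair_over) pair_central: "central_functor V (pcat P) (pfun P) (pair_braid P)"
proof -
  let ?T = "pcat P" and ?F = "pfun P" and ?Z = "pcen P"
  have om: "omap ?F v = fst (omap ?Z v)" if "v \<in> obj V" for v
    using that by (simp add: pfun_eq comp_mon_functor_def forget_def)
  then have c: "(omap ?F v, pair_braid P v) = omap ?Z v" if "v \<in> obj V" for v
    using that by (simp add: prod_eq_iff)
  have am: "amap ?Z f = (omap ?Z (src V f), amap ?F f, omap ?Z (trg V f))" "amap ?F f \<in> center_hom ?T (omap ?Z (src V f)) (omap ?Z (trg V f))"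
    if [simp]: "f \<in> arr V" for f
  proof -
    have "amap ?Z f \<in> arr (center ?T)" by simp
    then obtain X g Y where g: "amap ?Z f = (X, g, Y)" "X \<in> obj (center ?T)" "Y \<in> obj (center ?T)" "g \<in> center_hom ?T X Y"
      by (rule T.center_arr_cases)
    then have "X = omap ?Z (src V f)" "Y = omap ?Z (trg V f)"
      using FZ.map_typ(3,4)[of f] by (auto simp del: FZ.map_typ(3,4))
    moreover have "amap ?F f = g"
      using g by (simp add: pfun_eq comp_mon_functor_def forget_def)
    ultimately show "amap ?Z f = (omap ?Z (src V f), amap ?F f, omap ?Z (trg V f))"
      "amap ?F f \<in> center_hom ?T (omap ?Z (src V f)) (omap ?Z (trg V f))"
      using g by auto
  qed
  have ph: "phi2 ?Z (v, w) = (center_tens_obj ?T (omap ?Z v) (omap ?Z w), phi2 ?F (v, w), omap ?Z (v \<otimes>\<^bsub>V\<^esub> w))"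
    "phi2 ?F (v, w) \<in> center_hom ?T (center_tens_obj ?T (omap ?Z v) (omap ?Z w)) (omap ?Z (v \<otimes>\<^bsub>V\<^esub> w))"
    if [simp]: "v \<in> obj V" "w \<in> obj V" for v w
  proof -
    have "phi2 ?Z (v, w) \<in> arr (center ?T)" by simp
    then obtain X g Y where g: "phi2 ?Z (v, w) = (X, g, Y)" "X \<in> obj (center ?T)" "Y \<in> obj (center ?T)" "g \<in> center_hom ?T X Y"
        "g \<in> arr ?T" "src ?T g = fst X" "trg ?T g = fst Y"
      by (rule T.center_arr_cases)
    then have XY: "X = center_tens_obj ?T (omap ?Z v) (omap ?Z w)" "Y = omap ?Z (v \<otimes>\<^bsub>V\<^esub> w)"
      using FZ.phi2_typ(2,3)[of v w] by (auto simp del: FZ.phi2_typ(2,3))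
    moreover have "phi2 ?F (v, w) = g"
      using g XY by (simp add: pfun_eq comp_mon_functor_def forget_def)
    ultimately show "phi2 ?Z (v, w) = (center_tens_obj ?T (omap ?Z v) (omap ?Z w), phi2 ?F (v, w), omap ?Z (v \<otimes>\<^bsub>V\<^esub> w))"
      "phi2 ?F (v, w) \<in> center_hom ?T (center_tens_obj ?T (omap ?Z v) (omap ?Z w)) (omap ?Z (v \<otimes>\<^bsub>V\<^esub> w))"
      using g by auto
  qed
  have p0: "phi0 ?F \<in> center_hom ?T (center_unit ?T) (omap ?Z \<I>\<^bsub>V\<^esub>)"
  proof -
    have "phi0 ?Z \<in> arr (center ?T)" by simp
    then obtain X g Y where g: "phi0 ?Z = (X, g, Y)" "X \<in> obj (center ?T)" "Y \<in> obj (center ?T)" "g \<in> center_hom ?T X Y"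
        "g \<in> arr ?T" "src ?T g = fst X" "trg ?T g = fst Y"
      by (rule T.center_arr_cases)
    then have XY: "X = center_unit ?T" "Y = omap ?Z \<I>\<^bsub>V\<^esub>"
      using FZ.phi0_typ(2,3) by (auto simp del: FZ.phi0_typ(2,3))
    moreover have "phi0 ?F = g"
      using g XY by (simp add: pfun_eq comp_mon_functor_def forget_def)
    ultimately show ?thesis
      using g by auto
  qed
  have br: "braid V (v, w) \<in> arr V" "src V (braid V (v, w)) = v \<otimes>\<^bsub>V\<^esub> w" "trg V (braid V (v, w)) = w \<otimes>\<^bsub>V\<^esub> v"
    if "v \<in> obj V" "w \<in> obj V" for v w
    using nat_isoD(2-4)[OF V.braid_iso, of "(v, w)"] that by auto
  show ?thesis
  proof (intro central_functor.intro central_functor_axioms.intro V.braided_category_axioms F.monoidal_functor_axioms, goal_cases)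
    case (1 v)
    then show ?case using FZ.map_typ(1)[of v] om[of v] by (simp add: T.center_simps(1))
  next
    case (2 f)
    then show ?case using am(2)[of f] by (simp add: c)
  next
    case (3 v w)
    then show ?case using ph(2)[of v w] by (simp add: c)
  next
    case 4
    then show ?case using p0 by (simp add: c)
  next
    case (5 v w)
    have b: "snd (omap ?Z v) (omap ?F w) \<in> center_hom ?T (center_tens_obj ?T (omap ?Z v) (omap ?Z w)) (center_tens_obj ?T (omap ?Z w) (omap ?Z v))"
      using 5 T.center_hom_braid[of "omap ?Z v" "omap ?Z w"] by (simp add: om)
    have "amap ?F (braid V (v, w)) \<in> center_hom ?T (omap ?Z (v \<otimes>\<^bsub>V\<^esub> w)) (omap ?Z (w \<otimes>\<^bsub>V\<^esub> v))"
      using am(2)[of "braid V (v, w)"] 5 by (simp add: br)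
    then show ?case using FZ.braid_compat[of v w] 5 b ph(2)[of v w] ph(2)[of w v]
      by (simp add: am(1) ph(1) br flip: om)
  qed
qed

section \<open>Morphisms of pairs and module monoidal functors\<close>

context module_functor
begin

lemma s_typ [simp]:
  assumes "v \<in> obj V" "x \<in> obj M"
  shows "s (v, x) \<in> arr N" "src N (s (v, x)) = v \<rhd>\<^bsub>B\<^esub> omap F x" "trg N (s (v, x)) = omap F (v \<rhd>\<^bsub>A\<^esub> x)" "iso_arr N (s (v, x))"
  using nat_isoD(2-5)[OF s_iso, of "(v, x)"] assms by auto

lemma s_out:
  "x \<in> obj M \<Longrightarrow> f \<in> arr V \<Longrightarrow> src V f = v \<Longrightarrow> \<lfloor>amap F (f \<rhd>\<^sub>a\<^bsub>A\<^esub> ident M x)\<rfloor>\<^bsub>N\<^esub> \<odot>\<^bsub>N\<^esub> \<lfloor>s (v, x)\<rfloor>\<^bsub>N\<^esub> =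
    \<lfloor>s (trg V f, x)\<rfloor>\<^bsub>N\<^esub> \<odot>\<^bsub>N\<^esub> \<lfloor>f \<rhd>\<^sub>a\<^bsub>B\<^esub> ident N (omap F x)\<rfloor>\<^bsub>N\<^esub>"
  "v \<in> obj V \<Longrightarrow> g \<in> arr M \<Longrightarrow> src M g = x \<Longrightarrow> \<lfloor>amap F (ident V v \<rhd>\<^sub>a\<^bsub>A\<^esub> g)\<rfloor>\<^bsub>N\<^esub> \<odot>\<^bsub>N\<^esub> \<lfloor>s (v, x)\<rfloor>\<^bsub>N\<^esub> =
    \<lfloor>s (v, trg M g)\<rfloor>\<^bsub>N\<^esub> \<odot>\<^bsub>N\<^esub> \<lfloor>ident V v \<rhd>\<^sub>a\<^bsub>B\<^esub> amap F g\<rfloor>\<^bsub>N\<^esub>"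
  using nat_isoD(6)[OF s_iso, of "(f, ident M x)", THEN N.M.up] nat_isoD(6)[OF s_iso, of "(ident V v, g)", THEN N.M.up]
  by (auto simp: chase)

lemma s_assoc_l:
  assumes [simp]: "v \<in> obj V" "w \<in> obj V" "x \<in> obj M"
  shows "\<lfloor>amap F (massoc A (v, w, x))\<rfloor>\<^bsub>N\<^esub> \<odot>\<^bsub>N\<^esub> \<lfloor>s (v \<otimes>\<^bsub>V\<^esub> w, x)\<rfloor>\<^bsub>N\<^esub> =
      \<lfloor>s (v, w \<rhd>\<^bsub>A\<^esub> x)\<rfloor>\<^bsub>N\<^esub> \<odot>\<^bsub>N\<^esub> \<lfloor>ident V v \<rhd>\<^sub>a\<^bsub>B\<^esub> s (w, x)\<rfloor>\<^bsub>N\<^esub> \<odot>\<^bsub>N\<^esub> \<lfloor>massoc B (v, w, omap F x)\<rfloor>\<^bsub>N\<^esub>"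
  using s_assoc[of v w x, THEN N.M.up] by (simp add: chase)

lemma s_unit_l:
  assumes [simp]: "x \<in> obj M"
  shows "\<lfloor>amap F (munit A x)\<rfloor>\<^bsub>N\<^esub> \<odot>\<^bsub>N\<^esub> \<lfloor>s (\<I>\<^bsub>V\<^esub>, x)\<rfloor>\<^bsub>N\<^esub> = \<lfloor>munit B (omap F x)\<rfloor>\<^bsub>N\<^esub>"
  using s_unit[of x, THEN N.M.up] by (simp add: chase)

end

text \<open>
  Morphisms of pairs in terms of central functors, so without reference to the center.
\<close>

locale central_morphism =
  P: central_functor V C F B + Q: central_functor V D F' B' + G: monoidal_functor C D G
  for V :: "('v, 'w) braided_cat" and C :: "('o, 'a) mon_cat" and D :: "('o, 'a) mon_cat" (structure)
    and F B F' B' and G :: "('o, 'a, 'o, 'a) mon_functor" +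
  fixes \<gamma> :: "'v \<Rightarrow> 'a"
  assumes \<gamma>_hom: "v \<in> obj V \<Longrightarrow> \<gamma> v \<in> hom D (omap F' v) (omap G (omap F v))"
    and \<gamma>_iso: "v \<in> obj V \<Longrightarrow> iso_arr D (\<gamma> v)"
    and \<gamma>_nat: "f \<in> arr V \<Longrightarrow> amap G (amap F f) \<cdot> \<gamma> (src V f) = \<gamma> (trg V f) \<cdot> amap F' f"
    and \<gamma>_tens: "v \<in> obj V \<Longrightarrow> w \<in> obj V \<Longrightarrow> \<gamma> (v \<otimes>\<^bsub>V\<^esub> w) \<cdot> phi2 F' (v, w) =
      (amap G (phi2 F (v, w)) \<cdot> phi2 G (omap F v, omap F w)) \<cdot> (\<gamma> v \<otimes>\<^sub>a \<gamma> w)"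
    and \<gamma>_unit: "\<gamma> \<I>\<^bsub>V\<^esub> \<cdot> phi0 F' = amap G (phi0 F) \<cdot> phi0 G"
    and \<gamma>_braid: "v \<in> obj V \<Longrightarrow> x \<in> obj C \<Longrightarrow>
      amap G (B v x) \<cdot> phi2 G (omap F v, x) \<cdot> (\<gamma> v \<otimes>\<^sub>a ident D (omap G x)) =
      phi2 G (x, omap F v) \<cdot> (ident D (omap G x) \<otimes>\<^sub>a \<gamma> v) \<cdot> B' v (omap G x)"
begin

lemma \<gamma>_typ [simp]:
  assumes "v \<in> obj V"
  shows "\<gamma> v \<in> arr D" "src D (\<gamma> v) = omap F' v" "trg D (\<gamma> v) = omap G (omap F v)" "iso_arr D (\<gamma> v)"
  using \<gamma>_hom[OF assms] \<gamma>_iso[OF assms] by (auto simp: hom_def)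

definition strength :: "'v \<times> 'o \<Rightarrow> 'a" where
  "strength = (\<lambda>(v, x) \<in> obj V \<times> obj C. phi2 G (omap F v, x) \<cdot> (\<gamma> v \<otimes>\<^sub>a ident D (omap G x)))"

lemma strength_simp [simp]:
  "v \<in> obj V \<Longrightarrow> x \<in> obj C \<Longrightarrow> strength (v, x) = phi2 G (omap F v, x) \<cdot> (\<gamma> v \<otimes>\<^sub>a ident D (omap G x))"
  by (simp add: strength_def)

lemma strength_module_functor: "module_functor V C P.induced_act D Q.induced_act G strength"
proof (intro module_functor.intro module_functor_axioms.intro P.induced_module Q.induced_module G.cat_functor_axioms, goal_cases)
  case 1
  show ?case
  proof (rule nat_isoI2, goal_cases)
    case 1
    show ?case by (simp add: strength_def)
  next
    case (2 v x)
    then show ?case by (simp add: hom_def)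
  next
    case (3 f g)
    note [simp] = 3
    have p: "\<lfloor>amap G (amap F f \<otimes>\<^sub>a\<^bsub>C\<^esub> g)\<rfloor> \<odot> \<lfloor>phi2 G (omap F (src V f), src C g)\<rfloor> =
        \<lfloor>phi2 G (omap F (trg V f), trg C g)\<rfloor> \<odot> \<lfloor>amap G (amap F f) \<otimes>\<^sub>a amap G g\<rfloor>"
      using G.phi2_nat[of "amap F f" g, THEN Q.D.up] by (simp add: chase)
    show ?case
      by (rule Q.D.lift_eqI) (simp_all add: chase p[THEN Q.D.re] Q.D.ocmp_assoc Q.D.tens.bimap_ocmp \<gamma>_nat)
  qed
next
  case (2 v w x)
  note [simp] = 2
  let ?F = "omap F" and ?F' = "omap F'" and ?G = "omap G"
  have t: "\<lfloor>\<gamma> v \<otimes>\<^sub>a \<gamma> w\<rfloor> = \<lfloor>\<gamma> v \<otimes>\<^sub>a ident D (?G (?F w))\<rfloor> \<odot> \<lfloor>ident D (?F' v) \<otimes>\<^sub>a \<gamma> w\<rfloor>"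
    by (simp add: Q.D.tens.bimap_ocmp)
  have t': "\<gamma> v \<otimes>\<^sub>a \<gamma> w = (\<gamma> v \<otimes>\<^sub>a ident D (?G (?F w))) \<cdot> (ident D (?F' v) \<otimes>\<^sub>a \<gamma> w)"
    by (rule Q.D.lift_eqI) (simp_all add: chase t)
  have g: "\<lfloor>\<gamma> (v \<otimes>\<^bsub>V\<^esub> w) \<otimes>\<^sub>a ident D (?G x)\<rfloor> \<odot> \<lfloor>phi2 F' (v, w) \<otimes>\<^sub>a ident D (?G x)\<rfloor> =
     \<lfloor>amap G (phi2 F (v, w)) \<otimes>\<^sub>a ident D (?G x)\<rfloor> \<odot> \<lfloor>phi2 G (?F v, ?F w) \<otimes>\<^sub>a ident D (?G x)\<rfloor> \<odot>
     \<lfloor>(\<gamma> v \<otimes>\<^sub>a ident D (?G (?F w))) \<otimes>\<^sub>a ident D (?G x)\<rfloor> \<odot> \<lfloor>(ident D (?F' v) \<otimes>\<^sub>a \<gamma> w) \<otimes>\<^sub>a ident D (?G x)\<rfloor>"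
    using arg_cong[OF \<gamma>_tens[of v w], of "\<lambda>h. \<lfloor>h \<otimes>\<^sub>a ident D (?G x)\<rfloor>"] by (simp add: chase t')
  show ?case
  proof (rule Q.D.iso_right_cancel)
    let ?h = "phi2 F' (v, w) \<otimes>\<^sub>a ident D (?G x)"
    show "\<lfloor>amap G (massoc P.induced_act (v, w, x)) \<cdot> strength (v \<otimes>\<^bsub>V\<^esub> w, x)\<rfloor> \<odot> \<lfloor>?h\<rfloor> =
      \<lfloor>strength (v, w \<rhd>\<^bsub>P.induced_act\<^esub> x) \<cdot> (ident V v \<rhd>\<^sub>a\<^bsub>Q.induced_act\<^esub> strength (w, x)) \<cdot> massoc Q.induced_act (v, w, ?G x)\<rfloor> \<odot> \<lfloor>?h\<rfloor>"
      by (simp add: chase g G.phi2_in G.phi2_in[THEN Q.D.re] G.phi2_assoc_l[THEN Q.D.re3] Q.D.assoc_in Q.D.assoc_in_re Q.D.tens.slide')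
  qed simp_all
next
  case (3 x)
  note [simp] = 3
  let ?G = "omap G"
  have g: "\<lfloor>\<gamma> \<I>\<^bsub>V\<^esub> \<otimes>\<^sub>a ident D (?G x)\<rfloor> \<odot> \<lfloor>phi0 F' \<otimes>\<^sub>a ident D (?G x)\<rfloor> =
     \<lfloor>amap G (phi0 F) \<otimes>\<^sub>a ident D (?G x)\<rfloor> \<odot> \<lfloor>phi0 G \<otimes>\<^sub>a ident D (?G x)\<rfloor>"
    using arg_cong[OF \<gamma>_unit, of "\<lambda>h. \<lfloor>h \<otimes>\<^sub>a ident D (?G x)\<rfloor>"] by (simp add: chase)
  show ?case
  proof (rule Q.D.iso_right_cancel)
    let ?h = "phi0 F' \<otimes>\<^sub>a ident D (?G x)"
    show "\<lfloor>amap G (munit P.induced_act x) \<cdot> strength (\<I>\<^bsub>V\<^esub>, x)\<rfloor> \<odot> \<lfloor>?h\<rfloor> = \<lfloor>munit Q.induced_act (?G x)\<rfloor> \<odot> \<lfloor>?h\<rfloor>"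
      by (simp add: chase g G.phi2_in[THEN Q.D.re] G.phi0_left_l)
  qed simp_all
qed

lemma strength_\<alpha>1:
  assumes [simp]: "v \<in> obj V" "x \<in> obj C" "y \<in> obj C"
  shows "strength (v, x \<otimes>\<^bsub>C\<^esub> y) \<cdot> (ident V v \<rhd>\<^sub>a\<^bsub>Q.induced_act\<^esub> phi2 G (x, y)) \<cdot> Q.induced_\<alpha>1 (v, omap G x, omap G y) =
    amap G (P.induced_\<alpha>1 (v, x, y)) \<cdot> phi2 G (v \<rhd>\<^bsub>P.induced_act\<^esub> x, y) \<cdot> (strength (v, x) \<otimes>\<^sub>a ident D (omap G y))"
  by (rule Q.D.lift_eqI) (simp_all add: chase G.phi2_assoc_l[THEN Q.D.re3] Q.D.assoc_in Q.D.tens.slide')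

text \<open>
  Here the compatibility of \<open>\<gamma>\<close> with the half-braidings enters. The equation
  is composed with the tail that \<open>\<alpha>2\<close> inverts, which leaves an equation
  about the half-braidings themselves.
\<close>

lemma strength_\<alpha>2:
  assumes [simp]: "v \<in> obj V" "x \<in> obj C" "y \<in> obj C"
  shows "strength (v, x \<otimes>\<^bsub>C\<^esub> y) \<cdot> (ident V v \<rhd>\<^sub>a\<^bsub>Q.induced_act\<^esub> phi2 G (x, y)) \<cdot> Q.induced_\<alpha>2 (v, omap G x, omap G y) =
    amap G (P.induced_\<alpha>2 (v, x, y)) \<cdot> phi2 G (x, v \<rhd>\<^bsub>P.induced_act\<^esub> y) \<cdot> (ident D (omap G x) \<otimes>\<^sub>a strength (v, y))"
    (is "?f = ?g")
proof (rule Q.D.iso_right_cancel)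
  let ?X = "omap G x" and ?Y = "omap G y" and ?v = "omap F v" and ?v' = "omap F' v" and ?h = "Q.bt v (omap G x) (omap G y) \<cdot> assoc D (omap F' v, omap G x, omap G y)"
  have b: "\<lfloor>phi2 G (x, ?v) \<otimes>\<^sub>a ident D ?Y\<rfloor> \<odot> \<lfloor>(ident D ?X \<otimes>\<^sub>a \<gamma> v) \<otimes>\<^sub>a ident D ?Y\<rfloor> \<odot> \<lfloor>B' v ?X \<otimes>\<^sub>a ident D ?Y\<rfloor> =
     \<lfloor>amap G (B v x) \<otimes>\<^sub>a ident D ?Y\<rfloor> \<odot> \<lfloor>phi2 G (?v, x) \<otimes>\<^sub>a ident D ?Y\<rfloor> \<odot> \<lfloor>(\<gamma> v \<otimes>\<^sub>a ident D ?X) \<otimes>\<^sub>a ident D ?Y\<rfloor>"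
    using arg_cong[OF \<gamma>_braid[of v x], of "\<lambda>h. \<lfloor>h \<otimes>\<^sub>a ident D ?Y\<rfloor>", symmetric] by (simp add: chase)
  have "P.bt v x y \<cdot>\<^bsub>C\<^esub> assoc C (?v, x, y) = assoc C (x, ?v, y) \<cdot>\<^bsub>C\<^esub> (B v x \<otimes>\<^sub>a\<^bsub>C\<^esub> ident C y)"
    by (rule P.D.lift_eqI) (simp_all add: chase P.bt_assoc)
  from arg_cong[OF this, of "\<lambda>h. \<lfloor>amap G h\<rfloor>"]
  have t: "\<lfloor>amap G (assoc C (x, ?v, y))\<rfloor> \<odot> \<lfloor>amap G (B v x \<otimes>\<^sub>a\<^bsub>C\<^esub> ident C y)\<rfloor> =
      \<lfloor>amap G (P.bt v x y)\<rfloor> \<odot> \<lfloor>amap G (assoc C (?v, x, y))\<rfloor>"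
    by (simp add: chase)
  have "\<lfloor>?g\<rfloor> \<odot> \<lfloor>?h\<rfloor> = \<lfloor>inv_arr D (amap G (P.bt v x y))\<rfloor> \<odot> \<lfloor>phi2 G (x, ?v \<otimes>\<^bsub>C\<^esub> y)\<rfloor> \<odot> \<lfloor>ident D ?X \<otimes>\<^sub>a phi2 G (?v, y)\<rfloor> \<odot>
      \<lfloor>assoc D (?X, omap G ?v, ?Y)\<rfloor> \<odot> \<lfloor>(ident D ?X \<otimes>\<^sub>a \<gamma> v) \<otimes>\<^sub>a ident D ?Y\<rfloor> \<odot> \<lfloor>B' v ?X \<otimes>\<^sub>a ident D ?Y\<rfloor>"
    by (simp add: chase Q.bt_assoc Q.D.assoc_out_re)
  also have "\<dots> = \<lfloor>amap G (assoc C (?v, x, y))\<rfloor> \<odot> \<lfloor>phi2 G (?v \<otimes>\<^bsub>C\<^esub> x, y)\<rfloor> \<odot> \<lfloor>phi2 G (?v, x) \<otimes>\<^sub>a ident D ?Y\<rfloor> \<odot> \<lfloor>(\<gamma> v \<otimes>\<^sub>a ident D ?X) \<otimes>\<^sub>a ident D ?Y\<rfloor>"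
    by (simp add: chase G.phi2_assoc_l[symmetric, THEN Q.D.re3] b G.phi2_in[THEN Q.D.re] t[THEN Q.D.re])
  also have "\<dots> = \<lfloor>?f\<rfloor> \<odot> \<lfloor>?h\<rfloor>"
    by (simp add: chase G.phi2_assoc_l[THEN Q.D.re3] Q.D.assoc_in Q.D.tens.slide')
  finally show "\<lfloor>?f\<rfloor> \<odot> \<lfloor>?h\<rfloor> = \<lfloor>?g\<rfloor> \<odot> \<lfloor>?h\<rfloor>" by simp
qed simp_all

end

sublocale umm_functor \<subseteq> S: umm V "ucat M" "uact M" "alpha1 M" "alpha2 M"
  using source by (simp add: umm_def)

sublocale umm_functor \<subseteq> T: umm V "ucat N" "uact N" "alpha1 N" "alpha2 N"
  using target by (simp add: umm_def)

context umm_functor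
begin

abbreviation "MC \<equiv> ucat M"
abbreviation "NC \<equiv> ucat N"
abbreviation "G \<equiv> ufun F"
abbreviation "st \<equiv> ustr F"

lemma alpha1_compat_l:
  assumes [simp]: "v \<in> obj V" "x \<in> obj MC" "y \<in> obj MC"
  shows "\<lfloor>amap G (alpha1 M (v, x, y))\<rfloor>\<^bsub>NC\<^esub> \<odot>\<^bsub>NC\<^esub> \<lfloor>phi2 G (v \<rhd>\<^bsub>uact M\<^esub> x, y)\<rfloor>\<^bsub>NC\<^esub> \<odot>\<^bsub>NC\<^esub> \<lfloor>st (v, x) \<otimes>\<^sub>a\<^bsub>NC\<^esub> ident NC (omap G y)\<rfloor>\<^bsub>NC\<^esub> =
    \<lfloor>st (v, x \<otimes>\<^bsub>MC\<^esub> y)\<rfloor>\<^bsub>NC\<^esub> \<odot>\<^bsub>NC\<^esub> \<lfloor>ident V v \<rhd>\<^sub>a\<^bsub>uact N\<^esub> phi2 G (x, y)\<rfloor>\<^bsub>NC\<^esub> \<odot>\<^bsub>NC\<^esub> \<lfloor>alpha1 N (v, omap G x, omap G y)\<rfloor>\<^bsub>NC\<^esub>"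
  using alpha1_compat[of v x y, THEN D.up, symmetric] by (simp add: chase)

lemma alpha2_compat_l:
  assumes [simp]: "v \<in> obj V" "x \<in> obj MC" "y \<in> obj MC"
  shows "\<lfloor>amap G (alpha2 M (v, x, y))\<rfloor>\<^bsub>NC\<^esub> \<odot>\<^bsub>NC\<^esub> \<lfloor>phi2 G (x, v \<rhd>\<^bsub>uact M\<^esub> y)\<rfloor>\<^bsub>NC\<^esub> \<odot>\<^bsub>NC\<^esub> \<lfloor>ident NC (omap G x) \<otimes>\<^sub>a\<^bsub>NC\<^esub> st (v, y)\<rfloor>\<^bsub>NC\<^esub> =
    \<lfloor>st (v, x \<otimes>\<^bsub>MC\<^esub> y)\<rfloor>\<^bsub>NC\<^esub> \<odot>\<^bsub>NC\<^esub> \<lfloor>ident V v \<rhd>\<^sub>a\<^bsub>uact N\<^esub> phi2 G (x, y)\<rfloor>\<^bsub>NC\<^esub> \<odot>\<^bsub>NC\<^esub> \<lfloor>alpha2 N (v, omap G x, omap G y)\<rfloor>\<^bsub>NC\<^esub>"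
  using alpha2_compat[of v x y, THEN D.up, symmetric] by (simp add: chase)

text \<open>
  The arrow \<open>v \<rhd> \<I> \<rightarrow> v \<rhd> G \<I> \<rightarrow> G (v \<rhd>
  \<I>)\<close> between free objects.
\<close>

definition unit_strength :: "'v \<Rightarrow> 'a" where
  "unit_strength = (\<lambda>v \<in> obj V. st (v, \<I>\<^bsub>MC\<^esub>) \<cdot>\<^bsub>NC\<^esub> (ident V v \<rhd>\<^sub>a\<^bsub>uact N\<^esub> phi0 G))"

lemma unit_strength_simp: "v \<in> obj V \<Longrightarrow> unit_strength v = st (v, \<I>\<^bsub>MC\<^esub>) \<cdot>\<^bsub>NC\<^esub> (ident V v \<rhd>\<^sub>a\<^bsub>uact N\<^esub> phi0 G)"
  by (simp add: unit_strength_def)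

lemma unit_strength_typ [simp]:
  assumes "v \<in> obj V"
  shows "unit_strength v \<in> arr NC" "src NC (unit_strength v) = v \<rhd>\<^bsub>uact N\<^esub> \<I>\<^bsub>NC\<^esub>"
    "trg NC (unit_strength v) = omap G (v \<rhd>\<^bsub>uact M\<^esub> \<I>\<^bsub>MC\<^esub>)" "iso_arr NC (unit_strength v)"
  using assms by (simp_all add: unit_strength_simp)

text \<open>
  A module monoidal functor preserves \<open>act_left\<close>, because \<open>act_left\<close>
  is built from \<open>\<alpha>1\<close> and the left unit constraint, and the functor preserves
  both.
\<close>

lemma strength_act_left:
  assumes [simp]: "v \<in> obj V" "x \<in> obj MC"
  shows "amap G (S.act_left v x) \<cdot>\<^bsub>NC\<^esub> phi2 G (v \<rhd>\<^bsub>uact M\<^esub> \<I>\<^bsub>MC\<^esub>, x) \<cdot>\<^bsub>NC\<^esub> (unit_strength v \<otimes>\<^sub>a\<^bsub>NC\<^esub> ident NC (omap G x)) =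
    st (v, x) \<cdot>\<^bsub>NC\<^esub> T.act_left v (omap G x)"
proof -
  let ?v = "ident V v" and ?X = "omap G x"
  have p: "\<lfloor>?v \<rhd>\<^sub>a\<^bsub>uact N\<^esub> amap G (lunit MC x)\<rfloor>\<^bsub>NC\<^esub> \<odot>\<^bsub>NC\<^esub> \<lfloor>?v \<rhd>\<^sub>a\<^bsub>uact N\<^esub> phi2 G (\<I>\<^bsub>MC\<^esub>, x)\<rfloor>\<^bsub>NC\<^esub> \<odot>\<^bsub>NC\<^esub>
      \<lfloor>?v \<rhd>\<^sub>a\<^bsub>uact N\<^esub> (phi0 G \<otimes>\<^sub>a\<^bsub>NC\<^esub> ident NC ?X)\<rfloor>\<^bsub>NC\<^esub> = \<lfloor>?v \<rhd>\<^sub>a\<^bsub>uact N\<^esub> lunit NC ?X\<rfloor>\<^bsub>NC\<^esub>"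
    using arg_cong[OF phi0_left[of x], of "\<lambda>h. \<lfloor>?v \<rhd>\<^sub>a\<^bsub>uact N\<^esub> h\<rfloor>\<^bsub>NC\<^esub>"] by (simp add: chase)
  show ?thesis
    by (rule D.lift_eqI)
      (simp_all add: unit_strength_simp S.act_left_def T.act_left_def chase alpha1_compat_l[THEN D.re3] s_out[THEN D.re] T.\<alpha>1_in p[THEN D.re3])
qed

lemma strength_act_right:
  assumes [simp]: "v \<in> obj V" "x \<in> obj MC"
  shows "amap G (S.act_right v x) \<cdot>\<^bsub>NC\<^esub> phi2 G (x, v \<rhd>\<^bsub>uact M\<^esub> \<I>\<^bsub>MC\<^esub>) \<cdot>\<^bsub>NC\<^esub> (ident NC (omap G x) \<otimes>\<^sub>a\<^bsub>NC\<^esub> unit_strength v) =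
    st (v, x) \<cdot>\<^bsub>NC\<^esub> T.act_right v (omap G x)"
proof -
  let ?v = "ident V v" and ?X = "omap G x"
  have p: "\<lfloor>?v \<rhd>\<^sub>a\<^bsub>uact N\<^esub> amap G (runit MC x)\<rfloor>\<^bsub>NC\<^esub> \<odot>\<^bsub>NC\<^esub> \<lfloor>?v \<rhd>\<^sub>a\<^bsub>uact N\<^esub> phi2 G (x, \<I>\<^bsub>MC\<^esub>)\<rfloor>\<^bsub>NC\<^esub> \<odot>\<^bsub>NC\<^esub>
      \<lfloor>?v \<rhd>\<^sub>a\<^bsub>uact N\<^esub> (ident NC ?X \<otimes>\<^sub>a\<^bsub>NC\<^esub> phi0 G)\<rfloor>\<^bsub>NC\<^esub> = \<lfloor>?v \<rhd>\<^sub>a\<^bsub>uact N\<^esub> runit NC ?X\<rfloor>\<^bsub>NC\<^esub>"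
    using arg_cong[OF phi0_right[of x], of "\<lambda>h. \<lfloor>?v \<rhd>\<^sub>a\<^bsub>uact N\<^esub> h\<rfloor>\<^bsub>NC\<^esub>"] by (simp add: chase)
  show ?thesis
    by (rule D.lift_eqI)
      (simp_all add: unit_strength_simp S.act_right_def T.act_right_def chase alpha2_compat_l[THEN D.re3] s_out[THEN D.re] T.\<alpha>2_in p[THEN D.re3])
qed

lemma strength_act_left_l:
  assumes [simp]: "v \<in> obj V" "x \<in> obj MC"
  shows "\<lfloor>amap G (S.act_left v x)\<rfloor>\<^bsub>NC\<^esub> \<odot>\<^bsub>NC\<^esub> \<lfloor>phi2 G (v \<rhd>\<^bsub>uact M\<^esub> \<I>\<^bsub>MC\<^esub>, x)\<rfloor>\<^bsub>NC\<^esub> \<odot>\<^bsub>NC\<^esub> \<lfloor>unit_strength v \<otimes>\<^sub>a\<^bsub>NC\<^esub> ident NC (omap G x)\<rfloor>\<^bsub>NC\<^esub> =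
    \<lfloor>st (v, x)\<rfloor>\<^bsub>NC\<^esub> \<odot>\<^bsub>NC\<^esub> \<lfloor>T.act_left v (omap G x)\<rfloor>\<^bsub>NC\<^esub>"
  using strength_act_left[THEN D.up, of v x] by (simp add: chase)

lemma strength_act_right_l:
  assumes [simp]: "v \<in> obj V" "x \<in> obj MC"
  shows "\<lfloor>amap G (S.act_right v x)\<rfloor>\<^bsub>NC\<^esub> \<odot>\<^bsub>NC\<^esub> \<lfloor>phi2 G (x, v \<rhd>\<^bsub>uact M\<^esub> \<I>\<^bsub>MC\<^esub>)\<rfloor>\<^bsub>NC\<^esub> \<odot>\<^bsub>NC\<^esub> \<lfloor>ident NC (omap G x) \<otimes>\<^sub>a\<^bsub>NC\<^esub> unit_strength v\<rfloor>\<^bsub>NC\<^esub> =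
    \<lfloor>st (v, x)\<rfloor>\<^bsub>NC\<^esub> \<odot>\<^bsub>NC\<^esub> \<lfloor>T.act_right v (omap G x)\<rfloor>\<^bsub>NC\<^esub>"
  using strength_act_right[THEN D.up, of v x] by (simp add: chase)

text \<open>
  Multiplication and half-braiding of the free functor are defined from \<open>act_left\<close>
  and \<open>act_right\<close>, so their preservation follows from that of the latter after
  cancelling an invertible arrow.
\<close>

lemma unit_strength_central:
  "central_morphism V MC NC S.free_functor S.free_braid T.free_functor T.free_braid G unit_strength"
proof (intro central_morphism.intro central_morphism_axioms.intro S.free.central_functor_axioms T.free.central_functor_axioms
    monoidal_functor_axioms, goal_cases)
  case (1 v)
  then show ?case by (simp add: hom_def)
next
  case (2 v)
  then show ?case by simp
next
  case (3 f)
  note [simp] = 3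
  show ?case
    by (rule D.lift_eqI) (simp_all add: unit_strength_simp chase s_out[THEN D.re] N.act.slide)
next
  case (4 v w)
  note [simp] = 4
  let ?v = "v \<rhd>\<^bsub>uact M\<^esub> \<I>\<^bsub>MC\<^esub>" and ?w = "w \<rhd>\<^bsub>uact M\<^esub> \<I>\<^bsub>MC\<^esub>"
  have m: "\<lfloor>amap G (massoc (uact M) (v, w, \<I>\<^bsub>MC\<^esub>))\<rfloor>\<^bsub>NC\<^esub> \<odot>\<^bsub>NC\<^esub> \<lfloor>amap G (S.free_tens v w)\<rfloor>\<^bsub>NC\<^esub> = \<lfloor>amap G (S.act_left v ?w)\<rfloor>\<^bsub>NC\<^esub>"
    using arg_cong[OF S.massoc_free_tens[of v w], of "\<lambda>h. \<lfloor>amap G h\<rfloor>\<^bsub>NC\<^esub>"] by (simp add: chase)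
  have u: "\<lfloor>ident V v \<rhd>\<^sub>a\<^bsub>uact N\<^esub> unit_strength w\<rfloor>\<^bsub>NC\<^esub> = \<lfloor>ident V v \<rhd>\<^sub>a\<^bsub>uact N\<^esub> st (w, \<I>\<^bsub>MC\<^esub>)\<rfloor>\<^bsub>NC\<^esub> \<odot>\<^bsub>NC\<^esub>
      \<lfloor>ident V v \<rhd>\<^sub>a\<^bsub>uact N\<^esub> (ident V w \<rhd>\<^sub>a\<^bsub>uact N\<^esub> phi0 G)\<rfloor>\<^bsub>NC\<^esub>"
    by (simp add: unit_strength_simp chase)
  have t: "\<lfloor>unit_strength v \<otimes>\<^sub>a\<^bsub>NC\<^esub> unit_strength w\<rfloor>\<^bsub>NC\<^esub> = \<lfloor>unit_strength v \<otimes>\<^sub>a\<^bsub>NC\<^esub> ident NC (omap G ?w)\<rfloor>\<^bsub>NC\<^esub> \<odot>\<^bsub>NC\<^esub>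
      \<lfloor>ident NC (v \<rhd>\<^bsub>uact N\<^esub> \<I>\<^bsub>NC\<^esub>) \<otimes>\<^sub>a\<^bsub>NC\<^esub> unit_strength w\<rfloor>\<^bsub>NC\<^esub>"
    by (simp add: D.tens.bimap_ocmp)
  show ?case
  proof (rule D.iso_left_cancel)
    let ?h = "amap G (massoc (uact M) (v, w, \<I>\<^bsub>MC\<^esub>))"
    have "\<lfloor>?h\<rfloor>\<^bsub>NC\<^esub> \<odot>\<^bsub>NC\<^esub> \<lfloor>unit_strength (v \<otimes>\<^bsub>V\<^esub> w) \<cdot>\<^bsub>NC\<^esub> phi2 T.free_functor (v, w)\<rfloor>\<^bsub>NC\<^esub> =
        \<lfloor>st (v, ?w)\<rfloor>\<^bsub>NC\<^esub> \<odot>\<^bsub>NC\<^esub> \<lfloor>ident V v \<rhd>\<^sub>a\<^bsub>uact N\<^esub> unit_strength w\<rfloor>\<^bsub>NC\<^esub> \<odot>\<^bsub>NC\<^esub> \<lfloor>T.act_left v (w \<rhd>\<^bsub>uact N\<^esub> \<I>\<^bsub>NC\<^esub>)\<rfloor>\<^bsub>NC\<^esub>"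
      unfolding u by (simp add: unit_strength_simp chase s_assoc_l[THEN D.re] N.massoc_in[THEN D.re] T.massoc_free_tens_l)
    also have "\<dots> = \<lfloor>?h\<rfloor>\<^bsub>NC\<^esub> \<odot>\<^bsub>NC\<^esub> \<lfloor>(amap G (phi2 S.free_functor (v, w)) \<cdot>\<^bsub>NC\<^esub> phi2 G (omap S.free_functor v, omap S.free_functor w)) \<cdot>\<^bsub>NC\<^esub>
        (unit_strength v \<otimes>\<^sub>a\<^bsub>NC\<^esub> unit_strength w)\<rfloor>\<^bsub>NC\<^esub>"
      by (simp add: chase m[THEN D.re] t strength_act_left_l[THEN D.re3] T.act_left_out)
    finally show "\<lfloor>?h\<rfloor>\<^bsub>NC\<^esub> \<odot>\<^bsub>NC\<^esub> \<lfloor>unit_strength (v \<otimes>\<^bsub>V\<^esub> w) \<cdot>\<^bsub>NC\<^esub> phi2 T.free_functor (v, w)\<rfloor>\<^bsub>NC\<^esub> =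
        \<lfloor>?h\<rfloor>\<^bsub>NC\<^esub> \<odot>\<^bsub>NC\<^esub> \<lfloor>(amap G (phi2 S.free_functor (v, w)) \<cdot>\<^bsub>NC\<^esub> phi2 G (omap S.free_functor v, omap S.free_functor w)) \<cdot>\<^bsub>NC\<^esub>
        (unit_strength v \<otimes>\<^sub>a\<^bsub>NC\<^esub> unit_strength w)\<rfloor>\<^bsub>NC\<^esub>" .
  qed simp_all
next
  case 5
  show ?case
  proof (rule D.iso_left_cancel)
    let ?h = "amap G (munit (uact M) \<I>\<^bsub>MC\<^esub>)"
    show "\<lfloor>?h\<rfloor>\<^bsub>NC\<^esub> \<odot>\<^bsub>NC\<^esub> \<lfloor>unit_strength \<I>\<^bsub>V\<^esub> \<cdot>\<^bsub>NC\<^esub> phi0 T.free_functor\<rfloor>\<^bsub>NC\<^esub> = \<lfloor>?h\<rfloor>\<^bsub>NC\<^esub> \<odot>\<^bsub>NC\<^esub> \<lfloor>amap G (phi0 S.free_functor) \<cdot>\<^bsub>NC\<^esub> phi0 G\<rfloor>\<^bsub>NC\<^esub>"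
      by (simp add: unit_strength_simp chase s_unit_l[THEN D.re] N.munit_in[THEN D.re])
  qed simp_all
next
  case (6 v x)
  note [simp] = 6
  have m: "\<lfloor>amap G (S.act_right v x)\<rfloor>\<^bsub>NC\<^esub> \<odot>\<^bsub>NC\<^esub> \<lfloor>amap G (S.free_braid v x)\<rfloor>\<^bsub>NC\<^esub> = \<lfloor>amap G (S.act_left v x)\<rfloor>\<^bsub>NC\<^esub>"
    using arg_cong[OF S.act_right_free_braid[of v x], of "\<lambda>h. \<lfloor>amap G h\<rfloor>\<^bsub>NC\<^esub>"] by (simp add: chase)
  show ?case
  proof (rule D.iso_left_cancel)
    let ?h = "amap G (S.act_right v x)"
    show "\<lfloor>?h\<rfloor>\<^bsub>NC\<^esub> \<odot>\<^bsub>NC\<^esub> \<lfloor>amap G (S.free_braid v x) \<cdot>\<^bsub>NC\<^esub> phi2 G (omap S.free_functor v, x) \<cdot>\<^bsub>NC\<^esub> (unit_strength v \<otimes>\<^sub>a\<^bsub>NC\<^esub> ident NC (omap G x))\<rfloor>\<^bsub>NC\<^esub> =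
      \<lfloor>?h\<rfloor>\<^bsub>NC\<^esub> \<odot>\<^bsub>NC\<^esub> \<lfloor>phi2 G (x, omap S.free_functor v) \<cdot>\<^bsub>NC\<^esub> (ident NC (omap G x) \<otimes>\<^sub>a\<^bsub>NC\<^esub> unit_strength v) \<cdot>\<^bsub>NC\<^esub> T.free_braid v (omap G x)\<rfloor>\<^bsub>NC\<^esub>"
      by (simp add: chase m[THEN D.re] strength_act_left_l strength_act_right_l[THEN D.re3] T.act_right_free_braid_l)
  qed simp_all
qed

end

section \<open>Strict 2-categories of structured categories\<close>

text \<open>
  Pairs and module monoidal categories form 2-categories for the same reason: 1-cells have
  underlying functors and compose strictly, and the 2-cells are natural transformations between
  these that are closed under identities and both compositions. Interchange then is naturality.
\<close>

locale concrete_two_category =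
  fixes Os :: "'x set" and H :: "'x \<Rightarrow> 'x \<Rightarrow> 'f set" and i :: "'x \<Rightarrow> 'f"
    and c :: "'x \<Rightarrow> 'x \<Rightarrow> 'x \<Rightarrow> 'f \<Rightarrow> 'f \<Rightarrow> 'f"
    and T :: "'x \<Rightarrow> 'x \<Rightarrow> 'f \<Rightarrow> 'f \<Rightarrow> ('o \<Rightarrow> 'a) set"
    and U :: "'x \<Rightarrow> ('o, 'a) mon_cat" and u :: "'f \<Rightarrow> ('o, 'a, 'o, 'a) mon_functor"
  assumes U_cat: "X \<in> Os \<Longrightarrow> category (U X)"
    and u_functor: "X \<in> Os \<Longrightarrow> Y \<in> Os \<Longrightarrow> F \<in> H X Y \<Longrightarrow> cat_functor (U X) (U Y) (u F)"
    and i_in: "X \<in> Os \<Longrightarrow> i X \<in> H X X"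
    and c_in: "X \<in> Os \<Longrightarrow> Y \<in> Os \<Longrightarrow> Z \<in> Os \<Longrightarrow> F \<in> H X Y \<Longrightarrow> G \<in> H Y Z \<Longrightarrow> c X Y Z G F \<in> H X Z"
    and c_right: "X \<in> Os \<Longrightarrow> Y \<in> Os \<Longrightarrow> F \<in> H X Y \<Longrightarrow> c X X Y F (i X) = F"
    and c_left: "X \<in> Os \<Longrightarrow> Y \<in> Os \<Longrightarrow> F \<in> H X Y \<Longrightarrow> c X Y Y (i Y) F = F"
    and c_assoc: "W \<in> Os \<Longrightarrow> X \<in> Os \<Longrightarrow> Y \<in> Os \<Longrightarrow> Z \<in> Os \<Longrightarrow> F \<in> H W X \<Longrightarrow> G \<in> H X Y \<Longrightarrow> K \<in> H Y Z \<Longrightarrow>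
      c W X Z (c X Y Z K G) F = c W Y Z K (c W X Y G F)"
    and u_i: "X \<in> Os \<Longrightarrow> x \<in> obj (U X) \<Longrightarrow> omap (u (i X)) x = x"
      "X \<in> Os \<Longrightarrow> f \<in> arr (U X) \<Longrightarrow> amap (u (i X)) f = f"
    and u_c: "X \<in> Os \<Longrightarrow> Y \<in> Os \<Longrightarrow> Z \<in> Os \<Longrightarrow> F \<in> H X Y \<Longrightarrow> G \<in> H Y Z \<Longrightarrow> x \<in> obj (U X) \<Longrightarrow>
        omap (u (c X Y Z G F)) x = omap (u G) (omap (u F) x)"
      "X \<in> Os \<Longrightarrow> Y \<in> Os \<Longrightarrow> Z \<in> Os \<Longrightarrow> F \<in> H X Y \<Longrightarrow> G \<in> H Y Z \<Longrightarrow> f \<in> arr (U X) \<Longrightarrow>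
        amap (u (c X Y Z G F)) f = amap (u G) (amap (u F) f)"
    and T_nat: "X \<in> Os \<Longrightarrow> Y \<in> Os \<Longrightarrow> F \<in> H X Y \<Longrightarrow> G \<in> H X Y \<Longrightarrow> \<eta> \<in> T X Y F G \<Longrightarrow> nat_trans (U X) (U Y) (u F) (u G) \<eta>"
    and T_ident: "X \<in> Os \<Longrightarrow> Y \<in> Os \<Longrightarrow> F \<in> H X Y \<Longrightarrow> (\<lambda>x \<in> obj (U X). ident (U Y) (omap (u F) x)) \<in> T X Y F F"
    and T_vcomp: "X \<in> Os \<Longrightarrow> Y \<in> Os \<Longrightarrow> F \<in> H X Y \<Longrightarrow> G \<in> H X Y \<Longrightarrow> K \<in> H X Y \<Longrightarrow> \<eta> \<in> T X Y F G \<Longrightarrow> \<theta> \<in> T X Y G K \<Longrightarrow>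
      (\<lambda>x \<in> obj (U X). \<theta> x \<cdot>\<^bsub>U Y\<^esub> \<eta> x) \<in> T X Y F K"
    and T_hcomp: "X \<in> Os \<Longrightarrow> Y \<in> Os \<Longrightarrow> Z \<in> Os \<Longrightarrow> F \<in> H X Y \<Longrightarrow> G \<in> H X Y \<Longrightarrow> F' \<in> H Y Z \<Longrightarrow> G' \<in> H Y Z \<Longrightarrow>
      \<eta> \<in> T X Y F G \<Longrightarrow> \<theta> \<in> T Y Z F' G' \<Longrightarrow>
      (\<lambda>x \<in> obj (U X). \<theta> (omap (u G) x) \<cdot>\<^bsub>U Z\<^esub> amap (u F') (\<eta> x)) \<in> T X Z (c X Y Z F' F) (c X Y Z G' G)"
begin

abbreviation "K \<equiv> concrete_two_cat Os H i c T U u"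

definition cell1 :: "'x \<Rightarrow> 'f \<Rightarrow> 'x \<Rightarrow> bool" where
  "cell1 X F Y \<longleftrightarrow> X \<in> Os \<and> Y \<in> Os \<and> F \<in> H X Y"

definition cell2 :: "'x \<Rightarrow> 'x \<Rightarrow> 'f \<Rightarrow> ('o \<Rightarrow> 'a) \<Rightarrow> 'f \<Rightarrow> bool" where
  "cell2 X Y F \<eta> G \<longleftrightarrow> cell1 X F Y \<and> cell1 X G Y \<and> \<eta> \<in> T X Y F G"

lemma cell1D: "cell1 X F Y \<Longrightarrow> X \<in> Os" "cell1 X F Y \<Longrightarrow> Y \<in> Os" "cell1 X F Y \<Longrightarrow> F \<in> H X Y"
  by (auto simp: cell1_def)

lemma cell2D: "cell2 X Y F \<eta> G \<Longrightarrow> cell1 X F Y" "cell2 X Y F \<eta> G \<Longrightarrow> cell1 X G Y"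
  by (auto simp: cell2_def)

lemma cell2_obj: "cell2 X Y F \<eta> G \<Longrightarrow> X \<in> Os" "cell2 X Y F \<eta> G \<Longrightarrow> Y \<in> Os"
  by (auto simp: cell2_def cell1_def)

lemma cat1_K: "cat1 K = hom_cat Os H i c"
  by (simp add: concrete_two_cat_def Let_def)

lemma cat1_simps [simp]:
  "obj (cat1 K) = Os"
  "(X, F, Y) \<in> arr (cat1 K) \<longleftrightarrow> cell1 X F Y"
  "cell1 X F Y \<Longrightarrow> src (cat1 K) (X, F, Y) = X"
  "cell1 X F Y \<Longrightarrow> trg (cat1 K) (X, F, Y) = Y"
  "X \<in> Os \<Longrightarrow> ident (cat1 K) X = (X, i X, X)"
  "cell1 X F Y \<Longrightarrow> cell1 Y G Z \<Longrightarrow> (Y, G, Z) \<cdot>\<^bsub>cat1 K\<^esub> (X, F, Y) = (X, c X Y Z G F, Z)"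
  by (auto simp: cat1_K cell1_def)

lemma cell1_id [simp]: "X \<in> Os \<Longrightarrow> cell1 X (i X) X"
  by (simp add: cell1_def i_in)

lemma cell1_comp [simp]: "cell1 X F Y \<Longrightarrow> cell1 Y G Z \<Longrightarrow> cell1 X (c X Y Z G F) Z"
  by (simp add: cell1_def c_in)

lemma cat1_category: "category (cat1 K)"
  unfolding cat1_K by (rule hom_cat_category) (auto simp: i_in c_in c_right c_left c_assoc)

lemma vcat_K: "vcat K = hom_cat (arr (cat1 K))
    (\<lambda>(X, F, Y) (X', G, Y'). if X = X' \<and> Y = Y' then T X Y F G else {})
    (\<lambda>(X, F, Y). \<lambda>x \<in> obj (U X). ident (U Y) (omap (u F) x))
    (\<lambda>(X, F, Y) _ _ \<theta> \<eta>. \<lambda>x \<in> obj (U X). \<theta> x \<cdot>\<^bsub>U Y\<^esub> \<eta> x)"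
  by (simp add: concrete_two_cat_def Let_def)

definition vid :: "'x \<Rightarrow> 'f \<Rightarrow> 'x \<Rightarrow> 'o \<Rightarrow> 'a" where
  "vid X F Y = (\<lambda>x \<in> obj (U X). ident (U Y) (omap (u F) x))"

definition vcomp :: "'x \<Rightarrow> 'x \<Rightarrow> ('o \<Rightarrow> 'a) \<Rightarrow> ('o \<Rightarrow> 'a) \<Rightarrow> 'o \<Rightarrow> 'a" where
  "vcomp X Y \<theta> \<eta> = (\<lambda>x \<in> obj (U X). \<theta> x \<cdot>\<^bsub>U Y\<^esub> \<eta> x)"

definition hcomp :: "'x \<Rightarrow> 'x \<Rightarrow> 'f \<Rightarrow> 'f \<Rightarrow> ('o \<Rightarrow> 'a) \<Rightarrow> ('o \<Rightarrow> 'a) \<Rightarrow> 'o \<Rightarrow> 'a" where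
  "hcomp X Z G F' \<theta> \<eta> = (\<lambda>x \<in> obj (U X). \<theta> (omap (u G) x) \<cdot>\<^bsub>U Z\<^esub> amap (u F') (\<eta> x))"

lemma vcat_simps [simp]:
  "obj (vcat K) = arr (cat1 K)"
  "((X, F, Y), \<eta>, (X', G, Y')) \<in> arr (vcat K) \<longleftrightarrow> X = X' \<and> Y = Y' \<and> cell2 X Y F \<eta> G"
  "cell2 X Y F \<eta> G \<Longrightarrow> src (vcat K) ((X, F, Y), \<eta>, (X, G, Y)) = (X, F, Y)"
  "cell2 X Y F \<eta> G \<Longrightarrow> trg (vcat K) ((X, F, Y), \<eta>, (X, G, Y)) = (X, G, Y)"
  "cell1 X F Y \<Longrightarrow> ident (vcat K) (X, F, Y) = ((X, F, Y), vid X F Y, (X, F, Y))"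
  "cell2 X Y F \<eta> G \<Longrightarrow> cell2 X Y G \<theta> L \<Longrightarrow>
    ((X, G, Y), \<theta>, (X, L, Y)) \<cdot>\<^bsub>vcat K\<^esub> ((X, F, Y), \<eta>, (X, G, Y)) = ((X, F, Y), vcomp X Y \<theta> \<eta>, (X, L, Y))"
  by (auto simp: vcat_K cell2_def vid_def vcomp_def)

lemma arr_cat1_cases:
  assumes "a \<in> arr (cat1 K)"
  obtains X F Y where "a = (X, F, Y)" "cell1 X F Y"
  using assms by (cases a) auto

lemma arr_vcat_cases:
  assumes "a \<in> arr (vcat K)"
  obtains X Y F \<eta> G where "a = ((X, F, Y), \<eta>, (X, G, Y))" "cell2 X Y F \<eta> G"
  using assms by (cases a) auto

lemma cell2_nat:
  assumes "cell2 X Y F \<eta> G"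
  shows "x \<in> obj (U X) \<Longrightarrow> \<eta> x \<in> arr (U Y)" "x \<in> obj (U X) \<Longrightarrow> src (U Y) (\<eta> x) = omap (u F) x"
    "x \<in> obj (U X) \<Longrightarrow> trg (U Y) (\<eta> x) = omap (u G) x" "\<eta> \<in> extensional (obj (U X))"
    "f \<in> arr (U X) \<Longrightarrow> amap (u G) f \<cdot>\<^bsub>U Y\<^esub> \<eta> (src (U X) f) = \<eta> (trg (U X) f) \<cdot>\<^bsub>U Y\<^esub> amap (u F) f"
  using assms T_nat[of X Y F G \<eta>] by (auto simp: cell2_def cell1_def nat_trans_def hom_def)

lemma cell1_functor: "cell1 X F Y \<Longrightarrow> cat_functor (U X) (U Y) (u F)"
  by (simp add: cell1_def u_functor)

lemma cell2_vid [simp]: "cell1 X F Y \<Longrightarrow> cell2 X Y F (vid X F Y) F"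
  by (simp add: cell2_def vid_def T_ident cell1_def)

lemma cell2_vcomp [simp]: "cell2 X Y F \<eta> G \<Longrightarrow> cell2 X Y G \<theta> L \<Longrightarrow> cell2 X Y F (vcomp X Y \<theta> \<eta>) L"
  using T_vcomp[of X Y F G L \<eta> \<theta>] by (simp add: cell2_def vcomp_def cell1_def)

lemma cell2_hcomp [simp]: "cell2 X Y F \<eta> G \<Longrightarrow> cell2 Y Z F' \<theta> G' \<Longrightarrow>
    cell2 X Z (c X Y Z F' F) (hcomp X Z G F' \<theta> \<eta>) (c X Y Z G' G)"
  using T_hcomp[of X Y Z F G F' G' \<eta> \<theta>] by (simp add: cell2_def hcomp_def cell1_def c_in)

lemma vcat_category: "category (vcat K)"
  unfolding vcat_K
proof (rule hom_cat_category, goal_cases)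
  case (1 a)
  then obtain X F Y where "a = (X, F, Y)" "cell1 X F Y" by (rule arr_cat1_cases)
  then show ?case using cell2_vid[of X F Y] by (simp add: cell2_def vid_def)
next
  case (2 a b d \<eta> \<theta>)
  then show ?case
    using cell2_vcomp by (auto simp: cell2_def vcomp_def split: if_splits elim!: arr_cat1_cases)
next
  case (3 a b \<eta>)
  then obtain X F Y G where ab: "a = (X, F, Y)" "b = (X, G, Y)" and 2: "cell2 X Y F \<eta> G"
    by (auto simp: cell2_def split: if_splits elim!: arr_cat1_cases)
  interpret Y: category "U Y" using 2 by (intro U_cat) (auto dest: cell1D cell2D)
  show ?case
    using cell2_nat(1-4)[OF 2] by (intro extensionalityI[where A = "obj (U X)"]) (simp_all add: ab)
next
  case (4 a b \<eta>)
  then obtain X F Y G where ab: "a = (X, F, Y)" "b = (X, G, Y)" and 2: "cell2 X Y F \<eta> G"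
    by (auto simp: cell2_def split: if_splits elim!: arr_cat1_cases)
  interpret Y: category "U Y" using 2 by (intro U_cat) (auto dest: cell1D cell2D)
  show ?case
    using cell2_nat(1-4)[OF 2] by (intro extensionalityI[where A = "obj (U X)"]) (simp_all add: ab)
next
  case (5 a b d e \<eta> \<theta> \<zeta>)
  then obtain X F Y G L M where ab: "a = (X, F, Y)" "b = (X, G, Y)" "d = (X, L, Y)" "e = (X, M, Y)"
    and 2: "cell2 X Y F \<eta> G" "cell2 X Y G \<theta> L" "cell2 X Y L \<zeta> M"
    by (auto simp: cell2_def split: if_splits elim!: arr_cat1_cases)
  interpret Y: category "U Y" using 2 by (intro U_cat) (auto dest: cell1D cell2D)
  show ?case
    using cell2_nat[OF 2(1)] cell2_nat[OF 2(2)] cell2_nat[OF 2(3)] by (auto simp: ab Y.assoc_arr intro!: restrict_ext)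
qed

lemma hcat_simps [simp]:
  "obj (hcat K) = Os"
  "arr (hcat K) = arr (vcat K)"
  "cell2 X Y F \<eta> G \<Longrightarrow> src (hcat K) ((X, F, Y), \<eta>, (X, G, Y)) = X"
  "cell2 X Y F \<eta> G \<Longrightarrow> trg (hcat K) ((X, F, Y), \<eta>, (X, G, Y)) = Y"
  "X \<in> Os \<Longrightarrow> ident (hcat K) X = ((X, i X, X), vid X (i X) X, (X, i X, X))"
  "cell2 X Y F \<eta> G \<Longrightarrow> cell2 Y Z F' \<theta> G' \<Longrightarrow>
    ((Y, F', Z), \<theta>, (Y, G', Z)) \<cdot>\<^bsub>hcat K\<^esub> ((X, F, Y), \<eta>, (X, G, Y)) =
    ((X, c X Y Z F' F, Z), hcomp X Z G F' \<theta> \<eta>, (X, c X Y Z G' G, Z))"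
proof -
  have h: "hcat K =
       \<lparr>obj = Os, arr = arr (vcat K), src = \<lambda>\<alpha> \<in> arr (vcat K). src (cat1 K) (src (vcat K) \<alpha>),
        trg = \<lambda>\<alpha> \<in> arr (vcat K). trg (cat1 K) (src (vcat K) \<alpha>),
        ident = (\<lambda>X \<in> Os. ident (vcat K) (ident (cat1 K) X)),
        cmp = (\<lambda>(H1, \<theta>, H2) (G1, \<eta>, G2).
          if (H1, \<theta>, H2) \<in> arr (vcat K) \<and> (G1, \<eta>, G2) \<in> arr (vcat K) \<and>
            (\<lambda>\<alpha> \<in> arr (vcat K). trg (cat1 K) (src (vcat K) \<alpha>)) (G1, \<eta>, G2) = (\<lambda>\<alpha> \<in> arr (vcat K). src (cat1 K) (src (vcat K) \<alpha>)) (H1, \<theta>, H2)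
          then
            (H1 \<cdot>\<^bsub>cat1 K\<^esub> G1,
             \<lambda>x \<in> obj (U (src (cat1 K) G1)).
               \<theta> (omap (u (fst (snd G2))) x) \<cdot>\<^bsub>U (trg (cat1 K) H1)\<^esub> amap (u (fst (snd H1))) (\<eta> x),
             H2 \<cdot>\<^bsub>cat1 K\<^esub> G2)
          else undefined)\<rparr>"
    by (simp only: concrete_two_cat_def Let_def two_cat.select_convs)
  show "obj (hcat K) = Os" "arr (hcat K) = arr (vcat K)"
    "cell2 X Y F \<eta> G \<Longrightarrow> src (hcat K) ((X, F, Y), \<eta>, (X, G, Y)) = X"
    "cell2 X Y F \<eta> G \<Longrightarrow> trg (hcat K) ((X, F, Y), \<eta>, (X, G, Y)) = Y"
    "X \<in> Os \<Longrightarrow> ident (hcat K) X = ((X, i X, X), vid X (i X) X, (X, i X, X))"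
    unfolding h by (simp_all add: cell2D)
  show "cell2 X Y F \<eta> G \<Longrightarrow> cell2 Y Z F' \<theta> G' \<Longrightarrow>
    ((Y, F', Z), \<theta>, (Y, G', Z)) \<cdot>\<^bsub>hcat K\<^esub> ((X, F, Y), \<eta>, (X, G, Y)) =
    ((X, c X Y Z F' F, Z), hcomp X Z G F' \<theta> \<eta>, (X, c X Y Z G' G, Z))"
    unfolding h by (simp add: hcomp_def cell2D(1)[of X Y F \<eta> G] cell2D(2)[of X Y F \<eta> G]
        cell2D(1)[of Y Z F' \<theta> G'] cell2D(2)[of Y Z F' \<theta> G'])
qed

lemma hcat_ext:
  "src (hcat K) \<in> extensional (arr (vcat K))" "trg (hcat K) \<in> extensional (arr (vcat K))" "ident (hcat K) \<in> extensional Os"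
  "\<not> (\<eta> \<in> arr (vcat K) \<and> \<theta> \<in> arr (vcat K) \<and> trg (hcat K) \<eta> = src (hcat K) \<theta>) \<Longrightarrow> \<theta> \<cdot>\<^bsub>hcat K\<^esub> \<eta> = undefined"
proof -
  show "src (hcat K) \<in> extensional (arr (vcat K))" "trg (hcat K) \<in> extensional (arr (vcat K))" "ident (hcat K) \<in> extensional Os"
    by (simp_all add: concrete_two_cat_def Let_def)
  show "\<not> (\<eta> \<in> arr (vcat K) \<and> \<theta> \<in> arr (vcat K) \<and> trg (hcat K) \<eta> = src (hcat K) \<theta>) \<Longrightarrow> \<theta> \<cdot>\<^bsub>hcat K\<^esub> \<eta> = undefined"
    by (cases \<eta>; cases \<theta>) (auto simp add: concrete_two_cat_def Let_def)
qed

lemma hcomp_assoc: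
  assumes "cell2 W X F \<eta> G" "cell2 X Y F' \<theta> G'" "cell2 Y Z F'' \<zeta> G''"
  shows "hcomp W Z G (c X Y Z F'' F') (hcomp X Z G' F'' \<zeta> \<theta>) \<eta> = hcomp W Z (c W X Y G' G) F'' \<zeta> (hcomp W Y G F' \<theta> \<eta>)"
  unfolding hcomp_def
proof (rule restrict_ext)
  fix x assume [simp]: "x \<in> obj (U W)"
  note d = cell2D[OF assms(1)] cell2D[OF assms(2)] cell2D[OF assms(3)]
  note o = d[THEN cell1D(1)] d[THEN cell1D(2)] d[THEN cell1D(3)]
  interpret W: category "U W" using o by (intro U_cat)
  interpret X: category "U X" using o by (intro U_cat)
  interpret Y: category "U Y" using o by (intro U_cat)
  interpret Z: category "U Z" using o by (intro U_cat)
  interpret F: cat_functor "U W" "U X" "u F" using d by (intro cell1_functor)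
  interpret G: cat_functor "U W" "U X" "u G" using d by (intro cell1_functor)
  interpret F': cat_functor "U X" "U Y" "u F'" using d by (intro cell1_functor)
  interpret G': cat_functor "U X" "U Y" "u G'" using d by (intro cell1_functor)
  interpret F'': cat_functor "U Y" "U Z" "u F''" using d by (intro cell1_functor)
  note n = cell2_nat(1-3)[OF assms(1)] cell2_nat(1-3)[OF assms(2)] cell2_nat(1-3)[OF assms(3)]
  show "(\<lambda>x \<in> obj (U X). \<zeta> (omap (u G') x) \<cdot>\<^bsub>U Z\<^esub> amap (u F'') (\<theta> x)) (omap (u G) x) \<cdot>\<^bsub>U Z\<^esub> amap (u (c X Y Z F'' F')) (\<eta> x) =
    \<zeta> (omap (u (c W X Y G' G)) x) \<cdot>\<^bsub>U Z\<^esub> amap (u F'') ((\<lambda>x \<in> obj (U W). \<theta> (omap (u G) x) \<cdot>\<^bsub>U Y\<^esub> amap (u F') (\<eta> x)) x)"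
    using o n by (simp add: u_c F''.map_cmp Z.assoc_arr)
qed

lemma hcomp_id_right:
  assumes "cell2 X Y F \<eta> G"
  shows "hcomp X Y (i X) F \<eta> (vid X (i X) X) = \<eta>"
proof (rule extensionalityI)
  note d = cell2D[OF assms]
  note o = d[THEN cell1D(1)] d[THEN cell1D(2)] d[THEN cell1D(3)]
  interpret F: cat_functor "U X" "U Y" "u F" using d by (intro cell1_functor)
  fix x assume "x \<in> obj (U X)"
  then show "hcomp X Y (i X) F \<eta> (vid X (i X) X) x = \<eta> x"
    using o cell2_nat(1-3)[OF assms] by (simp add: hcomp_def vid_def u_i)
qed (use cell2_nat(4)[OF assms] in \<open>auto simp: hcomp_def\<close>)

lemma hcomp_id_left:
  assumes "cell2 X Y F \<eta> G"
  shows "hcomp X Y G (i Y) (vid Y (i Y) Y) \<eta> = \<eta>"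
proof (rule extensionalityI)
  note d = cell2D[OF assms]
  note o = d[THEN cell1D(1)] d[THEN cell1D(2)] d[THEN cell1D(3)]
  interpret G: cat_functor "U X" "U Y" "u G" using d by (intro cell1_functor)
  fix x assume "x \<in> obj (U X)"
  then show "hcomp X Y G (i Y) (vid Y (i Y) Y) \<eta> x = \<eta> x"
    using o cell2_nat(1-3)[OF assms] by (simp add: hcomp_def vid_def u_i)
qed (use cell2_nat(4)[OF assms] in \<open>auto simp: hcomp_def\<close>)

lemma c_right': "cell1 X F Y \<Longrightarrow> c X X Y F (i X) = F"
  and c_left': "cell1 X F Y \<Longrightarrow> c X Y Y (i Y) F = F"
  and c_assoc': "cell1 W F X \<Longrightarrow> cell1 X G Y \<Longrightarrow> cell1 Y L Z \<Longrightarrow> c W X Z (c X Y Z L G) F = c W Y Z L (c W X Y G F)"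
  by (simp_all add: cell1_def c_right c_left c_assoc)

lemma hom_hcat_cases:
  assumes "a \<in> hom (hcat K) X Y"
  obtains F \<eta> G where "a = ((X, F, Y), \<eta>, (X, G, Y))" "cell2 X Y F \<eta> G"
proof -
  from assms have "a \<in> arr (vcat K)" by (simp add: hom_def)
  then obtain X' Y' F \<eta> G where a: "a = ((X', F, Y'), \<eta>, (X', G, Y'))" "cell2 X' Y' F \<eta> G" by (rule arr_vcat_cases)
  with assms have "X' = X" "Y' = Y" by (auto simp: hom_def)
  with a that show ?thesis by blast
qed

lemma hcat_category: "category (hcat K)"
proof (unfold_locales, goal_cases)
  case (1 f)
  then show ?case by (auto elim!: arr_vcat_cases intro: cell2_obj)
next
  case (2 f)
  then show ?case by (auto elim!: arr_vcat_cases intro: cell2_obj)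
next
  case (3 x)
  then show ?case by (simp add: hom_def)
next
  case (4 f x y g z)
  then show ?case by (elim hom_hcat_cases) (simp add: hom_def)
next
  case (5 f x y)
  then obtain F \<eta> G where f: "f = ((x, F, y), \<eta>, (x, G, y))" "cell2 x y F \<eta> G" by (rule hom_hcat_cases)
  then show ?case
    using cell2_obj[OF f(2)] cell2D[OF f(2)] by (simp add: hcomp_id_right c_right')
next
  case (6 f x y)
  then obtain F \<eta> G where f: "f = ((x, F, y), \<eta>, (x, G, y))" "cell2 x y F \<eta> G" by (rule hom_hcat_cases)
  then show ?case
    using cell2_obj[OF f(2)] cell2D[OF f(2)] by (simp add: hcomp_id_left c_left')
next
  case (7 f w x g y h z)
  then show ?case by (elim hom_hcat_cases) (auto simp: hcomp_assoc dest: cell2D intro!: c_assoc')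
next
  case 8
  show ?case using hcat_ext(1) by simp
next
  case 9
  show ?case using hcat_ext(2) by simp
next
  case 10
  show ?case using hcat_ext(3) by simp
next
  case (11 f g)
  then show ?case using hcat_ext(4)[of f g] by simp
qed

lemma vcomp_hcomp:
  assumes "cell2 X Y F \<eta> G" "cell2 X Y G \<eta>' L" "cell2 Y Z F' \<theta> G'" "cell2 Y Z G' \<theta>' L'"
  shows "hcomp X Z L F' (vcomp Y Z \<theta>' \<theta>) (vcomp X Y \<eta>' \<eta>) = vcomp X Z (hcomp X Z L G' \<theta>' \<eta>') (hcomp X Z G F' \<theta> \<eta>)"
  unfolding hcomp_def vcomp_def
proof (rule restrict_ext)
  fix x assume [simp]: "x \<in> obj (U X)"
  note d = cell2D[OF assms(1)] cell2D[OF assms(2)] cell2D[OF assms(3)] cell2D[OF assms(4)]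
  note o = d[THEN cell1D(1)] d[THEN cell1D(2)]
  interpret Y: category "U Y" using o by (intro U_cat)
  interpret Z: category "U Z" using o by (intro U_cat)
  interpret G: cat_functor "U X" "U Y" "u G" using d by (intro cell1_functor)
  interpret L: cat_functor "U X" "U Y" "u L" using d by (intro cell1_functor)
  interpret F': cat_functor "U Y" "U Z" "u F'" using d by (intro cell1_functor)
  interpret G': cat_functor "U Y" "U Z" "u G'" using d by (intro cell1_functor)
  note n = cell2_nat(1-3)[OF assms(1)] cell2_nat(1-3)[OF assms(2)] cell2_nat(1-3)[OF assms(3)] cell2_nat(1-3)[OF assms(4)]
  have "amap (u G') (\<eta>' x) \<cdot>\<^bsub>U Z\<^esub> \<theta> (omap (u G) x) = \<theta> (omap (u L) x) \<cdot>\<^bsub>U Z\<^esub> amap (u F') (\<eta>' x)"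
    using cell2_nat(5)[OF assms(3), of "\<eta>' x"] n by simp
  from Z.up[OF this] have w: "\<lfloor>amap (u G') (\<eta>' x)\<rfloor>\<^bsub>U Z\<^esub> \<odot>\<^bsub>U Z\<^esub> \<lfloor>\<theta> (omap (u G) x)\<rfloor>\<^bsub>U Z\<^esub> = \<lfloor>\<theta> (omap (u L) x)\<rfloor>\<^bsub>U Z\<^esub> \<odot>\<^bsub>U Z\<^esub> \<lfloor>amap (u F') (\<eta>' x)\<rfloor>\<^bsub>U Z\<^esub>"
    using n by (simp add: chase)
  show "(\<lambda>x \<in> obj (U Y). \<theta>' x \<cdot>\<^bsub>U Z\<^esub> \<theta> x) (omap (u L) x) \<cdot>\<^bsub>U Z\<^esub> amap (u F') ((\<lambda>x \<in> obj (U X). \<eta>' x \<cdot>\<^bsub>U Y\<^esub> \<eta> x) x) =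
    (\<lambda>x \<in> obj (U X). \<theta>' (omap (u L) x) \<cdot>\<^bsub>U Z\<^esub> amap (u G') (\<eta>' x)) x \<cdot>\<^bsub>U Z\<^esub> (\<lambda>x \<in> obj (U X). \<theta> (omap (u G) x) \<cdot>\<^bsub>U Z\<^esub> amap (u F') (\<eta> x)) x"
    by (rule Z.lift_eqI) (use n in \<open>simp_all add: chase w[THEN Z.re]\<close>)
qed

lemma hcomp_vid:
  assumes "cell1 X F Y" "cell1 Y G Z"
  shows "hcomp X Z F G (vid Y G Z) (vid X F Y) = vid X (c X Y Z G F) Z"
  unfolding hcomp_def vid_def
proof (rule restrict_ext)
  note o = assms[THEN cell1D(1)] assms[THEN cell1D(2)] assms[THEN cell1D(3)]
  interpret F: cat_functor "U X" "U Y" "u F" using assms by (intro cell1_functor)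
  interpret G: cat_functor "U Y" "U Z" "u G" using assms by (intro cell1_functor)
  fix x assume "x \<in> obj (U X)"
  then show "(\<lambda>x \<in> obj (U Y). ident (U Z) (omap (u G) x)) (omap (u F) x) \<cdot>\<^bsub>U Z\<^esub> amap (u G) ((\<lambda>x \<in> obj (U X). ident (U Y) (omap (u F) x)) x) =
    ident (U Z) (omap (u (c X Y Z G F)) x)"
    using o by (simp add: u_c)
qed

lemma hom_cat1_cases:
  assumes "a \<in> hom (cat1 K) X Y"
  obtains F where "a = (X, F, Y)" "cell1 X F Y"
  using assms by (cases a) (auto simp: hom_def)

lemma concrete_strict: "strict_two_category K"
proof (intro strict_two_category.intro strict_two_category_axioms.intro cat1_category vcat_category hcat_category, goal_cases)
  case 1
  show ?case by simp
next
  case 2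
  show ?case by simp
next
  case 3
  show ?case by simp
next
  case (4 a)
  then obtain X Y F \<eta> G where a: "a = ((X, F, Y), \<eta>, (X, G, Y))" "cell2 X Y F \<eta> G" by (rule arr_vcat_cases)
  then show ?case using cell2D[OF a(2)] by simp
next
  case (5 a)
  then obtain X Y F \<eta> G where a: "a = ((X, F, Y), \<eta>, (X, G, Y))" "cell2 X Y F \<eta> G" by (rule arr_vcat_cases)
  then show ?case using cell2D[OF a(2)] by simp
next
  case (6 X)
  then show ?case by simp
next
  case (7 a X Y b Z)
  then show ?case by (elim hom_hcat_cases) (simp add: cell2D)
next
  case (8 a X Y b Z)
  then show ?case by (elim hom_hcat_cases) (simp add: cell2D)
next
  case (9 f X Y g Z)
  then show ?case by (elim hom_cat1_cases) (simp add: hcomp_vid)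
next
  case (10 a X Y a' b Z b')
  then show ?case by (elim hom_hcat_cases) (auto simp: vcomp_hcomp)
qed

end

text \<open>
  A 2-functor between such 2-categories that changes the structure on the underlying categories, but
  not the underlying categories, functors and transformations themselves.
\<close>

definition structure_functor ::
  "('x, ('x, 'f) cell1, ('x, 'f, 'o, 'a) cell2) two_cat \<Rightarrow> ('x \<Rightarrow> 'y) \<Rightarrow> ('x \<Rightarrow> 'x \<Rightarrow> 'f \<Rightarrow> 'g) \<Rightarrow>
   ('x, ('x, 'f) cell1, ('x, 'f, 'o, 'a) cell2, 'y, ('y, 'g) cell1, ('y, 'g, 'o, 'a) cell2) two_functor" where
  "structure_functor K f0 f1 =
    (let m = (\<lambda>(X, F, Y). (f0 X, f1 X Y F, f0 Y)) in
     \<lparr>map0 = (\<lambda>X \<in> obj (cat1 K). f0 X),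
      map1 = (\<lambda>a \<in> arr (cat1 K). m a),
      map2 = (\<lambda>(a, \<eta>, b) \<in> arr (vcat K). (m a, \<eta>, m b))\<rparr>)"

locale structure_two_functor =
  K: concrete_two_category Os H i c T U u + L: concrete_two_category Os' H' i' c' T' U' u'
  for Os :: "'x set" and H :: "'x \<Rightarrow> 'x \<Rightarrow> 'f set" and i c T and U :: "'x \<Rightarrow> ('o, 'a) mon_cat" and u
    and Os' :: "'y set" and H' :: "'y \<Rightarrow> 'y \<Rightarrow> 'g set" and i' c' T' and U' :: "'y \<Rightarrow> ('o, 'a) mon_cat" and u' +
  fixes f0 :: "'x \<Rightarrow> 'y" and f1 :: "'x \<Rightarrow> 'x \<Rightarrow> 'f \<Rightarrow> 'g"
  assumes f0_in: "X \<in> Os \<Longrightarrow> f0 X \<in> Os'"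
    and U_f0: "X \<in> Os \<Longrightarrow> U' (f0 X) = U X"
    and f1_in: "X \<in> Os \<Longrightarrow> Y \<in> Os \<Longrightarrow> F \<in> H X Y \<Longrightarrow> f1 X Y F \<in> H' (f0 X) (f0 Y)"
    and u_f1: "X \<in> Os \<Longrightarrow> Y \<in> Os \<Longrightarrow> F \<in> H X Y \<Longrightarrow> u' (f1 X Y F) = u F"
    and f1_i: "X \<in> Os \<Longrightarrow> f1 X X (i X) = i' (f0 X)"
    and f1_c: "X \<in> Os \<Longrightarrow> Y \<in> Os \<Longrightarrow> Z \<in> Os \<Longrightarrow> F \<in> H X Y \<Longrightarrow> G \<in> H Y Z \<Longrightarrow>
      f1 X Z (c X Y Z G F) = c' (f0 X) (f0 Y) (f0 Z) (f1 Y Z G) (f1 X Y F)"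
    and T_sub: "X \<in> Os \<Longrightarrow> Y \<in> Os \<Longrightarrow> F \<in> H X Y \<Longrightarrow> G \<in> H X Y \<Longrightarrow> \<eta> \<in> T X Y F G \<Longrightarrow> \<eta> \<in> T' (f0 X) (f0 Y) (f1 X Y F) (f1 X Y G)"
begin

abbreviation "\<Phi> \<equiv> structure_functor K.K f0 f1"

lemma map_cell1 [simp]: "K.cell1 X F Y \<Longrightarrow> L.cell1 (f0 X) (f1 X Y F) (f0 Y)"
  by (simp add: K.cell1_def L.cell1_def f0_in f1_in)

lemma map_cell2 [simp]: "K.cell2 X Y F \<eta> G \<Longrightarrow> L.cell2 (f0 X) (f0 Y) (f1 X Y F) \<eta> (f1 X Y G)"
  using T_sub[of X Y F G \<eta>] map_cell1[of X F Y] map_cell1[of X G Y] by (auto simp: K.cell2_def L.cell2_def K.cell1_def)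

lemma structure_functor_simps [simp]:
  "X \<in> Os \<Longrightarrow> map0 \<Phi> X = f0 X"
  "K.cell1 X F Y \<Longrightarrow> map1 \<Phi> (X, F, Y) = (f0 X, f1 X Y F, f0 Y)"
  "K.cell2 X Y F \<eta> G \<Longrightarrow> map2 \<Phi> ((X, F, Y), \<eta>, (X, G, Y)) = ((f0 X, f1 X Y F, f0 Y), \<eta>, (f0 X, f1 X Y G, f0 Y))"
  by (simp_all add: structure_functor_def Let_def)

lemma structure_functor_ext:
  "map0 \<Phi> \<in> extensional Os" "map1 \<Phi> \<in> extensional (arr (cat1 K.K))" "map2 \<Phi> \<in> extensional (arr (vcat K.K))"
  by (simp_all add: structure_functor_def Let_def)

lemma vid_f1: "K.cell1 X F Y \<Longrightarrow> L.vid (f0 X) (f1 X Y F) (f0 Y) = K.vid X F Y"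
  by (simp add: K.vid_def L.vid_def K.cell1_def U_f0 u_f1)

lemma vcomp_f0: "X \<in> Os \<Longrightarrow> Y \<in> Os \<Longrightarrow> L.vcomp (f0 X) (f0 Y) \<theta> \<eta> = K.vcomp X Y \<theta> \<eta>"
  by (simp add: K.vcomp_def L.vcomp_def U_f0)

lemma hcomp_f1: "K.cell1 X G Y \<Longrightarrow> K.cell1 Y F' Z \<Longrightarrow> L.hcomp (f0 X) (f0 Z) (f1 X Y G) (f1 Y Z F') \<theta> \<eta> = K.hcomp X Z G F' \<theta> \<eta>"
  by (simp add: K.hcomp_def L.hcomp_def K.cell1_def U_f0 u_f1)

lemma f1_c': "K.cell1 X F Y \<Longrightarrow> K.cell1 Y G Z \<Longrightarrow> f1 X Z (c X Y Z G F) = c' (f0 X) (f0 Y) (f0 Z) (f1 Y Z G) (f1 X Y F)"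
  by (simp add: K.cell1_def f1_c)

lemma structure_two_functor: "two_functor K.K L.K \<Phi>"
proof (intro two_functor.intro two_functor_axioms.intro K.concrete_strict L.concrete_strict
    cat_functor.intro cat_functor_axioms.intro K.cat1_category L.cat1_category
    K.vcat_category L.vcat_category K.hcat_category L.hcat_category, goal_cases)
  case 1
  show ?case using structure_functor_ext(1) by (simp add: PiE_def Pi_def f0_in)
next
  case 2
  show ?case using structure_functor_ext(2) by simp
next
  case (3 f X Y)
  then obtain F where f: "f = (X, F, Y)" "K.cell1 X F Y" by (rule K.hom_cat1_cases)
  then show ?case using K.cell1D[OF f(2)] by (simp add: hom_def)
next
  case (4 X)
  then show ?case by (simp add: f1_i f0_in)
next
  case (5 f X Y g Z)
  then show ?case by (elim K.hom_cat1_cases) (simp add: f1_c')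
next
  case 6
  show ?case using structure_functor_ext(2) by (simp add: PiE_def Pi_def)
next
  case 7
  show ?case using structure_functor_ext(3) by simp
next
  case (8 f x y)
  then obtain X F \<eta> G Y where "f = ((X, F, Y), \<eta>, (X, G, Y))" "K.cell2 X Y F \<eta> G" "x = (X, F, Y)" "y = (X, G, Y)"
    by (auto simp: hom_def elim!: K.arr_vcat_cases)
  then show ?case using K.cell2D[of X Y F \<eta> G] by (simp add: hom_def)
next
  case (9 x)
  then show ?case by (auto elim!: K.arr_cat1_cases simp: vid_f1)
next
  case (10 f x y g z)
  then obtain X F \<eta> G Y where f: "f = ((X, F, Y), \<eta>, (X, G, Y))" "K.cell2 X Y F \<eta> G" "y = (X, G, Y)"
    by (auto simp: hom_def elim!: K.arr_vcat_cases)
  with 10 obtain \<theta> M where g: "g = ((X, G, Y), \<theta>, (X, M, Y))" "K.cell2 X Y G \<theta> M"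
    by (auto simp: hom_def elim!: K.arr_vcat_cases)
  show ?case using f g K.cell2_obj[OF f(2)] by (simp add: vcomp_f0)
next
  case 11
  show ?case using structure_functor_ext(1) by (simp add: PiE_def Pi_def f0_in)
next
  case 12
  show ?case using structure_functor_ext(3) by simp
next
  case (13 f X Y)
  then obtain F \<eta> G where f: "f = ((X, F, Y), \<eta>, (X, G, Y))" "K.cell2 X Y F \<eta> G" by (rule K.hom_hcat_cases)
  then show ?case using K.cell2_obj[OF f(2)] by (simp add: hom_def)
next
  case (14 X)
  then show ?case by (simp add: f1_i f0_in vid_f1 flip: f1_i)
next
  case (15 f X Y g Z)
  then show ?case by (elim K.hom_hcat_cases) (simp add: f1_c' K.cell2D hcomp_f1)
qed

end

lemma comp_structure_functor:
  assumes "structure_two_functor Os H i c T U u Os' H' i' c' T' U' u' f0 f1"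
  shows "comp_two_functor (concrete_two_cat Os H i c T U u) (structure_functor (concrete_two_cat Os' H' i' c' T' U' u') g0 g1)
      (structure_functor (concrete_two_cat Os H i c T U u) f0 f1) =
    structure_functor (concrete_two_cat Os H i c T U u) (\<lambda>X. g0 (f0 X)) (\<lambda>X Y F. g1 (f0 X) (f0 Y) (f1 X Y F))"
proof -
  interpret structure_two_functor Os H i c T U u Os' H' i' c' T' U' u' f0 f1 by fact
  have "map0 (structure_functor L.K g0 g1) (map0 \<Phi> X) = g0 (f0 X)" if "X \<in> Os" for X
    using that by (simp add: structure_functor_def Let_def f0_in)
  moreover have "map1 (structure_functor L.K g0 g1) (map1 \<Phi> a) = (\<lambda>(X, F, Y). (g0 (f0 X), g1 (f0 X) (f0 Y) (f1 X Y F), g0 (f0 Y))) a"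
    if "a \<in> arr (cat1 K.K)" for a
    using that by (elim K.arr_cat1_cases) (simp add: structure_functor_def Let_def)
  moreover have "map2 (structure_functor L.K g0 g1) (map2 \<Phi> a) =
    (\<lambda>((X, F, Y), \<eta>, (X', G, Y')). ((g0 (f0 X), g1 (f0 X) (f0 Y) (f1 X Y F), g0 (f0 Y)), \<eta>, (g0 (f0 X'), g1 (f0 X') (f0 Y') (f1 X' Y' G), g0 (f0 Y')))) a"
    if "a \<in> arr (vcat K.K)" for a
    using that by (elim K.arr_vcat_cases) (simp add: structure_functor_def Let_def)
  ultimately show ?thesis
    by (simp add: comp_two_functor_def structure_functor_def[where ?f0.0 = "\<lambda>X. g0 (f0 X)"] case_prod_unfold Let_def cong: restrict_cong)
qed

lemma id_structure_functor:
  "id_two_functor K = structure_functor K (\<lambda>X. X) (\<lambda>X Y F. F)"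
  by (simp add: id_two_functor_def structure_functor_def case_prod_unfold Let_def)

text \<open>
  If the components act as the identity on underlying objects and arrows, then whiskering a
  2-cell with them does not change it, and naturality for 2-cells reduces to naturality for
  1-cells.
\<close>

locale structure_two_natural_iso =
  A: structure_two_functor Os H i c T U u Os' H' i' c' T' U' u' a0 a1 +
  B: structure_two_functor Os H i c T U u Os' H' i' c' T' U' u' b0 b1
  for Os :: "'x set" and H :: "'x \<Rightarrow> 'x \<Rightarrow> 'f set" and i c T and U :: "'x \<Rightarrow> ('o, 'a) mon_cat" and u
    and Os' :: "'y set" and H' :: "'y \<Rightarrow> 'y \<Rightarrow> 'g set" and i' c' T' and U' :: "'y \<Rightarrow> ('o, 'a) mon_cat" and u'
    and a0 a1 b0 b1 +
  fixes \<eta> \<eta>' :: "'x \<Rightarrow> 'g"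
  assumes \<eta>_in: "X \<in> Os \<Longrightarrow> \<eta> X \<in> H' (a0 X) (b0 X)" and \<eta>'_in: "X \<in> Os \<Longrightarrow> \<eta>' X \<in> H' (b0 X) (a0 X)"
    and u_\<eta>: "X \<in> Os \<Longrightarrow> x \<in> obj (U X) \<Longrightarrow> omap (u' (\<eta> X)) x = x" "X \<in> Os \<Longrightarrow> f \<in> arr (U X) \<Longrightarrow> amap (u' (\<eta> X)) f = f"
    and \<eta>_inv: "X \<in> Os \<Longrightarrow> c' (a0 X) (b0 X) (a0 X) (\<eta>' X) (\<eta> X) = i' (a0 X)"
      "X \<in> Os \<Longrightarrow> c' (b0 X) (a0 X) (b0 X) (\<eta> X) (\<eta>' X) = i' (b0 X)"
    and \<eta>_nat: "X \<in> Os \<Longrightarrow> Y \<in> Os \<Longrightarrow> F \<in> H X Y \<Longrightarrow>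
      c' (a0 X) (b0 X) (b0 Y) (b1 X Y F) (\<eta> X) = c' (a0 X) (a0 Y) (b0 Y) (\<eta> Y) (a1 X Y F)"
begin

lemma \<eta>_cell [simp]: "X \<in> Os \<Longrightarrow> A.L.cell1 (a0 X) (\<eta> X) (b0 X)" "X \<in> Os \<Longrightarrow> A.L.cell1 (b0 X) (\<eta>' X) (a0 X)"
  by (simp_all add: A.L.cell1_def \<eta>_in \<eta>'_in A.f0_in B.f0_in)

lemma natural2_component:
  assumes 2: "A.K.cell2 X Y F \<alpha> G"
  shows "A.L.hcomp (a0 X) (b0 Y) (\<eta> X) (b1 X Y F) \<alpha> (A.L.vid (a0 X) (\<eta> X) (b0 X)) =
    A.L.hcomp (a0 X) (b0 Y) (a1 X Y G) (\<eta> Y) (A.L.vid (a0 Y) (\<eta> Y) (b0 Y)) \<alpha>"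
  unfolding A.L.hcomp_def A.L.vid_def
proof (rule restrict_ext)
  note o = A.K.cell2_obj[OF 2] A.K.cell2D[OF 2, THEN A.K.cell1D(3)]
  note n = A.K.cell2_nat(1-3)[OF 2]
  interpret F: cat_functor "U X" "U Y" "u F" using A.K.cell2D[OF 2] by (intro A.K.cell1_functor)
  interpret G: cat_functor "U X" "U Y" "u G" using A.K.cell2D[OF 2] by (intro A.K.cell1_functor)
  fix x assume "x \<in> obj (U' (a0 X))"
  then have x: "x \<in> obj (U X)" using o by (simp add: A.U_f0)
  show "\<alpha> (omap (u' (\<eta> X)) x) \<cdot>\<^bsub>U' (b0 Y)\<^esub> amap (u' (b1 X Y F)) ((\<lambda>x \<in> obj (U' (a0 X)). ident (U' (b0 X)) (omap (u' (\<eta> X)) x)) x) =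
    (\<lambda>x \<in> obj (U' (a0 Y)). ident (U' (b0 Y)) (omap (u' (\<eta> Y)) x)) (omap (u' (a1 X Y G)) x) \<cdot>\<^bsub>U' (b0 Y)\<^esub> amap (u' (\<eta> Y)) (\<alpha> x)"
    using o n x by (simp add: A.U_f0 B.U_f0 A.u_f1 B.u_f1 u_\<eta>)
qed

definition "\<tau> = (\<lambda>X \<in> Os. (a0 X, \<eta> X, b0 X))"

lemma structure_natural: "two_natural_iso A.K.K A.L.K A.\<Phi> B.\<Phi> \<tau>"
proof (intro two_natural_iso.intro two_natural_iso_axioms.intro A.structure_two_functor B.structure_two_functor)
  show "nat_iso (cat1 A.K.K) (cat1 A.L.K) \<lparr>omap = map0 A.\<Phi>, amap = map1 A.\<Phi>\<rparr> \<lparr>omap = map0 B.\<Phi>, amap = map1 B.\<Phi>\<rparr> \<tau>"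
  proof (rule nat_isoI, goal_cases)
    case 1
    show ?case by (simp add: \<tau>_def)
  next
    case (2 X)
    then have X: "X \<in> Os" by simp
    then have "inverse_arrows (cat1 A.L.K) (\<tau> X) (b0 X, \<eta>' X, a0 X)"
      by (simp add: \<tau>_def inverse_arrows_def hom_def \<eta>_inv A.f0_in B.f0_in)
    with X show ?case
      by (simp add: hom_def \<tau>_def) (auto simp: iso_arr_def)
  next
    case (3 a)
    then obtain X F Y where a: "a = (X, F, Y)" "A.K.cell1 X F Y" by (rule A.K.arr_cat1_cases)
    then show ?case using A.K.cell1D[OF a(2)] by (simp add: \<tau>_def \<eta>_nat)
  qed
next
  fix \<alpha> X Y
  assume "\<alpha> \<in> hom (hcat A.K.K) X Y"
  then obtain F \<beta> G where a: "\<alpha> = ((X, F, Y), \<beta>, (X, G, Y))" "A.K.cell2 X Y F \<beta> G" by (rule A.K.hom_hcat_cases)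
  then show "map2 B.\<Phi> \<alpha> \<cdot>\<^bsub>hcat A.L.K\<^esub> ident (vcat A.L.K) (\<tau> X) = ident (vcat A.L.K) (\<tau> Y) \<cdot>\<^bsub>hcat A.L.K\<^esub> map2 A.\<Phi> \<alpha>"
    using A.K.cell2_obj[OF a(2)] A.K.cell2D[OF a(2), THEN A.K.cell1D(3)]
    by (simp add: \<tau>_def natural2_component \<eta>_nat)
qed

end

section \<open>Composition of monoidal functors and transformations\<close>

lemma (in monoidal_category) id_monoidal_functor: "monoidal_functor C C (id_mon_functor C)"
proof (intro monoidal_functor.intro monoidal_functor_axioms.intro monoidal_category_axioms
    cat_functor.intro cat_functor_axioms.intro category_axioms, goal_cases)
  case 6
  show ?case
    by (rule nat_isoI2) (auto simp: id_mon_functor_def hom_def)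
next
  case (9 u v w)
  then show ?case by (simp add: id_mon_functor_def)
next
  case (10 v)
  then show ?case by (simp add: id_mon_functor_def)
next
  case (11 v)
  then show ?case by (simp add: id_mon_functor_def)
qed (auto simp: id_mon_functor_def hom_def)

locale two_monoidal_functors = F: monoidal_functor C D F + G: monoidal_functor D E G
  for C :: "('o, 'a, 'x) mon_cat_scheme" and D :: "('p, 'b, 'y) mon_cat_scheme" and E :: "('q, 'c, 'z) mon_cat_scheme" (structure)
    and F :: "('o, 'a, 'p, 'b) mon_functor" and G :: "('p, 'b, 'q, 'c) mon_functor"
begin

abbreviation "GF \<equiv> comp_mon_functor C E G F"

lemma comp_simps [simp]:
  "x \<in> obj C \<Longrightarrow> omap GF x = omap G (omap F x)"
  "f \<in> arr C \<Longrightarrow> amap GF f = amap G (amap F f)"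
  "x \<in> obj C \<Longrightarrow> y \<in> obj C \<Longrightarrow> phi2 GF (x, y) = amap G (phi2 F (x, y)) \<cdot> phi2 G (omap F x, omap F y)"
  "phi0 GF = amap G (phi0 F) \<cdot> phi0 G"
  by (simp_all add: comp_mon_functor_def)

lemma comp_monoidal_functor: "monoidal_functor C E GF"
proof (intro monoidal_functor.intro monoidal_functor_axioms.intro F.C.monoidal_category_axioms G.D.monoidal_category_axioms
    cat_functor.intro cat_functor_axioms.intro F.C.category_axioms G.D.category_axioms, goal_cases)
  case 1
  show ?case by (auto simp: comp_mon_functor_def)
next
  case 2
  show ?case by (simp add: comp_mon_functor_def)
next
  case (3 f x y)
  then show ?case by (auto simp: hom_def)
next
  case (4 x)
  then show ?case by simp
next
  case (5 f x y g z)
  then show ?case by (auto simp: hom_def F.map_cmp G.map_cmp)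
next
  case 6
  show ?case
  proof (rule nat_isoI2, goal_cases)
    case 1
    show ?case by (simp add: comp_mon_functor_def)
  next
    case (2 x y)
    then show ?case by (simp add: hom_def)
  next
    case (3 f g)
    note [simp] = 3
    have a: "\<lfloor>amap G (amap F (f \<otimes>\<^sub>a\<^bsub>C\<^esub> g))\<rfloor> \<odot> \<lfloor>amap G (phi2 F (src C f, src C g))\<rfloor> =
      \<lfloor>amap G (phi2 F (trg C f, trg C g))\<rfloor> \<odot> \<lfloor>amap G (amap F f \<otimes>\<^sub>a\<^bsub>D\<^esub> amap F g)\<rfloor>"
      using arg_cong[OF F.phi2_nat[of f g], of "\<lambda>h. \<lfloor>amap G h\<rfloor>"] by (simp add: chase)
    have b: "\<lfloor>amap G (amap F f \<otimes>\<^sub>a\<^bsub>D\<^esub> amap F g)\<rfloor> \<odot> \<lfloor>phi2 G (omap F (src C f), omap F (src C g))\<rfloor> =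
      \<lfloor>phi2 G (omap F (trg C f), omap F (trg C g))\<rfloor> \<odot> \<lfloor>amap G (amap F f) \<otimes>\<^sub>a amap G (amap F g)\<rfloor>"
      using G.phi2_nat[of "amap F f" "amap F g", THEN G.D.up] by (simp add: chase)
    show ?case
      by (rule G.D.lift_eqI) (simp_all add: chase a[THEN G.D.re] b)
  qed
next
  case 7
  show ?case by (simp add: hom_def)
next
  case 8
  show ?case by simp
next
  case (9 u v w)
  note [simp] = 9
  have a: "\<lfloor>amap G (amap F (assoc C (u, v, w)))\<rfloor> \<odot> \<lfloor>amap G (phi2 F (u \<otimes>\<^bsub>C\<^esub> v, w))\<rfloor> \<odot> \<lfloor>amap G (phi2 F (u, v) \<otimes>\<^sub>a\<^bsub>D\<^esub> ident D (omap F w))\<rfloor> =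
    \<lfloor>amap G (phi2 F (u, v \<otimes>\<^bsub>C\<^esub> w))\<rfloor> \<odot> \<lfloor>amap G (ident D (omap F u) \<otimes>\<^sub>a\<^bsub>D\<^esub> phi2 F (v, w))\<rfloor> \<odot> \<lfloor>amap G (assoc D (omap F u, omap F v, omap F w))\<rfloor>"
    using arg_cong[OF F.phi2_assoc[of u v w], of "\<lambda>h. \<lfloor>amap G h\<rfloor>"] by (simp add: chase)
  show ?case
    by (rule G.D.lift_eqI) (simp_all add: chase G.phi2_in[THEN G.D.re] a[THEN G.D.re3] G.phi2_assoc_l)
next
  case (10 v)
  note [simp] = 10
  have a: "\<lfloor>amap G (amap F (lunit C v))\<rfloor> \<odot> \<lfloor>amap G (phi2 F (\<I>\<^bsub>C\<^esub>, v))\<rfloor> \<odot> \<lfloor>amap G (phi0 F \<otimes>\<^sub>a\<^bsub>D\<^esub> ident D (omap F v))\<rfloor> =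
    \<lfloor>amap G (lunit D (omap F v))\<rfloor>"
    using arg_cong[OF F.phi0_left[of v], of "\<lambda>h. \<lfloor>amap G h\<rfloor>"] by (simp add: chase)
  show ?case
    by (rule G.D.lift_eqI) (simp_all add: chase G.phi2_in[THEN G.D.re] a[THEN G.D.re3] G.phi0_left_l)
next
  case (11 v)
  note [simp] = 11
  have a: "\<lfloor>amap G (amap F (runit C v))\<rfloor> \<odot> \<lfloor>amap G (phi2 F (v, \<I>\<^bsub>C\<^esub>))\<rfloor> \<odot> \<lfloor>amap G (ident D (omap F v) \<otimes>\<^sub>a\<^bsub>D\<^esub> phi0 F)\<rfloor> =
    \<lfloor>amap G (runit D (omap F v))\<rfloor>"
    using arg_cong[OF F.phi0_right[of v], of "\<lambda>h. \<lfloor>amap G h\<rfloor>"] by (simp add: chase)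
  show ?case
    by (rule G.D.lift_eqI) (simp_all add: chase G.phi2_in[THEN G.D.re] a[THEN G.D.re3] G.phi0_right_l)
qed

end

context monoidal_functor
begin

lemma functor_ext: "omap F \<in> extensional (obj C)" "amap F \<in> extensional (arr C)" "phi2 F \<in> extensional (obj C \<times> obj C)"
  using omap_obj amap_ext nat_isoD(1)[OF phi2_iso] by (auto simp: PiE_def)

end

lemma id_mon_functor_simps [simp]:
  "x \<in> obj C \<Longrightarrow> omap (id_mon_functor C) x = x"
  "f \<in> arr C \<Longrightarrow> amap (id_mon_functor C) f = f"
  "x \<in> obj C \<Longrightarrow> y \<in> obj C \<Longrightarrow> phi2 (id_mon_functor C) (x, y) = ident C (x \<otimes>\<^bsub>C\<^esub> y)"
  "phi0 (id_mon_functor C) = ident C \<I>\<^bsub>C\<^esub>"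
  by (simp_all add: id_mon_functor_def)

lemma comp_id_mon_functor:
  assumes "monoidal_functor C D F"
  shows "comp_mon_functor C D F (id_mon_functor C) = F" "comp_mon_functor C D (id_mon_functor D) F = F"
proof -
  interpret monoidal_functor C D F by fact
  show "comp_mon_functor C D F (id_mon_functor C) = F"
  proof (rule mon_functor_eqI)
    show "omap (comp_mon_functor C D F (id_mon_functor C)) = omap F"
      by (rule extensionalityI[OF _ functor_ext(1)]) (auto simp: comp_mon_functor_def)
    show "amap (comp_mon_functor C D F (id_mon_functor C)) = amap F"
      by (rule extensionalityI[OF _ functor_ext(2)]) (auto simp: comp_mon_functor_def)
    show "phi2 (comp_mon_functor C D F (id_mon_functor C)) = phi2 F"
      by (rule extensionalityI[OF _ functor_ext(3)]) (auto simp: comp_mon_functor_def)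
  qed (simp add: comp_mon_functor_def)
  show "comp_mon_functor C D (id_mon_functor D) F = F"
  proof (rule mon_functor_eqI)
    show "omap (comp_mon_functor C D (id_mon_functor D) F) = omap F"
      by (rule extensionalityI[OF _ functor_ext(1)]) (auto simp: comp_mon_functor_def)
    show "amap (comp_mon_functor C D (id_mon_functor D) F) = amap F"
      by (rule extensionalityI[OF _ functor_ext(2)]) (auto simp: comp_mon_functor_def)
    show "phi2 (comp_mon_functor C D (id_mon_functor D) F) = phi2 F"
      by (rule extensionalityI[OF _ functor_ext(3)]) (auto simp: comp_mon_functor_def)
  qed (simp add: comp_mon_functor_def)
qed

lemma comp_mon_functor_assoc:
  assumes "monoidal_functor C D F" "monoidal_functor D E G" "monoidal_functor E E' L"
  shows "comp_mon_functor C E' (comp_mon_functor D E' L G) F = comp_mon_functor C E' L (comp_mon_functor C E G F)"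
proof -
  interpret F: monoidal_functor C D F by fact
  interpret G: monoidal_functor D E G by fact
  interpret L: monoidal_functor E E' L by fact
  show ?thesis
    by (auto simp: comp_mon_functor_def L.map_cmp L.D.assoc_arr intro!: restrict_ext)
qed

lemma mon_nat_transD:
  assumes "mon_nat_trans C D F G \<eta>"
  shows "\<eta> \<in> extensional (obj C)"
    "x \<in> obj C \<Longrightarrow> \<eta> x \<in> arr D" "x \<in> obj C \<Longrightarrow> src D (\<eta> x) = omap F x" "x \<in> obj C \<Longrightarrow> trg D (\<eta> x) = omap G x"
    "f \<in> arr C \<Longrightarrow> amap G f \<cdot>\<^bsub>D\<^esub> \<eta> (src C f) = \<eta> (trg C f) \<cdot>\<^bsub>D\<^esub> amap F f"
    "x \<in> obj C \<Longrightarrow> y \<in> obj C \<Longrightarrow> \<eta> (x \<otimes>\<^bsub>C\<^esub> y) \<cdot>\<^bsub>D\<^esub> phi2 F (x, y) = phi2 G (x, y) \<cdot>\<^bsub>D\<^esub> (\<eta> x \<otimes>\<^sub>a\<^bsub>D\<^esub> \<eta> y)"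
    "\<eta> \<I>\<^bsub>C\<^esub> \<cdot>\<^bsub>D\<^esub> phi0 F = phi0 G"
  using assms by (auto simp: mon_nat_trans_def nat_trans_def hom_def)

lemma ident_mon_nat_trans:
  assumes "monoidal_functor C D F"
  shows "mon_nat_trans C D F F (\<lambda>x \<in> obj C. ident D (omap F x))"
proof -
  interpret monoidal_functor C D F by fact
  show ?thesis
    by (simp add: mon_nat_trans_def nat_trans_def hom_def)
qed

lemma vcomp_mon_nat_trans:
  fixes D (structure)
  assumes "monoidal_functor C D F" "monoidal_functor C D G" "monoidal_functor C D L"
    and \<eta>: "mon_nat_trans C D F G \<eta>" and \<theta>: "mon_nat_trans C D G L \<theta>"
  shows "mon_nat_trans C D F L (\<lambda>x \<in> obj C. \<theta> x \<cdot> \<eta> x)"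
proof -
  interpret F: monoidal_functor C D F by fact
  interpret G: monoidal_functor C D G by fact
  interpret L: monoidal_functor C D L by fact
  note t = mon_nat_transD(2-4)[OF \<eta>] mon_nat_transD(2-4)[OF \<theta>]
  have n: "amap L f \<cdot> (\<theta> (src C f) \<cdot> \<eta> (src C f)) = (\<theta> (trg C f) \<cdot> \<eta> (trg C f)) \<cdot> amap F f" if [simp]: "f \<in> arr C" for f
  proof -
    have a: "\<lfloor>amap G f\<rfloor> \<odot> \<lfloor>\<eta> (src C f)\<rfloor> = \<lfloor>\<eta> (trg C f)\<rfloor> \<odot> \<lfloor>amap F f\<rfloor>"
      "\<lfloor>amap L f\<rfloor> \<odot> \<lfloor>\<theta> (src C f)\<rfloor> = \<lfloor>\<theta> (trg C f)\<rfloor> \<odot> \<lfloor>amap G f\<rfloor>"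
      using mon_nat_transD(5)[OF \<eta>, of f, THEN F.D.up] mon_nat_transD(5)[OF \<theta>, of f, THEN F.D.up] by (simp_all add: chase t)
    show ?thesis
      by (rule F.D.lift_eqI) (simp_all add: chase t a(1) a(2)[THEN F.D.re])
  qed
  have m: "(\<theta> (x \<otimes>\<^bsub>C\<^esub> y) \<cdot> \<eta> (x \<otimes>\<^bsub>C\<^esub> y)) \<cdot> phi2 F (x, y) = phi2 L (x, y) \<cdot> ((\<theta> x \<cdot> \<eta> x) \<otimes>\<^sub>a (\<theta> y \<cdot> \<eta> y))"
    if [simp]: "x \<in> obj C" "y \<in> obj C" for x y
  proof -
    have a: "\<lfloor>\<eta> (x \<otimes>\<^bsub>C\<^esub> y)\<rfloor> \<odot> \<lfloor>phi2 F (x, y)\<rfloor> = \<lfloor>phi2 G (x, y)\<rfloor> \<odot> \<lfloor>\<eta> x \<otimes>\<^sub>a \<eta> y\<rfloor>"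
      "\<lfloor>\<theta> (x \<otimes>\<^bsub>C\<^esub> y)\<rfloor> \<odot> \<lfloor>phi2 G (x, y)\<rfloor> = \<lfloor>phi2 L (x, y)\<rfloor> \<odot> \<lfloor>\<theta> x \<otimes>\<^sub>a \<theta> y\<rfloor>"
      using mon_nat_transD(6)[OF \<eta>, of x y, THEN F.D.up] mon_nat_transD(6)[OF \<theta>, of x y, THEN F.D.up] by (simp_all add: chase t)
    show ?thesis
      by (rule F.D.lift_eqI) (simp_all add: chase t a a[THEN F.D.re] F.D.tens.bimap_ocmp)
  qed
  have u: "(\<theta> \<I>\<^bsub>C\<^esub> \<cdot> \<eta> \<I>\<^bsub>C\<^esub>) \<cdot> phi0 F = phi0 L"
    using mon_nat_transD(7)[OF \<eta>] mon_nat_transD(7)[OF \<theta>] by (simp add: F.D.assoc_arr t)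
  show ?thesis
    using t n m u by (simp add: mon_nat_trans_def nat_trans_def hom_def)
qed

lemma hcomp_mon_nat_trans:
  fixes E (structure)
  assumes "monoidal_functor C D F" "monoidal_functor C D G" "monoidal_functor D E F'" "monoidal_functor D E G'"
    and \<eta>: "mon_nat_trans C D F G \<eta>" and \<theta>: "mon_nat_trans D E F' G' \<theta>"
  shows "mon_nat_trans C E (comp_mon_functor C E F' F) (comp_mon_functor C E G' G)
    (\<lambda>x \<in> obj C. \<theta> (omap G x) \<cdot> amap F' (\<eta> x))"
proof -
  interpret F: monoidal_functor C D F by fact
  interpret G: monoidal_functor C D G by fact
  interpret F': monoidal_functor D E F' by fact
  interpret G': monoidal_functor D E G' by fact
  interpret F'F: two_monoidal_functors C D E F F' ..
  interpret G'G: two_monoidal_functors C D E G G' ..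
  note t = mon_nat_transD(2-4)[OF \<eta>] mon_nat_transD(2-4)[OF \<theta>]
  have nat: "\<lfloor>amap G' f\<rfloor> \<odot> \<lfloor>\<theta> (src D f)\<rfloor> = \<lfloor>\<theta> (trg D f)\<rfloor> \<odot> \<lfloor>amap F' f\<rfloor>" if "f \<in> arr D" for f
    using mon_nat_transD(5)[OF \<theta>, of f, THEN F'.D.up] that by (simp add: chase t)
  have n: "amap G' (amap G f) \<cdot> (\<theta> (omap G (src C f)) \<cdot> amap F' (\<eta> (src C f))) =
      (\<theta> (omap G (trg C f)) \<cdot> amap F' (\<eta> (trg C f))) \<cdot> amap F' (amap F f)" if [simp]: "f \<in> arr C" for f
  proof -
    have a: "\<lfloor>amap F' (amap G f)\<rfloor> \<odot> \<lfloor>amap F' (\<eta> (src C f))\<rfloor> = \<lfloor>amap F' (\<eta> (trg C f))\<rfloor> \<odot> \<lfloor>amap F' (amap F f)\<rfloor>"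
      using arg_cong[OF mon_nat_transD(5)[OF \<eta>, of f], of "\<lambda>h. \<lfloor>amap F' h\<rfloor>"] by (simp add: chase t)
    have b: "\<lfloor>amap G' (amap G f)\<rfloor> \<odot> \<lfloor>\<theta> (omap G (src C f))\<rfloor> = \<lfloor>\<theta> (omap G (trg C f))\<rfloor> \<odot> \<lfloor>amap F' (amap G f)\<rfloor>"
      using nat[of "amap G f"] by simp
    show ?thesis
      by (rule F'.D.lift_eqI) (simp_all add: chase t b[THEN F'.D.re] a)
  qed
  have m: "(\<theta> (omap G (x \<otimes>\<^bsub>C\<^esub> y)) \<cdot> amap F' (\<eta> (x \<otimes>\<^bsub>C\<^esub> y))) \<cdot> (amap F' (phi2 F (x, y)) \<cdot> phi2 F' (omap F x, omap F y)) =
      (amap G' (phi2 G (x, y)) \<cdot> phi2 G' (omap G x, omap G y)) \<cdot>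
      ((\<theta> (omap G x) \<cdot> amap F' (\<eta> x)) \<otimes>\<^sub>a (\<theta> (omap G y) \<cdot> amap F' (\<eta> y)))"
    if [simp]: "x \<in> obj C" "y \<in> obj C" for x y
  proof -
    have a: "\<lfloor>amap F' (\<eta> (x \<otimes>\<^bsub>C\<^esub> y))\<rfloor> \<odot> \<lfloor>amap F' (phi2 F (x, y))\<rfloor> = \<lfloor>amap F' (phi2 G (x, y))\<rfloor> \<odot> \<lfloor>amap F' (\<eta> x \<otimes>\<^sub>a\<^bsub>D\<^esub> \<eta> y)\<rfloor>"
      using arg_cong[OF mon_nat_transD(6)[OF \<eta>, of x y], of "\<lambda>h. \<lfloor>amap F' h\<rfloor>"] by (simp add: chase t)
    have b: "\<lfloor>\<theta> (omap G (x \<otimes>\<^bsub>C\<^esub> y))\<rfloor> \<odot> \<lfloor>amap F' (phi2 G (x, y))\<rfloor> = \<lfloor>amap G' (phi2 G (x, y))\<rfloor> \<odot> \<lfloor>\<theta> (omap G x \<otimes>\<^bsub>D\<^esub> omap G y)\<rfloor>"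
      using nat[of "phi2 G (x, y)"] by simp
    have d: "\<lfloor>amap F' (\<eta> x \<otimes>\<^sub>a\<^bsub>D\<^esub> \<eta> y)\<rfloor> \<odot> \<lfloor>phi2 F' (omap F x, omap F y)\<rfloor> = \<lfloor>phi2 F' (omap G x, omap G y)\<rfloor> \<odot> \<lfloor>amap F' (\<eta> x) \<otimes>\<^sub>a amap F' (\<eta> y)\<rfloor>"
      using F'.phi2_nat[of "\<eta> x" "\<eta> y", THEN F'.D.up] by (simp add: chase t)
    have e: "\<lfloor>\<theta> (omap G x \<otimes>\<^bsub>D\<^esub> omap G y)\<rfloor> \<odot> \<lfloor>phi2 F' (omap G x, omap G y)\<rfloor> = \<lfloor>phi2 G' (omap G x, omap G y)\<rfloor> \<odot> \<lfloor>\<theta> (omap G x) \<otimes>\<^sub>a \<theta> (omap G y)\<rfloor>"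
      using mon_nat_transD(6)[OF \<theta>, of "omap G x" "omap G y", THEN F'.D.up] by (simp add: chase t)
    show ?thesis
      by (rule F'.D.lift_eqI) (simp_all add: chase t a[THEN F'.D.re] b[THEN F'.D.re] d e[THEN F'.D.re] F'.D.tens.bimap_ocmp)
  qed
  have u: "(\<theta> (omap G \<I>\<^bsub>C\<^esub>) \<cdot> amap F' (\<eta> \<I>\<^bsub>C\<^esub>)) \<cdot> (amap F' (phi0 F) \<cdot> phi0 F') = amap G' (phi0 G) \<cdot> phi0 G'"
  proof -
    have a: "\<lfloor>amap F' (\<eta> \<I>\<^bsub>C\<^esub>)\<rfloor> \<odot> \<lfloor>amap F' (phi0 F)\<rfloor> = \<lfloor>amap F' (phi0 G)\<rfloor>"
      using arg_cong[OF mon_nat_transD(7)[OF \<eta>], of "\<lambda>h. \<lfloor>amap F' h\<rfloor>"] by (simp add: chase t)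
    have b: "\<lfloor>\<theta> (omap G \<I>\<^bsub>C\<^esub>)\<rfloor> \<odot> \<lfloor>amap F' (phi0 G)\<rfloor> = \<lfloor>amap G' (phi0 G)\<rfloor> \<odot> \<lfloor>\<theta> \<I>\<^bsub>D\<^esub>\<rfloor>"
      using nat[of "phi0 G"] by simp
    have d: "\<lfloor>\<theta> \<I>\<^bsub>D\<^esub>\<rfloor> \<odot> \<lfloor>phi0 F'\<rfloor> = \<lfloor>phi0 G'\<rfloor>"
      using mon_nat_transD(7)[OF \<theta>, THEN F'.D.up] by (simp add: chase t)
    show ?thesis
      by (rule F'.D.lift_eqI) (simp_all add: chase t a[THEN F'.D.re] b[THEN F'.D.re] d)
  qed
  show ?thesis
    using t n m u by (simp add: mon_nat_trans_def nat_trans_def hom_def)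
qed

section \<open>The 2-category of pairs\<close>

text \<open>
  The extensionality premise is part of \<open>gamma G\<close> being a natural transformation;
  \<open>central_morphism\<close> leaves it out.
\<close>

lemma pair_morphism_iff:
  "pair_morphism V P Q G \<longleftrightarrow> pair_over V P \<and> pair_over V Q \<and> gamma G \<in> extensional (obj V) \<and>
    central_morphism V (pcat P) (pcat Q) (pfun P) (pair_braid P) (pfun Q) (pair_braid Q) (gfun G) (gamma G)" (is "?L \<longleftrightarrow> ?R")
proof
  assume ?L
  then interpret pair_morphism V P Q G .
  interpret PG: two_monoidal_functors V "pcat P" "pcat Q" "pfun P" "gfun G" ..
  note n = mon_nat_transD[OF gamma_mon_nat]
  have "central_morphism V (pcat P) (pcat Q) (pfun P) (pair_braid P) (pfun Q) (pair_braid Q) (gfun G) (gamma G)"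
  proof (intro central_morphism.intro central_morphism_axioms.intro P.pair_central Q.pair_central G.monoidal_functor_axioms, goal_cases)
    case (1 v)
    then show ?case using n(2-4)[of v] by (simp add: hom_def)
  next
    case (2 v)
    then show ?case by (rule gamma_iso)
  next
    case (3 f)
    then show ?case using n(5)[of f] by simp
  next
    case (4 v w)
    then show ?case using n(6)[of v w] by simp
  next
    case 5
    then show ?case using n(7) by simp
  next
    case (6 v x)
    then show ?case by (rule gamma_braid)
  qed
  then show ?R using n(1) P.pair_over_axioms Q.pair_over_axioms by simp
next
  assume R: ?R
  then interpret P: pair_over V P by simp
  interpret Q: pair_over V Q using R by simp
  interpret central_morphism V "pcat P" "pcat Q" "pfun P" "pair_braid P" "pfun Q" "pair_braid Q" "gfun G" "gamma G"
    using R by simp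
  interpret PG: two_monoidal_functors V "pcat P" "pcat Q" "pfun P" "gfun G" ..
  show ?L
  proof (intro pair_morphism.intro pair_morphism_axioms.intro P.pair_over_axioms Q.pair_over_axioms G.monoidal_functor_axioms, goal_cases)
    case 1
    show ?case
      using R \<gamma>_nat \<gamma>_tens \<gamma>_unit by (simp add: mon_nat_trans_def nat_trans_def hom_def)
  next
    case (2 v)
    then show ?case by simp
  next
    case (3 v t)
    then show ?case by (rule \<gamma>_braid)
  qed
qed

lemma (in central_functor) id_central_morphism:
  "central_morphism V C C F B F B (id_mon_functor C) (\<lambda>v \<in> obj V. ident C (omap F v))"
proof (intro central_morphism.intro central_morphism_axioms.intro central_functor_axioms D.id_monoidal_functor, goal_cases)
qed (simp_all add: hom_def)

lemma comp_central_morphism: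
  fixes E (structure)
  assumes "central_morphism V C D F B F' B' G \<gamma>" "central_morphism V D E F' B' F'' B'' G' \<gamma>'"
  shows "central_morphism V C E F B F'' B'' (comp_mon_functor C E G' G) (\<lambda>v \<in> obj V. amap G' (\<gamma> v) \<cdot> \<gamma>' v)"
proof -
  interpret G: central_morphism V C D F B F' B' G \<gamma> by fact
  interpret G': central_morphism V D E F' B' F'' B'' G' \<gamma>' by fact
  interpret G'G: two_monoidal_functors C D E G G' ..
  show ?thesis
  proof (intro central_morphism.intro central_morphism_axioms.intro G.P.central_functor_axioms G'.Q.central_functor_axioms
      G'G.comp_monoidal_functor, goal_cases)
    case (1 v)
    then show ?case by (simp add: hom_def)
  next
    case (2 v)
    then show ?case by simp
  next
    case (3 f)
    note [simp] = 3
    have a: "\<lfloor>amap G' (amap G (amap F f))\<rfloor> \<odot> \<lfloor>amap G' (\<gamma> (src V f))\<rfloor> = \<lfloor>amap G' (\<gamma> (trg V f))\<rfloor> \<odot> \<lfloor>amap G' (amap F' f)\<rfloor>"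
      using arg_cong[OF G.\<gamma>_nat[of f], of "\<lambda>h. \<lfloor>amap G' h\<rfloor>"] by (simp add: chase)
    have b: "\<lfloor>amap G' (amap F' f)\<rfloor> \<odot> \<lfloor>\<gamma>' (src V f)\<rfloor> = \<lfloor>\<gamma>' (trg V f)\<rfloor> \<odot> \<lfloor>amap F'' f\<rfloor>"
      using G'.\<gamma>_nat[of f, THEN G'.Q.D.up] by (simp add: chase)
    show ?case
      by (rule G'.Q.D.lift_eqI) (simp_all add: chase a[THEN G'.Q.D.re] b)
  next
    case (4 v w)
    note [simp] = 4
    have a: "\<lfloor>amap G' (\<gamma> (v \<otimes>\<^bsub>V\<^esub> w))\<rfloor> \<odot> \<lfloor>amap G' (phi2 F' (v, w))\<rfloor> =
        \<lfloor>amap G' (amap G (phi2 F (v, w)))\<rfloor> \<odot> \<lfloor>amap G' (phi2 G (omap F v, omap F w))\<rfloor> \<odot> \<lfloor>amap G' (\<gamma> v \<otimes>\<^sub>a\<^bsub>D\<^esub> \<gamma> w)\<rfloor>"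
      using arg_cong[OF G.\<gamma>_tens[of v w], of "\<lambda>h. \<lfloor>amap G' h\<rfloor>"] by (simp add: chase)
    have b: "\<lfloor>\<gamma>' (v \<otimes>\<^bsub>V\<^esub> w)\<rfloor> \<odot> \<lfloor>phi2 F'' (v, w)\<rfloor> =
        \<lfloor>amap G' (phi2 F' (v, w))\<rfloor> \<odot> \<lfloor>phi2 G' (omap F' v, omap F' w)\<rfloor> \<odot> \<lfloor>\<gamma>' v \<otimes>\<^sub>a \<gamma>' w\<rfloor>"
      using G'.\<gamma>_tens[of v w, THEN G'.Q.D.up] by (simp add: chase)
    have d: "\<lfloor>amap G' (\<gamma> v \<otimes>\<^sub>a\<^bsub>D\<^esub> \<gamma> w)\<rfloor> \<odot> \<lfloor>phi2 G' (omap F' v, omap F' w)\<rfloor> =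
        \<lfloor>phi2 G' (omap G (omap F v), omap G (omap F w))\<rfloor> \<odot> \<lfloor>amap G' (\<gamma> v) \<otimes>\<^sub>a amap G' (\<gamma> w)\<rfloor>"
      using G'.G.phi2_nat[of "\<gamma> v" "\<gamma> w", THEN G'.Q.D.up] by (simp add: chase)
    show ?case
      by (rule G'.Q.D.lift_eqI) (simp_all add: chase b a[THEN G'.Q.D.re] d[THEN G'.Q.D.re] G'.Q.D.tens.bimap_ocmp)
  next
    case 5
    have a: "\<lfloor>amap G' (\<gamma> \<I>\<^bsub>V\<^esub>)\<rfloor> \<odot> \<lfloor>amap G' (phi0 F')\<rfloor> = \<lfloor>amap G' (amap G (phi0 F))\<rfloor> \<odot> \<lfloor>amap G' (phi0 G)\<rfloor>"
      using arg_cong[OF G.\<gamma>_unit, of "\<lambda>h. \<lfloor>amap G' h\<rfloor>"] by (simp add: chase)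
    have b: "\<lfloor>\<gamma>' \<I>\<^bsub>V\<^esub>\<rfloor> \<odot> \<lfloor>phi0 F''\<rfloor> = \<lfloor>amap G' (phi0 F')\<rfloor> \<odot> \<lfloor>phi0 G'\<rfloor>"
      using G'.\<gamma>_unit[THEN G'.Q.D.up] by (simp add: chase)
    show ?case
      by (rule G'.Q.D.lift_eqI) (simp_all add: chase b a[THEN G'.Q.D.re])
  next
    case (6 v x)
    note [simp] = 6
    let ?X = "omap G x"
    have a: "\<lfloor>amap G' (amap G (B v x))\<rfloor> \<odot> \<lfloor>amap G' (phi2 G (omap F v, x))\<rfloor> \<odot> \<lfloor>amap G' (\<gamma> v \<otimes>\<^sub>a\<^bsub>D\<^esub> ident D ?X)\<rfloor> =
        \<lfloor>amap G' (phi2 G (x, omap F v))\<rfloor> \<odot> \<lfloor>amap G' (ident D ?X \<otimes>\<^sub>a\<^bsub>D\<^esub> \<gamma> v)\<rfloor> \<odot> \<lfloor>amap G' (B' v ?X)\<rfloor>"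
      using arg_cong[OF G.\<gamma>_braid[of v x], of "\<lambda>h. \<lfloor>amap G' h\<rfloor>"] by (simp add: chase)
    have b: "\<lfloor>amap G' (B' v ?X)\<rfloor> \<odot> \<lfloor>phi2 G' (omap F' v, ?X)\<rfloor> \<odot> \<lfloor>\<gamma>' v \<otimes>\<^sub>a ident E (omap G' ?X)\<rfloor> =
        \<lfloor>phi2 G' (?X, omap F' v)\<rfloor> \<odot> \<lfloor>ident E (omap G' ?X) \<otimes>\<^sub>a \<gamma>' v\<rfloor> \<odot> \<lfloor>B'' v (omap G' ?X)\<rfloor>"
      using G'.\<gamma>_braid[of v ?X, THEN G'.Q.D.up] by (simp add: chase)
    show ?case
      by (rule G'.Q.D.lift_eqI) (simp_all add: chase G'.G.phi2_in[THEN G'.Q.D.re] a[THEN G'.Q.D.re3] b)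
  qed
qed

lemma pair_mor_eqI:
  fixes G H :: "('v, 'o, 'a) pair_mor"
  shows "gfun G = gfun H \<Longrightarrow> gamma G = gamma H \<Longrightarrow> G = H"
  by simp

lemma id_pair_morphism: "pair_over V P \<Longrightarrow> pair_morphism V P P (id_pair_mor V P)"
  unfolding pair_morphism_iff id_pair_mor_def
  using central_functor.id_central_morphism[OF pair_over.pair_central] by auto

lemma comp_pair_morphism:
  "pair_morphism V P Q G \<Longrightarrow> pair_morphism V Q R H \<Longrightarrow> pair_morphism V P R (comp_pair_mor V P R H G)"
  unfolding pair_morphism_iff comp_pair_mor_def
  using comp_central_morphism by auto

lemma pair_mor_gamma:
  assumes "pair_morphism V P Q G" "v \<in> obj V"
  shows "gamma G v \<in> arr (pcat Q)" "src (pcat Q) (gamma G v) = omap (pfun Q) v"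
    "trg (pcat Q) (gamma G v) = omap (gfun G) (omap (pfun P) v)"
proof -
  interpret central_morphism V "pcat P" "pcat Q" "pfun P" "pair_braid P" "pfun Q" "pair_braid Q" "gfun G" "gamma G"
    using assms by (simp add: pair_morphism_iff)
  show "gamma G v \<in> arr (pcat Q)" "src (pcat Q) (gamma G v) = omap (pfun Q) v"
    "trg (pcat Q) (gamma G v) = omap (gfun G) (omap (pfun P) v)"
    using assms by simp_all
qed

lemma pair_morphism_monoidal: "pair_morphism V P Q G \<Longrightarrow> monoidal_functor (pcat P) (pcat Q) (gfun G)"
  by (simp add: pair_morphism_def)

lemma pairs_concrete:
  "concrete_two_category {P. pair_over V P} (\<lambda>P Q. {G. pair_morphism V P Q G}) (id_pair_mor V) (\<lambda>P Q R. comp_pair_mor V P R)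
    (pair_trans V) pcat gfun"
proof (intro concrete_two_category.intro, unfold mem_Collect_eq, goal_cases)
  case (1 P)
  then interpret pair_over V P .
  show ?case by (rule T.category_axioms)
next
  case (2 P Q G)
  then interpret monoidal_functor "pcat P" "pcat Q" "gfun G" by (intro pair_morphism_monoidal)
  show ?case by (rule cat_functor_axioms)
next
  case (3 P)
  then show ?case by (rule id_pair_morphism)
next
  case (4 P Q R F G)
  then show ?case by (intro comp_pair_morphism)
next
  case (5 P Q F)
  then interpret pair_morphism V P Q F by simp
  show ?case
  proof (rule pair_mor_eqI)
    show "gamma (comp_pair_mor V P Q F (id_pair_mor V P)) = gamma F"
      using mon_nat_transD(1)[OF gamma_mon_nat] pair_mor_gamma[OF 5(3)]
      by (intro extensionalityI[where A = "obj V"]) (simp_all add: comp_pair_mor_def id_pair_mor_def)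
  qed (simp add: comp_pair_mor_def id_pair_mor_def comp_id_mon_functor G.monoidal_functor_axioms)
next
  case (6 P Q F)
  then interpret pair_morphism V P Q F by simp
  show ?case
  proof (rule pair_mor_eqI)
    show "gamma (comp_pair_mor V P Q (id_pair_mor V Q) F) = gamma F"
      using mon_nat_transD(1)[OF gamma_mon_nat] pair_mor_gamma[OF 6(3)]
      by (intro extensionalityI[where A = "obj V"]) (simp_all add: comp_pair_mor_def id_pair_mor_def)
  qed (simp add: comp_pair_mor_def id_pair_mor_def comp_id_mon_functor G.monoidal_functor_axioms)
next
  case (7 P Q R S F G L)
  note m = 7(5-7)[THEN pair_morphism_monoidal]
  note t = pair_mor_gamma[OF 7(5)] pair_mor_gamma[OF 7(6)] pair_mor_gamma[OF 7(7)]
  interpret P: pair_over V P using 7 by simp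
  interpret F: monoidal_functor "pcat P" "pcat Q" "gfun F" by (rule m)
  interpret G: monoidal_functor "pcat Q" "pcat R" "gfun G" by (rule m)
  interpret L: monoidal_functor "pcat R" "pcat S" "gfun L" by (rule m)
  interpret Q: pair_over V Q using 7 by simp
  interpret R: pair_over V R using 7 by simp
  interpret LG: two_monoidal_functors "pcat Q" "pcat R" "pcat S" "gfun G" "gfun L" ..
  show ?case
    using comp_mon_functor_assoc[OF m]
    by (simp add: comp_pair_mor_def t L.map_cmp L.D.assoc_arr cong: restrict_cong)
next
  case (8 P x)
  then show ?case by (simp add: id_pair_mor_def)
next
  case (9 P f)
  then show ?case by (simp add: id_pair_mor_def)
next
  case (10 P Q R F G x)
  then show ?case by (simp add: comp_pair_mor_def comp_mon_functor_def)
next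
  case (11 P Q R F G x)
  then show ?case by (simp add: comp_pair_mor_def comp_mon_functor_def)
next
  case (12 P Q F G \<eta>)
  then show ?case by (simp add: pair_trans_def mon_nat_trans_def)
next
  case (13 P Q F)
  interpret pair_over V P using 13 by simp
  interpret Q: pair_over V Q using 13 by simp
  show ?case
    using 13 ident_mon_nat_trans[OF 13(3)[THEN pair_morphism_monoidal]] pair_mor_gamma[OF 13(3)]
    by (simp add: pair_trans_def)
next
  case (14 P Q F G L \<eta> \<theta>)
  interpret P: pair_over V P using 14 by simp
  interpret Q: pair_over V Q using 14 by simp
  have n: "mon_nat_trans (pcat P) (pcat Q) (gfun F) (gfun G) \<eta>" "mon_nat_trans (pcat P) (pcat Q) (gfun G) (gfun L) \<theta>"
    and e: "v \<in> obj V \<Longrightarrow> \<eta> (omap (pfun P) v) \<cdot>\<^bsub>pcat Q\<^esub> gamma F v = gamma G v"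
      "v \<in> obj V \<Longrightarrow> \<theta> (omap (pfun P) v) \<cdot>\<^bsub>pcat Q\<^esub> gamma G v = gamma L v" for v
    using 14 by (simp_all add: pair_trans_def)
  note t = mon_nat_transD(2-4)[OF n(1)] mon_nat_transD(2-4)[OF n(2)]
  have "(\<theta> (omap (pfun P) v) \<cdot>\<^bsub>pcat Q\<^esub> \<eta> (omap (pfun P) v)) \<cdot>\<^bsub>pcat Q\<^esub> gamma F v = gamma L v" if "v \<in> obj V" for v
    using that e[of v] t by (simp add: Q.T.assoc_arr pair_mor_gamma[OF 14(3)])
  then show ?case
    using vcomp_mon_nat_trans[OF 14(3-5)[THEN pair_morphism_monoidal] n] by (simp add: pair_trans_def)
next
  case (15 P Q R F G F' G' \<eta> \<theta>)
  interpret P: pair_over V P using 15 by simp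
  interpret Q: pair_over V Q using 15 by simp
  interpret R: pair_over V R using 15 by simp
  note m = 15(4-7)[THEN pair_morphism_monoidal]
  interpret F: monoidal_functor "pcat P" "pcat Q" "gfun F" by (rule m)
  interpret G: monoidal_functor "pcat P" "pcat Q" "gfun G" by (rule m)
  interpret F': monoidal_functor "pcat Q" "pcat R" "gfun F'" by (rule m)
  interpret G': monoidal_functor "pcat Q" "pcat R" "gfun G'" by (rule m)
  let ?E = "pcat R"
  have n: "mon_nat_trans (pcat P) (pcat Q) (gfun F) (gfun G) \<eta>" "mon_nat_trans (pcat Q) (pcat R) (gfun F') (gfun G') \<theta>"
    and e: "v \<in> obj V \<Longrightarrow> \<eta> (omap (pfun P) v) \<cdot>\<^bsub>pcat Q\<^esub> gamma F v = gamma G v"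
      "v \<in> obj V \<Longrightarrow> \<theta> (omap (pfun Q) v) \<cdot>\<^bsub>pcat R\<^esub> gamma F' v = gamma G' v" for v
    using 15 by (simp_all add: pair_trans_def)
  note t = mon_nat_transD(2-4)[OF n(1)] mon_nat_transD(2-4)[OF n(2)]
    pair_mor_gamma[OF 15(4)] pair_mor_gamma[OF 15(5)] pair_mor_gamma[OF 15(6)] pair_mor_gamma[OF 15(7)]
  have "(\<theta> (omap (gfun G) (omap (pfun P) v)) \<cdot>\<^bsub>?E\<^esub> amap (gfun F') (\<eta> (omap (pfun P) v))) \<cdot>\<^bsub>?E\<^esub>
      (amap (gfun F') (gamma F v) \<cdot>\<^bsub>?E\<^esub> gamma F' v) = amap (gfun G') (gamma G v) \<cdot>\<^bsub>?E\<^esub> gamma G' v"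
    if [simp]: "v \<in> obj V" for v
  proof -
    have a: "\<lfloor>amap (gfun F') (\<eta> (omap (pfun P) v))\<rfloor>\<^bsub>?E\<^esub> \<odot>\<^bsub>?E\<^esub> \<lfloor>amap (gfun F') (gamma F v)\<rfloor>\<^bsub>?E\<^esub> = \<lfloor>amap (gfun F') (gamma G v)\<rfloor>\<^bsub>?E\<^esub>"
      using arg_cong[OF e(1)[of v], of "\<lambda>h. \<lfloor>amap (gfun F') h\<rfloor>\<^bsub>?E\<^esub>"] by (simp add: chase t)
    have b: "\<lfloor>amap (gfun G') (gamma G v)\<rfloor>\<^bsub>?E\<^esub> \<odot>\<^bsub>?E\<^esub> \<lfloor>\<theta> (omap (pfun Q) v)\<rfloor>\<^bsub>?E\<^esub> =
        \<lfloor>\<theta> (omap (gfun G) (omap (pfun P) v))\<rfloor>\<^bsub>?E\<^esub> \<odot>\<^bsub>?E\<^esub> \<lfloor>amap (gfun F') (gamma G v)\<rfloor>\<^bsub>?E\<^esub>"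
      using mon_nat_transD(5)[OF n(2), of "gamma G v", THEN R.T.up] by (simp add: chase t)
    have d: "\<lfloor>\<theta> (omap (pfun Q) v)\<rfloor>\<^bsub>?E\<^esub> \<odot>\<^bsub>?E\<^esub> \<lfloor>gamma F' v\<rfloor>\<^bsub>?E\<^esub> = \<lfloor>gamma G' v\<rfloor>\<^bsub>?E\<^esub>"
      using e(2)[of v, THEN R.T.up] by (simp add: chase t)
    show ?thesis
      by (rule R.T.lift_eqI) (simp_all add: chase t a[THEN R.T.re] b[symmetric, THEN R.T.re] d)
  qed
  then show ?case
    using hcomp_mon_nat_trans[OF m n] by (simp add: pair_trans_def comp_pair_mor_def)
qed

section \<open>The 2-category of module monoidal categories\<close>

lemma (in module_functor) s_ext: "s \<in> extensional (obj V \<times> obj M)"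
  using nat_isoD(1)[OF s_iso] by simp

lemma id_umm_functor:
  assumes "umm_category V M"
  shows "umm_functor V M M (id_umm_functor V M)"
proof -
  interpret umm V "ucat M" "uact M" "alpha1 M" "alpha2 M"
    using assms by (simp add: umm_def)
  have [simp]: "ufun (id_umm_functor V M) = id_mon_functor (ucat M)"
    "v \<in> obj V \<Longrightarrow> x \<in> obj (ucat M) \<Longrightarrow> ustr (id_umm_functor V M) (v, x) = ident (ucat M) (v \<rhd>\<^bsub>uact M\<^esub> x)" for v x
    by (simp_all add: id_umm_functor_def)
  have f: "monoidal_functor (ucat M) (ucat M) (id_mon_functor (ucat M))" by (rule C.id_monoidal_functor)
  then interpret I: monoidal_functor "ucat M" "ucat M" "id_mon_functor (ucat M)" .
  show ?thesis
  proof (intro umm_functor.intro umm_functor_axioms.intro module_functor.intro module_functor_axioms.intro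
      module_category_axioms assms, goal_cases)
    case 1
    show ?case using f by simp
  next
    case 2
    show ?case using I.cat_functor_axioms by simp
  next
    case 3
    show ?case
      by (rule nat_isoI2) (simp_all add: id_umm_functor_def hom_def)
  qed simp_all
qed

text \<open>
  Each law of the composite is the law for \<open>F\<close>, transported by \<open>G\<close>,
  followed by the law for \<open>G\<close> at the images under \<open>F\<close>; the naturality
  of the strength of \<open>G\<close> connects the two.
\<close>

lemma comp_umm_functor:
  assumes "umm_functor V M N F" "umm_functor V N R G"
  shows "umm_functor V M R (comp_umm_functor V M R G F)"
proof -
  interpret F: umm_functor V M N F by fact
  interpret G: umm_functor V N R G by fact
  interpret GF: two_monoidal_functors "ucat M" "ucat N" "ucat R" "ufun F" "ufun G" ..
  let ?E = "ucat R"
  let ?F = "ufun F" and ?G = "ufun G" and ?H = "comp_mon_functor (ucat M) ?E (ufun G) (ufun F)"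
  have [simp]: "ufun (comp_umm_functor V M R G F) = ?H"
    "v \<in> obj V \<Longrightarrow> x \<in> obj (ucat M) \<Longrightarrow> ustr (comp_umm_functor V M R G F) (v, x) = amap ?G (ustr F (v, x)) \<cdot>\<^bsub>?E\<^esub> ustr G (v, omap ?F x)" for v x
    by (simp_all add: comp_umm_functor_def)
  interpret H: monoidal_functor "ucat M" ?E ?H by (rule GF.comp_monoidal_functor)
  show ?thesis
  proof (intro umm_functor.intro umm_functor_axioms.intro module_functor.intro module_functor_axioms.intro
      F.M.module_category_axioms G.N.module_category_axioms F.source G.target, goal_cases)
    case 1
    show ?case using H.monoidal_functor_axioms by simp
  next
    case 2
    show ?case using H.cat_functor_axioms by simp
  next
    case 3
    show ?case
    proof (rule nat_isoI2, goal_cases)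
      case 1
      show ?case by (simp add: comp_umm_functor_def)
    next
      case (2 v x)
      then show ?case by (simp add: hom_def)
    next
      case (3 f g)
      note [simp] = 3
      have a: "\<lfloor>amap ?G (amap ?F (f \<rhd>\<^sub>a\<^bsub>uact M\<^esub> g))\<rfloor>\<^bsub>?E\<^esub> \<odot>\<^bsub>?E\<^esub> \<lfloor>amap ?G (ustr F (src V f, src (ucat M) g))\<rfloor>\<^bsub>?E\<^esub> =
        \<lfloor>amap ?G (ustr F (trg V f, trg (ucat M) g))\<rfloor>\<^bsub>?E\<^esub> \<odot>\<^bsub>?E\<^esub> \<lfloor>amap ?G (f \<rhd>\<^sub>a\<^bsub>uact N\<^esub> amap ?F g)\<rfloor>\<^bsub>?E\<^esub>"
        using arg_cong[OF nat_isoD(6)[OF F.s_iso, of "(f, g)"], of "\<lambda>h. \<lfloor>amap ?G h\<rfloor>\<^bsub>?E\<^esub>"] by (simp add: chase)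
      have b: "\<lfloor>amap ?G (f \<rhd>\<^sub>a\<^bsub>uact N\<^esub> amap ?F g)\<rfloor>\<^bsub>?E\<^esub> \<odot>\<^bsub>?E\<^esub> \<lfloor>ustr G (src V f, omap ?F (src (ucat M) g))\<rfloor>\<^bsub>?E\<^esub> =
        \<lfloor>ustr G (trg V f, omap ?F (trg (ucat M) g))\<rfloor>\<^bsub>?E\<^esub> \<odot>\<^bsub>?E\<^esub> \<lfloor>f \<rhd>\<^sub>a\<^bsub>uact R\<^esub> amap ?G (amap ?F g)\<rfloor>\<^bsub>?E\<^esub>"
        using nat_isoD(6)[OF G.s_iso, of "(f, amap ?F g)", THEN G.D.up] by (simp add: chase)
      show ?case
        by (rule G.D.lift_eqI) (simp_all add: chase a[THEN G.D.re] b)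
    qed
  next
    case (4 v w x)
    note [simp] = 4
    have a: "\<lfloor>amap ?G (amap ?F (massoc (uact M) (v, w, x)))\<rfloor>\<^bsub>?E\<^esub> \<odot>\<^bsub>?E\<^esub> \<lfloor>amap ?G (ustr F (v \<otimes>\<^bsub>V\<^esub> w, x))\<rfloor>\<^bsub>?E\<^esub> =
      \<lfloor>amap ?G (ustr F (v, w \<rhd>\<^bsub>uact M\<^esub> x))\<rfloor>\<^bsub>?E\<^esub> \<odot>\<^bsub>?E\<^esub> \<lfloor>amap ?G (ident V v \<rhd>\<^sub>a\<^bsub>uact N\<^esub> ustr F (w, x))\<rfloor>\<^bsub>?E\<^esub> \<odot>\<^bsub>?E\<^esub>
      \<lfloor>amap ?G (massoc (uact N) (v, w, omap ?F x))\<rfloor>\<^bsub>?E\<^esub>"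
      using arg_cong[OF F.s_assoc[of v w x], of "\<lambda>h. \<lfloor>amap ?G h\<rfloor>\<^bsub>?E\<^esub>"] by (simp add: chase)
    show ?case
      by (rule G.D.lift_eqI) (simp_all add: chase a[THEN G.D.re] G.s_assoc_l G.s_out[THEN G.D.re])
  next
    case (5 x)
    note [simp] = 5
    have a: "\<lfloor>amap ?G (amap ?F (munit (uact M) x))\<rfloor>\<^bsub>?E\<^esub> \<odot>\<^bsub>?E\<^esub> \<lfloor>amap ?G (ustr F (\<I>\<^bsub>V\<^esub>, x))\<rfloor>\<^bsub>?E\<^esub> = \<lfloor>amap ?G (munit (uact N) (omap ?F x))\<rfloor>\<^bsub>?E\<^esub>"
      using arg_cong[OF F.s_unit[of x], of "\<lambda>h. \<lfloor>amap ?G h\<rfloor>\<^bsub>?E\<^esub>"] by (simp add: chase)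
    show ?case
      by (rule G.D.lift_eqI) (simp_all add: chase a[THEN G.D.re] G.s_unit_l)
  next
    case (6 v x y)
    note [simp] = 6
    have a: "\<lfloor>amap ?G (amap ?F (alpha1 M (v, x, y)))\<rfloor>\<^bsub>?E\<^esub> \<odot>\<^bsub>?E\<^esub> \<lfloor>amap ?G (phi2 ?F (v \<rhd>\<^bsub>uact M\<^esub> x, y))\<rfloor>\<^bsub>?E\<^esub> \<odot>\<^bsub>?E\<^esub>
      \<lfloor>amap ?G (ustr F (v, x) \<otimes>\<^sub>a\<^bsub>ucat N\<^esub> ident (ucat N) (omap ?F y))\<rfloor>\<^bsub>?E\<^esub> =
      \<lfloor>amap ?G (ustr F (v, x \<otimes>\<^bsub>ucat M\<^esub> y))\<rfloor>\<^bsub>?E\<^esub> \<odot>\<^bsub>?E\<^esub> \<lfloor>amap ?G (ident V v \<rhd>\<^sub>a\<^bsub>uact N\<^esub> phi2 ?F (x, y))\<rfloor>\<^bsub>?E\<^esub> \<odot>\<^bsub>?E\<^esub>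
      \<lfloor>amap ?G (alpha1 N (v, omap ?F x, omap ?F y))\<rfloor>\<^bsub>?E\<^esub>"
      using arg_cong[OF F.alpha1_compat[of v x y], of "\<lambda>h. \<lfloor>amap ?G h\<rfloor>\<^bsub>?E\<^esub>"] by (simp add: chase)
    show ?case
      by (rule G.D.lift_eqI)
        (simp_all add: chase G.phi2_in[THEN G.D.re] a[THEN G.D.re3] G.alpha1_compat_l G.s_out[THEN G.D.re])
  next
    case (7 v x y)
    note [simp] = 7
    have a: "\<lfloor>amap ?G (amap ?F (alpha2 M (v, x, y)))\<rfloor>\<^bsub>?E\<^esub> \<odot>\<^bsub>?E\<^esub> \<lfloor>amap ?G (phi2 ?F (x, v \<rhd>\<^bsub>uact M\<^esub> y))\<rfloor>\<^bsub>?E\<^esub> \<odot>\<^bsub>?E\<^esub>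
      \<lfloor>amap ?G (ident (ucat N) (omap ?F x) \<otimes>\<^sub>a\<^bsub>ucat N\<^esub> ustr F (v, y))\<rfloor>\<^bsub>?E\<^esub> =
      \<lfloor>amap ?G (ustr F (v, x \<otimes>\<^bsub>ucat M\<^esub> y))\<rfloor>\<^bsub>?E\<^esub> \<odot>\<^bsub>?E\<^esub> \<lfloor>amap ?G (ident V v \<rhd>\<^sub>a\<^bsub>uact N\<^esub> phi2 ?F (x, y))\<rfloor>\<^bsub>?E\<^esub> \<odot>\<^bsub>?E\<^esub>
      \<lfloor>amap ?G (alpha2 N (v, omap ?F x, omap ?F y))\<rfloor>\<^bsub>?E\<^esub>"
      using arg_cong[OF F.alpha2_compat[of v x y], of "\<lambda>h. \<lfloor>amap ?G h\<rfloor>\<^bsub>?E\<^esub>"] by (simp add: chase)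
    show ?case
      by (rule G.D.lift_eqI)
        (simp_all add: chase G.phi2_in[THEN G.D.re] a[THEN G.D.re3] G.alpha2_compat_l G.s_out[THEN G.D.re])
  qed
qed

lemma umm_functor_eqI:
  fixes F G :: "('v, 'o, 'a) umm_functor"
  shows "ufun F = ufun G \<Longrightarrow> ustr F = ustr G \<Longrightarrow> F = G"
  by simp

lemma umm_functor_monoidal: "umm_functor V M N F \<Longrightarrow> monoidal_functor (ucat M) (ucat N) (ufun F)"
  by (simp add: umm_functor_def)

lemma umm_trans_iff:
  "\<eta> \<in> umm_trans V M N F G \<longleftrightarrow> mon_nat_trans (ucat M) (ucat N) (ufun F) (ufun G) \<eta> \<and>
    (\<forall>v \<in> obj V. \<forall>x \<in> obj (ucat M). \<eta> (v \<rhd>\<^bsub>uact M\<^esub> x) \<cdot>\<^bsub>ucat N\<^esub> ustr F (v, x) = ustr G (v, x) \<cdot>\<^bsub>ucat N\<^esub> (ident V v \<rhd>\<^sub>a\<^bsub>uact N\<^esub> \<eta> x))"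
  by (auto simp: umm_trans_def mod_nat_trans_def mon_nat_trans_def)

lemma umm_concrete:
  "concrete_two_category {M. umm_category V M} (\<lambda>M N. {F. umm_functor V M N F}) (id_umm_functor V) (\<lambda>M N R. comp_umm_functor V M R)
    (umm_trans V) ucat ufun"
proof (intro concrete_two_category.intro, unfold mem_Collect_eq, goal_cases)
  case (1 M)
  then interpret umm V "ucat M" "uact M" "alpha1 M" "alpha2 M" by (simp add: umm_def)
  show ?case by (rule C.category_axioms)
next
  case (2 M N F)
  then interpret monoidal_functor "ucat M" "ucat N" "ufun F" by (intro umm_functor_monoidal)
  show ?case by (rule cat_functor_axioms)
next
  case (3 M)
  then show ?case by (rule id_umm_functor)
next
  case (4 M N R F G)
  then show ?case by (intro comp_umm_functor)
next
  case (5 M N F)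
  then interpret F: umm_functor V M N F by simp
  show ?case
  proof (rule umm_functor_eqI)
    show "ustr (comp_umm_functor V M N F (id_umm_functor V M)) = ustr F"
      using F.s_ext by (intro extensionalityI[where A = "obj V \<times> obj (ucat M)"]) (auto simp: comp_umm_functor_def id_umm_functor_def)
  qed (simp add: comp_umm_functor_def id_umm_functor_def comp_id_mon_functor F.monoidal_functor_axioms)
next
  case (6 M N F)
  then interpret F: umm_functor V M N F by simp
  show ?case
  proof (rule umm_functor_eqI)
    show "ustr (comp_umm_functor V M N (id_umm_functor V N) F) = ustr F"
      using F.s_ext by (intro extensionalityI[where A = "obj V \<times> obj (ucat M)"]) (auto simp: comp_umm_functor_def id_umm_functor_def)
  qed (simp add: comp_umm_functor_def id_umm_functor_def comp_id_mon_functor F.monoidal_functor_axioms)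
next
  case (7 M N R S F G L)
  note m = 7(5-7)[THEN umm_functor_monoidal]
  interpret F: umm_functor V M N F using 7 by simp
  interpret G: umm_functor V N R G using 7 by simp
  interpret L: umm_functor V R S L using 7 by simp
  interpret LG: two_monoidal_functors "ucat N" "ucat R" "ucat S" "ufun G" "ufun L" ..
  interpret GF: two_monoidal_functors "ucat M" "ucat N" "ucat R" "ufun F" "ufun G" ..
  show ?case
  proof (rule umm_functor_eqI)
    show "ustr (comp_umm_functor V M S (comp_umm_functor V N S L G) F) = ustr (comp_umm_functor V M S L (comp_umm_functor V M R G F))"
      by (rule extensionalityI[where A = "obj V \<times> obj (ucat M)"]) (auto simp: comp_umm_functor_def L.map_cmp L.D.assoc_arr)
  qed (simp add: comp_umm_functor_def comp_mon_functor_assoc[OF m])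
next
  case (8 M x)
  then show ?case by (simp add: id_umm_functor_def)
next
  case (9 M f)
  then show ?case by (simp add: id_umm_functor_def)
next
  case (10 M N R F G x)
  then show ?case by (simp add: comp_umm_functor_def comp_mon_functor_def)
next
  case (11 M N R F G x)
  then show ?case by (simp add: comp_umm_functor_def comp_mon_functor_def)
next
  case (12 M N F G \<eta>)
  then show ?case by (simp add: umm_trans_def mon_nat_trans_def)
next
  case (13 M N F)
  interpret F: umm_functor V M N F using 13 by simp
  show ?case
    using ident_mon_nat_trans[OF F.monoidal_functor_axioms] by (simp add: umm_trans_iff)
next
  case (14 M N F G L \<eta> \<theta>)
  interpret F: umm_functor V M N F using 14 by simp
  interpret G: umm_functor V M N G using 14 by simp
  interpret L: umm_functor V M N L using 14 by simp
  have n: "mon_nat_trans (ucat M) (ucat N) (ufun F) (ufun G) \<eta>" "mon_nat_trans (ucat M) (ucat N) (ufun G) (ufun L) \<theta>"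
    and e: "v \<in> obj V \<Longrightarrow> x \<in> obj (ucat M) \<Longrightarrow> \<eta> (v \<rhd>\<^bsub>uact M\<^esub> x) \<cdot>\<^bsub>ucat N\<^esub> ustr F (v, x) = ustr G (v, x) \<cdot>\<^bsub>ucat N\<^esub> (ident V v \<rhd>\<^sub>a\<^bsub>uact N\<^esub> \<eta> x)"
      "v \<in> obj V \<Longrightarrow> x \<in> obj (ucat M) \<Longrightarrow> \<theta> (v \<rhd>\<^bsub>uact M\<^esub> x) \<cdot>\<^bsub>ucat N\<^esub> ustr G (v, x) = ustr L (v, x) \<cdot>\<^bsub>ucat N\<^esub> (ident V v \<rhd>\<^sub>a\<^bsub>uact N\<^esub> \<theta> x)" for v x
    using 14 by (simp_all add: umm_trans_iff)
  note t = mon_nat_transD(2-4)[OF n(1)] mon_nat_transD(2-4)[OF n(2)]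
  have "(\<theta> (v \<rhd>\<^bsub>uact M\<^esub> x) \<cdot>\<^bsub>ucat N\<^esub> \<eta> (v \<rhd>\<^bsub>uact M\<^esub> x)) \<cdot>\<^bsub>ucat N\<^esub> ustr F (v, x) =
      ustr L (v, x) \<cdot>\<^bsub>ucat N\<^esub> (ident V v \<rhd>\<^sub>a\<^bsub>uact N\<^esub> (\<theta> x \<cdot>\<^bsub>ucat N\<^esub> \<eta> x))" if [simp]: "v \<in> obj V" "x \<in> obj (ucat M)" for v x
  proof -
    have a: "\<lfloor>\<eta> (v \<rhd>\<^bsub>uact M\<^esub> x)\<rfloor>\<^bsub>ucat N\<^esub> \<odot>\<^bsub>ucat N\<^esub> \<lfloor>ustr F (v, x)\<rfloor>\<^bsub>ucat N\<^esub> = \<lfloor>ustr G (v, x)\<rfloor>\<^bsub>ucat N\<^esub> \<odot>\<^bsub>ucat N\<^esub> \<lfloor>ident V v \<rhd>\<^sub>a\<^bsub>uact N\<^esub> \<eta> x\<rfloor>\<^bsub>ucat N\<^esub>"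
      "\<lfloor>\<theta> (v \<rhd>\<^bsub>uact M\<^esub> x)\<rfloor>\<^bsub>ucat N\<^esub> \<odot>\<^bsub>ucat N\<^esub> \<lfloor>ustr G (v, x)\<rfloor>\<^bsub>ucat N\<^esub> = \<lfloor>ustr L (v, x)\<rfloor>\<^bsub>ucat N\<^esub> \<odot>\<^bsub>ucat N\<^esub> \<lfloor>ident V v \<rhd>\<^sub>a\<^bsub>uact N\<^esub> \<theta> x\<rfloor>\<^bsub>ucat N\<^esub>"
      using e(1)[of v x, THEN F.D.up] e(2)[of v x, THEN F.D.up] by (simp_all add: chase t)
    show ?thesis
      by (rule F.D.lift_eqI) (simp_all add: chase t a a[THEN F.D.re])
  qed
  then show ?case
    using vcomp_mon_nat_trans[OF 14(3-5)[THEN umm_functor_monoidal] n] by (simp add: umm_trans_iff)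
next
  case (15 M N R F G F' G' \<eta> \<theta>)
  interpret F: umm_functor V M N F using 15 by simp
  interpret G: umm_functor V M N G using 15 by simp
  interpret F': umm_functor V N R F' using 15 by simp
  interpret G': umm_functor V N R G' using 15 by simp
  note m = 15(4-7)[THEN umm_functor_monoidal]
  let ?E = "ucat R"
  have n: "mon_nat_trans (ucat M) (ucat N) (ufun F) (ufun G) \<eta>" "mon_nat_trans (ucat N) (ucat R) (ufun F') (ufun G') \<theta>"
    and e: "v \<in> obj V \<Longrightarrow> x \<in> obj (ucat M) \<Longrightarrow> \<eta> (v \<rhd>\<^bsub>uact M\<^esub> x) \<cdot>\<^bsub>ucat N\<^esub> ustr F (v, x) = ustr G (v, x) \<cdot>\<^bsub>ucat N\<^esub> (ident V v \<rhd>\<^sub>a\<^bsub>uact N\<^esub> \<eta> x)"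
      "v \<in> obj V \<Longrightarrow> y \<in> obj (ucat N) \<Longrightarrow> \<theta> (v \<rhd>\<^bsub>uact N\<^esub> y) \<cdot>\<^bsub>ucat R\<^esub> ustr F' (v, y) = ustr G' (v, y) \<cdot>\<^bsub>ucat R\<^esub> (ident V v \<rhd>\<^sub>a\<^bsub>uact R\<^esub> \<theta> y)" for v x y
    using 15 by (simp_all add: umm_trans_iff)
  note t = mon_nat_transD(2-4)[OF n(1)] mon_nat_transD(2-4)[OF n(2)]
  have "(\<theta> (omap (ufun G) (v \<rhd>\<^bsub>uact M\<^esub> x)) \<cdot>\<^bsub>?E\<^esub> amap (ufun F') (\<eta> (v \<rhd>\<^bsub>uact M\<^esub> x))) \<cdot>\<^bsub>?E\<^esub>
      (amap (ufun F') (ustr F (v, x)) \<cdot>\<^bsub>?E\<^esub> ustr F' (v, omap (ufun F) x)) =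
      (amap (ufun G') (ustr G (v, x)) \<cdot>\<^bsub>?E\<^esub> ustr G' (v, omap (ufun G) x)) \<cdot>\<^bsub>?E\<^esub>
      (ident V v \<rhd>\<^sub>a\<^bsub>uact R\<^esub> (\<theta> (omap (ufun G) x) \<cdot>\<^bsub>?E\<^esub> amap (ufun F') (\<eta> x)))"
    if [simp]: "v \<in> obj V" "x \<in> obj (ucat M)" for v x
  proof -
    have a: "\<lfloor>amap (ufun F') (\<eta> (v \<rhd>\<^bsub>uact M\<^esub> x))\<rfloor>\<^bsub>?E\<^esub> \<odot>\<^bsub>?E\<^esub> \<lfloor>amap (ufun F') (ustr F (v, x))\<rfloor>\<^bsub>?E\<^esub> =
        \<lfloor>amap (ufun F') (ustr G (v, x))\<rfloor>\<^bsub>?E\<^esub> \<odot>\<^bsub>?E\<^esub> \<lfloor>amap (ufun F') (ident V v \<rhd>\<^sub>a\<^bsub>uact N\<^esub> \<eta> x)\<rfloor>\<^bsub>?E\<^esub>"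
      using arg_cong[OF e(1)[of v x], of "\<lambda>h. \<lfloor>amap (ufun F') h\<rfloor>\<^bsub>?E\<^esub>"] by (simp add: chase t)
    have b: "\<lfloor>\<theta> (omap (ufun G) (v \<rhd>\<^bsub>uact M\<^esub> x))\<rfloor>\<^bsub>?E\<^esub> \<odot>\<^bsub>?E\<^esub> \<lfloor>amap (ufun F') (ustr G (v, x))\<rfloor>\<^bsub>?E\<^esub> =
        \<lfloor>amap (ufun G') (ustr G (v, x))\<rfloor>\<^bsub>?E\<^esub> \<odot>\<^bsub>?E\<^esub> \<lfloor>\<theta> (v \<rhd>\<^bsub>uact N\<^esub> omap (ufun G) x)\<rfloor>\<^bsub>?E\<^esub>"
      using mon_nat_transD(5)[OF n(2), of "ustr G (v, x)", THEN F'.D.up] by (simp add: chase t)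
    have d: "\<lfloor>\<theta> (v \<rhd>\<^bsub>uact N\<^esub> omap (ufun G) x)\<rfloor>\<^bsub>?E\<^esub> \<odot>\<^bsub>?E\<^esub> \<lfloor>ustr F' (v, omap (ufun G) x)\<rfloor>\<^bsub>?E\<^esub> =
        \<lfloor>ustr G' (v, omap (ufun G) x)\<rfloor>\<^bsub>?E\<^esub> \<odot>\<^bsub>?E\<^esub> \<lfloor>ident V v \<rhd>\<^sub>a\<^bsub>uact R\<^esub> \<theta> (omap (ufun G) x)\<rfloor>\<^bsub>?E\<^esub>"
      using e(2)[of v "omap (ufun G) x", THEN F'.D.up] by (simp add: chase t)
    show ?thesis
      by (rule F'.D.lift_eqI) (simp_all add: chase t a[THEN F'.D.re] b[THEN F'.D.re] F'.s_out d[THEN F'.D.re])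
  qed
  then show ?case
    using hcomp_mon_nat_trans[OF m n] by (simp add: umm_trans_iff comp_umm_functor_def)
qed

section \<open>The two 2-functors\<close>

definition umm_of_pair :: "('v, 'w) braided_cat \<Rightarrow> ('v, 'w, 'o, 'a) pair \<Rightarrow> ('v, 'w, 'o, 'a) umm_cat" where
  "umm_of_pair V P =
    \<lparr>ucat = pcat P, uact = central_functor.induced_act V (pcat P) (pfun P),
     alpha1 = central_functor.induced_\<alpha>1 V (pcat P) (pfun P),
     alpha2 = central_functor.induced_\<alpha>2 V (pcat P) (pfun P) (pair_braid P)\<rparr>"

definition umm_functor_of_pair_mor ::
  "('v, 'w) braided_cat \<Rightarrow> ('v, 'w, 'o, 'a) pair \<Rightarrow> ('v, 'w, 'o, 'a) pair \<Rightarrow> ('v, 'o, 'a) pair_mor \<Rightarrow> ('v, 'o, 'a) umm_functor" where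
  "umm_functor_of_pair_mor V P Q G =
    \<lparr>ufun = gfun G, ustr = central_morphism.strength V (pcat P) (pcat Q) (pfun P) (gfun G) (gamma G)\<rparr>"

definition pair_of_umm :: "('v, 'w) braided_cat \<Rightarrow> ('v, 'w, 'o, 'a) umm_cat \<Rightarrow> ('v, 'w, 'o, 'a) pair" where
  "pair_of_umm V M =
    (let F = module_monoidal_category.free_functor V (ucat M) (uact M) (alpha1 M) in
     \<lparr>pcat = ucat M, pfun = F,
      pcen = central_lift V (ucat M) F (module_monoidal_category.free_braid V (ucat M) (uact M) (alpha1 M) (alpha2 M))\<rparr>)"

definition pair_mor_of_umm_functor ::
  "('v, 'w) braided_cat \<Rightarrow> ('v, 'w, 'o, 'a) umm_cat \<Rightarrow> ('v, 'w, 'o, 'a) umm_cat \<Rightarrow> ('v, 'o, 'a) umm_functor \<Rightarrow> ('v, 'o, 'a) pair_mor" where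
  "pair_mor_of_umm_functor V M N F = \<lparr>gfun = ufun F, gamma = umm_functor.unit_strength V M N F\<rparr>"

lemma umm_of_pair_simps [simp]:
  "ucat (umm_of_pair V P) = pcat P"
  "uact (umm_of_pair V P) = central_functor.induced_act V (pcat P) (pfun P)"
  "alpha1 (umm_of_pair V P) = central_functor.induced_\<alpha>1 V (pcat P) (pfun P)"
  "alpha2 (umm_of_pair V P) = central_functor.induced_\<alpha>2 V (pcat P) (pfun P) (pair_braid P)"
  "ufun (umm_functor_of_pair_mor V P Q G) = gfun G"
  "ustr (umm_functor_of_pair_mor V P Q G) = central_morphism.strength V (pcat P) (pcat Q) (pfun P) (gfun G) (gamma G)"
  by (simp_all add: umm_of_pair_def umm_functor_of_pair_mor_def)

lemma pair_of_umm_simps [simp]: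
  "pcat (pair_of_umm V M) = ucat M"
  "pfun (pair_of_umm V M) = module_monoidal_category.free_functor V (ucat M) (uact M) (alpha1 M)"
  "v \<in> obj V \<Longrightarrow> pair_braid (pair_of_umm V M) v x =
    module_monoidal_category.free_braid V (ucat M) (uact M) (alpha1 M) (alpha2 M) v x"
  "gfun (pair_mor_of_umm_functor V M N F) = ufun F"
  "gamma (pair_mor_of_umm_functor V M N F) = umm_functor.unit_strength V M N F"
  by (simp_all add: pair_of_umm_def pair_mor_of_umm_functor_def central_lift_def Let_def)

lemma umm_of_pair: "pair_over V P \<Longrightarrow> umm_category V (umm_of_pair V P)"
  by (simp add: central_functor.induced_umm[OF pair_over.pair_central])

lemma pair_of_umm:
  assumes "umm_category V M" shows "pair_over V (pair_of_umm V M)"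
proof -
  interpret umm V "ucat M" "uact M" "alpha1 M" "alpha2 M" using assms by (simp add: umm_def)
  show ?thesis using free.pair_over_central by (simp add: pair_of_umm_def Let_def)
qed

lemma pair_morphism_central: "pair_morphism V P Q G \<Longrightarrow>
  central_morphism V (pcat P) (pcat Q) (pfun P) (pair_braid P) (pfun Q) (pair_braid Q) (gfun G) (gamma G)"
  by (simp add: pair_morphism_iff)

lemma umm_functor_of_pair_mor:
  assumes "pair_morphism V P Q G"
  shows "umm_functor V (umm_of_pair V P) (umm_of_pair V Q) (umm_functor_of_pair_mor V P Q G)"
proof -
  interpret central_morphism V "pcat P" "pcat Q" "pfun P" "pair_braid P" "pfun Q" "pair_braid Q" "gfun G" "gamma G"
    using assms by (rule pair_morphism_central)
  have "umm_category V (umm_of_pair V P)" "umm_category V (umm_of_pair V Q)"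
    using assms by (simp_all add: pair_morphism_iff umm_of_pair del: umm_of_pair_simps)
  then show ?thesis
    using strength_module_functor strength_\<alpha>1 strength_\<alpha>2
    by (intro umm_functor.intro umm_functor_axioms.intro) (simp_all add: G.monoidal_functor_axioms)
qed

lemma pair_mor_of_umm_functor:
  assumes "umm_functor V M N F"
  shows "pair_morphism V (pair_of_umm V M) (pair_of_umm V N) (pair_mor_of_umm_functor V M N F)"
proof -
  interpret umm_functor V M N F by fact
  interpret U: central_morphism V "ucat M" "ucat N" S.free_functor S.free_braid T.free_functor T.free_braid "ufun F" unit_strength
    by (rule unit_strength_central)
  have P: "pair_over V (pair_of_umm V M)" "pair_over V (pair_of_umm V N)"
    using source target by (simp_all add: pair_of_umm)
  have "central_morphism V (ucat M) (ucat N) S.free_functor (pair_braid (pair_of_umm V M)) T.free_functor (pair_braid (pair_of_umm V N))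
    (ufun F) unit_strength"
    using P[THEN pair_over.pair_central] U.\<gamma>_hom U.\<gamma>_nat U.\<gamma>_tens U.\<gamma>_unit U.\<gamma>_braid
    by (intro central_morphism.intro central_morphism_axioms.intro monoidal_functor_axioms) simp_all
  then show ?thesis
    using P by (simp add: pair_morphism_iff) (simp add: unit_strength_def)
qed

abbreviation "pairs_obj V \<equiv> {P. pair_over V P}"
abbreviation "pairs_hom V \<equiv> \<lambda>P Q. {G. pair_morphism V P Q G}"
abbreviation "umm_obj V \<equiv> {M. umm_category V M}"
abbreviation "umm_hom V \<equiv> \<lambda>M N. {F. umm_functor V M N F}"

text \<open>
  The strengths of a composite agree by naturality of \<open>phi2\<close>. A transformation of
  pairs respects the strengths because these are built from \<open>phi2\<close> and
  \<open>\<gamma>\<close>, both of which it respects.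
\<close>

lemma umm_of_pair_two_functor:
  "structure_two_functor (pairs_obj V) (pairs_hom V) (id_pair_mor V) (\<lambda>P Q R. comp_pair_mor V P R) (pair_trans V) pcat gfun
    (umm_obj V) (umm_hom V) (id_umm_functor V) (\<lambda>M N R. comp_umm_functor V M R) (umm_trans V) ucat ufun
    (umm_of_pair V) (umm_functor_of_pair_mor V)"
proof (intro structure_two_functor.intro structure_two_functor_axioms.intro pairs_concrete umm_concrete, unfold mem_Collect_eq, goal_cases)
  case (1 P)
  then show ?case by (rule umm_of_pair)
next
  case (2 P)
  show ?case by simp
next
  case (3 P Q G)
  then show ?case by (intro umm_functor_of_pair_mor)
next
  case (4 P Q G)
  show ?case by simp
next
  case (5 P)
  interpret central_functor V "pcat P" "pfun P" "pair_braid P" using 5 by (rule pair_over.pair_central)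
  interpret I: central_morphism V "pcat P" "pcat P" "pfun P" "pair_braid P" "pfun P" "pair_braid P"
    "id_mon_functor (pcat P)" "\<lambda>v \<in> obj V. ident (pcat P) (omap (pfun P) v)" by (rule id_central_morphism)
  show ?case
    by (rule umm_functor_eqI)
      (auto simp: id_umm_functor_def id_pair_mor_def I.strength_def intro!: extensionalityI[where A = "obj V \<times> obj (pcat P)"])
next
  case (6 P Q R F G)
  interpret F: central_morphism V "pcat P" "pcat Q" "pfun P" "pair_braid P" "pfun Q" "pair_braid Q" "gfun F" "gamma F"
    using 6 by (intro pair_morphism_central)
  interpret G: central_morphism V "pcat Q" "pcat R" "pfun Q" "pair_braid Q" "pfun R" "pair_braid R" "gfun G" "gamma G"
    using 6 by (intro pair_morphism_central)
  interpret GF: two_monoidal_functors "pcat P" "pcat Q" "pcat R" "gfun F" "gfun G" ..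
  interpret H: central_morphism V "pcat P" "pcat R" "pfun P" "pair_braid P" "pfun R" "pair_braid R"
    "comp_mon_functor (pcat P) (pcat R) (gfun G) (gfun F)" "\<lambda>v \<in> obj V. amap (gfun G) (gamma F v) \<cdot>\<^bsub>pcat R\<^esub> gamma G v"
    by (rule comp_central_morphism) (rule F.central_morphism_axioms G.central_morphism_axioms)+
  have "H.strength (v, x) = amap (gfun G) (F.strength (v, x)) \<cdot>\<^bsub>pcat R\<^esub> G.strength (v, omap (gfun F) x)"
    if [simp]: "v \<in> obj V" "x \<in> obj (pcat P)" for v x
    by (rule G.Q.D.lift_eqI) (simp_all add: chase G.G.phi2_in[THEN G.Q.D.re])
  then show ?case
    by (intro umm_functor_eqI extensionalityI[where A = "obj V \<times> obj (pcat P)"])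
      (auto simp: comp_umm_functor_def comp_pair_mor_def H.strength_def simp del: F.strength_simp G.strength_simp H.strength_simp)
next
  case (7 P Q F G \<eta>)
  interpret F: central_morphism V "pcat P" "pcat Q" "pfun P" "pair_braid P" "pfun Q" "pair_braid Q" "gfun F" "gamma F"
    using 7 by (intro pair_morphism_central)
  interpret G: central_morphism V "pcat P" "pcat Q" "pfun P" "pair_braid P" "pfun Q" "pair_braid Q" "gfun G" "gamma G"
    using 7 by (intro pair_morphism_central)
  have n: "mon_nat_trans (pcat P) (pcat Q) (gfun F) (gfun G) \<eta>"
    and e: "v \<in> obj V \<Longrightarrow> \<eta> (omap (pfun P) v) \<cdot>\<^bsub>pcat Q\<^esub> gamma F v = gamma G v" for v
    using 7 by (simp_all add: pair_trans_def)
  note t = mon_nat_transD(2-4)[OF n]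
  have "\<eta> (omap (pfun P) v \<otimes>\<^bsub>pcat P\<^esub> x) \<cdot>\<^bsub>pcat Q\<^esub> F.strength (v, x) = G.strength (v, x) \<cdot>\<^bsub>pcat Q\<^esub> (ident V v \<rhd>\<^sub>a\<^bsub>F.Q.induced_act\<^esub> \<eta> x)"
    if [simp]: "v \<in> obj V" "x \<in> obj (pcat P)" for v x
  proof -
    let ?D = "pcat Q" and ?v = "omap (pfun P) v"
    have a: "\<lfloor>\<eta> (?v \<otimes>\<^bsub>pcat P\<^esub> x)\<rfloor>\<^bsub>?D\<^esub> \<odot>\<^bsub>?D\<^esub> \<lfloor>phi2 (gfun F) (?v, x)\<rfloor>\<^bsub>?D\<^esub> = \<lfloor>phi2 (gfun G) (?v, x)\<rfloor>\<^bsub>?D\<^esub> \<odot>\<^bsub>?D\<^esub> \<lfloor>\<eta> ?v \<otimes>\<^sub>a\<^bsub>?D\<^esub> \<eta> x\<rfloor>\<^bsub>?D\<^esub>"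
      using mon_nat_transD(6)[OF n, of ?v x, THEN F.Q.D.up] by (simp add: chase t)
    show ?thesis
      by (rule F.Q.D.lift_eqI) (simp_all add: chase t a[THEN F.Q.D.re] F.Q.D.tens.bimap_ocmp e)
  qed
  then show ?case using n by (simp add: umm_trans_iff del: F.strength_simp G.strength_simp)
qed

text \<open>
  Dually, \<open>unit_strength\<close> is built from the strength and \<open>phi0\<close>, and
  both are respected by transformations and composed in the same way.
\<close>

lemma pair_of_umm_two_functor:
  "structure_two_functor (umm_obj V) (umm_hom V) (id_umm_functor V) (\<lambda>M N R. comp_umm_functor V M R) (umm_trans V) ucat ufun
    (pairs_obj V) (pairs_hom V) (id_pair_mor V) (\<lambda>P Q R. comp_pair_mor V P R) (pair_trans V) pcat gfun
    (pair_of_umm V) (pair_mor_of_umm_functor V)"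
proof (intro structure_two_functor.intro structure_two_functor_axioms.intro pairs_concrete umm_concrete, unfold mem_Collect_eq, goal_cases)
  case (1 M)
  then show ?case by (rule pair_of_umm)
next
  case (2 M)
  show ?case by simp
next
  case (3 M N F)
  then show ?case by (intro pair_mor_of_umm_functor)
next
  case (4 M N F)
  show ?case by simp
next
  case (5 M)
  interpret I: umm_functor V M M "id_umm_functor V M" using 5 by (rule id_umm_functor)
  have [simp]: "ufun (id_umm_functor V M) = id_mon_functor (ucat M)"
    "v \<in> obj V \<Longrightarrow> x \<in> obj (ucat M) \<Longrightarrow> ustr (id_umm_functor V M) (v, x) = ident (ucat M) (v \<rhd>\<^bsub>uact M\<^esub> x)" for v x
    by (simp_all add: id_umm_functor_def)
  show ?case
    by (intro pair_mor_eqI extensionalityI[where A = "obj V"]) (simp_all add: id_pair_mor_def I.unit_strength_def)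
next
  case (6 M N R F G)
  interpret F: umm_functor V M N F using 6 by simp
  interpret G: umm_functor V N R G using 6 by simp
  interpret H: umm_functor V M R "comp_umm_functor V M R G F"
    by (rule comp_umm_functor) (rule F.umm_functor_axioms G.umm_functor_axioms)+
  have [simp]: "ufun (comp_umm_functor V M R G F) = comp_mon_functor (ucat M) (ucat R) (ufun G) (ufun F)"
    "v \<in> obj V \<Longrightarrow> x \<in> obj (ucat M) \<Longrightarrow> ustr (comp_umm_functor V M R G F) (v, x) =
      amap (ufun G) (ustr F (v, x)) \<cdot>\<^bsub>ucat R\<^esub> ustr G (v, omap (ufun F) x)" for v x
    by (simp_all add: comp_umm_functor_def)
  have "H.unit_strength v = amap (ufun G) (F.unit_strength v) \<cdot>\<^bsub>ucat R\<^esub> G.unit_strength v" if [simp]: "v \<in> obj V" for v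
    by (rule G.D.lift_eqI) (simp_all add: chase F.unit_strength_simp G.unit_strength_simp H.unit_strength_simp comp_mon_functor_sel G.s_out[THEN G.D.re])
  then show ?case
    by (intro pair_mor_eqI extensionalityI[where A = "obj V"]) (simp_all add: comp_pair_mor_def H.unit_strength_def)
next
  case (7 M N F G \<eta>)
  interpret F: umm_functor V M N F using 7 by simp
  interpret G: umm_functor V M N G using 7 by simp
  have n: "mon_nat_trans (ucat M) (ucat N) (ufun F) (ufun G) \<eta>"
    and e: "v \<in> obj V \<Longrightarrow> x \<in> obj (ucat M) \<Longrightarrow> \<eta> (v \<rhd>\<^bsub>uact M\<^esub> x) \<cdot>\<^bsub>ucat N\<^esub> ustr F (v, x) = ustr G (v, x) \<cdot>\<^bsub>ucat N\<^esub> (ident V v \<rhd>\<^sub>a\<^bsub>uact N\<^esub> \<eta> x)" for v x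
    using 7 by (simp_all add: umm_trans_iff)
  note t = mon_nat_transD(2-4)[OF n]
  have "\<eta> (v \<rhd>\<^bsub>uact M\<^esub> \<I>\<^bsub>ucat M\<^esub>) \<cdot>\<^bsub>ucat N\<^esub> F.unit_strength v = G.unit_strength v" if [simp]: "v \<in> obj V" for v
  proof -
    let ?D = "ucat N"
    have a: "\<lfloor>\<eta> (v \<rhd>\<^bsub>uact M\<^esub> \<I>\<^bsub>ucat M\<^esub>)\<rfloor>\<^bsub>?D\<^esub> \<odot>\<^bsub>?D\<^esub> \<lfloor>ustr F (v, \<I>\<^bsub>ucat M\<^esub>)\<rfloor>\<^bsub>?D\<^esub> =
        \<lfloor>ustr G (v, \<I>\<^bsub>ucat M\<^esub>)\<rfloor>\<^bsub>?D\<^esub> \<odot>\<^bsub>?D\<^esub> \<lfloor>ident V v \<rhd>\<^sub>a\<^bsub>uact N\<^esub> \<eta> \<I>\<^bsub>ucat M\<^esub>\<rfloor>\<^bsub>?D\<^esub>"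
      using e[of v "\<I>\<^bsub>ucat M\<^esub>", THEN F.D.up] by (simp add: chase t)
    have b: "\<lfloor>ident V v \<rhd>\<^sub>a\<^bsub>uact N\<^esub> \<eta> \<I>\<^bsub>ucat M\<^esub>\<rfloor>\<^bsub>?D\<^esub> \<odot>\<^bsub>?D\<^esub> \<lfloor>ident V v \<rhd>\<^sub>a\<^bsub>uact N\<^esub> phi0 (ufun F)\<rfloor>\<^bsub>?D\<^esub> =
        \<lfloor>ident V v \<rhd>\<^sub>a\<^bsub>uact N\<^esub> phi0 (ufun G)\<rfloor>\<^bsub>?D\<^esub>"
      using arg_cong[OF mon_nat_transD(7)[OF n], of "\<lambda>h. \<lfloor>ident V v \<rhd>\<^sub>a\<^bsub>uact N\<^esub> h\<rfloor>\<^bsub>?D\<^esub>"] by (simp add: chase t)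
    show ?thesis
      by (rule F.D.lift_eqI) (simp_all add: chase t F.unit_strength_simp G.unit_strength_simp a[THEN F.D.re] b)
  qed
  then show ?case using n by (simp add: pair_trans_def)
qed

section \<open>Isomorphisms over the identity functor\<close>

text \<open>
  A morphism of pairs over the identity functor is invertible: inverting \<open>\<gamma>\<close>
  exchanges the two sides of each of its laws.
\<close>

lemma (in central_morphism) inverse_central_morphism:
  assumes CD: "D = C" and id: "G = id_mon_functor C"
  shows "central_morphism V C C F' B' F B (id_mon_functor C) (\<lambda>v \<in> obj V. inv_arr C (\<gamma> v))"
proof -
  note Q = Q.central_functor_axioms[unfolded CD]
  note t = \<gamma>_typ[unfolded CD id] and n = \<gamma>_nat[unfolded CD id] \<gamma>_tens[unfolded CD id] \<gamma>_unit[unfolded CD id] \<gamma>_braid[unfolded CD id]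
  interpret Q': central_functor V C F' B' by (rule Q)
  have [simp]: "\<gamma> v \<in> arr C" "src C (\<gamma> v) = omap F' v" "trg C (\<gamma> v) = omap F v" "iso_arr C (\<gamma> v)" if "v \<in> obj V" for v
    using t[of v] that by simp_all
  show ?thesis
  proof (intro central_morphism.intro central_morphism_axioms.intro Q P.central_functor_axioms P.D.id_monoidal_functor, goal_cases)
    case (1 v)
    then show ?case by (simp add: hom_def)
  next
    case (2 v)
    then show ?case by simp
  next
    case (3 f)
    note [simp] = 3
    have "\<lfloor>amap F' f\<rfloor>\<^bsub>C\<^esub> \<odot>\<^bsub>C\<^esub> \<lfloor>inv_arr C (\<gamma> (src V f))\<rfloor>\<^bsub>C\<^esub> = \<lfloor>inv_arr C (\<gamma> (trg V f))\<rfloor>\<^bsub>C\<^esub> \<odot>\<^bsub>C\<^esub> \<lfloor>amap F f\<rfloor>\<^bsub>C\<^esub>"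
      by (rule P.D.iso_flip) (use n(1)[of f, THEN P.D.up] in \<open>simp_all add: chase\<close>)
    then show ?case
      by (intro P.D.lift_eqI) (simp_all add: chase)
  next
    case (4 v w)
    note [simp] = 4
    have "\<lfloor>phi2 F' (v, w)\<rfloor>\<^bsub>C\<^esub> \<odot>\<^bsub>C\<^esub> \<lfloor>inv_arr C (\<gamma> v \<otimes>\<^sub>a\<^bsub>C\<^esub> \<gamma> w)\<rfloor>\<^bsub>C\<^esub> = \<lfloor>inv_arr C (\<gamma> (v \<otimes>\<^bsub>V\<^esub> w))\<rfloor>\<^bsub>C\<^esub> \<odot>\<^bsub>C\<^esub> \<lfloor>phi2 F (v, w)\<rfloor>\<^bsub>C\<^esub>"
      by (rule P.D.iso_flip) (use n(2)[of v w, THEN P.D.up] in \<open>simp_all add: chase\<close>)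
    then show ?case
      by (intro P.D.lift_eqI) (simp_all add: chase P.D.tens.bimap_iso)
  next
    case 5
    have "\<lfloor>\<gamma> \<I>\<^bsub>V\<^esub>\<rfloor>\<^bsub>C\<^esub> \<odot>\<^bsub>C\<^esub> \<lfloor>phi0 F'\<rfloor>\<^bsub>C\<^esub> = \<lfloor>phi0 F\<rfloor>\<^bsub>C\<^esub>"
      using n(3)[THEN P.D.up] by (simp add: chase)
    then show ?case
      by (intro P.D.lift_eqI) (simp_all add: chase flip: \<open>\<lfloor>\<gamma> \<I>\<^bsub>V\<^esub>\<rfloor>\<^bsub>C\<^esub> \<odot>\<^bsub>C\<^esub> \<lfloor>phi0 F'\<rfloor>\<^bsub>C\<^esub> = \<lfloor>phi0 F\<rfloor>\<^bsub>C\<^esub>\<close>)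
  next
    case (6 v x)
    note [simp] = 6
    have "\<lfloor>B' v x\<rfloor>\<^bsub>C\<^esub> \<odot>\<^bsub>C\<^esub> \<lfloor>inv_arr C (\<gamma> v \<otimes>\<^sub>a\<^bsub>C\<^esub> ident C x)\<rfloor>\<^bsub>C\<^esub> = \<lfloor>inv_arr C (ident C x \<otimes>\<^sub>a\<^bsub>C\<^esub> \<gamma> v)\<rfloor>\<^bsub>C\<^esub> \<odot>\<^bsub>C\<^esub> \<lfloor>B v x\<rfloor>\<^bsub>C\<^esub>"
      by (rule P.D.iso_flip) (use n(4)[of v x, THEN P.D.up] in \<open>simp_all add: chase\<close>)
    then show ?case
      by (intro P.D.lift_eqI) (simp_all add: chase)
  qed
qed

text \<open>
  Two module structures on one monoidal category, isomorphic over the identity functor: a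
  symmetric notion, which provides the counit together with its inverse.
\<close>

locale module_structure_iso =
  S: module_monoidal_category V C A \<alpha>1 \<alpha>2 + T: module_monoidal_category V C A' \<alpha>1' \<alpha>2'
  for V :: "('v, 'w) braided_cat" and C :: "('o, 'a) mon_cat" (structure) and A \<alpha>1 \<alpha>2 A' \<alpha>1' \<alpha>2' +
  fixes s :: "'v \<times> 'o \<Rightarrow> 'a"
  assumes s_ext: "s \<in> extensional (obj V \<times> obj C)"
    and s_hom: "v \<in> obj V \<Longrightarrow> x \<in> obj C \<Longrightarrow> iso_arr C (s (v, x)) \<and> s (v, x) \<in> hom C (v \<rhd>\<^bsub>A'\<^esub> x) (v \<rhd>\<^bsub>A\<^esub> x)"
    and s_nat: "f \<in> arr V \<Longrightarrow> g \<in> arr C \<Longrightarrow>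
      (f \<rhd>\<^sub>a\<^bsub>A\<^esub> g) \<cdot> s (src V f, src C g) = s (trg V f, trg C g) \<cdot> (f \<rhd>\<^sub>a\<^bsub>A'\<^esub> g)"
    and s_massoc: "v \<in> obj V \<Longrightarrow> w \<in> obj V \<Longrightarrow> x \<in> obj C \<Longrightarrow> massoc A (v, w, x) \<cdot> s (v \<otimes>\<^bsub>V\<^esub> w, x) =
      s (v, w \<rhd>\<^bsub>A\<^esub> x) \<cdot> (ident V v \<rhd>\<^sub>a\<^bsub>A'\<^esub> s (w, x)) \<cdot> massoc A' (v, w, x)"
    and s_munit: "x \<in> obj C \<Longrightarrow> munit A x \<cdot> s (\<I>\<^bsub>V\<^esub>, x) = munit A' x"
    and s_\<alpha>1: "v \<in> obj V \<Longrightarrow> x \<in> obj C \<Longrightarrow> y \<in> obj C \<Longrightarrow>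
      s (v, x \<otimes> y) \<cdot> \<alpha>1' (v, x, y) = \<alpha>1 (v, x, y) \<cdot> (s (v, x) \<otimes>\<^sub>a ident C y)"
    and s_\<alpha>2: "v \<in> obj V \<Longrightarrow> x \<in> obj C \<Longrightarrow> y \<in> obj C \<Longrightarrow>
      s (v, x \<otimes> y) \<cdot> \<alpha>2' (v, x, y) = \<alpha>2 (v, x, y) \<cdot> (ident C x \<otimes>\<^sub>a s (v, y))"
begin

lemma s_typ [simp]:
  assumes "v \<in> obj V" "x \<in> obj C"
  shows "s (v, x) \<in> arr C" "src C (s (v, x)) = v \<rhd>\<^bsub>A'\<^esub> x" "trg C (s (v, x)) = v \<rhd>\<^bsub>A\<^esub> x" "iso_arr C (s (v, x))"
  using s_hom[OF assms] by (auto simp: hom_def)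

definition s_inv :: "'v \<times> 'o \<Rightarrow> 'a" where
  "s_inv = (\<lambda>(v, x) \<in> obj V \<times> obj C. inv_arr C (s (v, x)))"

lemma s_inv_simp [simp]: "v \<in> obj V \<Longrightarrow> x \<in> obj C \<Longrightarrow> s_inv (v, x) = inv_arr C (s (v, x))"
  by (simp add: s_inv_def)

lemma inverse_module_structure_iso: "module_structure_iso V C A' \<alpha>1' \<alpha>2' A \<alpha>1 \<alpha>2 s_inv"
proof (intro module_structure_iso.intro module_structure_iso_axioms.intro S.module_monoidal_category_axioms
    T.module_monoidal_category_axioms, goal_cases)
  case 1
  show ?case by (simp add: s_inv_def)
next
  case (2 v x)
  then show ?case by (simp add: hom_def)
next
  case (3 f g)
  note [simp] = 3
  have "\<lfloor>f \<rhd>\<^sub>a\<^bsub>A'\<^esub> g\<rfloor> \<odot> \<lfloor>inv_arr C (s (src V f, src C g))\<rfloor> = \<lfloor>inv_arr C (s (trg V f, trg C g))\<rfloor> \<odot> \<lfloor>f \<rhd>\<^sub>a\<^bsub>A\<^esub> g\<rfloor>"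
    by (rule S.C.iso_flip) (use s_nat[of f g, THEN S.C.up] in \<open>simp_all add: chase\<close>)
  then show ?case
    by (intro S.C.lift_eqI) (simp_all add: chase)
next
  case (4 v w x)
  note [simp] = 4
  have n: "\<lfloor>ident V v \<rhd>\<^sub>a\<^bsub>A\<^esub> s (w, x)\<rfloor> \<odot> \<lfloor>s (v, w \<rhd>\<^bsub>A'\<^esub> x)\<rfloor> = \<lfloor>s (v, w \<rhd>\<^bsub>A\<^esub> x)\<rfloor> \<odot> \<lfloor>ident V v \<rhd>\<^sub>a\<^bsub>A'\<^esub> s (w, x)\<rfloor>"
    using s_nat[of "ident V v" "s (w, x)", THEN S.C.up] by (simp add: chase)
  have "\<lfloor>massoc A' (v, w, x)\<rfloor> \<odot> \<lfloor>inv_arr C (s (v \<otimes>\<^bsub>V\<^esub> w, x))\<rfloor> =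
    \<lfloor>inv_arr C ((ident V v \<rhd>\<^sub>a\<^bsub>A\<^esub> s (w, x)) \<cdot> s (v, w \<rhd>\<^bsub>A'\<^esub> x))\<rfloor> \<odot> \<lfloor>massoc A (v, w, x)\<rfloor>"
    by (rule S.C.iso_flip) (use s_massoc[of v w x, THEN S.C.up] in \<open>simp_all add: chase n[THEN S.C.re]\<close>)
  then show ?case
    by (intro S.C.lift_eqI) (simp_all add: chase)
next
  case (5 x)
  note [simp] = 5
  have m: "\<lfloor>munit A' x\<rfloor> = \<lfloor>munit A x\<rfloor> \<odot> \<lfloor>s (\<I>\<^bsub>V\<^esub>, x)\<rfloor>"
    using s_munit[of x, THEN S.C.up] by (simp add: chase)
  show ?case
    by (rule S.C.lift_eqI) (simp_all add: chase m)
next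
  case (6 v x y)
  note [simp] = 6
  have "\<lfloor>\<alpha>1' (v, x, y)\<rfloor> \<odot> \<lfloor>inv_arr C (s (v, x) \<otimes>\<^sub>a ident C y)\<rfloor> = \<lfloor>inv_arr C (s (v, x \<otimes> y))\<rfloor> \<odot> \<lfloor>\<alpha>1 (v, x, y)\<rfloor>"
    by (rule S.C.iso_flip) (use s_\<alpha>1[of v x y, THEN S.C.up] in \<open>simp_all add: chase\<close>)
  then show ?case
    by (intro S.C.lift_eqI) (simp_all add: chase)
next
  case (7 v x y)
  note [simp] = 7
  have "\<lfloor>\<alpha>2' (v, x, y)\<rfloor> \<odot> \<lfloor>inv_arr C (ident C x \<otimes>\<^sub>a s (v, y))\<rfloor> = \<lfloor>inv_arr C (s (v, x \<otimes> y))\<rfloor> \<odot> \<lfloor>\<alpha>2 (v, x, y)\<rfloor>"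
    by (rule S.C.iso_flip) (use s_\<alpha>2[of v x y, THEN S.C.up] in \<open>simp_all add: chase\<close>)
  then show ?case
    by (intro S.C.lift_eqI) (simp_all add: chase)
qed

lemma id_umm_functor:
  fixes M N :: "('v, 'w, 'o, 'a) umm_cat"
  assumes M: "ucat M = C" "uact M = A" "alpha1 M = \<alpha>1" "alpha2 M = \<alpha>2"
    and N: "ucat N = C" "uact N = A'" "alpha1 N = \<alpha>1'" "alpha2 N = \<alpha>2'"
  shows "umm_functor V M N \<lparr>ufun = id_mon_functor C, ustr = s\<rparr>"
proof -
  interpret I: monoidal_functor C C "id_mon_functor C" by (rule S.C.id_monoidal_functor)
  have "module_functor V C A C A' (id_mon_functor C) s"
  proof (intro module_functor.intro module_functor_axioms.intro S.module_category_axioms T.module_category_axioms I.cat_functor_axioms, goal_cases)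
    case 1
    show ?case
      by (rule nat_isoI2) (use s_ext s_hom in \<open>simp_all add: s_nat\<close>)
  next
    case (2 v w x)
    then show ?case by (simp add: s_massoc)
  next
    case (3 x)
    then show ?case by (simp add: s_munit)
  qed
  then show ?thesis
    using s_\<alpha>1 s_\<alpha>2 S.module_monoidal_category_axioms T.module_monoidal_category_axioms I.monoidal_functor_axioms
    by (intro umm_functor.intro umm_functor_axioms.intro) (simp_all add: M N)
qed

end

section \<open>The unit and the counit\<close>

context central_functor
begin

text \<open>
  The round trip on pairs sends \<open>F v\<close> to \<open>F v \<otimes> \<I>\<close>. By the
  triangle, \<open>act_left\<close> of the induced action is \<open>runit (F v) \<otimes>
  x\<close>; by the hexagon in the form of \<open>bt_assoc\<close>, \<open>act_right\<close> is
  \<open>x \<otimes> runit (F v)\<close> followed by the inverse half-braiding. So the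
  half-braiding on \<open>F v \<otimes> \<I>\<close> is the one on \<open>F v\<close>,
  conjugated by the right unit constraint.
\<close>

lemma runit_central_morphism:
  fixes F' B'
  defines "F' \<equiv> module_monoidal_category.free_functor V C induced_act induced_\<alpha>1"
    and "B' \<equiv> module_monoidal_category.free_braid V C induced_act induced_\<alpha>1 induced_\<alpha>2"
  shows "central_morphism V C C F B F' B' (id_mon_functor C) (\<lambda>v \<in> obj V. runit C (omap F v))"
proof -
  interpret Y: umm V C induced_act induced_\<alpha>1 induced_\<alpha>2
    using induced_umm by (simp add: umm_def)
  have F': "F' = Y.free_functor" and B': "B' = Y.free_braid" by (simp_all add: F'_def B'_def)
  have left: "\<lfloor>Y.act_left v x\<rfloor> = \<lfloor>runit C (omap F v) \<otimes>\<^sub>a ident C x\<rfloor>" if [simp]: "v \<in> obj V" "x \<in> obj C" for v x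
    by (simp add: Y.act_left_def chase D.triangle_l)
  have r: "\<lfloor>ident C y \<otimes>\<^sub>a runit C z\<rfloor> \<odot> \<lfloor>assoc C (y, z, \<I>)\<rfloor> = \<lfloor>runit C (y \<otimes> z)\<rfloor>"
      if "y \<in> obj C" "z \<in> obj C" for y z
      using D.runit_tens[of y z, THEN D.up] that by (simp add: chase)
  have right: "\<lfloor>B v x\<rfloor> \<odot> \<lfloor>Y.act_right v x\<rfloor> = \<lfloor>ident C x \<otimes>\<^sub>a runit C (omap F v)\<rfloor>"
    if [simp]: "v \<in> obj V" "x \<in> obj C" for v x
  proof -
    have "B v x \<cdot> Y.act_right v x = ident C x \<otimes>\<^sub>a runit C (omap F v)" (is "?f = ?g")
    proof (rule D.iso_right_cancel)
      let ?h = "bt v x \<I> \<cdot> assoc C (omap F v, x, \<I>)"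
      have "\<lfloor>?f\<rfloor> \<odot> \<lfloor>?h\<rfloor> = \<lfloor>runit C (x \<otimes> omap F v)\<rfloor> \<odot> \<lfloor>B v x \<otimes>\<^sub>a ident C \<I>\<rfloor>"
        by (simp add: Y.act_right_def chase r D.unit_out(2)[of "B v x"])
      also have "\<dots> = \<lfloor>?g\<rfloor> \<odot> \<lfloor>?h\<rfloor>"
        by (simp add: chase bt_assoc r[THEN D.re])
      finally show "\<lfloor>?f\<rfloor> \<odot> \<lfloor>?h\<rfloor> = \<lfloor>?g\<rfloor> \<odot> \<lfloor>?h\<rfloor>" .
    qed simp_all
    then show ?thesis by (auto dest: D.up simp: chase)
  qed
  show ?thesis
    unfolding F' B'
  proof (intro central_morphism.intro central_morphism_axioms.intro central_functor_axioms Y.free.central_functor_axioms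
      D.id_monoidal_functor, goal_cases)
    case (1 v)
    then show ?case by (simp add: hom_def)
  next
    case (2 v)
    then show ?case by simp
  next
    case (3 f)
    then show ?case using D.runit_nat[of "amap F f"] by simp
  next
    case (4 v w)
    note [simp] = 4
    have i: "\<lfloor>runit C (omap F v \<otimes> omap F w)\<rfloor> \<odot> \<lfloor>inv_arr C (assoc C (omap F v, omap F w, \<I>))\<rfloor> =
        \<lfloor>ident C (omap F v) \<otimes>\<^sub>a runit C (omap F w)\<rfloor>"
      by (simp add: r[symmetric] chase)
    show ?case
      by (rule D.lift_eqI)
        (simp_all add: Y.free_tens_def chase left D.unit_in_re(2) i[THEN D.re] D.tens.bimap_ocmp)
  next
    case 5
    show ?case
      by (rule D.lift_eqI) (simp_all add: chase D.unit_in_re(2) flip: D.lunit_unit)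
  next
    case (6 v x)
    note [simp] = 6
    show ?case
      by (rule D.lift_eqI) (simp_all add: chase right[symmetric] Y.act_right_free_braid_l left)
  qed
qed

end

context umm
begin

text \<open>
  The round trip on module monoidal categories replaces \<open>v \<rhd> x\<close> by \<open>(v
  \<rhd> \<I>) \<otimes> x\<close>, and \<open>act_left\<close> undoes this. Its laws have all
  been established on the way to the free functor; the one for \<open>\<alpha>2\<close> is
  \<open>act_right_left\<close>. The half-braiding \<open>B\<close> is arbitrary outside the
  objects of \<open>V\<close> since the one recovered from a pair is extensional in
  \<open>v\<close>.
\<close>

lemma act_left_structure_iso:
  assumes B: "\<And>v x. v \<in> obj V \<Longrightarrow> x \<in> obj C \<Longrightarrow> B v x = free_braid v x" and c: "central_functor V C free_functor B"
  shows "module_structure_iso V C A \<alpha>1 \<alpha>2 (central_functor.induced_act V C free_functor)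
    (central_functor.induced_\<alpha>1 V C free_functor) (central_functor.induced_\<alpha>2 V C free_functor B)
    (\<lambda>(v, x) \<in> obj V \<times> obj C. act_left v x)"
proof -
  interpret X: central_functor V C free_functor B by (rule c)
  show ?thesis
  proof (intro module_structure_iso.intro module_structure_iso_axioms.intro module_monoidal_category_axioms X.induced_umm, goal_cases)
    case 1
    show ?case by simp
  next
    case (2 v x)
    then show ?case by (simp add: hom_def)
  next
    case (3 f g)
    note [simp] = 3
    have "\<lfloor>f \<rhd>\<^sub>a\<^bsub>A\<^esub> g\<rfloor> \<odot> \<lfloor>act_left (src V f) (src C g)\<rfloor> = \<lfloor>f \<rhd>\<^sub>a\<^bsub>A\<^esub> ident C (trg C g)\<rfloor> \<odot> \<lfloor>ident V (src V f) \<rhd>\<^sub>a\<^bsub>A\<^esub> g\<rfloor> \<odot> \<lfloor>act_left (src V f) (src C g)\<rfloor>"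
      by (simp add: act.bimap_ocmp[THEN C.re])
    also have "\<dots> = \<lfloor>act_left (trg V f) (trg C g)\<rfloor> \<odot> \<lfloor>(f \<rhd>\<^sub>a\<^bsub>A\<^esub> ident C \<I>) \<otimes>\<^sub>a g\<rfloor>"
      by (simp add: act_left_out act_left_out[THEN C.re] C.tens.bimap_ocmp C.ocmp_assoc)
    finally show ?case
      by (intro C.lift_eqI) (simp_all add: chase)
  next
    case (4 v w x)
    note [simp] = 4
    have i: "\<lfloor>act_left v (w \<rhd>\<^bsub>A\<^esub> x) \<cdot> (ident C (v \<rhd>\<^bsub>A\<^esub> \<I>) \<otimes>\<^sub>a act_left w x) \<cdot> assoc C (v \<rhd>\<^bsub>A\<^esub> \<I>, w \<rhd>\<^bsub>A\<^esub> \<I>, x)\<rfloor> \<odot>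
        \<lfloor>inv_arr C (free_tens v w \<otimes>\<^sub>a ident C x)\<rfloor> = \<lfloor>massoc A (v, w, x)\<rfloor> \<odot> \<lfloor>act_left (v \<otimes>\<^bsub>V\<^esub> w) x\<rfloor>"
      by (simp flip: act_left_massoc add: chase)
    then show ?case
      by (intro C.lift_eqI) (simp_all add: chase)
  next
    case (5 x)
    then show ?case by (simp add: act_left_munit)
  next
    case (6 v x y)
    then show ?case by (simp add: act_left_tens)
  next
    case (7 v x y)
    note [simp] = 7
    let ?b = "X.bt v x y" and ?v = "v \<rhd>\<^bsub>A\<^esub> \<I>"
    have b: "\<lfloor>?b\<rfloor> \<odot> \<lfloor>assoc C (?v, x, y)\<rfloor> = \<lfloor>assoc C (x, ?v, y)\<rfloor> \<odot> \<lfloor>free_braid v x \<otimes>\<^sub>a ident C y\<rfloor>"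
      using X.bt_assoc[of v x y] by (simp add: B)
    have r: "\<lfloor>act_right v x \<otimes>\<^sub>a ident C y\<rfloor> \<odot> \<lfloor>free_braid v x \<otimes>\<^sub>a ident C y\<rfloor> = \<lfloor>act_left v x \<otimes>\<^sub>a ident C y\<rfloor>"
      using arg_cong[OF act_right_free_braid[of v x], of "\<lambda>h. \<lfloor>h \<otimes>\<^sub>a ident C y\<rfloor>"] by (simp add: chase)
    have "act_left v (x \<otimes> y) \<cdot> inv_arr C ?b = \<alpha>2 (v, x, y) \<cdot> (ident C x \<otimes>\<^sub>a act_left v y)" (is "?f = ?g")
    proof (rule C.iso_right_cancel)
      let ?h = "?b \<cdot> assoc C (?v, x, y)"
      have "\<lfloor>?f\<rfloor> \<odot> \<lfloor>?h\<rfloor> = \<lfloor>\<alpha>1 (v, x, y)\<rfloor> \<odot> \<lfloor>act_right v x \<otimes>\<^sub>a ident C y\<rfloor> \<odot> \<lfloor>free_braid v x \<otimes>\<^sub>a ident C y\<rfloor>"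
        using X.bt_typ[of v x y] by (simp add: chase act_left_tens_l r)
      also have "\<dots> = \<lfloor>?g\<rfloor> \<odot> \<lfloor>?h\<rfloor>"
        using X.bt_typ[of v x y] by (simp add: chase b act_right_left_l[THEN C.re])
      finally show "\<lfloor>?f\<rfloor> \<odot> \<lfloor>?h\<rfloor> = \<lfloor>?g\<rfloor> \<odot> \<lfloor>?h\<rfloor>" .
    qed (use X.bt_typ[of v x y] in simp_all)
    then show ?case by simp
  qed
qed

end

lemma central_morphism_cong:
  assumes "central_morphism V C D F B F' B' G \<gamma>" "central_functor V C F B1" "central_functor V D F' B1'"
    and "\<And>v x. v \<in> obj V \<Longrightarrow> x \<in> obj C \<Longrightarrow> B1 v x = B v x" "\<And>v x. v \<in> obj V \<Longrightarrow> x \<in> obj D \<Longrightarrow> B1' v x = B' v x"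
  shows "central_morphism V C D F B1 F' B1' G \<gamma>"
proof -
  interpret central_morphism V C D F B F' B' G \<gamma> by fact
  show ?thesis
    using assms(2-) \<gamma>_hom \<gamma>_nat \<gamma>_tens \<gamma>_unit \<gamma>_braid
    by (intro central_morphism.intro central_morphism_axioms.intro G.monoidal_functor_axioms) simp_all
qed

definition pair_unit :: "('v, 'w) braided_cat \<Rightarrow> ('v, 'w, 'o, 'a) pair \<Rightarrow> ('v, 'o, 'a) pair_mor" where
  "pair_unit V P = \<lparr>gfun = id_mon_functor (pcat P), gamma = \<lambda>v \<in> obj V. runit (pcat P) (omap (pfun P) v)\<rparr>"

definition pair_unit_inv :: "('v, 'w) braided_cat \<Rightarrow> ('v, 'w, 'o, 'a) pair \<Rightarrow> ('v, 'o, 'a) pair_mor" where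
  "pair_unit_inv V P =
    \<lparr>gfun = id_mon_functor (pcat P), gamma = \<lambda>v \<in> obj V. inv_arr (pcat P) (runit (pcat P) (omap (pfun P) v))\<rparr>"

text \<open>
  The counit points from the round trip to the given category, whereas a strength points from
  the action on the target to the image of the action on the source; hence
  \<open>act_left\<close> is the strength of the inverse.
\<close>

definition umm_counit_inv :: "('v, 'w) braided_cat \<Rightarrow> ('v, 'w, 'o, 'a) umm_cat \<Rightarrow> ('v, 'o, 'a) umm_functor" where
  "umm_counit_inv V M = \<lparr>ufun = id_mon_functor (ucat M),
    ustr = \<lambda>(v, x) \<in> obj V \<times> obj (ucat M). module_monoidal_category.act_left V (ucat M) (uact M) (alpha1 M) v x\<rparr>"

definition umm_counit :: "('v, 'w) braided_cat \<Rightarrow> ('v, 'w, 'o, 'a) umm_cat \<Rightarrow> ('v, 'o, 'a) umm_functor" where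
  "umm_counit V M = \<lparr>ufun = id_mon_functor (ucat M),
    ustr = \<lambda>(v, x) \<in> obj V \<times> obj (ucat M). inv_arr (ucat M) (module_monoidal_category.act_left V (ucat M) (uact M) (alpha1 M) v x)\<rparr>"

lemma pair_unit:
  assumes "pair_over V P"
  shows "pair_morphism V P (pair_of_umm V (umm_of_pair V P)) (pair_unit V P)" (is "pair_morphism V P ?Q _")
    and "pair_morphism V (pair_of_umm V (umm_of_pair V P)) P (pair_unit_inv V P)"
proof -
  interpret pair_over V P by fact
  interpret X: central_functor V "pcat P" "pfun P" "pair_braid P" by (rule pair_central)
  have Q: "pair_over V ?Q" using assms by (simp add: pair_of_umm umm_of_pair del: umm_of_pair_simps pair_of_umm_simps)
  interpret M: central_morphism V "pcat P" "pcat P" "pfun P" "pair_braid P" "pfun ?Q" "pair_braid ?Q" "id_mon_functor (pcat P)"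
    "\<lambda>v \<in> obj V. runit (pcat P) (omap (pfun P) v)"
    using X.runit_central_morphism Q[THEN pair_over.pair_central]
    by (intro central_morphism_cong[OF _ pair_central]) simp_all
  show "pair_morphism V P ?Q (pair_unit V P)"
    using Q assms M.central_morphism_axioms by (simp add: pair_morphism_iff pair_unit_def)
  have "central_morphism V (pcat P) (pcat P) (pfun ?Q) (pair_braid ?Q) (pfun P) (pair_braid P) (id_mon_functor (pcat P))
    (\<lambda>v \<in> obj V. inv_arr (pcat P) (runit (pcat P) (omap (pfun P) v)))"
    using M.inverse_central_morphism by (simp cong: restrict_cong)
  then show "pair_morphism V ?Q P (pair_unit_inv V P)"
    using Q assms by (simp add: pair_morphism_iff pair_unit_inv_def)
qed

lemma umm_counit:
  assumes "umm_category V M"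
  shows "umm_functor V M (umm_of_pair V (pair_of_umm V M)) (umm_counit_inv V M)"
    and "umm_functor V (umm_of_pair V (pair_of_umm V M)) M (umm_counit V M)"
proof -
  interpret umm V "ucat M" "uact M" "alpha1 M" "alpha2 M" using assms by (simp add: umm_def)
  interpret I: module_structure_iso V "ucat M" "uact M" "alpha1 M" "alpha2 M"
    "central_functor.induced_act V (ucat M) free_functor" "central_functor.induced_\<alpha>1 V (ucat M) free_functor"
    "central_functor.induced_\<alpha>2 V (ucat M) free_functor (pair_braid (pair_of_umm V M))"
    "\<lambda>(v, x) \<in> obj V \<times> obj (ucat M). act_left v x"
    using pair_over.pair_central[OF pair_of_umm[OF assms]] by (intro act_left_structure_iso) simp_all
  interpret J: module_structure_iso V "ucat M"
    "central_functor.induced_act V (ucat M) free_functor" "central_functor.induced_\<alpha>1 V (ucat M) free_functor"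
    "central_functor.induced_\<alpha>2 V (ucat M) free_functor (pair_braid (pair_of_umm V M))"
    "uact M" "alpha1 M" "alpha2 M" I.s_inv
    by (rule I.inverse_module_structure_iso)
  show "umm_functor V M (umm_of_pair V (pair_of_umm V M)) (umm_counit_inv V M)"
    unfolding umm_counit_inv_def by (rule I.id_umm_functor) simp_all
  have "umm_counit V M = \<lparr>ufun = id_mon_functor (ucat M), ustr = I.s_inv\<rparr>"
    by (rule umm_functor_eqI)
      (auto simp: umm_counit_def I.s_inv_def intro!: extensionalityI[where A = "obj V \<times> obj (ucat M)"])
  then show "umm_functor V (umm_of_pair V (pair_of_umm V M)) M (umm_counit V M)"
    by simp (rule J.id_umm_functor; simp)
qed

lemma (in concrete_two_category) id_structure_two_functor:
  "structure_two_functor Os H i c T U u Os H i c T U u (\<lambda>X. X) (\<lambda>X Y F. F)"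
  by (intro structure_two_functor.intro structure_two_functor_axioms.intro concrete_two_category_axioms) simp_all

lemma comp_structure_two_functor:
  assumes "structure_two_functor Os H i c T U u Os' H' i' c' T' U' u' f0 f1"
    and "structure_two_functor Os' H' i' c' T' U' u' Os'' H'' i'' c'' T'' U'' u'' g0 g1"
  shows "structure_two_functor Os H i c T U u Os'' H'' i'' c'' T'' U'' u'' (\<lambda>X. g0 (f0 X)) (\<lambda>X Y F. g1 (f0 X) (f0 Y) (f1 X Y F))"
proof -
  interpret F: structure_two_functor Os H i c T U u Os' H' i' c' T' U' u' f0 f1 by fact
  interpret G: structure_two_functor Os' H' i' c' T' U' u' Os'' H'' i'' c'' T'' U'' u'' g0 g1 by fact
  show ?thesis
    by (intro structure_two_functor.intro structure_two_functor_axioms.intro F.K.concrete_two_category_axioms G.L.concrete_two_category_axioms)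
      (simp_all add: F.f0_in G.f0_in F.U_f0 G.U_f0 F.f1_in G.f1_in F.u_f1 G.u_f1 F.f1_i G.f1_i F.f1_c G.f1_c F.T_sub G.T_sub)
qed

text \<open>
  Naturality in \<open>G\<close> says that \<open>runit\<close> carries the
  \<open>\<gamma>\<close> recovered from the strength to the given one: the unit law for
  \<open>phi0\<close> and naturality of \<open>runit\<close>.
\<close>

lemma pair_unit_natural:
  "structure_two_natural_iso (pairs_obj V) (pairs_hom V) (id_pair_mor V) (\<lambda>P Q R. comp_pair_mor V P R) (pair_trans V) pcat gfun
    (pairs_obj V) (pairs_hom V) (id_pair_mor V) (\<lambda>P Q R. comp_pair_mor V P R) (pair_trans V) pcat gfun
    (\<lambda>P. P) (\<lambda>P Q G. G) (\<lambda>P. pair_of_umm V (umm_of_pair V P))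
    (\<lambda>P Q G. pair_mor_of_umm_functor V (umm_of_pair V P) (umm_of_pair V Q) (umm_functor_of_pair_mor V P Q G))
    (pair_unit V) (pair_unit_inv V)"
proof (intro structure_two_natural_iso.intro structure_two_natural_iso_axioms.intro
    concrete_two_category.id_structure_two_functor[OF pairs_concrete]
    comp_structure_two_functor[OF umm_of_pair_two_functor pair_of_umm_two_functor], unfold mem_Collect_eq, goal_cases)
  case (1 P)
  then show ?case by (rule pair_unit)
next
  case (2 P)
  then show ?case by (rule pair_unit)
next
  case (3 P x)
  then show ?case by (simp add: pair_unit_def)
next
  case (4 P f)
  then show ?case by (simp add: pair_unit_def)
next
  case (5 P)
  interpret pair_over V P by fact
  note id = T.id_monoidal_functor
  have "runit (pcat P) x \<cdot>\<^bsub>pcat P\<^esub> inv_arr (pcat P) (runit (pcat P) x) = ident (pcat P) x" if [simp]: "x \<in> obj (pcat P)" for x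
    by (rule T.lift_eqI) (simp_all add: chase)
  then show ?case
    by (intro pair_mor_eqI extensionalityI[where A = "obj V"])
      (simp_all add: pair_unit_def pair_unit_inv_def comp_pair_mor_def id_pair_mor_def comp_id_mon_functor[OF id])
next
  case (6 P)
  interpret pair_over V P by fact
  interpret X: central_functor V "pcat P" "pfun P" "pair_braid P" by (rule pair_central)
  interpret Y: umm V "pcat P" X.induced_act X.induced_\<alpha>1 X.induced_\<alpha>2
    using X.induced_umm by (simp add: umm_def)
  note id = T.id_monoidal_functor
  have "inv_arr (pcat P) (runit (pcat P) x) \<cdot>\<^bsub>pcat P\<^esub> runit (pcat P) x = ident (pcat P) (x \<otimes>\<^bsub>pcat P\<^esub> \<I>\<^bsub>pcat P\<^esub>)" if [simp]: "x \<in> obj (pcat P)" for x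
    by (rule T.lift_eqI) (simp_all add: chase)
  then show ?case
    by (intro pair_mor_eqI extensionalityI[where A = "obj V"])
      (simp_all add: pair_unit_def pair_unit_inv_def comp_pair_mor_def id_pair_mor_def comp_id_mon_functor[OF id])
next
  case (7 P Q G)
  interpret G: central_morphism V "pcat P" "pcat Q" "pfun P" "pair_braid P" "pfun Q" "pair_braid Q" "gfun G" "gamma G"
    using 7 by (intro pair_morphism_central)
  interpret U: umm_functor V "umm_of_pair V P" "umm_of_pair V Q" "umm_functor_of_pair_mor V P Q G"
    using 7 by (intro umm_functor_of_pair_mor)
  let ?D = "pcat Q" and ?G = "gfun G"
  have "amap ?G (runit (pcat P) (omap (pfun P) v)) \<cdot>\<^bsub>?D\<^esub> U.unit_strength v = gamma G v \<cdot>\<^bsub>?D\<^esub> runit ?D (omap (pfun Q) v)"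
    if [simp]: "v \<in> obj V" for v
    using U.unit_strength_typ[of v]
    by (intro G.Q.D.lift_eqI) (simp_all add: chase U.unit_strength_simp G.G.phi0_right_l[THEN G.Q.D.re3] G.Q.D.tens.slide G.Q.D.unit_out(2)[of "gamma G v"])
  then show ?case
    by (intro pair_mor_eqI extensionalityI[where A = "obj V"])
      (simp_all add: pair_unit_def comp_pair_mor_def comp_id_mon_functor[OF G.G.monoidal_functor_axioms])
qed

text \<open>
  Naturality in \<open>F\<close> is \<open>strength_act_left\<close>, with both instances of
  \<open>act_left\<close> moved to the other side.
\<close>

lemma umm_counit_natural:
  "structure_two_natural_iso (umm_obj V) (umm_hom V) (id_umm_functor V) (\<lambda>M N R. comp_umm_functor V M R) (umm_trans V) ucat ufun
    (umm_obj V) (umm_hom V) (id_umm_functor V) (\<lambda>M N R. comp_umm_functor V M R) (umm_trans V) ucat ufun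
    (\<lambda>M. umm_of_pair V (pair_of_umm V M))
    (\<lambda>M N F. umm_functor_of_pair_mor V (pair_of_umm V M) (pair_of_umm V N) (pair_mor_of_umm_functor V M N F))
    (\<lambda>M. M) (\<lambda>M N F. F) (umm_counit V) (umm_counit_inv V)"
proof (intro structure_two_natural_iso.intro structure_two_natural_iso_axioms.intro
    concrete_two_category.id_structure_two_functor[OF umm_concrete]
    comp_structure_two_functor[OF pair_of_umm_two_functor umm_of_pair_two_functor], unfold mem_Collect_eq, goal_cases)
  case (1 M)
  then show ?case by (rule umm_counit)
next
  case (2 M)
  then show ?case by (rule umm_counit)
next
  case (3 M x)
  then show ?case by (simp add: umm_counit_def)
next
  case (4 M f)
  then show ?case by (simp add: umm_counit_def)
next
  case (5 M)
  interpret umm V "ucat M" "uact M" "alpha1 M" "alpha2 M" using 5 by (simp add: umm_def)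
  note id = C.id_monoidal_functor
  have "inv_arr (ucat M) (act_left v x) \<cdot>\<^bsub>ucat M\<^esub> act_left v x = ident (ucat M) ((v \<rhd>\<^bsub>uact M\<^esub> \<I>\<^bsub>ucat M\<^esub>) \<otimes>\<^bsub>ucat M\<^esub> x)"
    if [simp]: "v \<in> obj V" "x \<in> obj (ucat M)" for v x
    by (rule C.lift_eqI) (simp_all add: chase)
  then show ?case
    by (intro umm_functor_eqI extensionalityI[where A = "obj V \<times> obj (ucat M)"])
      (auto simp: umm_counit_def umm_counit_inv_def comp_umm_functor_def id_umm_functor_def comp_id_mon_functor[OF id])
next
  case (6 M)
  interpret umm V "ucat M" "uact M" "alpha1 M" "alpha2 M" using 6 by (simp add: umm_def)
  note id = C.id_monoidal_functor
  have "act_left v x \<cdot>\<^bsub>ucat M\<^esub> inv_arr (ucat M) (act_left v x) = ident (ucat M) (v \<rhd>\<^bsub>uact M\<^esub> x)"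
    if [simp]: "v \<in> obj V" "x \<in> obj (ucat M)" for v x
    by (rule C.lift_eqI) (simp_all add: chase)
  then show ?case
    by (intro umm_functor_eqI extensionalityI[where A = "obj V \<times> obj (ucat M)"])
      (auto simp: umm_counit_def umm_counit_inv_def comp_umm_functor_def id_umm_functor_def comp_id_mon_functor[OF id])
next
  case (7 M N F)
  interpret F: umm_functor V M N F using 7 by simp
  interpret P: central_morphism V "ucat M" "ucat N" F.S.free_functor F.S.free_braid F.T.free_functor F.T.free_braid
      "ufun F" F.unit_strength
    by (rule F.unit_strength_central)
  let ?D = "ucat N"
  have [simp]: "v \<in> obj V \<Longrightarrow> x \<in> obj (ucat M) \<Longrightarrow> P.strength (v, x) \<in> arr ?D" for v x
    by simp
  have "amap (ufun F) (inv_arr (ucat M) (F.S.act_left v x)) \<cdot>\<^bsub>?D\<^esub> ustr F (v, x) =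
    P.strength (v, x) \<cdot>\<^bsub>?D\<^esub> inv_arr ?D (F.T.act_left v (omap (ufun F) x))" if [simp]: "v \<in> obj V" "x \<in> obj (ucat M)" for v x
  proof -
    have "\<lfloor>phi2 (ufun F) (v \<rhd>\<^bsub>uact M\<^esub> \<I>\<^bsub>ucat M\<^esub>, x) \<cdot>\<^bsub>?D\<^esub> (F.unit_strength v \<otimes>\<^sub>a\<^bsub>?D\<^esub> ident ?D (omap (ufun F) x))\<rfloor>\<^bsub>?D\<^esub> \<odot>\<^bsub>?D\<^esub>
        \<lfloor>inv_arr ?D (F.T.act_left v (omap (ufun F) x))\<rfloor>\<^bsub>?D\<^esub> =
      \<lfloor>inv_arr ?D (amap (ufun F) (F.S.act_left v x))\<rfloor>\<^bsub>?D\<^esub> \<odot>\<^bsub>?D\<^esub> \<lfloor>ustr F (v, x)\<rfloor>\<^bsub>?D\<^esub>"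
      by (rule F.D.iso_flip) (simp_all add: chase F.strength_act_left_l)
    then show ?thesis
      by (intro F.D.lift_eqI) (simp_all add: chase)
  qed
  then show ?case
    by (intro umm_functor_eqI extensionalityI[where A = "obj V \<times> obj (ucat M)"])
      (auto simp: umm_counit_def comp_umm_functor_def comp_id_mon_functor[OF F.monoidal_functor_axioms] simp del: P.strength_simp)
qed

theorem theorem5p0p1:
  fixes V :: "('v, 'w) braided_cat"
  assumes "braided_category V"
  shows "two_equivalent
    (Pairs V :: ('v, 'w, 'o, 'a) pairs_two_cat)
    (UModMonCat V :: ('v, 'w, 'o, 'a) umm_two_cat)"
proof -
  let ?\<Psi> = "structure_functor (Pairs V :: ('v, 'w, 'o, 'a) pairs_two_cat) (umm_of_pair V) (umm_functor_of_pair_mor V)"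
  let ?\<Phi> = "structure_functor (UModMonCat V :: ('v, 'w, 'o, 'a) umm_two_cat) (pair_of_umm V) (pair_mor_of_umm_functor V)"
  have "two_functor (Pairs V) (UModMonCat V) ?\<Psi>"
    unfolding Pairs_def UModMonCat_def by (rule structure_two_functor.structure_two_functor[OF umm_of_pair_two_functor])
  moreover have "two_functor (UModMonCat V) (Pairs V) ?\<Phi>"
    unfolding Pairs_def UModMonCat_def by (rule structure_two_functor.structure_two_functor[OF pair_of_umm_two_functor])
  moreover have "\<exists>\<eta>. two_natural_iso (Pairs V) (Pairs V) (id_two_functor (Pairs V)) (comp_two_functor (Pairs V) ?\<Phi> ?\<Psi>) \<eta>"
    unfolding Pairs_def UModMonCat_def comp_structure_functor[OF umm_of_pair_two_functor] id_structure_functor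
    using structure_two_natural_iso.structure_natural[OF pair_unit_natural] by blast
  moreover have "\<exists>\<epsilon>. two_natural_iso (UModMonCat V) (UModMonCat V) (comp_two_functor (UModMonCat V) ?\<Psi> ?\<Phi>) (id_two_functor (UModMonCat V)) \<epsilon>"
    unfolding Pairs_def UModMonCat_def comp_structure_functor[OF pair_of_umm_two_functor] id_structure_functor
    using structure_two_natural_iso.structure_natural[OF umm_counit_natural] by blast
  ultimately show ?thesis
    unfolding two_equivalent_def by blast
qed

end
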